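(* The model-checking problem for $\mathrm{RB}\pm\mathrm{ATL}^{\#}$ with imperfect information and perfect recall, under strongly uniform strategies (given a resource-bounded concurrent game structure with diminishing resource $M$ equipped with indistinguishability relations $\sim_a$, a state $s$ of $M$, and an $\mathrm{RB}\pm\mathrm{ATL}^{\#}$ formula $\phi$, decide whether $M,s\models\phi$), is decidable in EXPSPACE, provided the resource bounds occurring in $\phi$ are represented in unary.
   Context: **Models.** A resource-bounded concurrent game structure with diminishing resource (RB-CGS$^\#$) is a tuple $M=(Agt,Res,S,\Pi,\pi,Act,d,c,\delta)$ where: $Agt=\{a_1,\dots,a_n\}$ is a non-empty finite set of agents; $Res=\{res_1,\dots,res_r\}$ is a non-empty finite set of resource types, the first of which is the distinguished diminishing resource; $S$ is a non-empty finite set of states; $\Pi$ is a finite set of propositions and $\pi:\Pi\to\wp(S)$; $Act$ is a non-empty finite set of actions; $d:S\times Agt\to\wp(Act)\setminus\{\emptyset\}$ gives the actions available to each agent at each state, and $D(s)=d(s,a_1)\times\cdots\times d(s,a_n)$; $c:S\times Act\to\mathbb{Z}^r$ is a partial function (defined for available actions) whose $i$-th component is the consumption (negative) or production (positive) of resource $i$, and the first component of $c(s,\sigma)$ is always at most $-1$; $\delta:S\times Act^{|Agt|}\to S$ is a partial function giving a successor state for every $s$ and $\sigma\in D(s)$. In addition, for each agent $a$ there is a binary indistinguishability relation $\sim_a$ on $S$ ($s\sim_a s'$ means that $a$ cannot distinguish $s$ from $s'$), lifted to finite sequences of states of equal length componentwise: $s_1\cdots s_k\sim_a s_1'\cdots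 s_k'$ iff $s_i\sim_a s_i'$ for all $i$. Models are given as explicit finite inputs. **Costs.** $\mathsf{prod}(s,\sigma)$ is $c(s,\sigma)$ with negative entries replaced by $0$; $\mathsf{cons}(s,\sigma)=(|\min(0,c_1(s,\sigma))|,\dots,|\min(0,c_r(s,\sigma))|)$. For a coalition $A\subseteq Agt$, $D_A(s)$ is the set of joint actions $\sigma=(\sigma_a)_{a\in A}$ with $\sigma_a\in d(s,a)$; $\mathsf{cons}(s,\sigma)=(\mathsf{cons}(s,\sigma_a))_{a\in A}$ and $\mathsf{prod}(s,\sigma)=(\mathsf{prod}(s,\sigma_a))_{a\in A}$. Vectors are compared and added pointwise. For $\sigma\in D_A(s)$, $out(s,\sigma)=\{s'\mid \exists\sigma'\in D(s):\ \sigma'_A=\sigma,\ s'=\delta(s,\sigma')\}$, where $\sigma'_A$ is the restriction of $\sigma'$ to $A$. **Syntax.** A resource bound for $A$ is $b\in\mathcal{B}_A$, assigning to each $a\in A$ a vector $b_a\in\mathbb{N}^r$. Formulas: $\phi,\psi::=p\mid\neg\phi\mid\phi\vee\psi\mid\langle\!\langle A^b\rangle\!\rangle\bigcirc\phi\mid\langle\!\langle A^b\rangle\!\rangle\phi\,\mathcal{U}\,\psi\mid\langle\!\langle A^b\rangle\!\rangle\phi\,\mathcal{R}\,\psi$, with $p\in\Pi$, $A\subseteq Agt$, $b\in\mathcal{B}_A$. **Strategies and computations.** A computation is $\lambda\in S^+$ (finite non-empty sequence of states), $\lambda[i]$ its $i$-th element, $\lambda[i,j]$ the segment from $i$ to $j$,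 $|\lambda|$ its length. A (perfect recall) strategy for $A$ is a map $F_A:S^+\to Act^{|A|}$ with $F_A(\lambda)\in D_A(\lambda[|\lambda|])$; $F_a(\lambda)$ denotes the component of $F_A(\lambda)$ for $a\in A$. $F_A$ is uniform if for every $a\in A$ and all $\lambda,\lambda'\in S^+$, $\lambda\sim_a\lambda'$ implies $F_a(\lambda)=F_a(\lambda')$. $\lambda$ is consistent with $F_A$ if $\lambda[i+1]\in out(\lambda[i],F_A(\lambda[1,i]))$ for all $1\le i<|\lambda|$. It is $b$-consistent with $F_A$ if moreover $\mathsf{cons}(\lambda[i],F_A(\lambda[1,i]))\le e_A(\lambda[i])$ for all $1\le i<|\lambda|$, where $e_A(\lambda[1])=b$ and $e_A(\lambda[i+1])=e_A(\lambda[i])-\mathsf{cons}(\lambda[i],F_A(\lambda[1,i]))+\mathsf{prod}(\lambda[i],F_A(\lambda[1,i]))$. It is $b$-maximal if it is $b$-consistent and cannot be extended further while remaining $b$-consistent (the next action prescribed by $F_A$ would violate $b$-consistency). $out(s,F_A,b)$ is the set of all $b$-maximal computations starting from $s$ that are $b$-consistent with $F_A$. **Semantics (strong uniformity).** Propositions ($M,s\models p$ iff $s\in\pi(p)$), $\neg$, $\vee$ as usual. - $M,s\models\langle\!\langle A^b\rangle\!\rangle\bigcirc\phi$ iff there is a uniform strategy $F_A$ such that for all $a\in A$, all $s'\sim_a s$ and all $\lambda\in out(s',F_A,b)$: $|\lambda|>1$ and $M,\lambda[2]\models\phi$. - $M,s\models\langle\!\langle A^b\rangle\!\rangle\phi\,\mathcal{U}\,\psi$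 iff there is a uniform $F_A$ such that for all $a\in A$, all $s'\sim_a s$ and all $\lambda\in out(s',F_A,b)$ there is $1\le i\le|\lambda|$ with $M,\lambda[i]\models\psi$ and $M,\lambda[j]\models\phi$ for all $1\le j<i$. - $M,s\models\langle\!\langle A^b\rangle\!\rangle\phi\,\mathcal{R}\,\psi$ iff there is a uniform $F_A$ such that for all $a\in A$, all $s'\sim_a s$ and all $\lambda\in out(s',F_A,b)$, either there is $1\le i\le|\lambda|$ with $M,\lambda[i]\models\phi$ and $M,\lambda[j]\models\psi$ for all $1\le j\le i$, or $M,\lambda[j]\models\psi$ for all $1\le j\le|\lambda|$. *)

theory Defs
  imports Main "HOL-Library.FuncSet"
begin

section \<open>Resource-bounded concurrent game structures with a diminishing resource\<close>

text \<open>
  Resource types are the numbers below \<open>nres\<close>; resource \<open>0\<close> is the diminishing one.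
  The partial functions of a structure are total here: the values of \<open>avail\<close>, \<open>cost\<close> and
  \<open>succ_state\<close> outside the domains required by \<open>rbcgs\<close> are junk and are never consulted.
  A pair \<open>(s, s')\<close> is in \<open>indist M a\<close> iff s is indistinguishable from s' for a; the
  relation is an arbitrary binary relation on states.
\<close>

record ('ag, 'st, 'act, 'pr) rbcgs =
  Agt :: "'ag set"
  nres :: nat
  States :: "'st set"
  Props :: "'pr set"
  val :: "'pr \<Rightarrow> 'st set"
  Acts :: "'act set"
  avail :: "'st \<Rightarrow> 'ag \<Rightarrow> 'act set"
  cost :: "'st \<Rightarrow> 'act \<Rightarrow> nat \<Rightarrow> int"
  succ_state :: "'st \<Rightarrow> ('ag \<Rightarrow> 'act) \<Rightarrow> 'st"
  indist :: "'ag \<Rightarrow> ('st \<times> 'st) set"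

text \<open>A joint action of a coalition is a function that is \<open>undefined\<close> outside the coalition.\<close>

definition joint_actions ::
  "('ag, 'st, 'act, 'pr) rbcgs \<Rightarrow> 'ag set \<Rightarrow> 'st \<Rightarrow> ('ag \<Rightarrow> 'act) set" where
  "joint_actions M A s = (\<Pi>\<^sub>E a\<in>A. avail M s a)"

definition rbcgs :: "('ag, 'st, 'act, 'pr) rbcgs \<Rightarrow> bool" where
  "rbcgs M \<longleftrightarrow>
     finite (Agt M) \<and> Agt M \<noteq> {} \<and>
     nres M \<ge> 1 \<and>
     finite (States M) \<and> States M \<noteq> {} \<and>
     finite (Props M) \<and> (\<forall>p\<in>Props M. val M p \<subseteq> States M) \<and>
     finite (Acts M) \<and> Acts M \<noteq> {} \<and>
     (\<forall>s\<in>States M. \<forall>a\<in>Agt M. avail M s a \<subseteq> Acts M \<and> avail M s a \<noteq> {}) \<and>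
     (\<forall>s\<in>States M. \<forall>a\<in>Agt M. \<forall>\<alpha>\<in>avail M s a. cost M s \<alpha> 0 \<le> -1) \<and>
     (\<forall>s\<in>States M. \<forall>\<sigma>\<in>joint_actions M (Agt M) s. succ_state M s \<sigma> \<in> States M) \<and>
     (\<forall>a\<in>Agt M. indist M a \<subseteq> States M \<times> States M)"

definition consumption :: "('ag, 'st, 'act, 'pr) rbcgs \<Rightarrow> 'st \<Rightarrow> 'act \<Rightarrow> nat \<Rightarrow> int" where
  "consumption M s \<alpha> i = \<bar>min 0 (cost M s \<alpha> i)\<bar>"

definition production :: "('ag, 'st, 'act, 'pr) rbcgs \<Rightarrow> 'st \<Rightarrow> 'act \<Rightarrow> nat \<Rightarrow> int" where
  "production M s \<alpha> i = max 0 (cost M s \<alpha> i)"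

definition outcomes ::
  "('ag, 'st, 'act, 'pr) rbcgs \<Rightarrow> 'ag set \<Rightarrow> 'st \<Rightarrow> ('ag \<Rightarrow> 'act) \<Rightarrow> 'st set" where
  "outcomes M A s \<sigma> =
     {s'. \<exists>\<sigma>'\<in>joint_actions M (Agt M) s. restrict \<sigma>' A = \<sigma> \<and> s' = succ_state M s \<sigma>'}"


section \<open>Strategies and computations\<close>

text \<open>
  Computations are non-empty lists, so the i-th element of \<open>\<lambda>\<close> in the usual numbering from 1
  is \<open>xs ! (i - 1)\<close> and the prefix \<open>\<lambda>[1,i]\<close> is \<open>take i xs\<close>.
\<close>

definition computations :: "('ag, 'st, 'act, 'pr) rbcgs \<Rightarrow> 'st list set" where
  "computations M = {xs. xs \<noteq> [] \<and> set xs \<subseteq> States M}"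

definition strategy ::
  "('ag, 'st, 'act, 'pr) rbcgs \<Rightarrow> 'ag set \<Rightarrow> ('st list \<Rightarrow> 'ag \<Rightarrow> 'act) \<Rightarrow> bool" where
  "strategy M A F \<longleftrightarrow> (\<forall>xs\<in>computations M. F xs \<in> joint_actions M A (last xs))"

definition uniform ::
  "('ag, 'st, 'act, 'pr) rbcgs \<Rightarrow> 'ag set \<Rightarrow> ('st list \<Rightarrow> 'ag \<Rightarrow> 'act) \<Rightarrow> bool" where
  "uniform M A F \<longleftrightarrow>
     (\<forall>a\<in>A. \<forall>xs\<in>computations M. \<forall>ys\<in>computations M.
        list_all2 (\<lambda>s s'. (s, s') \<in> indist M a) xs ys \<longrightarrow> F xs a = F ys a)"

definition consistent ::
  "('ag, 'st, 'act, 'pr) rbcgs \<Rightarrow> 'ag set \<Rightarrow> ('st list \<Rightarrow> 'ag \<Rightarrow> 'act) \<Rightarrow> 'st list \<Rightarrow> bool" where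
  "consistent M A F xs \<longleftrightarrow>
     xs \<in> computations M \<and>
     (\<forall>i. Suc i < length xs \<longrightarrow>
        xs ! Suc i \<in> outcomes M A (xs ! i) (F (take (Suc i) xs)))"

text \<open>\<open>energy M F b xs i a j\<close>: what agent a has of resource j at position i (from 0) of xs.\<close>

primrec energy ::
  "('ag, 'st, 'act, 'pr) rbcgs \<Rightarrow> ('st list \<Rightarrow> 'ag \<Rightarrow> 'act) \<Rightarrow> ('ag \<Rightarrow> nat \<Rightarrow> nat) \<Rightarrow> 'st list
     \<Rightarrow> nat \<Rightarrow> 'ag \<Rightarrow> nat \<Rightarrow> int" where
  "energy M F b xs 0 = (\<lambda>a j. int (b a j))"
| "energy M F b xs (Suc i) =
     (\<lambda>a j. energy M F b xs i a j
              - consumption M (xs ! i) (F (take (Suc i) xs) a) j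
              + production M (xs ! i) (F (take (Suc i) xs) a) j)"

definition b_consistent ::
  "('ag, 'st, 'act, 'pr) rbcgs \<Rightarrow> 'ag set \<Rightarrow> ('st list \<Rightarrow> 'ag \<Rightarrow> 'act) \<Rightarrow> ('ag \<Rightarrow> nat \<Rightarrow> nat)
     \<Rightarrow> 'st list \<Rightarrow> bool" where
  "b_consistent M A F b xs \<longleftrightarrow>
     consistent M A F xs \<and>
     (\<forall>i. Suc i < length xs \<longrightarrow>
        (\<forall>a\<in>A. \<forall>j<nres M.
           consumption M (xs ! i) (F (take (Suc i) xs) a) j \<le> energy M F b xs i a j))"

definition b_maximal ::
  "('ag, 'st, 'act, 'pr) rbcgs \<Rightarrow> 'ag set \<Rightarrow> ('st list \<Rightarrow> 'ag \<Rightarrow> 'act) \<Rightarrow> ('ag \<Rightarrow> nat \<Rightarrow> nat)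
     \<Rightarrow> 'st list \<Rightarrow> bool" where
  "b_maximal M A F b xs \<longleftrightarrow>
     b_consistent M A F b xs \<and> \<not> (\<exists>ys. ys \<noteq> [] \<and> b_consistent M A F b (xs @ ys))"

definition out ::
  "('ag, 'st, 'act, 'pr) rbcgs \<Rightarrow> 'ag set \<Rightarrow> 'st \<Rightarrow> ('st list \<Rightarrow> 'ag \<Rightarrow> 'act)
     \<Rightarrow> ('ag \<Rightarrow> nat \<Rightarrow> nat) \<Rightarrow> 'st list set" where
  "out M A s F b = {xs. b_maximal M A F b xs \<and> hd xs = s}"


section \<open>The logic\<close>

text \<open>
  A bound for the coalition A is a function whose values matter only for agents in A and
  resources below \<open>nres\<close>.
\<close>

datatype ('ag, 'pr) formula =
    Atom 'pr
  | Neg "('ag, 'pr) formula"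
  | Or "('ag, 'pr) formula" "('ag, 'pr) formula"
  | Next "'ag set" "'ag \<Rightarrow> nat \<Rightarrow> nat" "('ag, 'pr) formula"
  | Until "'ag set" "'ag \<Rightarrow> nat \<Rightarrow> nat" "('ag, 'pr) formula" "('ag, 'pr) formula"
  | Release "'ag set" "'ag \<Rightarrow> nat \<Rightarrow> nat" "('ag, 'pr) formula" "('ag, 'pr) formula"

primrec formula_over :: "('ag, 'st, 'act, 'pr) rbcgs \<Rightarrow> ('ag, 'pr) formula \<Rightarrow> bool" where
  "formula_over M (Atom p) \<longleftrightarrow> p \<in> Props M"
| "formula_over M (Neg \<phi>) \<longleftrightarrow> formula_over M \<phi>"
| "formula_over M (Or \<phi> \<psi>) \<longleftrightarrow> formula_over M \<phi> \<and> formula_over M \<psi>"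
| "formula_over M (Next A b \<phi>) \<longleftrightarrow> A \<subseteq> Agt M \<and> formula_over M \<phi>"
| "formula_over M (Until A b \<phi> \<psi>) \<longleftrightarrow> A \<subseteq> Agt M \<and> formula_over M \<phi> \<and> formula_over M \<psi>"
| "formula_over M (Release A b \<phi> \<psi>) \<longleftrightarrow> A \<subseteq> Agt M \<and> formula_over M \<phi> \<and> formula_over M \<psi>"

primrec sat :: "('ag, 'st, 'act, 'pr) rbcgs \<Rightarrow> 'st \<Rightarrow> ('ag, 'pr) formula \<Rightarrow> bool" where
  "sat M s (Atom p) \<longleftrightarrow> s \<in> val M p"
| "sat M s (Neg \<phi>) \<longleftrightarrow> \<not> sat M s \<phi>"
| "sat M s (Or \<phi> \<psi>) \<longleftrightarrow> sat M s \<phi> \<or> sat M s \<psi>"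
| "sat M s (Next A b \<phi>) \<longleftrightarrow>
     (\<exists>F. strategy M A F \<and> uniform M A F \<and>
        (\<forall>a\<in>A. \<forall>s'. (s', s) \<in> indist M a \<longrightarrow>
           (\<forall>xs\<in>out M A s' F b. length xs > 1 \<and> sat M (xs ! 1) \<phi>)))"
| "sat M s (Until A b \<phi> \<psi>) \<longleftrightarrow>
     (\<exists>F. strategy M A F \<and> uniform M A F \<and>
        (\<forall>a\<in>A. \<forall>s'. (s', s) \<in> indist M a \<longrightarrow>
           (\<forall>xs\<in>out M A s' F b.
              \<exists>i<length xs. sat M (xs ! i) \<psi> \<and> (\<forall>j<i. sat M (xs ! j) \<phi>))))"
| "sat M s (Release A b \<phi> \<psi>) \<longleftrightarrow>
     (\<exists>F. strategy M A F \<and> uniform M A F \<and>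
        (\<forall>a\<in>A. \<forall>s'. (s', s) \<in> indist M a \<longrightarrow>
           (\<forall>xs\<in>out M A s' F b.
              (\<exists>i<length xs. sat M (xs ! i) \<phi> \<and> (\<forall>j\<le>i. sat M (xs ! j) \<psi>)) \<or>
              (\<forall>j<length xs. sat M (xs ! j) \<psi>))))"


section \<open>Deterministic Turing machines and EXPSPACE\<close>

text \<open>
  Machines have finitely many tapes, each infinite to the right only; a head on the leftmost
  cell that is told to move left stays there. Control states are the numbers below
  \<open>tm_states\<close>; the tape alphabet consists of the blank, the input letters and finitely many
  auxiliary symbols.
\<close>

datatype 'a symbol = Blank | Input 'a | Aux nat

datatype move = MoveLeft | MoveRight | Stay

record 'a tm =
  tm_tapes :: nat
  tm_states :: nat
  tm_aux :: nat
  tm_start :: nat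
  tm_accept :: nat
  tm_reject :: nat
  tm_delta :: "nat \<Rightarrow> 'a symbol list \<Rightarrow> nat \<times> ('a symbol \<times> move) list"

definition tm_alphabet :: "'a tm \<Rightarrow> 'a symbol set" where
  "tm_alphabet T = {Blank} \<union> range Input \<union> Aux ` {..<tm_aux T}"

definition tm_wf :: "('a::finite) tm \<Rightarrow> bool" where
  "tm_wf T \<longleftrightarrow>
     tm_tapes T \<ge> 1 \<and>
     tm_start T < tm_states T \<and> tm_accept T < tm_states T \<and> tm_reject T < tm_states T \<and>
     tm_accept T \<noteq> tm_reject T \<and>
     (\<forall>q<tm_states T. \<forall>xs. length xs = tm_tapes T \<and> set xs \<subseteq> tm_alphabet T \<longrightarrow>
        (case tm_delta T q xs of (q', ys) \<Rightarrow>
           q' < tm_states T \<and> length ys = tm_tapes T \<and> fst ` set ys \<subseteq> tm_alphabet T))"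

type_synonym 'a tape = "(nat \<Rightarrow> 'a symbol) \<times> nat"

type_synonym 'a config = "nat \<times> 'a tape list"

fun move_head :: "move \<Rightarrow> nat \<Rightarrow> nat" where
  "move_head MoveLeft h = h - 1"
| "move_head MoveRight h = Suc h"
| "move_head Stay h = h"

definition tape_update :: "'a tape \<Rightarrow> 'a symbol \<times> move \<Rightarrow> 'a tape" where
  "tape_update = (\<lambda>(t, h) (x, m). (t(h := x), move_head m h))"

definition tm_step :: "'a tm \<Rightarrow> 'a config \<Rightarrow> 'a config" where
  "tm_step T = (\<lambda>(q, ts).
     if q = tm_accept T \<or> q = tm_reject T then (q, ts)
     else (case tm_delta T q (map (\<lambda>(t, h). t h) ts) of
             (q', ys) \<Rightarrow> (q', map2 tape_update ts ys)))"

definition tm_init :: "'a tm \<Rightarrow> 'a list \<Rightarrow> 'a config" where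
  "tm_init T w =
     (tm_start T,
      ((\<lambda>i. if i < length w then Input (w ! i) else Blank), 0)
        # replicate (tm_tapes T - 1) ((\<lambda>_. Blank), 0))"

definition tm_run :: "'a tm \<Rightarrow> 'a list \<Rightarrow> nat \<Rightarrow> 'a config" where
  "tm_run T w t = (tm_step T ^^ t) (tm_init T w)"

definition tm_decides :: "'a tm \<Rightarrow> 'a list set \<Rightarrow> bool" where
  "tm_decides T L \<longleftrightarrow>
     (\<forall>w. if w \<in> L then \<exists>t. fst (tm_run T w t) = tm_accept T
                   else \<exists>t. fst (tm_run T w t) = tm_reject T)"

text \<open>
  On each tape a head starting in cell 0 has scanned at most m cells iff its positions stay
  below m. Counting per tape rather than in total changes the space by a constant factor only.
\<close>

definition tm_space_le :: "'a tm \<Rightarrow> 'a list \<Rightarrow> nat \<Rightarrow> bool" where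
  "tm_space_le T w m \<longleftrightarrow> (\<forall>t. \<forall>(_, h)\<in>set (snd (tm_run T w t)). h < m)"

text \<open>
  For functions with positive values, the ones used below, a bound by a constant multiple on
  all inputs is the same as a bound by a constant multiple on all but finitely many inputs.
\<close>

definition DSPACE :: "(nat \<Rightarrow> nat) \<Rightarrow> ('a::finite) list set set" where
  "DSPACE f =
     {L. \<exists>T c. tm_wf T \<and> tm_decides T L \<and> (\<forall>w. tm_space_le T w (c * f (length w)))}"

definition EXPSPACE :: "('a::finite) list set set" where
  "EXPSPACE = (\<Union>k. DSPACE (\<lambda>n. 2 ^ (n ^ k)))"


section \<open>The model-checking problem as a language\<close>

datatype letter =
  LOpen | LClose | LZero | LOne | LAtom | LNeg | LOr | LNext | LUntil | LRelease

instance letter :: finite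
proof
  have "(UNIV :: letter set) =
      {LOpen, LClose, LZero, LOne, LAtom, LNeg, LOr, LNext, LUntil, LRelease}"
    using letter.exhaust by blast
  then show "finite (UNIV :: letter set)"
    by (metis finite.emptyI finite.insertI)
qed

definition bracket :: "letter list list \<Rightarrow> letter list" where
  "bracket ws = LOpen # concat ws @ [LClose]"

definition enc_bool :: "bool \<Rightarrow> letter list" where
  "enc_bool x = [if x then LOne else LZero]"

definition enc_unary :: "nat \<Rightarrow> letter list" where
  "enc_unary k = bracket (replicate k [LOne])"

text \<open>Binary digits, least significant first, without superfluous zeros.\<close>

fun bits :: "nat \<Rightarrow> letter list" where
  "bits k = (if k = 0 then [] else enc_bool (odd k) @ bits (k div 2))"

declare bits.simps [simp del]

definition enc_nat :: "nat \<Rightarrow> letter list" where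
  "enc_nat k = bracket [bits k]"

definition enc_int :: "int \<Rightarrow> letter list" where
  "enc_int z = bracket [enc_bool (z < 0), bits (nat \<bar>z\<bar>)]"

text \<open>
  An input structure has its agents, states, propositions and actions numbered from 0. Its
  encoding gives the cardinalities of these sets, and explicit tables for all functions and
  relations. All numbers occurring as values are in binary, in particular the costs. The table
  of \<open>cost\<close> has, for each state, an entry for each action available to some agent, and that of
  \<open>succ_state\<close> has an entry for each joint action in D(s), in lexicographic order.
\<close>

type_synonym nrbcgs = "(nat, nat, nat, nat) rbcgs"

definition numbered :: "nrbcgs \<Rightarrow> bool" where
  "numbered M \<longleftrightarrow>
     Agt M = {..<card (Agt M)} \<and> States M = {..<card (States M)} \<and>
     Props M = {..<card (Props M)} \<and> Acts M = {..<card (Acts M)}"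

definition joint_action_list :: "nrbcgs \<Rightarrow> nat \<Rightarrow> (nat \<Rightarrow> nat) list" where
  "joint_action_list M s =
     map (\<lambda>xs. restrict (\<lambda>a. xs ! a) {..<card (Agt M)})
       (product_lists
         (map (\<lambda>a. filter (\<lambda>\<alpha>. \<alpha> \<in> avail M s a) [0..<card (Acts M)]) [0..<card (Agt M)]))"

definition enc_model :: "nrbcgs \<Rightarrow> letter list" where
  "enc_model M =
    (let ags = [0..<card (Agt M)]; sts = [0..<card (States M)];
         prs = [0..<card (Props M)]; acts = [0..<card (Acts M)]
     in bracket
       [enc_unary (card (Agt M)), enc_unary (nres M), enc_unary (card (States M)),
        enc_unary (card (Props M)), enc_unary (card (Acts M)),
        bracket (map (\<lambda>p. bracket (map (\<lambda>s. enc_bool (s \<in> val M p)) sts)) prs),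
        bracket (map (\<lambda>s. bracket (map (\<lambda>a.
          bracket (map (\<lambda>\<alpha>. enc_bool (\<alpha> \<in> avail M s a)) acts)) ags)) sts),
        bracket (map (\<lambda>s. bracket (map (\<lambda>\<alpha>.
          bracket (map (\<lambda>i. enc_int (cost M s \<alpha> i)) [0..<nres M]))
            (filter (\<lambda>\<alpha>. \<exists>a\<in>Agt M. \<alpha> \<in> avail M s a) acts))) sts),
        bracket (map (\<lambda>s. bracket (map (\<lambda>\<sigma>.
          enc_nat (succ_state M s \<sigma>)) (joint_action_list M s))) sts),
        bracket (map (\<lambda>a. bracket (map (\<lambda>s.
          bracket (map (\<lambda>s'. enc_bool ((s, s') \<in> indist M a)) sts)) sts)) ags)])"

text \<open>
  A coalition with its bound is the list, over all agents, of the vector of bounds, in unary,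
  for members of the coalition, and of an empty bracket for the other agents.
\<close>

definition enc_bound :: "nrbcgs \<Rightarrow> nat set \<Rightarrow> (nat \<Rightarrow> nat \<Rightarrow> nat) \<Rightarrow> letter list" where
  "enc_bound M A b =
     bracket (map (\<lambda>a. if a \<in> A then bracket (map (\<lambda>i. enc_unary (b a i)) [0..<nres M])
                       else bracket []) [0..<card (Agt M)])"

primrec enc_formula :: "nrbcgs \<Rightarrow> (nat, nat) formula \<Rightarrow> letter list" where
  "enc_formula M (Atom p) = bracket [[LAtom], enc_nat p]"
| "enc_formula M (Neg \<phi>) = bracket [[LNeg], enc_formula M \<phi>]"
| "enc_formula M (Or \<phi> \<psi>) = bracket [[LOr], enc_formula M \<phi>, enc_formula M \<psi>]"
| "enc_formula M (Next A b \<phi>) = bracket [[LNext], enc_bound M A b, enc_formula M \<phi>]"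
| "enc_formula M (Until A b \<phi> \<psi>) =
     bracket [[LUntil], enc_bound M A b, enc_formula M \<phi>, enc_formula M \<psi>]"
| "enc_formula M (Release A b \<phi> \<psi>) =
     bracket [[LRelease], enc_bound M A b, enc_formula M \<phi>, enc_formula M \<psi>]"

definition enc_instance :: "nrbcgs \<Rightarrow> nat \<Rightarrow> (nat, nat) formula \<Rightarrow> letter list" where
  "enc_instance M s \<phi> = bracket [enc_model M, enc_nat s, enc_formula M \<phi>]"

definition model_checking :: "letter list set" where
  "model_checking =
     {enc_instance M s \<phi> | M s \<phi>.
        rbcgs M \<and> numbered M \<and> s \<in> States M \<and> formula_over M \<phi> \<and> sat M s \<phi>}"

end

theory Submission
  imports Defs "HOL-Library.Nat_Bijection"
begin

text \<open>
  Since every action of a member of the coalition consumes the diminishing resource, a play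
  within the bound b has at most b + 1 states, and b is at most the length n of the input as it is
  written in unary. So all relevant plays, energies and numbers have codes below
  \<open>U = 2 ^ ((n + 2) ^ 2 + 1)\<close>, and a strategy matters only as a function on numbers below U. That such a
  function is uniform and winning is expressed by local conditions on functions and relations on
  numbers polynomial in U. Guessing in addition the tables of the structure, the ends of the subformulas and
  their truth values, the whole problem becomes one fixed monadic second-order sentence with addition
  over the numbers below a power L of U. Such a sentence is evaluated by cycling through
  all subsets of \<open>{..<L}\<close>, one tape for each quantifier, hence in space \<open>O(L)\<close>, which is
  exponential in n.
\<close>

section \<open>Programs for multitape machines\<close>

text \<open>Two obstacles shape the proof. Uniformity concerns all histories, also those that no
  play follows, and \<open>indist\<close> is an arbitrary relation. So the sentence guesses a
  relation closed under extension by indistinguishable states instead of defining the lifted one,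
  and a table for short histories is continued to long ones by looking at the last state. Secondly,
  formulas live below L while the natural parameter is U. Hence two layers: \<open>raw\<close>
  formulas, exact below L, and \<open>definable\<close> properties, correct once L exceeds some
  power of U. The exponent comes from the sentence, not from the input, so L is polynomial in U. The
  machine searches for L: a first sentence recognises the lengths at which U exists with enough
  room. The exponent (n + 2)^2 in U covers the codes of plays and of joint actions, at most n^n, and
  the energies, at most n + n * 2^n because costs are in binary. For each fixed K, ((n + 2)^2 + 1) *
  K \<le> n^3 + D with a constant D, which yields space O(2^(n^3)). Multiplication, used for pairing
  and for extending histories, is reduced to addition and set quantifiers through
  divisibility.\<close>

datatype 'a instr =
    Branch nat "'a symbol" nat nat
  | GoRight "nat set" nat
  | AllLeft nat
  | Write nat "'a symbol" nat

text \<open>Program counter, tape contents and head positions. Tapes are indexed by all natural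
  numbers, so code can be generated before the number of tapes is known; \<open>to_config\<close>
  keeps the first K.\<close>

type_synonym 'a pconfig = "nat \<times> (nat \<Rightarrow> nat \<Rightarrow> 'a symbol) \<times> (nat \<Rightarrow> nat)"

fun exec :: "'a instr \<Rightarrow> (nat \<Rightarrow> nat \<Rightarrow> 'a symbol) \<Rightarrow> (nat \<Rightarrow> nat) \<Rightarrow> 'a pconfig" where
  "exec (Branch i s a b) c h = (if c i (h i) = s then a else b, c, h)"
| "exec (GoRight R a) c h = (a, c, \<lambda>i. if i \<in> R then Suc (h i) else h i)"
| "exec (AllLeft a) c h = (a, c, \<lambda>i. h i - 1)"
| "exec (Write i s a) c h = (a, c(i := (c i)(h i := s)), h)"

definition pstep :: "'a instr list \<Rightarrow> 'a pconfig \<Rightarrow> 'a pconfig" where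
  "pstep p = (\<lambda>(q, c, h). if q < length p then exec (p ! q) c h else (q, c, h))"

definition heads_below :: "nat \<Rightarrow> 'a pconfig \<Rightarrow> bool" where
  "heads_below m x \<longleftrightarrow> (\<forall>i. snd (snd x) i < m)"

text \<open>Space is recorded along the run: every step has both ends inside the first m cells. The
  empty run carries no such information, which is why \<open>reaches_funpow\<close> asks for it at
  the start.\<close>

definition reaches :: "'a instr list \<Rightarrow> nat \<Rightarrow> 'a pconfig \<Rightarrow> 'a pconfig \<Rightarrow> bool" where
  "reaches p m = (\<lambda>x y. y = pstep p x \<and> heads_below m x \<and> heads_below m y)\<^sup>*\<^sup>*"

lemma reaches_refl [simp]: "reaches p m x x"
  by (simp add: reaches_def)

lemma reaches_trans: "reaches p m x y \<Longrightarrow> reaches p m y z \<Longrightarrow> reaches p m x z"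
  unfolding reaches_def by (rule rtranclp_trans)

lemma reaches_step:
  assumes "heads_below m x" "heads_below m (pstep p x)" "reaches p m (pstep p x) y"
  shows "reaches p m x y"
  using assms unfolding reaches_def by (auto intro: converse_rtranclp_into_rtranclp)

text \<open>The rule for loops: \<open>S q\<close> is the configuration at the loop head after q
  rounds.\<close>

lemma reaches_iterate:
  assumes "\<And>q. q < r \<Longrightarrow> reaches p m (S q) (S (Suc q))"
  shows "reaches p m (S 0) (S r)"
  using assms
proof (induction r)
  case (Suc r)
  then show ?case using reaches_trans by (metis less_Suc_eq)
qed simp

lemma reaches_funpow:
  assumes "reaches p m x y" "heads_below m x"
  shows "\<exists>t. (pstep p ^^ t) x = y \<and> (\<forall>t'\<le>t. heads_below m ((pstep p ^^ t') x))"
  using assms unfolding reaches_def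
proof (induction rule: rtranclp_induct)
  case base
  then show ?case by (intro exI[of _ 0]) simp
next
  case (step y z)
  then obtain t where t: "(pstep p ^^ t) x = y" "\<forall>t'\<le>t. heads_below m ((pstep p ^^ t') x)"
    by blast
  have z: "pstep p y = z" "heads_below m z" using step.hyps(2) by auto
  show ?case
  proof (intro exI[of _ "Suc t"] conjI allI impI)
    show "(pstep p ^^ Suc t) x = z" using t(1) z by simp
    have "heads_below m ((pstep p ^^ Suc t) x)" using t(1) z by simp
    moreover fix t' assume "t' \<le> Suc t"
    ultimately show "heads_below m ((pstep p ^^ t') x)"
      using t(2) le_Suc_eq by metis
  qed
qed

lemma reaches_exec:
  assumes "q < length p" "p ! q = ins" "heads_below m (q, c, h)"
    and "heads_below m (exec ins c h)" "reaches p m (exec ins c h) z"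
  shows "reaches p m (q, c, h) z"
  by (rule reaches_step)
      (use assms in \<open>auto simp: pstep_def\<close>)

section \<open>Translation of programs into Turing machines\<close>

fun instr_wf :: "nat \<Rightarrow> nat \<Rightarrow> 'a instr \<Rightarrow> bool" where
  "instr_wf K N (Branch i s a b) \<longleftrightarrow> i < K \<and> a < N \<and> b < N"
| "instr_wf K N (GoRight R a) \<longleftrightarrow> a < N"
| "instr_wf K N (AllLeft a) \<longleftrightarrow> a < N"
| "instr_wf K N (Write i s a) \<longleftrightarrow> i < K \<and> s \<in> {Blank, Aux 0, Aux 1} \<and> a < N"

fun exec_symbols :: "'a instr \<Rightarrow> 'a symbol list \<Rightarrow> nat \<times> ('a symbol \<times> move) list" where
  "exec_symbols (Branch i s a b) xs = (if xs ! i = s then a else b, map (\<lambda>x. (x, Stay)) xs)"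
| "exec_symbols (GoRight R a) xs =
     (a, map (\<lambda>i. (xs ! i, if i \<in> R then MoveRight else Stay)) [0..<length xs])"
| "exec_symbols (AllLeft a) xs = (a, map (\<lambda>x. (x, MoveLeft)) xs)"
| "exec_symbols (Write i s a) xs = (a, map (\<lambda>x. (x, Stay)) (xs[i := s]))"

text \<open>Acceptance and rejection are the two first addresses behind the program.\<close>

definition program_tm :: "nat \<Rightarrow> 'a instr list \<Rightarrow> 'a tm" where
  "program_tm K p =
     \<lparr>tm_tapes = K, tm_states = length p + 2, tm_aux = 2, tm_start = 0,
      tm_accept = length p, tm_reject = Suc (length p),
      tm_delta = (\<lambda>q xs. if q < length p then exec_symbols (p ! q) xs
                          else (q, map (\<lambda>x. (x, Stay)) xs))\<rparr>"

lemma program_tm_wf: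
  fixes p :: "('a::finite) instr list"
  assumes "K \<ge> 1" "\<forall>ins\<in>set p. instr_wf K (length p + 2) ins"
  shows "tm_wf (program_tm K p)"
proof -
  have *: "case exec_symbols ins xs of (q', ys) \<Rightarrow>
      q' < length p + 2 \<and> length ys = length xs \<and> fst ` set ys \<subseteq> tm_alphabet (program_tm K p)"
    if "ins \<in> set p" "length xs = K" "set xs \<subseteq> tm_alphabet (program_tm K p)" for ins xs
  proof -
    have wf: "instr_wf K (length p + 2) ins" using assms that by blast
    have al: "{Blank, Aux 0, Aux 1} \<subseteq> tm_alphabet (program_tm K p)"
      by (auto simp: tm_alphabet_def program_tm_def)
    show ?thesis
    proof (cases ins)
      case (Write i s a)
      then have "set (xs[i := s]) \<subseteq> tm_alphabet (program_tm K p)"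
        using wf al that(3) set_update_subset_insert[of xs i s] by auto
      then show ?thesis using Write wf by (auto simp: image_image)
    qed (use wf that in \<open>auto simp: image_image subset_iff\<close>)
  qed
  show ?thesis
    unfolding tm_wf_def
    using assms(1) *[OF nth_mem]
    by (auto simp: program_tm_def image_image split: prod.splits if_splits)
qed

definition to_config :: "nat \<Rightarrow> 'a pconfig \<Rightarrow> 'a config" where
  "to_config K = (\<lambda>(q, c, h). (q, map (\<lambda>i. (c i, h i)) [0..<K]))"

text \<open>One instruction is one machine step. \<open>AllLeft\<close> matches
  \<open>MoveLeft\<close> because both leave a head in cell 0 where it is, and at the two addresses
  behind the program both sides stand still.\<close>

lemma tm_step_to_config:
  assumes "\<forall>ins\<in>set p. instr_wf K (length p + 2) ins" "fst x < length p + 2"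
  shows "tm_step (program_tm K p) (to_config K x) = to_config K (pstep p x)"
proof (cases x)
  case (fields q c h)
  show ?thesis
  proof (cases "q < length p")
    case True
    then have "instr_wf K (length p + 2) (p ! q)" using assms by simp
    then show ?thesis
      using True fields
      by (cases "p ! q")
        (auto simp: tm_step_def program_tm_def to_config_def pstep_def tape_update_def
          nth_list_update intro!: nth_equalityI)
  next
    case False
    then have "q = length p \<or> q = Suc (length p)" using assms fields by auto
    then show ?thesis using fields False
      by (auto simp: tm_step_def program_tm_def to_config_def pstep_def)
  qed
qed

lemma fst_pstep_less:
  assumes "\<forall>ins\<in>set p. instr_wf K (length p + 2) ins" "fst x < length p + 2"
  shows "fst (pstep p x) < length p + 2"
proof (cases x)
  case (fields q c h)
  show ?thesis
  proof (cases "q < length p")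
    case True
    then have "instr_wf K (length p + 2) (p ! q)" using assms by simp
    then show ?thesis using True fields by (cases "p ! q") (auto simp: pstep_def)
  qed (use fields assms in \<open>auto simp: pstep_def\<close>)
qed

definition blank_config :: "'a list \<Rightarrow> 'a pconfig" where
  "blank_config w =
     (0, \<lambda>i. if i = 0 then (\<lambda>j. if j < length w then Input (w ! j) else Blank) else (\<lambda>_. Blank),
      \<lambda>_. 0)"

lemma tm_run_program_tm:
  assumes "K \<ge> 1" "\<forall>ins\<in>set p. instr_wf K (length p + 2) ins"
  shows "tm_run (program_tm K p) w t = to_config K ((pstep p ^^ t) (blank_config w))"
    and "fst ((pstep p ^^ t) (blank_config w)) < length p + 2"
proof (induction t)
  case 0
  {
    case 1
    have "[0..<K] = 0 # map Suc [0..<K - 1]" using assms(1)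
      by (metis One_nat_def Suc_le_D diff_Suc_1 map_Suc_upt upt_conv_Cons zero_less_Suc)
    then show ?case
      by (simp add: tm_run_def tm_init_def program_tm_def to_config_def blank_config_def
          comp_def map_replicate_const)
  next
    case 2
    show ?case by (simp add: blank_config_def)
  }
next
  case (Suc t)
  {
    case 1
    show ?case using Suc tm_step_to_config[OF assms(2)] by (simp add: tm_run_def)
  next
    case 2
    show ?case using Suc fst_pstep_less[OF assms(2)] by simp
  }
qed

lemma program_tm_run:
  assumes "K \<ge> 1" "\<forall>ins\<in>set p. instr_wf K (length p + 2) ins"
    and "reaches p m (blank_config w) (q, c, h)" "length p \<le> q" "0 < m"
  shows "\<exists>t. fst (tm_run (program_tm K p) w t) = q"
    and "tm_space_le (program_tm K p) w m"
proof -
  have "heads_below m (blank_config w)" using assms(5) by (simp add: heads_below_def blank_config_def)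
  then obtain t where t: "(pstep p ^^ t) (blank_config w) = (q, c, h)"
      "\<forall>t'\<le>t. heads_below m ((pstep p ^^ t') (blank_config w))"
    using reaches_funpow[OF assms(3)] by blast
  show "\<exists>t. fst (tm_run (program_tm K p) w t) = q"
    using t by (intro exI[of _ t]) (simp add: tm_run_program_tm[OF assms(1,2)] to_config_def)
  \<comment> \<open>A halted configuration is a fixed point, so the bound on the heads up to time t
    covers all later times too.\<close>
  have "(pstep p ^^ (t + k)) (blank_config w) = (q, c, h)" for k
    using t(1) assms(4) by (induction k) (auto simp: pstep_def)
  then have "heads_below m ((pstep p ^^ t') (blank_config w))" for t'
    using t by (metis le_add_diff_inverse nle_le)
  then show "tm_space_le (program_tm K p) w m"
    by (auto simp: tm_space_le_def tm_run_program_tm[OF assms(1,2)] to_config_def heads_below_def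
        split: prod.splits) (metis snd_conv)
qed

text \<open>Jump targets are absolute addresses. Each piece of code is therefore generated for its
  base address b, and its correctness is stated for any program that carries it at b.\<close>

definition located :: "'a instr list \<Rightarrow> nat \<Rightarrow> 'a instr list \<Rightarrow> bool" where
  "located p b code \<longleftrightarrow> (\<forall>i<length code. b + i < length p \<and> p ! (b + i) = code ! i)"

lemma located_Nil [simp]: "located p b []"
  by (simp add: located_def)

lemma located_Cons [simp]:
  "located p b (x # xs) \<longleftrightarrow> b < length p \<and> p ! b = x \<and> located p (Suc b) xs"
  unfolding located_def by (auto simp: less_Suc_eq_0_disj)

lemma located_append [simp]:
  "located p b (xs @ ys) \<longleftrightarrow> located p b xs \<and> located p (b + length xs) ys"
  by (induction xs arbitrary: b) auto

lemma located_slice: "located p b code \<Longrightarrow> located p (b + k) (take n (drop k code))"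
  by (auto simp: located_def add.assoc)

section \<open>A logic of sets of tape positions\<close>

text \<open>Monadic second-order logic over \<open>{..<L}\<close> with addition. Numbers are minima
  of sets, so one sort of variable, one tape per variable and one kind of quantifier loop serve sets
  and numbers alike.\<close>

datatype 'a fm =
    Mem nat nat
  | Sym "'a symbol" nat
  | Add nat nat nat
  | FNeg "'a fm"
  | FAnd "'a fm" "'a fm"
  | FEx "'a fm"

definition input_tape :: "'a list \<Rightarrow> nat \<Rightarrow> 'a symbol" where
  "input_tape w j = (if j < length w then Input (w ! j) else Blank)"

text \<open>Variables are de Bruijn indices; a set stands for its minimum where a number is needed.\<close>

primrec sem :: "'a fm \<Rightarrow> 'a list \<Rightarrow> nat \<Rightarrow> nat set list \<Rightarrow> bool" where
  "sem (Mem x y) w L E \<longleftrightarrow> E ! x \<noteq> {} \<and> Min (E ! x) \<in> E ! y"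
| "sem (Sym s x) w L E \<longleftrightarrow> E ! x \<noteq> {} \<and> input_tape w (Min (E ! x)) = s"
| "sem (Add x y z) w L E \<longleftrightarrow>
     E ! x \<noteq> {} \<and> E ! y \<noteq> {} \<and> E ! z \<noteq> {} \<and> Min (E ! x) + Min (E ! y) = Min (E ! z)"
| "sem (FNeg f) w L E \<longleftrightarrow> \<not> sem f w L E"
| "sem (FAnd f g) w L E \<longleftrightarrow> sem f w L E \<and> sem g w L E"
| "sem (FEx f) w L E \<longleftrightarrow> (\<exists>X\<subseteq>{..<L}. sem f w L (X # E))"

text \<open>
  The three arguments of \<open>Add\<close> have to be distinct since the machine moves their heads
  independently of each other.
\<close>

primrec fm_wf :: "nat \<Rightarrow> 'a fm \<Rightarrow> bool" where
  "fm_wf d (Mem x y) \<longleftrightarrow> x < d \<and> y < d"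
| "fm_wf d (Sym s x) \<longleftrightarrow> x < d"
| "fm_wf d (Add x y z) \<longleftrightarrow> x < d \<and> y < d \<and> z < d \<and> distinct [x, y, z]"
| "fm_wf d (FNeg f) \<longleftrightarrow> fm_wf d f"
| "fm_wf d (FAnd f g) \<longleftrightarrow> fm_wf d f \<and> fm_wf d g"
| "fm_wf d (FEx f) \<longleftrightarrow> fm_wf (Suc d) f"

primrec fm_depth :: "'a fm \<Rightarrow> nat" where
  "fm_depth (Mem x y) = 0"
| "fm_depth (Sym s x) = 0"
| "fm_depth (Add x y z) = 0"
| "fm_depth (FNeg f) = fm_depth f"
| "fm_depth (FAnd f g) = max (fm_depth f) (fm_depth g)"
| "fm_depth (FEx f) = Suc (fm_depth f)"

text \<open>
  Tape 1 is a ruler that marks the cells 0 and L; the head on it moves right whenever some head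
  does, so walking left until cell 0 of the ruler brings all heads home. The variable bound at
  depth d lives on tape d + 2.
\<close>

definition ruler :: "nat \<Rightarrow> nat \<Rightarrow> 'a symbol" where
  "ruler L j = (if j = 0 then Aux 0 else if j = L then Aux 1 else Blank)"

definition marks :: "nat set \<Rightarrow> nat \<Rightarrow> 'a symbol" where
  "marks X j = (if j \<in> X then Aux 0 else Blank)"

text \<open>The default \<open>{}\<close> keeps the tapes of variables out of scope blank. Hence
  binding a variable to the empty set changes no tape (\<open>tapes_Cons_empty\<close>), which is
  how a quantifier loop starts and ends.\<close>

definition level :: "nat set list \<Rightarrow> nat \<Rightarrow> nat set" where
  "level E i = (if i < length E then rev E ! i else {})"

definition tapes :: "'a list \<Rightarrow> nat \<Rightarrow> nat set list \<Rightarrow> nat \<Rightarrow> nat \<Rightarrow> 'a symbol" where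
  "tapes w L E i = (if i = 0 then input_tape w else if i = 1 then ruler L else marks (level E (i - 2)))"

section \<open>Machine code for the formulas\<close>

definition home :: "nat \<Rightarrow> nat \<Rightarrow> 'a instr list" where
  "home b t = [Branch 1 (Aux 0) t (Suc b), AllLeft b]"

text \<open>The first marked cell on tape x is its minimum. The heads of y and of the ruler walk
  along, so y is read at this minimum, and the end mark of the ruler signals an empty x. Tape y may
  be the input or x itself.\<close>

definition check_code :: "nat \<Rightarrow> nat \<Rightarrow> 'a symbol \<Rightarrow> nat \<Rightarrow> nat \<Rightarrow> nat \<Rightarrow> 'a instr list" where
  "check_code x y s b t f =
     [Branch 1 (Aux 1) (b + 6) (b + 1), Branch x (Aux 0) (b + 2) (b + 3),
      Branch y s (b + 4) (b + 6), GoRight {1, x, y} b] @ home (b + 4) t @ home (b + 6) f"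

text \<open>Two scans, one after the other: x and z until x shows its minimum, then y and z until y
  does. The head of z is not taken back in between, so it ends at the sum of the two minima and must
  meet its own first mark exactly there. The ruler follows z, whose head is the furthest to the
  right.\<close>

definition add_code :: "nat \<Rightarrow> nat \<Rightarrow> nat \<Rightarrow> nat \<Rightarrow> nat \<Rightarrow> nat \<Rightarrow> 'a instr list" where
  "add_code x y z b t f =
     [Branch 1 (Aux 1) (b + 11) (b + 1), Branch x (Aux 0) (b + 4) (b + 2),
      Branch z (Aux 0) (b + 11) (b + 3), GoRight {1, x, z} b,
      Branch 1 (Aux 1) (b + 11) (b + 5), Branch y (Aux 0) (b + 6) (b + 7),
      Branch z (Aux 0) (b + 9) (b + 11), Branch z (Aux 0) (b + 11) (b + 8),
      GoRight {1, y, z} (b + 4)] @ home (b + 9) t @ home (b + 11) f"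

text \<open>
  A quantifier runs through all sets by binary counting. On success the set is erased,
  on overflow it is empty anyway.
\<close>

definition erase_code :: "nat \<Rightarrow> nat \<Rightarrow> nat \<Rightarrow> 'a instr list" where
  "erase_code x b t =
     [Branch 1 (Aux 1) (b + 3) (b + 1), Write x Blank (b + 2), GoRight {1, x} b] @ home (b + 3) t"

definition increment_code :: "nat \<Rightarrow> nat \<Rightarrow> nat \<Rightarrow> nat \<Rightarrow> 'a instr list" where
  "increment_code x b again f =
     [Branch 1 (Aux 1) (b + 7) (b + 1), Branch x (Aux 0) (b + 2) (b + 4),
      Write x Blank (b + 3), GoRight {1, x} b, Write x (Aux 0) (b + 5)]
     @ home (b + 5) again @ home (b + 7) f"

primrec fm_size :: "'a fm \<Rightarrow> nat" where
  "fm_size (Mem x y) = 8"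
| "fm_size (Sym s x) = 8"
| "fm_size (Add x y z) = 13"
| "fm_size (FNeg f) = fm_size f"
| "fm_size (FAnd f g) = fm_size f + fm_size g"
| "fm_size (FEx f) = fm_size f + 14"

primrec compile :: "'a fm \<Rightarrow> nat \<Rightarrow> nat \<Rightarrow> nat \<Rightarrow> nat \<Rightarrow> 'a instr list" where
  "compile (Mem x y) d b t f = check_code (d + 1 - x) (d + 1 - y) (Aux 0) b t f"
| "compile (Sym s x) d b t f = check_code (d + 1 - x) 0 s b t f"
| "compile (Add x y z) d b t f = add_code (d + 1 - x) (d + 1 - y) (d + 1 - z) b t f"
| "compile (FNeg \<phi>) d b t f = compile \<phi> d b f t"
| "compile (FAnd \<phi> \<psi>) d b t f =
     compile \<phi> d b (b + fm_size \<phi>) f @ compile \<psi> d (b + fm_size \<phi>) t f"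
| "compile (FEx \<phi>) d b t f =
     compile \<phi> (Suc d) b (b + fm_size \<phi>) (b + fm_size \<phi> + 5)
     @ erase_code (d + 2) (b + fm_size \<phi>) t
     @ increment_code (d + 2) (b + fm_size \<phi> + 5) b f"

lemmas code_defs = home_def check_code_def add_code_def erase_code_def increment_code_def

lemma length_compile [simp]: "length (compile \<phi> d b t f) = fm_size \<phi>"
  by (induction \<phi> arbitrary: d b t f) (auto simp: code_defs)

lemma length_erase_code [simp]: "length (erase_code x b t) = 5"
  by (simp add: code_defs)

lemma fm_size_pos: "0 < fm_size \<phi>"
  by (induction \<phi>) auto

lemma compile_wf:
  assumes "fm_wf d \<phi>" "d + fm_depth \<phi> + 2 \<le> K" "b + fm_size \<phi> \<le> N" "t < N" "f < N"
  shows "\<forall>ins\<in>set (compile \<phi> d b t f). instr_wf K N ins"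
  using assms
proof (induction \<phi> arbitrary: d b t f)
  case (FAnd \<phi> \<psi>)
  have "\<forall>ins\<in>set (compile \<phi> d b (b + fm_size \<phi>) f). instr_wf K N ins"
    by (rule FAnd.IH(1)) (use FAnd.prems fm_size_pos[of \<psi>] in auto)
  moreover have "\<forall>ins\<in>set (compile \<psi> d (b + fm_size \<phi>) t f). instr_wf K N ins"
    by (rule FAnd.IH(2)) (use FAnd.prems in auto)
  ultimately show ?case by auto
next
  case (FEx \<phi>)
  have "\<forall>ins\<in>set (compile \<phi> (Suc d) b (b + fm_size \<phi>) (b + fm_size \<phi> + 5)). instr_wf K N ins"
    by (rule FEx.IH) (use FEx.prems in auto)
  then show ?case using FEx.prems by (auto simp: code_defs)
qed (auto simp: code_defs)

section \<open>Correctness of the machine code\<close>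

lemma home_reaches:
  assumes "located p b (home b t)" "\<And>i. h i \<le> h 1" "h 1 \<le> L" "1 \<le> L" "L < m"
  shows "reaches p m (b, tapes w L E, h) (t, tapes w L E, \<lambda>_. 0)"
  using assms(2,3)
proof (induction "h 1" arbitrary: h)
  case 0
  then have h: "h = (\<lambda>_. 0)" by (metis le_zero_eq ext)
  show ?case unfolding h
    by (rule reaches_exec[of b p _ m])
      (use assms(1,4,5) in \<open>auto simp: home_def tapes_def ruler_def heads_below_def\<close>)
next
  case (Suc k)
  have lt: "h i < m" for i using Suc.prems assms(5) by (meson le_less_trans)
  have "reaches p m (b, tapes w L E, \<lambda>i. h i - 1) (t, tapes w L E, \<lambda>_. 0)"
    by (rule Suc.hyps(1)) (use Suc diff_le_mono in auto)
  then have r: "reaches p m (Suc b, tapes w L E, h) (t, tapes w L E, \<lambda>_. 0)"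
    by (intro reaches_exec[of "Suc b" p "AllLeft b" m])
      (use assms(1) lt in \<open>auto simp: home_def heads_below_def less_imp_diff_less\<close>)
  have "tapes w L E 1 (h 1) \<noteq> Aux 0"
    using Suc.hyps(2) by (auto simp: tapes_def ruler_def)
  then show ?case
    by (intro reaches_exec[of b p "Branch 1 (Aux 0) t (Suc b)" m])
      (use assms(1) lt r in \<open>auto simp: home_def heads_below_def\<close>)
qed

definition heads_at :: "nat set \<Rightarrow> nat \<Rightarrow> nat \<Rightarrow> nat" where
  "heads_at R q i = (if i \<in> R then q else 0)"

lemma heads_at_0: "heads_at R 0 = (\<lambda>_. 0)"
  by (auto simp: heads_at_def)

lemma heads_at_Suc: "(\<lambda>i. if i \<in> R then Suc (heads_at R q i) else heads_at R q i) = heads_at R (Suc q)"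
  by (auto simp: heads_at_def)

lemma heads_at_in: "i \<in> R \<Longrightarrow> heads_at R q i = q"
  by (simp add: heads_at_def)

lemma tapes_ruler: "0 < L \<Longrightarrow> tapes w L E (Suc 0) j = Aux (Suc 0) \<longleftrightarrow> j = L"
  by (auto simp: tapes_def ruler_def)

lemma tapes_var:
  assumes "x < length E"
  shows "tapes w L E (length E + 1 - x) = marks (E ! x)"
proof -
  have "length E + 1 - x - 2 = length E - Suc x" using assms by simp
  moreover have "length E + 1 - x \<noteq> 0" "length E + 1 - x \<noteq> 1" "length E - Suc x < length E"
    using assms by auto
  ultimately show ?thesis using assms by (simp add: tapes_def level_def rev_nth Suc_diff_Suc)
qed

lemma marks_iff [simp]: "marks X j = Aux 0 \<longleftrightarrow> j \<in> X"
  by (simp add: marks_def)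

lemma heads_below_at: "q < m \<Longrightarrow> heads_below m (l, c, heads_at R q)"
  by (simp add: heads_below_def heads_at_def)

text \<open>The cell at which a scan stops: the first mark of X, or the end mark of the ruler at
  L.\<close>

definition first :: "nat \<Rightarrow> nat set \<Rightarrow> nat" where
  "first L X = (if X = {} then L else Min X)"

lemma first:
  assumes "X \<subseteq> {..<L}"
  shows "first L X \<le> L" "q < first L X \<Longrightarrow> q \<notin> X" "X \<noteq> {} \<Longrightarrow> first L X \<in> X"
    "first L X < L \<longleftrightarrow> X \<noteq> {}" "X \<noteq> {} \<Longrightarrow> first L X = Min X"
proof -
  have fin: "finite X" using assms finite_subset by blast
  have *: "Min X \<in> X \<and> Min X < L" if "X \<noteq> {}"
    using Min_in[OF fin that] assms by auto
  show "first L X \<le> L" using * by (cases "X = {}") (auto simp: first_def)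
  show "X \<noteq> {} \<Longrightarrow> first L X \<in> X" using * by (auto simp: first_def)
  show "first L X < L \<longleftrightarrow> X \<noteq> {}" using * by (cases "X = {}") (auto simp: first_def)
  show "X \<noteq> {} \<Longrightarrow> first L X = Min X" by (simp add: first_def)
  show "q \<notin> X" if "q < first L X"
    using that Min_le[OF fin, of q] by (auto simp: first_def split: if_splits)
qed

lemma test_reaches:
  assumes loc: "located p b (check_code x y s b t f)"
    and x: "tapes w L E x = marks X" and X: "X \<subseteq> {..<L}"
    and L: "1 \<le> L" "L < m"
  shows "reaches p m (b, tapes w L E, \<lambda>_. 0)
     (if X \<noteq> {} \<and> tapes w L E y (Min X) = s then t else f, tapes w L E, \<lambda>_. 0)"
proof -
  define R where "R = {1, x, y}"
  let ?c = "tapes w L E"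
  let ?S = "\<lambda>k q. (b + k, ?c, heads_at R q)"
  define r where "r = first L X"
  have r: "r \<le> L" "\<And>q. q < r \<Longrightarrow> q \<notin> X" "X \<noteq> {} \<Longrightarrow> r \<in> X" "r < L \<longleftrightarrow> X \<noteq> {}"
    "X \<noteq> {} \<Longrightarrow> r = Min X"
    using first[OF X] unfolding r_def by auto
  have len: "b + k < length p" if "k < 8" for k
    using loc that by (simp add: located_def check_code_def home_def)
  have ins: "p ! (b + k) = check_code x y s b t f ! k" if "k < 8" for k
    using loc that by (simp add: located_def check_code_def home_def)
  have ins0: "p ! (b + 0) = Branch 1 (Aux 1) (b + 6) (b + 1)"
    and ins1: "p ! (b + 1) = Branch x (Aux 0) (b + 2) (b + 3)"
    and ins2: "p ! (b + 2) = Branch y s (b + 4) (b + 6)"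
    and ins3: "p ! (b + 3) = GoRight R (b + 0)"
    using ins[of 0] ins[of 1] ins[of 2] ins[of 3] by (simp_all add: check_code_def R_def)
  have hd: "heads_at R q 1 = q" "heads_at R q (Suc 0) = q" "heads_at R q x = q" "heads_at R q y = q" for q
    by (auto simp: heads_at_in R_def)
  have hT: "reaches p m (?S 4 r) (t, ?c, \<lambda>_. 0)"
    by (rule home_reaches)
      (use located_slice[OF loc, of 4 2] L r in \<open>auto simp: check_code_def home_def heads_at_def R_def\<close>)
  have hF: "reaches p m (?S 6 r) (f, ?c, \<lambda>_. 0)"
    by (rule home_reaches)
      (use located_slice[OF loc, of 6 2] L r in \<open>auto simp: check_code_def home_def heads_at_def R_def\<close>)
  have skip0: "reaches p m (?S 0 q) z" if "q < L" "reaches p m (?S 1 q) z" for q z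
    by (rule reaches_exec[OF len ins0])
      (use that L in \<open>auto simp: heads_below_at hd tapes_ruler\<close>)
  have "reaches p m (?S 0 0) (?S 0 r)"
  proof (rule reaches_iterate[where S = "?S 0"])
    fix q assume q: "q < r"
    have "q < L" "Suc q < m" "q \<notin> X" using q r L by auto
    have r3: "reaches p m (?S 3 q) (?S 0 (Suc q))"
      by (rule reaches_exec[OF len ins3])
        (use \<open>Suc q < m\<close> in \<open>auto simp: heads_below_at heads_at_Suc\<close>)
    have "reaches p m (?S 1 q) (?S 0 (Suc q))"
      by (rule reaches_exec[OF len ins1])
        (use r3 \<open>q \<notin> X\<close> \<open>Suc q < m\<close> in \<open>auto simp: heads_below_at hd x\<close>)
    then show "reaches p m (?S 0 q) (?S 0 (Suc q))" using skip0 \<open>q < L\<close> by blast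
  qed
  moreover have "reaches p m (?S 0 r) (if X \<noteq> {} \<and> ?c y (Min X) = s then t else f, ?c, \<lambda>_. 0)"
  proof (cases "X = {}")
    case True
    show ?thesis
      by (rule reaches_exec[OF len ins0])
        (use True L r(1,4) hF in \<open>auto simp: heads_below_at hd tapes_ruler\<close>)
  next
    case False
    then have r': "r < L" "r = Min X" "r \<in> X" using r by auto
    have r2: "reaches p m (?S 2 r) (if X \<noteq> {} \<and> ?c y (Min X) = s then t else f, ?c, \<lambda>_. 0)"
      by (rule reaches_exec[OF len ins2])
        (use False L hF hT r' in \<open>auto simp: heads_below_at hd x\<close>)
    have "reaches p m (?S 1 r) (if X \<noteq> {} \<and> ?c y (Min X) = s then t else f, ?c, \<lambda>_. 0)"
      by (rule reaches_exec[OF len ins1])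
        (use r2 L r' in \<open>auto simp: heads_below_at hd x\<close>)
    then show ?thesis using skip0 r' by blast
  qed
  ultimately have "reaches p m (?S 0 0) (if X \<noteq> {} \<and> ?c y (Min X) = s then t else f, ?c, \<lambda>_. 0)"
    by (rule reaches_trans)
  then show ?thesis by (simp add: heads_at_0)
qed

lemma add_reaches:
  assumes loc: "located p b (add_code x y z b t f)"
    and tp: "tapes w L E x = marks X" "tapes w L E y = marks Y" "tapes w L E z = marks Z"
    and sub: "X \<subseteq> {..<L}" "Y \<subseteq> {..<L}" "Z \<subseteq> {..<L}"
    and dist: "distinct [1, x, y, z]"
    and L: "1 \<le> L" "L < m"
  shows "reaches p m (b, tapes w L E, \<lambda>_. 0)
     (if X \<noteq> {} \<and> Y \<noteq> {} \<and> Z \<noteq> {} \<and> Min X + Min Y = Min Z then t else f, tapes w L E, \<lambda>_. 0)"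
proof -
  define R1 where "R1 = {1, x, z}"
  define R2 where "R2 = {1, y, z}"
  define ok where "ok = (X \<noteq> {} \<and> Y \<noteq> {} \<and> Z \<noteq> {} \<and> Min X + Min Y = Min Z)"
  let ?c = "tapes w L E"
  let ?A = "\<lambda>k q. (b + k, ?c, heads_at R1 q)"
  define u where "u = first L X"
  define v where "v = first L Y"
  define g where "g = first L Z"
  note X = first[OF sub(1), folded u_def] and Y = first[OF sub(2), folded v_def]
    and Z = first[OF sub(3), folded g_def]
  \<comment> \<open>Head positions after q rounds of the second scan: the head of x rests at its
    minimum u, that of y is at q, those of z and of the ruler are at u + q.\<close>
  define h where "h = (\<lambda>q i. if i = y then q else if i \<in> {1, z} then u + q else if i = x then u else 0)"
  let ?B = "\<lambda>k q. (b + k, ?c, h q)"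
  have len: "b + k < length p" if "k < 13" for k
    using loc that by (simp add: located_def add_code_def home_def)
  have ins: "p ! (b + k) = add_code x y z b t f ! k" if "k < 13" for k
    using loc that by (simp add: located_def add_code_def home_def)
  have ins0: "p ! (b + 0) = Branch 1 (Aux 1) (b + 11) (b + 1)"
    and ins1: "p ! (b + 1) = Branch x (Aux 0) (b + 4) (b + 2)"
    and ins2: "p ! (b + 2) = Branch z (Aux 0) (b + 11) (b + 3)"
    and ins3: "p ! (b + 3) = GoRight R1 (b + 0)"
    and ins4: "p ! (b + 4) = Branch 1 (Aux 1) (b + 11) (b + 5)"
    and ins5: "p ! (b + 5) = Branch y (Aux 0) (b + 6) (b + 7)"
    and ins6: "p ! (b + 6) = Branch z (Aux 0) (b + 9) (b + 11)"
    and ins7: "p ! (b + 7) = Branch z (Aux 0) (b + 11) (b + 8)"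
    and ins8: "p ! (b + 8) = GoRight R2 (b + 4)"
    using ins[of 0] ins[of 1] ins[of 2] ins[of 3] ins[of 4] ins[of 5] ins[of 6] ins[of 7] ins[of 8]
    by (simp_all add: add_code_def R1_def R2_def)
  have hd: "heads_at R1 q 1 = q" "heads_at R1 q (Suc 0) = q" "heads_at R1 q x = q" "heads_at R1 q z = q" for q
    by (auto simp: heads_at_in R1_def)
  have hB: "h q 1 = u + q" "h q (Suc 0) = u + q" "h q y = q" "h q z = u + q" for q
    using dist by (auto simp: h_def)
  have belowB: "heads_below m (l, c, h q)" if "u + q < m" for l c q
    using that by (auto simp: heads_below_def h_def)
  have goB: "(\<lambda>i. if i \<in> R2 then Suc (h q i) else h q i) = h (Suc q)" for q
    using dist by (auto simp: h_def R2_def)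
  have homeA: "reaches p m (?A 11 q) (f, ?c, \<lambda>_. 0)" if "q \<le> L" for q
    by (rule home_reaches)
      (use located_slice[OF loc, of 11 2] L that in \<open>auto simp: add_code_def home_def heads_at_def R1_def\<close>)
  have homeT: "reaches p m (?B 9 q) (t, ?c, \<lambda>_. 0)" if "u + q \<le> L" for q
    by (rule home_reaches)
      (use located_slice[OF loc, of 9 2] L that dist in \<open>auto simp: add_code_def home_def h_def\<close>)
  have homeF: "reaches p m (?B 11 q) (f, ?c, \<lambda>_. 0)" if "u + q \<le> L" for q
    by (rule home_reaches)
      (use located_slice[OF loc, of 11 2] L that dist in \<open>auto simp: add_code_def home_def h_def\<close>)
  have skip0: "reaches p m (?A 0 q) r" if "q < L" "reaches p m (?A 1 q) r" for q r
    by (rule reaches_exec[OF len ins0]) (use that L in \<open>auto simp: heads_below_at hd tapes_ruler\<close>)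
  have skip1: "reaches p m (?A 1 q) r" if "q < L" "q \<notin> X" "reaches p m (?A 2 q) r" for q r
    by (rule reaches_exec[OF len ins1]) (use that L tp in \<open>auto simp: heads_below_at hd\<close>)
  have skip4: "reaches p m (?B 4 q) r" if "u + q < L" "reaches p m (?B 5 q) r" for q r
    by (rule reaches_exec[OF len ins4]) (use that L in \<open>auto simp: belowB hB tapes_ruler\<close>)
  have skip5: "reaches p m (?B 5 q) r" if "u + q < L" "q \<notin> Y" "reaches p m (?B 7 q) r" for q r
    by (rule reaches_exec[OF len ins5]) (use that L tp in \<open>auto simp: belowB hB\<close>)
  \<comment> \<open>The first scan ends where x or z shows its first mark, or at the end mark if
    neither does; a mark of z strictly before that of x leads to rejection.\<close>
  have phaseA: "reaches p m (?A 0 0) (?A 0 (min u g))"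
  proof (rule reaches_iterate[where S = "?A 0"])
    fix q assume q: "q < min u g"
    then have q': "q < L" "Suc q < m" "q \<notin> X" "q \<notin> Z" using X Z L by auto
    have r3: "reaches p m (?A 3 q) (?A 0 (Suc q))"
      by (rule reaches_exec[OF len ins3])
        (use q' in \<open>auto simp: heads_below_at heads_at_Suc\<close>)
    have "reaches p m (?A 2 q) (?A 0 (Suc q))"
      by (rule reaches_exec[OF len ins2]) (use r3 q' tp in \<open>auto simp: heads_below_at hd\<close>)
    then show "reaches p m (?A 0 q) (?A 0 (Suc q))" using skip0 skip1 q' by blast
  qed
  \<comment> \<open>The distance g - u is what is left until z shows its first mark or the end is
    reached.\<close>
  have phaseB: "reaches p m (?B 4 0) (?B 4 (min v (g - u)))"
  proof (rule reaches_iterate[where S = "?B 4"])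
    fix q assume q: "q < min v (g - u)"
    then have q': "u + q < L" "Suc (u + q) < m" "q \<notin> Y" "u + q \<notin> Z" using Y Z L by auto
    have r3: "reaches p m (?B 8 q) (?B 4 (Suc q))"
      by (rule reaches_exec[OF len ins8]) (use q' in \<open>auto simp: belowB goB\<close>)
    have "reaches p m (?B 7 q) (?B 4 (Suc q))"
      by (rule reaches_exec[OF len ins7]) (use r3 q' tp in \<open>auto simp: belowB hB\<close>)
    then show "reaches p m (?B 4 q) (?B 4 (Suc q))" using skip4 skip5 q' by blast
  qed
  have endB: "reaches p m (?B 4 (min v (g - u))) (if ok then t else f, ?c, \<lambda>_. 0)"
    if ug: "u \<le> g" "u < L"
  proof -
    let ?q = "min v (g - u)"
    have le: "u + ?q \<le> L" using ug Z by auto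
    consider "u + ?q = L" | "u + ?q < L" "v \<le> g - u" | "u + ?q < L" "g - u < v"
      using le by linarith
    then show ?thesis
    proof cases
      case 1
      then have "g = L" using Z(1) ug by auto
      then have "\<not> ok" using Z unfolding ok_def by auto
      then show ?thesis using homeF[OF le]
        by (intro reaches_exec[OF len ins4]) (use 1 L in \<open>auto simp: belowB hB tapes_ruler\<close>)
    next
      case 2
      then have q: "?q = v" "u + v \<le> g" "u + v < L" using ug by auto
      then have "v < L" by simp
      then have v: "v \<in> Y" "Y \<noteq> {}" "v = Min Y" using Y by auto
      have ok: "ok \<longleftrightarrow> u + v \<in> Z"
        using q v X Z ug unfolding ok_def
        by (metis empty_iff le_neq_implies_less)
      have "reaches p m (?B 6 v) (if ok then t else f, ?c, \<lambda>_. 0)"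
        by (rule reaches_exec[OF len ins6])
          (use q L tp ok homeF[of v] homeT[of v] in \<open>auto simp: belowB hB\<close>)
      then have "reaches p m (?B 5 v) (if ok then t else f, ?c, \<lambda>_. 0)"
        by (intro reaches_exec[OF len ins5]) (use q L tp v in \<open>auto simp: belowB hB\<close>)
      then show ?thesis using skip4 q by simp
    next
      case 3
      then have q: "?q = g - u" "g < L" "g - u \<notin> Y" "u + (g - u) = g" using ug Y by auto
      have "g \<in> Z" using q Z by auto
      have "\<not> ok"
      proof
        assume "ok"
        then have "u + v = g" using X(5) Y(5) Z(5) unfolding ok_def by simp
        then show False using 3 by simp
      qed
      then have "reaches p m (?B 7 (g - u)) (if ok then t else f, ?c, \<lambda>_. 0)"
        by (intro reaches_exec[OF len ins7])
          (use q L tp \<open>g \<in> Z\<close> homeF[of "g - u"] in \<open>auto simp: belowB hB\<close>)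
      then show ?thesis using skip4[of "g - u"] skip5[of "g - u"] q by simp
    qed
  qed
  have "reaches p m (?A 0 (min u g)) (if ok then t else f, ?c, \<lambda>_. 0)"
  proof -
    consider "u = L" "g = L" | "u \<le> g" "u < L" | "g < u" "g < L"
      using X(1) Z(1) by linarith
    then show ?thesis
    proof cases
      case 1
      then have "\<not> ok" using X unfolding ok_def by auto
      then show ?thesis
        by (intro reaches_exec[OF len ins0])
          (use 1 L homeA[of L] in \<open>auto simp: heads_below_at hd tapes_ruler\<close>)
    next
      case 2
      have "h 0 = heads_at R1 u" using dist by (auto simp: h_def heads_at_def R1_def)
      moreover have "reaches p m (?B 4 0) (if ok then t else f, ?c, \<lambda>_. 0)"
        using phaseB endB 2 reaches_trans by blast
      ultimately have "reaches p m (?A 1 u) (if ok then t else f, ?c, \<lambda>_. 0)"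
        by (intro reaches_exec[OF len ins1])
          (use 2 X L tp in \<open>auto simp: heads_below_at hd\<close>)
      then show ?thesis using skip0 2 by (simp add: min_def)
    next
      case 3
      have "\<not> ok" using 3 X(1,4,5) Z(5) unfolding ok_def by linarith
      then have "reaches p m (?A 2 g) (if ok then t else f, ?c, \<lambda>_. 0)"
        by (intro reaches_exec[OF len ins2])
          (use 3 Z L tp homeA[of g] in \<open>auto simp: heads_below_at hd\<close>)
      then show ?thesis using skip0 skip1 3 X by (simp add: min_def)
    qed
  qed
  with phaseA have "reaches p m (?A 0 0) (if ok then t else f, ?c, \<lambda>_. 0)"
    by (rule reaches_trans)
  then show ?thesis by (simp add: heads_at_0 ok_def)
qed

lemma tapes_Cons_var: "tapes w L (X # E) (length E + 2) = marks X"
  using tapes_var[of 0 "X # E"] by simp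

lemma tapes_Cons_upd: "(tapes w L (X # E))(length E + 2 := marks Y) = tapes w L (Y # E)"
  by (rule ext) (auto simp: tapes_def level_def nth_append)

lemma tapes_Cons_empty: "tapes w L ({} # E) = tapes w L E"
  by (rule ext) (auto simp: tapes_def level_def nth_append less_Suc_eq)

lemma marks_upd: "(marks X)(q := Blank) = marks (X - {q})" "(marks X)(q := Aux 0) = marks (insert q X)"
  by (auto simp: marks_def)

lemma tapes_Cons_write:
  assumes "h (length E + 2) = q" "x = length E + 2"
  shows "exec (Write x Blank a) (tapes w L (X # E)) h = (a, tapes w L ((X - {q}) # E), h)"
    "exec (Write x (Aux 0) a) (tapes w L (X # E)) h = (a, tapes w L (insert q X # E), h)"
  using assms by (simp_all only: exec.simps tapes_Cons_var marks_upd tapes_Cons_upd)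

lemma erase_reaches:
  assumes loc: "located p b (erase_code x b t)" and x: "x = length E + 2"
    and X: "X \<subseteq> {..<L}" and L: "1 \<le> L" "L < m"
  shows "reaches p m (b, tapes w L (X # E), \<lambda>_. 0) (t, tapes w L E, \<lambda>_. 0)"
proof -
  define R where "R = {1, x}"
  let ?c = "\<lambda>q. tapes w L ((X - {..<q}) # E)"
  let ?S = "\<lambda>k q. (b + k, ?c q, heads_at R q)"
  have len: "b + k < length p" if "k < 5" for k
    using loc that by (simp add: located_def erase_code_def home_def)
  have ins: "p ! (b + k) = erase_code x b t ! k" if "k < 5" for k
    using loc that by (simp add: located_def erase_code_def home_def)
  have ins0: "p ! (b + 0) = Branch 1 (Aux 1) (b + 3) (b + 1)"
    and ins1: "p ! (b + 1) = Write x Blank (b + 2)"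
    and ins2: "p ! (b + 2) = GoRight R (b + 0)"
    using ins[of 0] ins[of 1] ins[of 2] by (simp_all add: erase_code_def R_def)
  have hd: "heads_at R q (Suc 0) = q" "heads_at R q (length E + 2) = q" for q
    by (auto simp: heads_at_in R_def x)
  have "reaches p m (?S 0 0) (?S 0 L)"
  proof (rule reaches_iterate[where S = "?S 0"])
    fix q assume q: "q < L"
    have r2: "reaches p m (b + 2, ?c (Suc q), heads_at R q) (?S 0 (Suc q))"
      by (rule reaches_exec[OF len ins2]) (use q L in \<open>auto simp: heads_below_at heads_at_Suc\<close>)
    have *: "(X - {..<q}) - {q} = X - {..<Suc q}" by auto
    have "reaches p m (?S 1 q) (?S 0 (Suc q))"
      by (rule reaches_exec[OF len ins1])
        (use r2 q L in \<open>simp_all del: exec.simps add: tapes_Cons_write[where h = "heads_at R q" and q = q and E = E, OF hd(2) x] heads_below_at *\<close>)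
    then show "reaches p m (?S 0 q) (?S 0 (Suc q))"
      by (intro reaches_exec[OF len ins0]) (use q L in \<open>auto simp: heads_below_at hd tapes_ruler\<close>)
  qed
  moreover have "reaches p m (?S 0 L) (t, tapes w L E, \<lambda>_. 0)"
  proof -
    have "?c L = tapes w L E" using X by (metis Diff_eq_empty_iff tapes_Cons_empty)
    moreover have "reaches p m (b + 3, tapes w L E, heads_at R L) (t, tapes w L E, \<lambda>_. 0)"
      by (rule home_reaches)
        (use located_slice[OF loc, of 3 2] L in \<open>auto simp: erase_code_def home_def heads_at_def R_def\<close>)
    ultimately show ?thesis
      by (intro reaches_exec[OF len ins0]) (use L in \<open>auto simp: heads_below_at hd tapes_ruler\<close>)
  qed
  ultimately have "reaches p m (?S 0 0) (t, tapes w L E, \<lambda>_. 0)" by (rule reaches_trans)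
  then show ?thesis by (simp add: heads_at_0)
qed

text \<open>The successor of the binary number with the set of ones X, cell 0 being the least
  significant: k is the first zero, and the ones below it are the carry.\<close>

definition increment :: "nat \<Rightarrow> nat set \<Rightarrow> nat set" where
  "increment L X = (let k = first L ({..<L} - X) in insert k (X - {..<k}))"

lemma increment_reaches:
  assumes loc: "located p b (increment_code x b again f)" and x: "x = length E + 2"
    and X: "X \<subseteq> {..<L}" and L: "1 \<le> L" "L < m"
  shows "reaches p m (b, tapes w L (X # E), \<lambda>_. 0)
    (if X = {..<L} then (f, tapes w L E, \<lambda>_. 0)
     else (again, tapes w L (increment L X # E), \<lambda>_. 0))" (is "reaches _ _ _ ?z")
proof -
  define R where "R = {1, x}"
  define k where "k = first L ({..<L} - X)"
  let ?c = "\<lambda>q. tapes w L ((X - {..<q}) # E)"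
  let ?S = "\<lambda>k q. (b + k, ?c q, heads_at R q)"
  have k: "k \<le> L" "\<And>q. q < k \<Longrightarrow> q \<in> X" "k < L \<longleftrightarrow> X \<noteq> {..<L}" "k < L \<Longrightarrow> k \<notin> X"
    using first[of "{..<L} - X" L] X unfolding k_def[symmetric] by fastforce+
  have len: "b + k < length p" if "k < 9" for k
    using loc that by (simp add: located_def increment_code_def home_def)
  have ins: "p ! (b + k) = increment_code x b again f ! k" if "k < 9" for k
    using loc that by (simp add: located_def increment_code_def home_def)
  have ins0: "p ! (b + 0) = Branch 1 (Aux 1) (b + 7) (b + 1)"
    and ins1: "p ! (b + 1) = Branch x (Aux 0) (b + 2) (b + 4)"
    and ins2: "p ! (b + 2) = Write x Blank (b + 3)"
    and ins3: "p ! (b + 3) = GoRight R (b + 0)"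
    and ins4: "p ! (b + 4) = Write x (Aux 0) (b + 5)"
    using ins[of 0] ins[of 1] ins[of 2] ins[of 3] ins[of 4] by (simp_all add: increment_code_def R_def)
  have hd: "heads_at R q (Suc 0) = q" "heads_at R q (length E + 2) = q" for q
    by (auto simp: heads_at_in R_def x)
  have x': "tapes w L (Y # E) x = marks Y" for Y
    using tapes_Cons_var x by blast
  have "reaches p m (?S 0 0) (?S 0 k)"
  proof (rule reaches_iterate[where S = "?S 0"])
    fix q assume "q < k"
    then have q: "q < L" "q \<in> X" using k by auto
    have r3: "reaches p m (b + 3, ?c (Suc q), heads_at R q) (?S 0 (Suc q))"
      by (rule reaches_exec[OF len ins3]) (use q L in \<open>auto simp: heads_below_at heads_at_Suc\<close>)
    have *: "(X - {..<q}) - {q} = X - {..<Suc q}" by auto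
    have r2: "reaches p m (?S 2 q) (?S 0 (Suc q))"
      by (rule reaches_exec[OF len ins2])
        (use r3 q L in \<open>simp_all del: exec.simps add: tapes_Cons_write[where h = "heads_at R q" and q = q and E = E, OF hd(2) x] heads_below_at *\<close>)
    have "heads_at R q x = q" by (simp add: heads_at_def R_def)
    then have "reaches p m (?S 1 q) (?S 0 (Suc q))"
      by (intro reaches_exec[OF len ins1]) (use r2 q L in \<open>auto simp: heads_below_at x'\<close>)
    then show "reaches p m (?S 0 q) (?S 0 (Suc q))"
      by (intro reaches_exec[OF len ins0]) (use q L in \<open>auto simp: heads_below_at hd tapes_ruler\<close>)
  qed
  moreover have "reaches p m (?S 0 k) ?z"
  proof (cases "X = {..<L}")
    case True
    then have "k = L" using k by simp
    have "?c L = tapes w L E" using X by (metis Diff_eq_empty_iff tapes_Cons_empty)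
    moreover have "reaches p m (b + 7, tapes w L E, heads_at R L) (f, tapes w L E, \<lambda>_. 0)"
      by (rule home_reaches)
        (use located_slice[OF loc, of 7 2] L in \<open>auto simp: increment_code_def home_def heads_at_def R_def\<close>)
    ultimately show ?thesis
      by (intro reaches_exec[OF len ins0])
        (use L \<open>k = L\<close> True in \<open>auto simp: heads_below_at hd tapes_ruler\<close>)
  next
    case False
    then have k': "k < L" "k \<notin> X" using k by auto
    have "reaches p m (b + 5, tapes w L (increment L X # E), heads_at R k)
       (again, tapes w L (increment L X # E), \<lambda>_. 0)"
      by (rule home_reaches)
        (use located_slice[OF loc, of 5 2] L k in \<open>auto simp: increment_code_def home_def heads_at_def R_def\<close>)
    then have r4: "reaches p m (?S 4 k) ?z"
      by (intro reaches_exec[OF len ins4])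
        (use k' L False in \<open>simp_all del: exec.simps
           add: tapes_Cons_write[where h = "heads_at R k" and q = k and E = E, OF hd(2) x] heads_below_at increment_def Let_def k_def[symmetric]\<close>)
    have "heads_at R k x = k" by (simp add: heads_at_def R_def)
    then have "reaches p m (?S 1 k) ?z"
      by (intro reaches_exec[OF len ins1]) (use r4 k' L in \<open>auto simp: heads_below_at x'\<close>)
    then show ?thesis
      by (intro reaches_exec[OF len ins0]) (use k' L in \<open>auto simp: heads_below_at hd tapes_ruler\<close>)
  qed
  ultimately have "reaches p m (?S 0 0) ?z" by (rule reaches_trans)
  then show ?thesis by (simp add: heads_at_0)
qed

lemma set_encode_increment:
  assumes X: "X \<subseteq> {..<L}" "X \<noteq> {..<L}"
  shows "increment L X \<subseteq> {..<L}" "set_encode (increment L X) = Suc (set_encode X)"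
proof -
  define k where "k = first L ({..<L} - X)"
  have "k < L" "k \<notin> X" and below: "\<And>q. q < k \<Longrightarrow> q \<in> X"
    using first[of "{..<L} - X" L] X unfolding k_def[symmetric] by fastforce+
  have inc: "increment L X = insert k (X - {..<k})"
    by (simp add: increment_def k_def Let_def)
  show "increment L X \<subseteq> {..<L}" using inc \<open>k < L\<close> X by auto
  have fin: "finite X" using X finite_subset by blast
  \<comment> \<open>The bits below k are all set and contribute 2^k - 1 to the code; the increment
    replaces them by 2^k.\<close>
  have "X = {..<k} \<union> (X - {..<k})" using below by auto
  then have "set_encode X = sum ((^) 2) {..<k} + sum ((^) 2) (X - {..<k})"
    unfolding set_encode_def using fin
    by (metis (no_types, lifting) Diff_disjoint finite_Diff finite_lessThan sum.union_disjoint)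
  moreover have "sum ((^) (2::nat)) {..<k} = 2 ^ k - 1"
    using sum_power2[of k] by (simp add: atLeast0LessThan)
  ultimately show "set_encode (increment L X) = Suc (set_encode X)"
    using fin \<open>k \<notin> X\<close> unfolding inc by (simp add: set_encode_def)
qed

lemma set_encode_mono: "finite Y \<Longrightarrow> X \<subseteq> Y \<Longrightarrow> set_encode X \<le> set_encode Y"
  by (simp add: set_encode_def sum_mono2)

text \<open>The subsets of \<open>{..<L}\<close> are visited in the order of their codes, from the
  empty set with code 0 up to the full set.\<close>

lemma exists_reaches:
  assumes body: "\<And>X. X \<subseteq> {..<L} \<Longrightarrow>
      reaches p m (b, tapes w L (X # E), \<lambda>_. 0)
        (if P X then e else e + 5, tapes w L (X # E), \<lambda>_. 0)"
    and er: "located p e (erase_code (length E + 2) e t)"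
    and inc: "located p (e + 5) (increment_code (length E + 2) (e + 5) b f)"
    and L: "1 \<le> L" "L < m"
  shows "reaches p m (b, tapes w L E, \<lambda>_. 0)
     (if \<exists>X\<subseteq>{..<L}. P X then t else f, tapes w L E, \<lambda>_. 0)"
proof -
  \<comment> \<open>Generalised to a loop that has arrived at X: left to be tried are the sets whose
    codes are at least that of X. The induction is on the number of codes still to come.\<close>
  have "reaches p m (b, tapes w L (X # E), \<lambda>_. 0)
     (if \<exists>Y\<subseteq>{..<L}. set_encode X \<le> set_encode Y \<and> P Y then t else f, tapes w L E, \<lambda>_. 0)"
    if "X \<subseteq> {..<L}" for X
    using that
  proof (induction "set_encode {..<L} - set_encode X" arbitrary: X rule: less_induct)
    case less
    show ?case
    proof (cases "P X")
      case True
      then show ?thesis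
        using reaches_trans[OF body[OF less.prems, unfolded if_P[OF True]]
            erase_reaches[OF er refl less.prems L, of w]] less.prems
        by auto
    next
      case False
      note step = reaches_trans[OF body[OF less.prems], unfolded if_not_P[OF False],
          OF increment_reaches[OF inc refl less.prems L, of w]]
      show ?thesis
      proof (cases "X = {..<L}")
        case True
        have "\<not> P Y" if "Y \<subseteq> {..<L}" "set_encode X \<le> set_encode Y" for Y
        proof -
          have "set_encode Y = set_encode X"
            using that set_encode_mono[of "{..<L}" Y] True by simp
          then have "Y = X" using that True set_encode_eq
            by (metis finite_lessThan finite_subset)
          then show ?thesis using False by simp
        qed
        then show ?thesis using step True by auto
      next
        case neq: False
        note enc = set_encode_increment[OF less.prems neq]
        have "set_encode X < set_encode {..<L}"
          using set_encode_mono[OF _ enc(1)] enc(2) by simp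
        then have "reaches p m (b, tapes w L (increment L X # E), \<lambda>_. 0)
          (if \<exists>Y\<subseteq>{..<L}. set_encode (increment L X) \<le> set_encode Y \<and> P Y then t else f,
            tapes w L E, \<lambda>_. 0)"
          using enc by (intro less.hyps) auto
        moreover have "set_encode (increment L X) \<le> set_encode Y \<longleftrightarrow> set_encode X \<le> set_encode Y"
          if "P Y" "Y \<subseteq> {..<L}" for Y
        proof -
          have "Y \<noteq> X" using that False by auto
          then have "set_encode Y \<noteq> set_encode X"
            using that less.prems set_encode_eq by (metis finite_lessThan finite_subset)
          then show ?thesis using enc(2) by auto
        qed
        ultimately show ?thesis using step neq
          by (smt (verit) reaches_trans)
      qed
    qed
  qed
  from this[of "{}"] show ?thesis by (simp add: tapes_Cons_empty)
qed

lemma compile_reaches: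
  assumes "fm_wf (length E) \<phi>" "\<forall>X\<in>set E. X \<subseteq> {..<L}" "1 \<le> L" "L < m"
    and "located p b (compile \<phi> (length E) b t f)"
  shows "reaches p m (b, tapes w L E, \<lambda>_. 0) (if sem \<phi> w L E then t else f, tapes w L E, \<lambda>_. 0)"
  using assms
proof (induction \<phi> arbitrary: E b t f)
  case (Mem x y)
  then have *: "x < length E" "y < length E" "E ! x \<subseteq> {..<L}" by auto
  have "reaches p m (b, tapes w L E, \<lambda>_. 0) (if E ! x \<noteq> {} \<and>
     tapes w L E (length E + 1 - y) (Min (E ! x)) = Aux 0 then t else f, tapes w L E, \<lambda>_. 0)"
    by (rule test_reaches[where x = "length E + 1 - x"]) (use * Mem tapes_var[of x E] in auto)
  then show ?case unfolding tapes_var[OF *(2)] by simp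
next
  case (Sym s x)
  then have *: "x < length E" "E ! x \<subseteq> {..<L}" by auto
  have "reaches p m (b, tapes w L E, \<lambda>_. 0) (if E ! x \<noteq> {} \<and>
     tapes w L E 0 (Min (E ! x)) = s then t else f, tapes w L E, \<lambda>_. 0)"
    by (rule test_reaches[where x = "length E + 1 - x"]) (use * Sym tapes_var[of x E] in auto)
  moreover have "tapes w L E 0 = input_tape w" by (simp add: tapes_def)
  ultimately show ?case by simp
next
  case (Add x y z)
  then have *: "x < length E" "y < length E" "z < length E" "distinct [x, y, z]"
    "E ! x \<subseteq> {..<L}" "E ! y \<subseteq> {..<L}" "E ! z \<subseteq> {..<L}" by auto
  show ?case unfolding sem.simps
    by (rule add_reaches[where x = "length E + 1 - x" and y = "length E + 1 - y"
          and z = "length E + 1 - z"])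
      (use * Add tapes_var[of _ E] in auto)
next
  case (FNeg \<phi>)
  then have "reaches p m (b, tapes w L E, \<lambda>_. 0) (if sem \<phi> w L E then f else t, tapes w L E, \<lambda>_. 0)"
    by (intro FNeg.IH) auto
  then show ?case by (cases "sem \<phi> w L E") simp_all
next
  case (FAnd \<phi> \<psi>)
  have "reaches p m (b, tapes w L E, \<lambda>_. 0)
      (if sem \<phi> w L E then b + fm_size \<phi> else f, tapes w L E, \<lambda>_. 0)"
    by (rule FAnd.IH(1)) (use FAnd.prems in auto)
  moreover have "reaches p m (b + fm_size \<phi>, tapes w L E, \<lambda>_. 0)
      (if sem \<psi> w L E then t else f, tapes w L E, \<lambda>_. 0)"
    by (rule FAnd.IH(2)) (use FAnd.prems in auto)
  ultimately show ?case
    by (cases "sem \<phi> w L E") (auto intro: reaches_trans)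
next
  case (FEx \<phi>)
  let ?e = "b + fm_size \<phi>"
  have loc: "located p b (compile \<phi> (length (X # E)) b ?e (?e + 5))"
    "located p ?e (erase_code (length E + 2) ?e t)"
    "located p (?e + 5) (increment_code (length E + 2) (?e + 5) b f)" for X
    using FEx.prems(5) by (simp_all only: compile.simps located_append length_compile
        length_erase_code length_Cons add.assoc)
  show ?case unfolding sem.simps
  proof (rule exists_reaches[OF _ loc(2,3) FEx.prems(3,4)])
    fix X assume X: "X \<subseteq> {..<L}"
    show "reaches p m (b, tapes w L (X # E), \<lambda>_. 0)
      (if sem \<phi> w L (X # E) then ?e else ?e + 5, tapes w L (X # E), \<lambda>_. 0)"
      by (rule FEx.IH[OF _ _ _ _ loc(1)]) (use FEx.prems X in auto)
  qed
qed

text \<open>The machine tries L = 1, 2, ... until the first sentence holds, then decides the second one.\<close>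

definition search_program :: "'a fm \<Rightarrow> 'a fm \<Rightarrow> 'a instr list" where
  "search_program B \<phi> = (let e = 5 + fm_size B + fm_size \<phi> in
     [Write 1 (Aux 0) 1, GoRight {1} 2, Write 1 (Aux 1) 3] @ home 3 5
     @ compile B 0 5 (5 + fm_size B) e @ compile \<phi> 0 (5 + fm_size B) (e + 4) (e + 5)
     @ [Branch 1 (Aux 1) (e + 2) (e + 1), GoRight {1} e, Write 1 Blank (e + 3), GoRight {1} 2])"

section \<open>The search for the tape length\<close>

lemma search_program_wf:
  assumes "fm_wf 0 B" "fm_wf 0 \<phi>"
  shows "\<forall>ins\<in>set (search_program B \<phi>).
    instr_wf (fm_depth B + fm_depth \<phi> + 2) (length (search_program B \<phi>) + 2) ins"
proof -
  let ?N = "length (search_program B \<phi>) + 2" and ?K = "fm_depth B + fm_depth \<phi> + 2"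
  have len: "?N = fm_size B + fm_size \<phi> + 11"
    by (simp add: search_program_def Let_def home_def)
  have "\<forall>ins\<in>set (compile B 0 5 (5 + fm_size B) (5 + fm_size B + fm_size \<phi>)). instr_wf ?K ?N ins"
    by (rule compile_wf) (use assms len in auto)
  moreover have "\<forall>ins\<in>set (compile \<phi> 0 (5 + fm_size B) (5 + fm_size B + fm_size \<phi> + 4)
      (5 + fm_size B + fm_size \<phi> + 5)). instr_wf ?K ?N ins"
    by (rule compile_wf) (use assms len in auto)
  ultimately show ?thesis unfolding len
    unfolding search_program_def Let_def home_def by auto
qed

lemma search_reaches:
  assumes wf: "fm_wf 0 B" "fm_wf 0 \<phi>"
    and L0: "1 \<le> L0" "sem B w L0 []" "\<And>L. 1 \<le> L \<Longrightarrow> L < L0 \<Longrightarrow> \<not> sem B w L []" "L0 < m"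
  defines "p \<equiv> search_program B \<phi>"
  shows "reaches p m (blank_config w)
    (if sem \<phi> w L0 [] then length p else Suc (length p), tapes w L0 [], \<lambda>_. 0)"
proof -
  define e where "e = 5 + fm_size B + fm_size \<phi>"
  let ?z = "(if sem \<phi> w L0 [] then length p else Suc (length p), tapes w L0 [], \<lambda>_. 0)"
  have lenp: "length p = e + 4"
    by (simp add: p_def search_program_def Let_def home_def e_def)
  have loc: "located p 0 code" if "code = p" for code
    using that by (simp add: located_def)
  have locs: "located p 0 [Write 1 (Aux 0) 1, GoRight {1} 2, Write 1 (Aux 1) 3]"
    "located p 3 (home 3 5)"
    "located p 5 (compile B (length []) 5 (5 + fm_size B) e)"
    "located p (5 + fm_size B) (compile \<phi> (length []) (5 + fm_size B) (e + 4) (e + 5))"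
    "located p e [Branch 1 (Aux 1) (e + 2) (e + 1), GoRight {1} e, Write 1 Blank (e + 3), GoRight {1} 2]"
    using loc[OF meta_eq_to_obj_eq[OF p_def[symmetric, unfolded search_program_def Let_def, folded e_def]]]
    by (simp_all add: home_def e_def numeral_eq_Suc)
  have move1: "(\<lambda>i. if i = Suc 0 then Suc (heads_at {Suc 0} q i) else heads_at {Suc 0} q i)
      = heads_at {Suc 0} (Suc q)" for q
    by (auto simp: heads_at_def)
  \<comment> \<open>The ruler with its end mark erased, as it is while the mark moves from L to L +
    1.\<close>
  define stub where "stub = (\<lambda>j::nat. if j = 0 then Aux 0 else Blank :: 'a symbol)"
  let ?T = "tapes w" and ?H = "heads_at {1}"
  have enter: "reaches p m (2, (?T L [])(1 := stub), ?H L) (5, ?T L [], \<lambda>_. 0)"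
    if "1 \<le> L" "L \<le> L0" for L
  proof -
    have "stub(L := Aux 1) = ruler L" using that by (auto simp: stub_def ruler_def)
    moreover have "(?T L [])(Suc 0 := ruler L) = ?T L []" by (auto simp: tapes_def)
    moreover have "reaches p m (3, ?T L [], ?H L) (5, ?T L [], \<lambda>_. 0)"
      by (rule home_reaches) (use locs(2) that L0 in \<open>auto simp: heads_at_def\<close>)
    ultimately show ?thesis
      by (intro reaches_exec[of 2 p "Write 1 (Aux 1) 3"])
        (use locs(1) that L0 in \<open>auto simp: heads_below_at heads_at_in numeral_2_eq_2\<close>)
  qed
  have tapes_stub: "(?T L [])(Suc 0 := x) = (?T L' [])(Suc 0 := x)" for L L' x
    by (auto simp: tapes_def)
  have extend: "reaches p m (e, ?T L [], \<lambda>_. 0) (2, (?T (Suc L) [])(1 := stub), ?H (Suc L))"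
    if "1 \<le> L" "L < L0" for L
  proof -
    have step: "reaches p m (e, ?T L [], ?H 0) (e, ?T L [], ?H L)"
    proof (rule reaches_iterate[where S = "\<lambda>q. (e, ?T L [], ?H q)"])
      fix q assume "q < L"
      then have "reaches p m (e + 1, ?T L [], ?H q) (e, ?T L [], ?H (Suc q))"
        by (intro reaches_exec[of "e + 1" p "GoRight {1} e"])
          (use locs(5) that L0 in \<open>auto simp: heads_below_at move1\<close>)
      then show "reaches p m (e, ?T L [], ?H q) (e, ?T L [], ?H (Suc q))"
        by (intro reaches_exec[of e p "Branch 1 (Aux 1) (e + 2) (e + 1)"])
          (use locs(5) that L0 \<open>q < L\<close> in \<open>auto simp: heads_below_at heads_at_in tapes_ruler\<close>)
    qed
    have "(ruler L)(L := Blank) = stub" using that by (auto simp: stub_def ruler_def)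
    moreover have "?T L [] (Suc 0) = ruler L" by (simp add: tapes_def)
    moreover have "reaches p m (e + 3, (?T (Suc L) [])(1 := stub), ?H L)
        (2, (?T (Suc L) [])(1 := stub), ?H (Suc L))"
      by (rule reaches_exec[of "e + 3" p "GoRight {1} 2"])
        (use locs(5) that L0 in \<open>auto simp: heads_below_at numeral_3_eq_3 move1\<close>)
    ultimately have "reaches p m (e + 2, ?T L [], ?H L) (2, (?T (Suc L) [])(1 := stub), ?H (Suc L))"
      by (intro reaches_exec[of "e + 2" p "Write 1 Blank (e + 3)"])
        (use locs(5) that L0 tapes_stub[of L stub "Suc L"] in
          \<open>auto simp: heads_below_at numeral_2_eq_2 heads_at_in\<close>)
    then have "reaches p m (e, ?T L [], ?H L) (2, (?T (Suc L) [])(1 := stub), ?H (Suc L))"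
      by (intro reaches_exec[of e p "Branch 1 (Aux 1) (e + 2) (e + 1)"])
        (use locs(5) that L0 in \<open>auto simp: heads_below_at heads_at_in tapes_ruler\<close>)
    from reaches_trans[OF step this] show ?thesis by (simp only: heads_at_0)
  qed
  have "reaches p m (5, ?T L [], \<lambda>_. 0) ?z" if "1 \<le> L" "L \<le> L0" for L
    using that
  proof (induction "L0 - L" arbitrary: L)
    case 0
    then have "L = L0" by simp
    have "reaches p m (5, ?T L0 [], \<lambda>_. 0)
        (if sem B w L0 [] then 5 + fm_size B else e, ?T L0 [], \<lambda>_. 0)"
      by (rule compile_reaches[OF _ _ _ _ locs(3)]) (use wf L0 in auto)
    then have 1: "reaches p m (5, ?T L0 [], \<lambda>_. 0) (5 + fm_size B, ?T L0 [], \<lambda>_. 0)"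
      using L0(2) by simp
    have "reaches p m (5 + fm_size B, ?T L0 [], \<lambda>_. 0)
        (if sem \<phi> w L0 [] then e + 4 else e + 5, ?T L0 [], \<lambda>_. 0)"
      by (rule compile_reaches[OF _ _ _ _ locs(4)]) (use wf L0 in auto)
    moreover have "(if sem \<phi> w L0 [] then e + 4 else e + 5)
        = (if sem \<phi> w L0 [] then length p else Suc (length p))"
      using lenp by simp
    ultimately have 2: "reaches p m (5 + fm_size B, ?T L0 [], \<lambda>_. 0) ?z" by (simp only:)
    show ?case unfolding \<open>L = L0\<close> by (rule reaches_trans[OF 1 2])
  next
    case (Suc k)
    then have L: "L < L0" by simp
    have "reaches p m (5, ?T L [], \<lambda>_. 0)
        (if sem B w L [] then 5 + fm_size B else e, ?T L [], \<lambda>_. 0)"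
      by (rule compile_reaches[OF _ _ _ _ locs(3)]) (use wf L0 Suc.prems in auto)
    then have 1: "reaches p m (5, ?T L [], \<lambda>_. 0) (e, ?T L [], \<lambda>_. 0)"
      using L0(3)[OF Suc.prems(1) L] by simp
    have 2: "reaches p m (2, (?T (Suc L) [])(1 := stub), ?H (Suc L)) (5, ?T (Suc L) [], \<lambda>_. 0)"
      by (rule enter) (use L in auto)
    have "reaches p m (5, ?T (Suc L) [], \<lambda>_. 0) ?z"
      by (rule Suc.hyps(1)) (use Suc L in auto)
    from reaches_trans[OF reaches_trans[OF reaches_trans[OF 1 extend[OF Suc.prems(1) L]] 2] this]
    show ?case .
  qed
  from reaches_trans[OF enter this, of 1] L0(1)
  have from2: "reaches p m (2, (?T 1 [])(1 := stub), ?H 1) ?z" by simp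
  define c0 where "c0 = fst (snd (blank_config w))"
  have c0: "c0(Suc 0 := (c0 (Suc 0))(0 := Aux 0)) = (?T 1 [])(1 := stub)"
    by (intro ext) (auto simp: c0_def blank_config_def tapes_def stub_def input_tape_def level_def
        marks_def)
  have "reaches p m (1, (?T 1 [])(1 := stub), ?H 0) ?z"
    by (rule reaches_exec[of 1 p "GoRight {1} 2"])
      (use locs(1) L0 from2 in \<open>auto simp: heads_below_at move1\<close>)
  then have "reaches p m (0, c0, ?H 0) ?z"
    by (intro reaches_exec[of 0 p "Write 1 (Aux 0) 1"])
      (use locs(1) L0 c0 in \<open>auto simp: heads_below_at heads_at_in\<close>)
  then show ?thesis
    by (simp add: c0_def blank_config_def heads_at_0)
qed

text \<open>\<open>B\<close> recognises the admissible tape lengths. The search stops at the least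
  of them, which is at most the one assumed to exist, so a bound on some admissible length bounds
  the space. In return \<phi> has to give the right answer at every admissible length.\<close>

theorem fm_DSPACE:
  fixes B \<phi> :: "('a::finite) fm"
  assumes wf: "fm_wf 0 B" "fm_wf 0 \<phi>"
    and B: "\<And>w. \<exists>L\<ge>1. L < c * g (length w) \<and> sem B w L []"
    and \<phi>: "\<And>w L. 1 \<le> L \<Longrightarrow> sem B w L [] \<Longrightarrow> sem \<phi> w L [] \<longleftrightarrow> w \<in> A"
  shows "A \<in> DSPACE g"
proof -
  define p where "p = search_program B \<phi>"
  define K where "K = fm_depth B + fm_depth \<phi> + 2"
  have K: "K \<ge> 1" by (simp add: K_def)
  have pwf: "\<forall>ins\<in>set p. instr_wf K (length p + 2) ins"
    unfolding p_def K_def by (rule search_program_wf[OF wf])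
  have run: "(\<exists>t. fst (tm_run (program_tm K p) w t) = (if w \<in> A then length p else Suc (length p)))
      \<and> tm_space_le (program_tm K p) w (c * g (length w))" for w
  proof -
    define L0 where "L0 = (LEAST L. L \<ge> 1 \<and> sem B w L [])"
    obtain L where L: "L \<ge> 1" "L < c * g (length w)" "sem B w L []" using B by blast
    have L0: "L0 \<ge> 1 \<and> sem B w L0 []" unfolding L0_def by (rule LeastI[of _ L]) (use L in simp)
    moreover have "L0 \<le> L" unfolding L0_def by (rule Least_le) (use L in simp)
    ultimately have "reaches p (c * g (length w)) (blank_config w)
        (if sem \<phi> w L0 [] then length p else Suc (length p), tapes w L0 [], \<lambda>_. 0)"
      unfolding p_def
      by (intro search_reaches) (use wf L not_less_Least in \<open>auto simp: L0_def\<close>)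
    then have r: "reaches p (c * g (length w)) (blank_config w)
        (if w \<in> A then length p else Suc (length p), tapes w L0 [], \<lambda>_. 0)"
      using \<phi>[of L0 w] L0 by simp
    have "0 < c * g (length w)" using L(2) by linarith
    from program_tm_run[OF K pwf r _ this] show ?thesis by simp
  qed
  have "tm_decides (program_tm K p) A"
    unfolding tm_decides_def
  proof
    fix w
    show "if w \<in> A then \<exists>t. fst (tm_run (program_tm K p) w t) = tm_accept (program_tm K p)
      else \<exists>t. fst (tm_run (program_tm K p) w t) = tm_reject (program_tm K p)"
      using run[of w] by (auto simp: program_tm_def)
  qed
  then show ?thesis
    unfolding DSPACE_def using program_tm_wf[OF K pwf] run by blast
qed

section \<open>Definability with all values below the length of the tapes\<close>

text \<open>The formula is hidden behind an existential quantifier: a property is shown to be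
  \<open>raw\<close> by closure rules applied along its structure, and the formula is assembled on
  the way. The rules in \<open>rawI\<close> act as these constructors.\<close>

definition raw :: "nat \<Rightarrow> ('a list \<Rightarrow> nat \<Rightarrow> nat set list \<Rightarrow> bool) \<Rightarrow> bool" where
  "raw d Q \<longleftrightarrow> (\<exists>\<phi>. fm_wf d \<phi> \<and> (\<forall>w L E. 1 \<le> L \<longrightarrow> length E = d \<longrightarrow> (\<forall>X\<in>set E. X \<subseteq> {..<L}) \<longrightarrow>
     sem \<phi> w L E = Q w L E))"

named_theorems rawI

lemma raw_cong:
  assumes "raw d Q"
    and "\<And>w L E. 1 \<le> L \<Longrightarrow> length E = d \<Longrightarrow> (\<forall>X\<in>set E. X \<subseteq> {..<L}) \<Longrightarrow> Q w L E = Q' w L E"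
  shows "raw d Q'"
  using assms unfolding raw_def by metis

lemma raw_neg [rawI]: "raw d Q \<Longrightarrow> raw d (\<lambda>w L E. \<not> Q w L E)"
  unfolding raw_def by (metis fm_wf.simps(4) sem.simps(4))

lemma raw_conj [rawI]: "raw d Q \<Longrightarrow> raw d Q' \<Longrightarrow> raw d (\<lambda>w L E. Q w L E \<and> Q' w L E)"
  unfolding raw_def by (metis fm_wf.simps(5) sem.simps(5))

text \<open>The bound set becomes \<open>hd E\<close> and the outer variables are read through
  \<open>tl E\<close>, so that \<open>rvar_hd\<close> and \<open>rvar_tl\<close> resolve the access
  to a variable at any depth.\<close>

lemma raw_ex [rawI]:
  assumes "raw (Suc d) (\<lambda>w L E. Q w L (hd E) (tl E))"
  shows "raw d (\<lambda>w L E. \<exists>X\<subseteq>{..<L}. Q w L X E)"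
proof -
  obtain \<phi> where \<phi>: "fm_wf (Suc d) \<phi>" "\<And>w L E. 1 \<le> L \<Longrightarrow> length E = Suc d \<Longrightarrow>
      (\<forall>X\<in>set E. X \<subseteq> {..<L}) \<Longrightarrow> sem \<phi> w L E = Q w L (hd E) (tl E)"
    using assms unfolding raw_def by blast
  show ?thesis unfolding raw_def
  proof (intro exI[of _ "FEx \<phi>"] conjI allI impI)
    fix w L E assume "1 \<le> (L::nat)" "length E = d" "\<forall>X\<in>set E. X \<subseteq> {..<L}"
    then have "sem \<phi> w L (X # E) = Q w L X E" if "X \<subseteq> {..<L}" for X
      using \<phi>(2)[of L "X # E" w] that by auto
    then show "sem (FEx \<phi>) w L E = (\<exists>X\<subseteq>{..<L}. Q w L X E)" by auto
  qed (use \<phi> in simp)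
qed

lemma raw_disj [rawI]:
  assumes "raw d Q" "raw d Q'"
  shows "raw d (\<lambda>w L E. Q w L E \<or> Q' w L E)"
  by (rule raw_cong[OF raw_neg[OF raw_conj[OF raw_neg[OF assms(1)] raw_neg[OF assms(2)]]]]) simp

lemma raw_imp [rawI]:
  assumes "raw d Q" "raw d Q'"
  shows "raw d (\<lambda>w L E. Q w L E \<longrightarrow> Q' w L E)"
  by (rule raw_cong[OF raw_disj[OF raw_neg[OF assms(1)] assms(2)]]) simp

text \<open>Applied to injective renamings, since \<open>Add\<close> wants three distinct
  variables.\<close>

primrec fm_rename :: "(nat \<Rightarrow> nat) \<Rightarrow> 'a fm \<Rightarrow> 'a fm" where
  "fm_rename r (Mem x y) = Mem (r x) (r y)"
| "fm_rename r (Sym s x) = Sym s (r x)"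
| "fm_rename r (Add x y z) = Add (r x) (r y) (r z)"
| "fm_rename r (FNeg f) = FNeg (fm_rename r f)"
| "fm_rename r (FAnd f g) = FAnd (fm_rename r f) (fm_rename r g)"
| "fm_rename r (FEx f) = FEx (fm_rename (\<lambda>i. case i of 0 \<Rightarrow> 0 | Suc j \<Rightarrow> Suc (r j)) f)"

lemma fm_rename:
  assumes "fm_wf d \<phi>" "inj_on r {..<d}" "\<forall>i<d. r i < d'"
  shows "fm_wf d' (fm_rename r \<phi>)"
    and "length E = d \<Longrightarrow> length E' = d' \<Longrightarrow> \<forall>i<d. E' ! r i = E ! i \<Longrightarrow>
      sem (fm_rename r \<phi>) w L E' = sem \<phi> w L E"
  using assms
proof (induction \<phi> arbitrary: d d' r E E')
  case (FEx \<phi>)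
  {
    case 1
    let ?r = "\<lambda>i. case i of 0 \<Rightarrow> 0 | Suc j \<Rightarrow> Suc (r j)"
    have "inj_on ?r {..<Suc d}" "\<forall>i<Suc d. ?r i < Suc d'"
      using 1 by (auto simp: inj_on_def less_Suc_eq_0_disj lessThan_def)
    then show ?case using FEx.IH(1)[of "Suc d" ?r "Suc d'"] 1 by simp
  next
    case 2
    let ?r = "\<lambda>i. case i of 0 \<Rightarrow> 0 | Suc j \<Rightarrow> Suc (r j)"
    have "inj_on ?r {..<Suc d}" "\<forall>i<Suc d. ?r i < Suc d'"
      using 2 by (auto simp: inj_on_def less_Suc_eq_0_disj lessThan_def)
    moreover have "\<forall>i<Suc d. (X # E') ! ?r i = (X # E) ! i" for X
      using 2 by (auto split: nat.splits)
    ultimately have "sem (fm_rename ?r \<phi>) w L (X # E') = sem \<phi> w L (X # E)" for X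
      using 2 by (intro FEx.IH(2)[of _ "Suc d" _ "Suc d'"]) auto
    then show ?case by simp
  }
qed (auto simp: inj_on_def)

lemma raw_rename:
  assumes "raw d Q" "length js = d" "distinct js" "\<forall>i\<in>set js. i < d'"
    and f: "\<And>E. length E = d' \<Longrightarrow> f E = map (\<lambda>i. E ! i) js"
  shows "raw d' (\<lambda>w L E. Q w L (f E))"
proof -
  obtain \<phi> where \<phi>: "fm_wf d \<phi>" "\<And>w L E. 1 \<le> L \<Longrightarrow> length E = d \<Longrightarrow>
      (\<forall>X\<in>set E. X \<subseteq> {..<L}) \<Longrightarrow> sem \<phi> w L E = Q w L E"
    using assms(1) unfolding raw_def by blast
  have r: "inj_on ((!) js) {..<d}" "\<forall>i<d. js ! i < d'"
    using assms(2-4) by (auto simp: inj_on_nth)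
  show ?thesis unfolding raw_def
  proof (intro exI[of _ "fm_rename ((!) js) \<phi>"] conjI allI impI)
    show "fm_wf d' (fm_rename ((!) js) \<phi>)" by (rule fm_rename(1)[OF \<phi>(1) r])
    fix w L E assume *: "1 \<le> (L::nat)" "length E = d'" "\<forall>X\<in>set E. X \<subseteq> {..<L}"
    have "\<forall>X\<in>set (f E). X \<subseteq> {..<L}" using * f assms(4) by (auto simp: subset_iff)
    moreover have "sem (fm_rename ((!) js) \<phi>) w L E = sem \<phi> w L (f E)"
      by (rule fm_rename(2)[OF \<phi>(1) r]) (use * f assms(2) in auto)
    ultimately show "sem (fm_rename ((!) js) \<phi>) w L E = Q w L (f E)"
      using \<phi>(2)[of L "f E" w] * f assms(2) by simp
  qed
qed

definition rvar :: "nat \<Rightarrow> (nat set list \<Rightarrow> nat set) \<Rightarrow> bool" where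
  "rvar d X \<longleftrightarrow> (\<exists>i<d. \<forall>E. length E = d \<longrightarrow> X E = E ! i)"

lemma rvar_hd [rawI]: "rvar (Suc d) hd"
  unfolding rvar_def by (intro exI[of _ 0]) (auto simp: length_Suc_conv)

lemma rvar_tl [rawI]: "rvar d X \<Longrightarrow> rvar (Suc d) (\<lambda>E. X (tl E))"
  unfolding rvar_def
proof (elim exE conjE)
  fix i assume "i < d" "\<forall>E. length E = d \<longrightarrow> X E = E ! i"
  then show "\<exists>i<Suc d. \<forall>E. length E = Suc d \<longrightarrow> X (tl E) = E ! i"
    by (intro exI[of _ "Suc i"]) (auto simp: nth_tl)
qed

lemma rvar_nth [rawI]: "i < d \<Longrightarrow> rvar d (\<lambda>E. E ! i)"
  unfolding rvar_def by blast

lemma rvar_subset: "rvar d X \<Longrightarrow> length E = d \<Longrightarrow> \<forall>Y\<in>set E. Y \<subseteq> {..<L} \<Longrightarrow> X E \<subseteq> {..<L}"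
  unfolding rvar_def by (metis nth_mem)

lemma rvar_finite: "rvar d X \<Longrightarrow> length E = d \<Longrightarrow> \<forall>Y\<in>set E. Y \<subseteq> {..<L} \<Longrightarrow> finite (X E)"
  by (rule finite_subset[OF rvar_subset finite_lessThan])

lemma raw_mem0:
  assumes "rvar d X" "rvar d Y"
  shows "raw d (\<lambda>w L E. X E \<noteq> {} \<and> Min (X E) \<in> Y E)"
proof -
  obtain i j where "i < d" "\<forall>E. length E = d \<longrightarrow> X E = E ! i"
    "j < d" "\<forall>E. length E = d \<longrightarrow> Y E = E ! j"
    using assms unfolding rvar_def by blast
  then show ?thesis unfolding raw_def by (intro exI[of _ "Mem i j"]) simp
qed

lemma raw_sym0:
  assumes "rvar d X"
  shows "raw d (\<lambda>w L E. X E \<noteq> {} \<and> input_tape w (Min (X E)) = s)"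
proof -
  obtain i where "i < d" "\<forall>E. length E = d \<longrightarrow> X E = E ! i"
    using assms unfolding rvar_def by blast
  then show ?thesis unfolding raw_def by (intro exI[of _ "Sym s i"]) simp
qed

lemma raw_nonempty [rawI]:
  assumes "rvar d X"
  shows "raw d (\<lambda>w L E. X E \<noteq> {})"
proof (rule raw_cong[OF raw_mem0[OF assms assms]])
  fix w L E assume *: "length E = d" "\<forall>X\<in>set E. X \<subseteq> {..<L::nat}"
  have "finite (X E)" by (rule rvar_finite[OF assms *])
  then show "(X E \<noteq> {} \<and> Min (X E) \<in> X E) = (X E \<noteq> {})" by (metis Min_in)
qed

lemma raw_empty [rawI]:
  assumes "rvar d X"
  shows "raw d (\<lambda>w L E. X E = {})"
  by (rule raw_cong[OF raw_neg[OF raw_nonempty[OF assms]]]) simp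

text \<open>If each minimum lies in the other set, each is at most the other; so two uses of
  \<open>Mem\<close> express equality of minima.\<close>

lemma raw_same_Min:
  assumes "rvar d X" "rvar d Y"
  shows "raw d (\<lambda>w L E. X E \<noteq> {} \<and> Y E \<noteq> {} \<and> Min (X E) = Min (Y E))"
proof (rule raw_cong[OF raw_conj[OF raw_mem0[OF assms] raw_mem0[OF assms(2,1)]]])
  fix w L E assume *: "length E = d" "\<forall>X\<in>set E. X \<subseteq> {..<L::nat}"
  have fin: "finite (X E)" "finite (Y E)"
    using rvar_finite[OF assms(1) *] rvar_finite[OF assms(2) *] by simp_all
  show "((X E \<noteq> {} \<and> Min (X E) \<in> Y E) \<and> Y E \<noteq> {} \<and> Min (Y E) \<in> X E) =
    (X E \<noteq> {} \<and> Y E \<noteq> {} \<and> Min (X E) = Min (Y E))"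
    using fin Min_in[OF fin(1)] Min_in[OF fin(2)] by (metis Min_le antisym)
qed

text \<open>The three arguments may be the same variable, which \<open>Add\<close> forbids; three
  fresh variables with the same minima stand in for them.\<close>

lemma raw_add0:
  assumes "rvar d X" "rvar d Y" "rvar d Z"
  shows "raw d (\<lambda>w L E. X E \<noteq> {} \<and> Y E \<noteq> {} \<and> Z E \<noteq> {} \<and> Min (X E) + Min (Y E) = Min (Z E))"
proof -
  have add: "raw (Suc (Suc (Suc d))) (\<lambda>w L E. E ! 2 \<noteq> {} \<and> E ! 1 \<noteq> {} \<and> E ! 0 \<noteq> {} \<and>
      Min (E ! 2) + Min (E ! 1) = Min (E ! 0))"
    unfolding raw_def by (intro exI[of _ "Add 2 1 0"]) simp
  have "raw d (\<lambda>w L E. \<exists>A\<subseteq>{..<L}. \<exists>B\<subseteq>{..<L}. \<exists>C\<subseteq>{..<L}.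
      (A \<noteq> {} \<and> X E \<noteq> {} \<and> Min A = Min (X E)) \<and> (B \<noteq> {} \<and> Y E \<noteq> {} \<and> Min B = Min (Y E)) \<and>
      (C \<noteq> {} \<and> Z E \<noteq> {} \<and> Min C = Min (Z E)) \<and>
      (A \<noteq> {} \<and> B \<noteq> {} \<and> C \<noteq> {} \<and> Min A + Min B = Min C))"
    by (rule raw_ex, rule raw_ex, rule raw_ex,
        rule raw_conj[OF _ raw_conj[OF _ raw_conj[OF _ raw_cong[OF add]]]])
      (intro raw_same_Min rawI assms | auto simp: length_Suc_conv numeral_2_eq_2)+
  then show ?thesis
  proof (rule raw_cong)
    fix w L E assume *: "length E = d" "\<forall>X\<in>set E. X \<subseteq> {..<L::nat}"
    note sub = rvar_subset[OF assms(1) *] rvar_subset[OF assms(2) *] rvar_subset[OF assms(3) *]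
    show "(\<exists>A\<subseteq>{..<L}. \<exists>B\<subseteq>{..<L}. \<exists>C\<subseteq>{..<L}.
      (A \<noteq> {} \<and> X E \<noteq> {} \<and> Min A = Min (X E)) \<and> (B \<noteq> {} \<and> Y E \<noteq> {} \<and> Min B = Min (Y E)) \<and>
      (C \<noteq> {} \<and> Z E \<noteq> {} \<and> Min C = Min (Z E)) \<and>
      (A \<noteq> {} \<and> B \<noteq> {} \<and> C \<noteq> {} \<and> Min A + Min B = Min C)) =
      (X E \<noteq> {} \<and> Y E \<noteq> {} \<and> Z E \<noteq> {} \<and> Min (X E) + Min (Y E) = Min (Z E))" (is "?l = ?r")
    proof
      assume ?r then show ?l
        using sub by (intro exI[of _ "X E"] exI[of _ "Y E"] exI[of _ "Z E"] conjI) auto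
    qed auto
  qed
qed

text \<open>The value 0 for the empty set makes every set denote a number, and for L \<ge> 1 a
  number below L if the set is below L.\<close>

definition number :: "nat set \<Rightarrow> nat" where
  "number X = (if X = {} then 0 else Min X)"

lemma number_singleton [simp]: "number {x} = x"
  by (simp add: number_def)

lemma number_less:
  assumes "X \<subseteq> {..<L}" "1 \<le> L"
  shows "number X < L"
proof (cases "X = {}")
  case False
  then have "Min X \<in> X" using assms(1) by (intro Min_in finite_subset[OF _ finite_lessThan])
  then show ?thesis using assms by (auto simp: number_def)
qed (use assms in \<open>simp add: number_def\<close>)

lemma raw_ex_number [rawI]:
  assumes "raw (Suc d) (\<lambda>w L E. Q w L (number (hd E)) (tl E))"
  shows "raw d (\<lambda>w L E. \<exists>x<L. Q w L x E)"
proof (rule raw_cong[OF raw_ex[OF assms]])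
  fix w E and L :: nat assume "1 \<le> L"
  show "(\<exists>X\<subseteq>{..<L}. Q w L (number X) E) = (\<exists>x<L. Q w L x E)"
  proof
    assume "\<exists>x<L. Q w L x E"
    then obtain x where "x < L" "Q w L x E" by blast
    then show "\<exists>X\<subseteq>{..<L}. Q w L (number X) E" by (intro exI[of _ "{x}"]) auto
  qed (use number_less \<open>1 \<le> L\<close> in blast)
qed

lemma raw_all_number [rawI]:
  assumes "raw (Suc d) (\<lambda>w L E. Q w L (number (hd E)) (tl E))"
  shows "raw d (\<lambda>w L E. \<forall>x<L. Q w L x E)"
  by (rule raw_cong[OF raw_neg[OF raw_ex_number[OF raw_neg[OF assms]]]]) simp

lemma raw_number_conv:
  assumes X: "rvar d X"
    and Q: "raw (Suc d) (\<lambda>w L E. hd E \<noteq> {} \<and> Q w L (Min (hd E)) (tl E))"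
  shows "raw d (\<lambda>w L E. Q w L (number (X E)) E)"
proof -
  \<comment> \<open>A nonempty A replaces X: it has the minimum of X or, if X is empty, the minimum
    0, characterised as the only m with m + m = m.\<close>
  have "raw d (\<lambda>w L E. \<exists>A\<subseteq>{..<L}. (A \<noteq> {} \<and> Q w L (Min A) E) \<and>
    ((A \<noteq> {} \<and> X E \<noteq> {} \<and> Min A = Min (X E)) \<or>
     (X E = {} \<and> (A \<noteq> {} \<and> A \<noteq> {} \<and> A \<noteq> {} \<and> Min A + Min A = Min A))))"
    by (intro rawI X Q raw_same_Min raw_add0)
  then show ?thesis
  proof (rule raw_cong)
    fix w L E assume *: "1 \<le> L" "length E = d" "\<forall>X\<in>set E. X \<subseteq> {..<L::nat}"
    note sub = rvar_subset[OF X *(2,3)]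
    show "(\<exists>A\<subseteq>{..<L}. (A \<noteq> {} \<and> Q w L (Min A) E) \<and>
      ((A \<noteq> {} \<and> X E \<noteq> {} \<and> Min A = Min (X E)) \<or>
       (X E = {} \<and> (A \<noteq> {} \<and> A \<noteq> {} \<and> A \<noteq> {} \<and> Min A + Min A = Min A)))) = Q w L (number (X E)) E"
      (is "?l = ?r")
    proof
      assume ?l then show ?r by (auto simp: number_def)
    next
      assume r: ?r
      show ?l
      proof (cases "X E = {}")
        case True
        then show ?thesis using r * by (intro exI[of _ "{0}"]) (auto simp: number_def)
      next
        case False
        then show ?thesis using r sub by (intro exI[of _ "X E"]) (auto simp: number_def)
      qed
    qed
  qed
qed

definition rnum :: "nat \<Rightarrow> (nat set list \<Rightarrow> nat) \<Rightarrow> bool" where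
  "rnum d x \<longleftrightarrow> (\<exists>X. rvar d X \<and> x = (\<lambda>E. number (X E)))"

lemma rnum_number [rawI]: "rvar d X \<Longrightarrow> rnum d (\<lambda>E. number (X E))"
  unfolding rnum_def by blast

lemma raw_mem [rawI]:
  assumes "rnum d x" "rvar d Y"
  shows "raw d (\<lambda>w L E. x E \<in> Y E)"
proof -
  obtain X where X: "rvar d X" "x = (\<lambda>E. number (X E))" using assms(1) unfolding rnum_def by blast
  show ?thesis unfolding X(2)
    by (rule raw_number_conv[OF X(1)]) (intro raw_mem0 rawI assms)
qed

lemma raw_sym [rawI]:
  assumes "rnum d x"
  shows "raw d (\<lambda>w L E. input_tape w (x E) = s)"
proof -
  obtain X where X: "rvar d X" "x = (\<lambda>E. number (X E))" using assms(1) unfolding rnum_def by blast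
  show ?thesis unfolding X(2)
    by (rule raw_number_conv[OF X(1)]) (intro raw_sym0 rawI)
qed

lemma raw_add [rawI]:
  assumes "rnum d x" "rnum d y" "rnum d z"
  shows "raw d (\<lambda>w L E. x E + y E = z E)"
proof -
  obtain X Y Z where X: "rvar d X" "x = (\<lambda>E. number (X E))" and Y: "rvar d Y" "y = (\<lambda>E. number (Y E))"
    and Z: "rvar d Z" "z = (\<lambda>E. number (Z E))"
    using assms unfolding rnum_def by blast
  have zero: "raw (Suc d) (\<lambda>w L E. hd E \<noteq> {})" for d
    by (intro rawI)
  \<comment> \<open>The nonempty variables are exchanged for arbitrary ones one at a time, first z,
    then y, then x; each exchange removes the variable at the head of the environment.\<close>
  have "raw (Suc (Suc (Suc d))) (\<lambda>w L E. hd (tl (tl E)) \<noteq> {} \<and> hd (tl E) \<noteq> {} \<and> hd E \<noteq> {} \<and>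
      Min (hd (tl (tl E))) + Min (hd (tl E)) = Min (hd E))"
    by (intro raw_add0 rawI)
  then have "raw (Suc (Suc (Suc d))) (\<lambda>w L E. hd E \<noteq> {} \<and> hd (tl E) \<noteq> {} \<and> hd (tl (tl E)) \<noteq> {} \<and>
      Min (hd (tl (tl E))) + Min (hd (tl E)) = Min (hd E))"
    by (rule raw_cong) auto
  from raw_number_conv[OF rvar_tl[OF rvar_tl[OF Z(1)]], of "\<lambda>w L z E. hd E \<noteq> {} \<and> hd (tl E) \<noteq> {} \<and>
      Min (hd (tl E)) + Min (hd E) = z", OF this]
  have "raw (Suc (Suc d)) (\<lambda>w L E. hd E \<noteq> {} \<and> hd (tl E) \<noteq> {} \<and>
      Min (hd (tl E)) + Min (hd E) = number (Z (tl (tl E))))" .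
  from raw_number_conv[OF rvar_tl[OF Y(1)], of "\<lambda>w L y E. hd E \<noteq> {} \<and>
      Min (hd E) + y = number (Z (tl E))", OF this]
  have "raw (Suc d) (\<lambda>w L E. hd E \<noteq> {} \<and> Min (hd E) + number (Y (tl E)) = number (Z (tl E)))" .
  from raw_number_conv[OF X(1), of "\<lambda>w L x E. x + number (Y E) = number (Z E)", OF this]
  show ?thesis unfolding X(2) Y(2) Z(2) .
qed

lemma rnum_less:
  assumes "rnum d x" "1 \<le> L" "length E = d" "\<forall>X\<in>set E. X \<subseteq> {..<L}"
  shows "x E < L"
  using assms number_less rvar_subset unfolding rnum_def by blast

lemma raw_zero [rawI]: "rnum d x \<Longrightarrow> raw d (\<lambda>w L E. x E = 0)"
  by (rule raw_cong[of _ "\<lambda>w L E. x E + x E = x E"]) (intro rawI, auto)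

lemma raw_le [rawI]:
  assumes "rnum d x" "rnum d y"
  shows "raw d (\<lambda>w L E. x E \<le> y E)"
proof -
  obtain X Y where X: "rvar d X" "x = (\<lambda>E. number (X E))" and Y: "rvar d Y" "y = (\<lambda>E. number (Y E))"
    using assms unfolding rnum_def by blast
  show ?thesis
  proof (rule raw_cong)
    show "raw d (\<lambda>w L E. \<exists>z<L. number (X E) + z = number (Y E))"
      by (intro rawI X Y)
    fix w L E assume *: "1 \<le> L" "length E = d" "\<forall>X\<in>set E. X \<subseteq> {..<L::nat}"
    show "(\<exists>z<L. number (X E) + z = number (Y E)) = (x E \<le> y E)"
      unfolding X(2)[symmetric] Y(2)[symmetric]
      using rnum_less[OF assms(2) *] X(2) Y(2)
      by (metis le_add1 le_add2 le_add_diff_inverse le_less_trans)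
  qed
qed

lemma raw_less [rawI]:
  assumes "rnum d x" "rnum d y"
  shows "raw d (\<lambda>w L E. x E < y E)"
  by (rule raw_cong[OF raw_neg[OF raw_le[OF assms(2,1)]]]) auto

lemma rnum_tl [rawI]: "rnum d x \<Longrightarrow> rnum (Suc d) (\<lambda>E. x (tl E))"
  unfolding rnum_def using rvar_tl by fastforce

lemma raw_one [rawI]:
  assumes "rnum d x"
  shows "raw d (\<lambda>w L E. x E = 1)"
proof (rule raw_cong)
  show "raw d (\<lambda>w L E. x E \<noteq> 0 \<and> (\<forall>v<L. v < x E \<longrightarrow> v = 0))"
    by (intro rawI assms)
  fix w E and L :: nat assume *: "1 \<le> L" "length E = d" "\<forall>X\<in>set E. X \<subseteq> {..<L}"
  have "1 < L" if "x E \<noteq> 0" using rnum_less[OF assms *] that by linarith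
  then show "(x E \<noteq> 0 \<and> (\<forall>v<L. v < x E \<longrightarrow> v = 0)) = (x E = 1)"
    by (cases "x E = 0") auto
qed

lemma raw_eq [rawI]:
  assumes "rnum d x" "rnum d y"
  shows "raw d (\<lambda>w L E. x E = y E)"
  by (rule raw_cong[OF raw_conj[OF raw_le[OF assms] raw_le[OF assms(2,1)]]]) auto

section \<open>Multiplication and powers from addition\<close>

definition dvd_below :: "nat \<Rightarrow> nat \<Rightarrow> nat \<Rightarrow> bool" where
  "dvd_below L x z \<longleftrightarrow> (\<exists>S\<subseteq>{..<L}. z \<in> S \<and>
     (\<forall>s<L. s \<in> S \<longrightarrow> s = 0 \<or> (\<exists>s'<L. s' \<in> S \<and> s' + x = s)))"

text \<open>A set that contains s - x with each of its nonzero elements s leads down to 0 in steps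
  of x, so all its elements are multiples of x. Conversely the multiples of x up to z form such a
  set.\<close>

lemma dvd_below:
  assumes "0 < x" "z < L"
  shows "dvd_below L x z \<longleftrightarrow> x dvd z"
proof
  assume "dvd_below L x z"
  then obtain S where S: "z \<in> S" "S \<subseteq> {..<L}"
      "\<And>s. s \<in> S \<Longrightarrow> s = 0 \<or> (\<exists>s'<L. s' \<in> S \<and> s' + x = s)"
    unfolding dvd_below_def by blast
  have "x dvd s" if "s \<in> S" for s
    using that
  proof (induction s rule: less_induct)
    case (less s)
    show ?case
    proof (cases "s = 0")
      case False
      then obtain s' where "s' \<in> S" "s' + x = s" using S(3) less.prems by blast
      then show ?thesis using less.IH[of s'] assms(1) by (metis dvd_add dvd_refl less_add_same_cancel1)
    qed simp
  qed
  then show "x dvd z" using S(1) by blast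
next
  assume "x dvd z"
  let ?S = "{s. s \<le> z \<and> x dvd s}"
  have "s = 0 \<or> (\<exists>s'<L. s' \<in> ?S \<and> s' + x = s)" if s: "s \<in> ?S" for s
  proof (cases "s = 0")
    case False
    then have "x \<le> s" using s dvd_imp_le by blast
    then show ?thesis using s assms by (intro disjI2 exI[of _ "s - x"]) auto
  qed simp
  moreover have "?S \<subseteq> {..<L}" "z \<in> ?S" using assms \<open>x dvd z\<close> by auto
  ultimately show "dvd_below L x z"
    unfolding dvd_below_def by blast
qed

lemma raw_dvd_below [rawI]:
  assumes "rnum d x" "rnum d z"
  shows "raw d (\<lambda>w L E. dvd_below L (x E) (z E))"
  unfolding dvd_below_def by (intro rawI assms)

definition product_candidate :: "nat \<Rightarrow> nat \<Rightarrow> nat \<Rightarrow> nat \<Rightarrow> bool" where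
  "product_candidate L x y z \<longleftrightarrow> dvd_below L x z \<and>
     (\<exists>s<L. (\<exists>v<L. v = 1 \<and> x + v = s) \<and> (\<exists>t<L. z + y = t \<and> dvd_below L s t))"

text \<open>For y at most x, the product is the least multiple z of x such that x + 1 divides z + y.\<close>

definition times_below :: "nat \<Rightarrow> nat \<Rightarrow> nat \<Rightarrow> nat \<Rightarrow> bool" where
  "times_below L x y z \<longleftrightarrow> ((x = 0 \<or> y = 0) \<and> z = 0) \<or> (x \<noteq> 0 \<and> y \<noteq> 0 \<and>
     ((y \<le> x \<and> product_candidate L x y z \<and> (\<forall>v<L. v < z \<longrightarrow> \<not> product_candidate L x y v)) \<or>
      (x < y \<and> product_candidate L y x z \<and> (\<forall>v<L. v < z \<longrightarrow> \<not> product_candidate L y x v))))"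

lemma raw_times_below [rawI]:
  assumes "rnum d x" "rnum d y" "rnum d z"
  shows "raw d (\<lambda>w L E. times_below L (x E) (y E) (z E))"
  unfolding times_below_def product_candidate_def by (intro rawI assms)

text \<open>Let z = x * a and z + y = (x + 1) * b. If z were below x * y, then b < y and x * (b - a)
  = y - b > 0. Hence a < b and y - b \<ge> x \<ge> y, which contradicts b > 0.\<close>

lemma product_le_multiple:
  fixes x y z :: nat
  assumes "0 < y" "y \<le> x" "x dvd z" "Suc x dvd z + y"
  shows "x * y \<le> z"
proof (rule ccontr)
  assume "\<not> x * y \<le> z"
  obtain a b where a: "z = x * a" and b: "z + y = Suc x * b" using assms(3,4) by (auto simp: dvd_def)
  have "Suc x * b < Suc x * y" using b \<open>\<not> x * y \<le> z\<close> by (metis add.commute add_less_cancel_left mult_Suc not_le)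
  then have "b < y" by (metis mult_less_cancel1)
  have eq: "x * a + y = x * b + b" using a b by simp
  then have "x * a < x * b" using \<open>b < y\<close> by linarith
  then have "Suc a \<le> b" by simp
  then have "x * Suc a \<le> x * b" by (rule mult_le_mono2)
  then show False using eq assms(2) \<open>Suc a \<le> b\<close> by simp
qed

lemma product_candidate_iff:
  assumes "0 < x" "z < L" "Suc x < L"
  shows "product_candidate L x y z \<longleftrightarrow> x dvd z \<and> z + y < L \<and> Suc x dvd z + y"
  using assms by (auto simp: product_candidate_def dvd_below)

lemma times_below_sound:
  assumes "times_below L x y z" "z < L"
  shows "z = x * y"
proof -
  have *: "z = x * y" if "0 < y" "y \<le> x" "product_candidate L x y z"
    "\<forall>v<L. v < z \<longrightarrow> \<not> product_candidate L x y v" for x y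
  proof -
    have "Suc x < L" using that(3) unfolding product_candidate_def by auto
    have pc: "x dvd z \<and> z + y < L \<and> Suc x dvd z + y"
      using that product_candidate_iff[of x z L y] assms(2) \<open>Suc x < L\<close> by simp
    then have le: "x * y \<le> z" using that product_le_multiple by blast
    moreover have "Suc x dvd x * y + y" by (metis add.commute dvd_triv_left mult_Suc)
    ultimately have "product_candidate L x y (x * y)"
      using product_candidate_iff[of x "x * y" L y] pc that \<open>Suc x < L\<close> by simp
    moreover have "x * y < L" using le pc by linarith
    ultimately show ?thesis using that(4) le by (metis le_neq_implies_less)
  qed
  show ?thesis using assms(1) *[of y x] *[of x y] unfolding times_below_def by auto
qed

text \<open>The room asked for in L is that of the auxiliary numbers in
  \<open>product_candidate\<close>: the successor of the larger factor, and the product plus the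
  smaller factor. For soundness the candidate itself guarantees this room.\<close>

lemma times_below_complete:
  assumes "x * y + x + y + 1 < L"
  shows "times_below L x y (x * y)"
proof -
  have *: "product_candidate L x y (x * y) \<and> (\<forall>v<L. v < x * y \<longrightarrow> \<not> product_candidate L x y v)"
    if "0 < y" "y \<le> x" "x * y + x + y + 1 < L" for x y
  proof -
    have "Suc x dvd x * y + y" by (metis add.commute dvd_triv_left mult_Suc)
    then have "product_candidate L x y (x * y)"
      using that product_candidate_iff[of x "x * y" L y] by auto
    moreover have "\<not> product_candidate L x y v" if "v < x * y" "v < L" for v
      using that \<open>0 < y\<close> \<open>y \<le> x\<close> \<open>x * y + x + y + 1 < L\<close>
        product_candidate_iff[of x v L y] product_le_multiple[of y x v] by auto
    ultimately show ?thesis by blast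
  qed
  show ?thesis
  proof (cases "x = 0 \<or> y = 0")
    case False
    show ?thesis
    proof (cases "y \<le> x")
      case True
      then show ?thesis using *[OF _ True assms] False unfolding times_below_def by simp
    next
      case yx: False
      then have "x \<le> y" "y * x + y + x + 1 < L" using assms by (simp_all add: mult.commute)
      then have "product_candidate L y x (x * y) \<and> (\<forall>v<L. v < x * y \<longrightarrow> \<not> product_candidate L y x v)"
        using *[of x y] False by (simp add: mult.commute)
      then show ?thesis using False yx unfolding times_below_def by simp
    qed
  qed (auto simp: times_below_def)
qed

primrec power_below :: "nat \<Rightarrow> nat \<Rightarrow> nat \<Rightarrow> nat \<Rightarrow> bool" where
  "power_below L u 0 z \<longleftrightarrow> z = 1"
| "power_below L u (Suc k) z \<longleftrightarrow> (\<exists>v<L. power_below L u k v \<and> times_below L v u z)"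

lemma raw_power_below [rawI]:
  assumes "rnum d u" "rnum d z"
  shows "raw d (\<lambda>w L E. power_below L (u E) k (z E))"
  using assms
proof (induction k arbitrary: d u z)
  case 0
  then show ?case unfolding power_below.simps by (intro rawI)
next
  case (Suc k)
  show ?case unfolding power_below.simps by (intro rawI Suc)
qed

lemma power_below_sound: "power_below L u k z \<Longrightarrow> z < L \<Longrightarrow> z = u ^ k"
proof (induction k arbitrary: z)
  case (Suc k)
  then show ?case using times_below_sound by (fastforce simp: mult.commute)
qed simp

text \<open>The surplus factor u^2 \<ge> 4 pays for the auxiliary numbers of each multiplication, as
  u^(k+1) + u^k + u + 1 \<le> 4 * u^(k+1).\<close>

lemma power_below_complete:
  assumes "2 \<le> u" "u ^ Suc (Suc k) < L"
  shows "power_below L u k (u ^ k)"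
  using assms(2)
proof (induction k)
  case (Suc k)
  have pos: "1 \<le> u ^ k" using assms(1) by simp
  have lt: "u ^ Suc (Suc k) < L"
    using Suc.prems assms(1) by (meson le_less_trans lessI less_imp_le order.trans power_increasing one_le_numeral)
  have "u ^ k * u + u ^ k + u + 1 < L"
  proof -
    have "u ^ k * u + u ^ k + u + 1 \<le> u ^ k * u + u ^ k * u + u ^ k * u + u ^ k * u"
      using pos assms(1) by (intro add_mono) (auto simp: Suc_le_eq)
    also have "\<dots> = u ^ k * u * 4" by simp
    also have "\<dots> \<le> u ^ k * u * (u * u)"
      using assms(1) mult_le_mono[of 2 u 2 u] by (intro mult_le_mono) auto
    also have "\<dots> = u ^ Suc (Suc (Suc k))" by simp
    finally show ?thesis using Suc.prems by simp
  qed
  then have "times_below L (u ^ k) u (u ^ k * u)" by (intro times_below_complete) simp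
  moreover have "u ^ k < L"
    using lt assms(1) by (metis le_less_trans lessI less_imp_le power_increasing Suc_1 Suc_leD)
  ultimately show ?case using Suc.IH[OF lt] by (auto simp: mult.commute)
qed simp

section \<open>Definability with small values\<close>

text \<open>
  Definability now refers to an environment that consists of the input, a bound U on all
  quantified numbers, and sets. The length L of the tapes is hidden: it only has to exceed a
  power of U, and the exponent may depend on the definition.
\<close>

datatype 'a env = Env (input: "'a list") (bound: nat) (sets_of: "nat set list")

definition pop :: "'a env \<Rightarrow> 'a env" where "pop e = Env (input e) (bound e) (tl (sets_of e))"
definition peek :: "'a env \<Rightarrow> nat set" where "peek e = hd (sets_of e)"
definition push :: "nat set \<Rightarrow> 'a env \<Rightarrow> 'a env" where
  "push X e = Env (input e) (bound e) (X # sets_of e)"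

lemma env_simps [simp]:
  "pop (push X e) = e" "peek (push X e) = X" "input (push X e) = input e"
  "bound (push X e) = bound e" "sets_of (push X e) = X # sets_of e"
  "input (pop e) = input e" "bound (pop e) = bound e" "sets_of (pop e) = tl (sets_of e)"
  by (simp_all add: push_def pop_def peek_def)

definition proper :: "nat \<Rightarrow> 'a env \<Rightarrow> bool" where
  "proper d e \<longleftrightarrow> length (sets_of e) = d \<and> length (input e) < bound e \<and> 2 \<le> bound e"

lemma proper_push [simp]: "proper (Suc d) (push X e) \<longleftrightarrow> proper d e"
  by (simp add: proper_def)

lemma proper_pop: "proper (Suc d) e \<Longrightarrow> proper d (pop e)"
  by (simp add: proper_def)

lemma push_peek_pop: "proper (Suc d) e \<Longrightarrow> push (peek e) (pop e) = e"
  by (cases e, cases "sets_of e")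
    (auto simp: proper_def push_def pop_def peek_def)

text \<open>The bound enters the formulas as one more set variable behind all others, at index d
  when d sets are in scope. The sets of an environment are arbitrary; a formula sees their part
  below L.\<close>

definition clip :: "nat \<Rightarrow> 'a env \<Rightarrow> nat set list" where
  "clip L e = map (\<lambda>X. X \<inter> {..<L}) (sets_of e) @ [{bound e}]"

lemma clip_push: "clip L (push X e) = (X \<inter> {..<L}) # clip L e"
  by (simp add: clip_def)

lemma length_clip: "proper d e \<Longrightarrow> length (clip L e) = Suc d"
  by (simp add: clip_def proper_def)

definition small :: "nat \<Rightarrow> 'a env \<Rightarrow> nat \<Rightarrow> bool" where
  "small k e L \<longleftrightarrow> bound e ^ Suc k < L"

lemma small_push [simp]: "small k (push X e) L = small k e L"
  by (simp add: small_def)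

lemma small_mono: "small k' e L \<Longrightarrow> k \<le> k' \<Longrightarrow> proper d e \<Longrightarrow> small k e L"
  unfolding small_def proper_def
  by (meson Suc_le_mono le_less_trans one_le_numeral order_trans power_increasing)

lemma small_bound: "small k e L \<Longrightarrow> proper d e \<Longrightarrow> bound e < L"
  using small_mono[of k e L 0 d] by (simp add: small_def)

lemma small_power:
  assumes "x \<le> bound e ^ k" "small k e L" "proper d e"
  shows "x < L"
proof -
  have "bound e ^ k \<le> bound e ^ Suc k"
    using assms(3) by (intro power_increasing) (auto simp: proper_def)
  then show ?thesis using assms(1,2) unfolding small_def by linarith
qed

lemma small_pos: "small k e L \<Longrightarrow> 1 \<le> L"
  by (simp add: small_def)

text \<open>One formula must be right for every sufficiently large L. So k may depend on the
  property but not on the environment, and P can depend only on the part of its sets up to a power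
  of the bound.\<close>

definition definable :: "nat \<Rightarrow> ('a env \<Rightarrow> bool) \<Rightarrow> bool" where
  "definable d P \<longleftrightarrow> (\<exists>k Q. raw (Suc d) Q \<and>
     (\<forall>e L. proper d e \<longrightarrow> small k e L \<longrightarrow> Q (input e) L (clip L e) = P e))"

text \<open>A term is given by its graph, with the value as an additional variable Y in front. The
  polynomial bound puts the value below L, within reach of a quantifier.\<close>

definition term_definable :: "nat \<Rightarrow> ('a env \<Rightarrow> nat) \<Rightarrow> bool" where
  "term_definable d t \<longleftrightarrow> (\<exists>k Q. raw (Suc (Suc d)) Q \<and>
     (\<forall>e. proper d e \<longrightarrow> t e \<le> bound e ^ k \<and> (\<forall>L Y. small k e L \<longrightarrow> Y \<subseteq> {..<L} \<longrightarrow>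
        Q (input e) L (Y # clip L e) = (number Y = t e))))"

text \<open>Values below the bound itself rather than below a power of it. The rules for limits of
  quantifiers, for division and for encoded numbers ask for such terms.\<close>

definition small_definable :: "nat \<Rightarrow> ('a env \<Rightarrow> nat) \<Rightarrow> bool" where
  "small_definable d t \<longleftrightarrow> term_definable d t \<and> (\<forall>e. proper d e \<longrightarrow> t e < bound e)"

definition set_var :: "nat \<Rightarrow> ('a env \<Rightarrow> nat set) \<Rightarrow> bool" where
  "set_var d X \<longleftrightarrow> (\<exists>i<d. \<forall>e. proper d e \<longrightarrow> X e = sets_of e ! i)"

definition bound_var :: "('a env \<Rightarrow> nat) \<Rightarrow> bool" where
  "bound_var b \<longleftrightarrow> (\<forall>e. b e = bound e)"

definition input_var :: "('a env \<Rightarrow> 'a list) \<Rightarrow> bool" where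
  "input_var w \<longleftrightarrow> (\<forall>e. w e = input e)"

named_theorems defI

section \<open>Closure properties of definability\<close>

lemma definableE:
  assumes "definable d P"
  obtains k Q where "raw (Suc d) Q"
    "\<And>k' e L. k \<le> k' \<Longrightarrow> proper d e \<Longrightarrow> small k' e L \<Longrightarrow> Q (input e) L (clip L e) = P e"
proof -
  obtain k Q where Q: "raw (Suc d) Q"
     "\<And>e L. proper d e \<Longrightarrow> small k e L \<Longrightarrow> Q (input e) L (clip L e) = P e"
    using assms unfolding definable_def by blast
  show ?thesis by (rule that[OF Q(1)]) (use Q(2) small_mono in blast)
qed

lemma term_definableE:
  assumes "term_definable d t"
  obtains k Q where "raw (Suc (Suc d)) Q"
    "\<And>k' e. k \<le> k' \<Longrightarrow> proper d e \<Longrightarrow> t e \<le> bound e ^ k'"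
    "\<And>k' e L Y. k \<le> k' \<Longrightarrow> proper d e \<Longrightarrow> small k' e L \<Longrightarrow> Y \<subseteq> {..<L} \<Longrightarrow>
       Q (input e) L (Y # clip L e) = (number Y = t e)"
proof -
  obtain k Q where Q: "raw (Suc (Suc d)) Q"
     "\<And>e. proper d e \<Longrightarrow> t e \<le> bound e ^ k"
     "\<And>e L Y. proper d e \<Longrightarrow> small k e L \<Longrightarrow> Y \<subseteq> {..<L} \<Longrightarrow>
        Q (input e) L (Y # clip L e) = (number Y = t e)"
    using assms unfolding term_definable_def by blast
  show ?thesis
  proof (rule that[OF Q(1)])
    fix k' and e :: "'a env" assume "k \<le> k'" "proper d e"
    then show "t e \<le> bound e ^ k'"
      using Q(2)[of e] power_increasing[of k k' "bound e"] unfolding proper_def by linarith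
  qed (use Q(3) small_mono in blast)
qed

lemma definable_cong:
  assumes "definable d P" "\<And>e. proper d e \<Longrightarrow> P e = P' e"
  shows "definable d P'"
  using assms unfolding definable_def by metis

lemma definable_neg [defI]:
  assumes "definable d P"
  shows "definable d (\<lambda>e. \<not> P e)"
proof -
  obtain k Q where Q: "raw (Suc d) Q"
    "\<And>k' e L. k \<le> k' \<Longrightarrow> proper d e \<Longrightarrow> small k' e L \<Longrightarrow> Q (input e) L (clip L e) = P e"
    by (rule definableE[OF assms], rule that)
  show ?thesis unfolding definable_def
    by (intro exI[of _ k] exI[of _ "\<lambda>w L E. \<not> Q w L E"] conjI rawI Q(1)) (simp add: Q(2)[of k])
qed

lemma definable_conj [defI]:
  assumes "definable d P" "definable d P'"
  shows "definable d (\<lambda>e. P e \<and> P' e)"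
proof -
  obtain k Q where Q: "raw (Suc d) Q"
    "\<And>k' e L. k \<le> k' \<Longrightarrow> proper d e \<Longrightarrow> small k' e L \<Longrightarrow> Q (input e) L (clip L e) = P e"
    by (rule definableE[OF assms(1)], rule that)
  obtain l R where R: "raw (Suc d) R"
    "\<And>k' e L. l \<le> k' \<Longrightarrow> proper d e \<Longrightarrow> small k' e L \<Longrightarrow> R (input e) L (clip L e) = P' e"
    by (rule definableE[OF assms(2)], rule that)
  show ?thesis unfolding definable_def
    by (intro exI[of _ "max k l"] exI[of _ "\<lambda>w L E. Q w L E \<and> R w L E"] conjI rawI Q(1) R(1))
      (simp add: Q(2)[of "max k l"] R(2)[of "max k l"])
qed

lemma definable_disj [defI]:
  assumes "definable d P" "definable d P'"
  shows "definable d (\<lambda>e. P e \<or> P' e)"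
  by (rule definable_cong[OF definable_neg[OF definable_conj[OF definable_neg[OF assms(1)]
        definable_neg[OF assms(2)]]]]) simp

lemma definable_imp [defI]:
  assumes "definable d P" "definable d P'"
  shows "definable d (\<lambda>e. P e \<longrightarrow> P' e)"
  by (rule definable_cong[OF definable_disj[OF definable_neg[OF assms(1)] assms(2)]]) simp

lemma definable_iff [defI]:
  assumes "definable d P" "definable d P'"
  shows "definable d (\<lambda>e. P e \<longleftrightarrow> P' e)"
  by (rule definable_cong[OF definable_conj[OF definable_imp[OF assms] definable_imp[OF assms(2,1)]]])
    blast

text \<open>The property quantifies over all sets of natural numbers, the formula over subsets of
  \<open>{..<L}\<close>. Both agree because the body sees X only through its clip.\<close>

lemma definable_ex_set [defI]:
  assumes "definable (Suc d) (\<lambda>e. P (peek e) (pop e))"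
  shows "definable d (\<lambda>e. \<exists>X. P X e)"
proof -
  obtain k Q where Q: "raw (Suc (Suc d)) Q"
    "\<And>k' e L. k \<le> k' \<Longrightarrow> proper (Suc d) e \<Longrightarrow> small k' e L \<Longrightarrow>
       Q (input e) L (clip L e) = P (peek e) (pop e)"
    by (rule definableE[OF assms], rule that)
  have *: "Q (input e) L ((X \<inter> {..<L}) # clip L e) = P X e" if "proper d e" "small k e L" for e L X
    using Q(2)[of k "push X e" L] that by (simp add: clip_push)
  show ?thesis unfolding definable_def
  proof (intro exI[of _ k] exI[of _ "\<lambda>w L E. \<exists>X\<subseteq>{..<L}. Q w L (X # E)"] conjI allI impI)
    show "raw (Suc d) (\<lambda>w L E. \<exists>X\<subseteq>{..<L}. Q w L (X # E))"
      by (rule raw_ex, rule raw_cong[OF Q(1)]) (auto simp: length_Suc_conv)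
    fix e :: "'a env" and L assume e: "proper d e" "small k e L"
    show "(\<exists>X\<subseteq>{..<L}. Q (input e) L (X # clip L e)) = (\<exists>X. P X e)"
      using *[OF e] by (metis inf.absorb1 inf_le2)
  qed
qed

text \<open>Substitution of a term into a property: its value is quantified and checked against the
  graph.\<close>

lemma term_definable_bind:
  assumes t: "term_definable d t"
    and R: "raw (Suc (Suc d)) (\<lambda>w L E. R w L (number (hd E)) (tl E))"
    and P: "\<And>e L. proper d e \<Longrightarrow> small lo e L \<Longrightarrow> t e < L \<Longrightarrow> R (input e) L (t e) (clip L e) = P e"
  shows "definable d P"
proof -
  obtain k Q where Q: "raw (Suc (Suc d)) Q"
    "\<And>k' e. k \<le> k' \<Longrightarrow> proper d e \<Longrightarrow> t e \<le> bound e ^ k'"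
    "\<And>k' e L Y. k \<le> k' \<Longrightarrow> proper d e \<Longrightarrow> small k' e L \<Longrightarrow> Y \<subseteq> {..<L} \<Longrightarrow>
       Q (input e) L (Y # clip L e) = (number Y = t e)"
    by (rule term_definableE[OF t], rule that)
  show ?thesis unfolding definable_def
  proof (intro exI[of _ "max k lo"] exI[of _ "\<lambda>w L E. \<exists>Y\<subseteq>{..<L}. Q w L (Y # E) \<and> R w L (number Y) E"]
      conjI allI impI)
    have "raw (Suc (Suc d)) (\<lambda>w L E. Q w L (hd E # tl E))"
      by (rule raw_cong[OF Q(1)]) (auto simp: length_Suc_conv)
    then show "raw (Suc d) (\<lambda>w L E. \<exists>Y\<subseteq>{..<L}. Q w L (Y # E) \<and> R w L (number Y) E)"
      by (intro raw_ex raw_conj R)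
    fix e :: "'a env" and L assume e: "proper d e" "small (max k lo) e L"
    have "small lo e L" by (rule small_mono[OF e(2) _ e(1)]) simp
    have "t e < L" by (rule small_power[OF Q(2) e(2,1)]) (use e in auto)
    have "Q (input e) L (Y # clip L e) = (number Y = t e)" if "Y \<subseteq> {..<L}" for Y
      using Q(3)[OF _ e that] by simp
    then have "(\<exists>Y\<subseteq>{..<L}. Q (input e) L (Y # clip L e) \<and> R (input e) L (number Y) (clip L e)) =
        (\<exists>Y\<subseteq>{..<L}. number Y = t e \<and> R (input e) L (t e) (clip L e))" by metis
    also have "\<dots> = R (input e) L (t e) (clip L e)"
      using \<open>t e < L\<close> by (metis empty_subsetI insert_subset lessThan_iff number_singleton)
    also have "\<dots> = P e" by (rule P[OF e(1) \<open>small lo e L\<close> \<open>t e < L\<close>])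
    finally show "(\<exists>Y\<subseteq>{..<L}. Q (input e) L (Y # clip L e) \<and> R (input e) L (number Y) (clip L e)) = P e" .
  qed
qed

lemma raw_insert:
  assumes "raw (Suc d) Q"
  shows "raw (Suc (Suc d)) (\<lambda>w L E. Q w L (hd E # tl (tl E)))"
proof (rule raw_rename[OF assms, where js = "0 # [2..<Suc (Suc d)]"])
  fix E :: "nat set list" assume "length E = Suc (Suc d)"
  then obtain A B E' where "E = A # B # E'" "length E' = d" by (auto simp: length_Suc_conv)
  then show "hd E # tl (tl E) = map ((!) E) (0 # [2..<Suc (Suc d)])"
    by (auto intro!: nth_equalityI simp: nth_Cons' simp del: upt_Suc)
qed auto

lemma definable_rel2:
  fixes t1 t2 :: "'a env \<Rightarrow> nat"
  assumes t1: "term_definable d t1" and t2: "term_definable d t2"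
    and R: "raw (Suc (Suc (Suc d))) (\<lambda>(w :: 'a list) L E. R (number (hd (tl E))) (number (hd E)))"
  shows "definable d (\<lambda>e. R (t1 e) (t2 e))"
proof -
  obtain k Q where Q: "raw (Suc (Suc d)) Q"
    "\<And>k' e. k \<le> k' \<Longrightarrow> proper d e \<Longrightarrow> t2 e \<le> bound e ^ k'"
    "\<And>k' e L Y. k \<le> k' \<Longrightarrow> proper d e \<Longrightarrow> small k' e L \<Longrightarrow> Y \<subseteq> {..<L} \<Longrightarrow>
       Q (input e) L (Y # clip L e) = (number Y = t2 e)"
    by (rule term_definableE[OF t2], rule that)
  show ?thesis
  proof (rule term_definable_bind[OF t1, where lo = k and
        R = "\<lambda>w L x E. \<exists>Y\<subseteq>{..<L}. Q w L (Y # E) \<and> R x (number Y)"])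
    show "raw (Suc (Suc d)) (\<lambda>w L E. \<exists>Y\<subseteq>{..<L}. Q w L (Y # tl E) \<and> R (number (hd E)) (number Y))"
      by (rule raw_ex, rule raw_conj[OF raw_insert[OF Q(1)] R])
    fix e :: "'a env" and L assume e: "proper d e" "small k e L"
    have lt: "t2 e < L" by (rule small_power[OF Q(2)[OF order_refl e(1)] e(2,1)])
    then have one: "(\<exists>Y\<subseteq>{..<L}. number Y = t2 e \<and> S) = S" for S
      by (metis empty_subsetI insert_subset lessThan_iff number_singleton)
    show "(\<exists>Y\<subseteq>{..<L}. Q (input e) L (Y # clip L e) \<and> R (t1 e) (number Y)) = R (t1 e) (t2 e)"
      using Q(3)[OF order_refl e] one by (auto cong: conj_cong)
  qed
qed

lemma definable_eq [defI]: "term_definable d s \<Longrightarrow> term_definable d t \<Longrightarrow> definable d (\<lambda>e. s e = t e)"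
  by (rule definable_rel2) (assumption | intro rawI)+

lemma definable_less [defI]: "term_definable d s \<Longrightarrow> term_definable d t \<Longrightarrow> definable d (\<lambda>e. s e < t e)"
  by (rule definable_rel2) (assumption | intro rawI)+

lemma definable_le [defI]: "term_definable d s \<Longrightarrow> term_definable d t \<Longrightarrow> definable d (\<lambda>e. s e \<le> t e)"
  by (rule definable_rel2) (assumption | intro rawI)+

lemma definable_mem [defI]:
  assumes t: "term_definable d t" and X: "set_var d X"
  shows "definable d (\<lambda>e. t e \<in> X e)"
proof -
  obtain i where i: "i < d" "\<And>e. proper d e \<Longrightarrow> X e = sets_of e ! i"
    using X unfolding set_var_def by blast
  show ?thesis
  proof (rule term_definable_bind[OF t, where lo = 0 and R = "\<lambda>w L x E. x \<in> E ! i"])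
    show "raw (Suc (Suc d)) (\<lambda>w L E. number (hd E) \<in> tl E ! i)"
      by (intro raw_mem rawI rvar_tl[of _ "\<lambda>E. E ! i"] rvar_nth) (use i(1) in simp)
    fix e :: "'a env" and L assume e: "proper d e" "t e < L"
    then show "(t e \<in> clip L e ! i) = (t e \<in> X e)"
      using i by (simp add: clip_def nth_append proper_def)
  qed
qed

lemma definable_input [defI]:
  assumes w: "input_var w" and t: "term_definable d t"
  shows "definable d (\<lambda>e. input_tape (w e) (t e) = s)"
  by (rule term_definable_bind[OF t, where lo = 0 and R = "\<lambda>w L x E. input_tape w x = s"])
    (intro rawI, use w in \<open>simp add: input_var_def\<close>)

text \<open>The left-hand side is the room that \<open>times_below_complete\<close> asks for; so
  operations on two terms with exponent k lead to the exponent 2 * k + 2.\<close>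

lemma power_bounds:
  fixes a b u :: nat
  assumes "a \<le> u ^ k" "b \<le> u ^ k" "2 \<le> u"
  shows "a * b + a + b + 1 \<le> u ^ (2 * k + 2)"
proof -
  let ?p = "u ^ k"
  have p: "1 \<le> ?p" using assms(3) by simp
  have "a * b + a + b + 1 \<le> ?p * ?p + ?p * ?p + ?p * ?p + ?p * ?p"
    using assms p by (intro add_mono mult_mono order.trans[OF assms(1)] order.trans[OF assms(2)]) auto
  also have "\<dots> = 2 * 2 * (?p * ?p)" by simp
  also have "\<dots> \<le> u * u * (?p * ?p)" using assms(3) by (intro mult_le_mono) auto
  also have "\<dots> = u ^ (2 * k + 2)" by (simp add: power_add mult_2 power2_eq_square)
  finally show ?thesis .
qed

lemma term_definable_op:
  fixes t1 t2 :: "'a env \<Rightarrow> nat"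
  assumes t1: "term_definable d t1" and t2: "term_definable d t2"
    and f: "\<And>a b. f a b \<le> a * b + a + b + 1"
    and G: "raw (Suc (Suc (Suc (Suc d))))
        (\<lambda>(w :: 'a list) L E. G L (number (hd (tl E))) (number (hd E)) (number (hd (tl (tl E)))))"
    and fG: "\<And>L a b y. y < L \<Longrightarrow> a * b + a + b + 1 < L \<Longrightarrow> G L a b y = (y = f a b)"
  shows "term_definable d (\<lambda>e. f (t1 e) (t2 e))"
proof -
  obtain k Q where Q: "raw (Suc (Suc d)) Q"
    "\<And>k' e. k \<le> k' \<Longrightarrow> proper d e \<Longrightarrow> t1 e \<le> bound e ^ k'"
    "\<And>k' e L Y. k \<le> k' \<Longrightarrow> proper d e \<Longrightarrow> small k' e L \<Longrightarrow> Y \<subseteq> {..<L} \<Longrightarrow>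
       Q (input e) L (Y # clip L e) = (number Y = t1 e)"
    by (rule term_definableE[OF t1], rule that)
  obtain l R where R: "raw (Suc (Suc d)) R"
    "\<And>k' e. l \<le> k' \<Longrightarrow> proper d e \<Longrightarrow> t2 e \<le> bound e ^ k'"
    "\<And>k' e L Y. l \<le> k' \<Longrightarrow> proper d e \<Longrightarrow> small k' e L \<Longrightarrow> Y \<subseteq> {..<L} \<Longrightarrow>
       R (input e) L (Y # clip L e) = (number Y = t2 e)"
    by (rule term_definableE[OF t2], rule that)
  define m where "m = max k l"
  have bd: "t1 e * t2 e + t1 e + t2 e + 1 \<le> bound e ^ (2 * m + 2)" if "proper d e" for e
    using that by (intro power_bounds Q(2) R(2)) (auto simp: m_def proper_def)
  let ?Q = "\<lambda>w L E. \<exists>A\<subseteq>{..<L}. Q w L (A # tl E) \<and> (\<exists>B\<subseteq>{..<L}. R w L (B # tl E) \<and>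
      G L (number A) (number B) (number (hd E)))"
  show ?thesis unfolding term_definable_def
  proof (intro exI[of _ "2 * m + 2"] exI[of _ ?Q] conjI allI impI)
    show "raw (Suc (Suc d)) ?Q"
      by (rule raw_ex, rule raw_conj[OF raw_insert[OF Q(1)]], rule raw_ex, rule raw_conj[OF _ G])
        (rule raw_cong[OF raw_insert[OF raw_insert[OF R(1)]]], simp)
    fix e :: "'a env" assume e: "proper d e"
    then show "f (t1 e) (t2 e) \<le> bound e ^ (2 * m + 2)" using bd f order.trans by blast
    fix L Y assume s: "small (2 * m + 2) e L" and Y: "Y \<subseteq> {..<L}"
    have lt: "t1 e * t2 e + t1 e + t2 e + 1 < L" by (rule small_power[OF bd[OF e] s e])
    have q: "Q (input e) L (A # clip L e) = (number A = t1 e)"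
      "R (input e) L (A # clip L e) = (number A = t2 e)" if "A \<subseteq> {..<L}" for A
      using Q(3)[OF _ e s that] R(3)[OF _ e s that] by (auto simp: m_def)
    have one: "(\<exists>A\<subseteq>{..<L}. number A = x \<and> S) = S" if "x < L" for x S
      using that by (metis empty_subsetI insert_subset lessThan_iff number_singleton)
    have "?Q (input e) L (Y # clip L e) \<longleftrightarrow> (\<exists>A\<subseteq>{..<L}. number A = t1 e \<and>
        (\<exists>B\<subseteq>{..<L}. number B = t2 e \<and> G L (t1 e) (t2 e) (number Y)))"
      using q by (auto cong: conj_cong)
    also have "\<dots> \<longleftrightarrow> G L (t1 e) (t2 e) (number Y)" using one lt by simp
    also have "\<dots> \<longleftrightarrow> number Y = f (t1 e) (t2 e)"
      using number_less[OF Y] lt by (intro fG) auto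
    finally show "?Q (input e) L (Y # clip L e) \<longleftrightarrow> number Y = f (t1 e) (t2 e)" .
  qed
qed

lemma term_definable_plus [defI]:
  assumes "term_definable d s" "term_definable d t"
  shows "term_definable d (\<lambda>e. s e + t e)"
  by (rule term_definable_op[OF assms, where G = "\<lambda>L a b y. a + b = y"]) (intro rawI | auto)+

lemma term_definable_times [defI]:
  assumes "term_definable d s" "term_definable d t"
  shows "term_definable d (\<lambda>e. s e * t e)"
proof (rule term_definable_op[OF assms, where G = times_below])
  show "times_below L a b y = (y = a * b)" if "y < L" "a * b + a + b + 1 < L" for L a b y
    using that times_below_sound times_below_complete by blast
qed (intro rawI | simp)+

lemma term_definable_direct:
  fixes t :: "'a env \<Rightarrow> nat"
  assumes "raw (Suc (Suc d)) (\<lambda>w L E. G w L (number (hd E)) (tl E))"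
    and "\<And>e. proper d e \<Longrightarrow> t e \<le> bound e ^ k"
    and "\<And>e L y. proper d e \<Longrightarrow> small k e L \<Longrightarrow> y < L \<Longrightarrow> G (input e) L y (clip L e) = (y = t e)"
  shows "term_definable d t"
  unfolding term_definable_def
proof (intro exI[of _ k] exI[of _ "\<lambda>w L E. G w L (number (hd E)) (tl E)"] conjI assms(1) allI impI)
  fix e :: "'a env" and L Y assume e: "proper d e" "small k e L" and Y: "Y \<subseteq> {..<L}"
  show "G (input e) L (number (hd (Y # clip L e))) (tl (Y # clip L e)) = (number Y = t e)"
    using assms(3)[OF e number_less[OF Y small_pos[OF e(2)]]] by simp
qed (rule assms(2))

lemma term_definable_0 [defI]: "term_definable d (\<lambda>e. 0)"
  by (rule term_definable_direct[where k = 0 and G = "\<lambda>w L y E. y = 0"]) (intro rawI, auto)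

lemma term_definable_1: "term_definable d (\<lambda>e. 1)"
  by (rule term_definable_direct[where k = 0 and G = "\<lambda>w L y E. y = 1"]) (intro rawI, auto)

lemma term_definable_Suc [defI]: "term_definable d t \<Longrightarrow> term_definable d (\<lambda>e. Suc (t e))"
  using term_definable_plus[OF _ term_definable_1, of d t] by simp

lemma term_definable_const [defI]: "term_definable d (\<lambda>e. c)"
  by (induction c) (simp_all add: term_definable_0 term_definable_Suc)

lemma term_definable_bound_var:
  assumes "bound_var b"
  shows "term_definable d b"
proof (rule term_definable_direct[where k = 1 and G = "\<lambda>w L y E. y = number (E ! d)"])
  show "raw (Suc (Suc d)) (\<lambda>w L E. number (hd E) = number (tl E ! d))"
    by (intro raw_eq rawI rvar_tl[of _ "\<lambda>E. E ! d"] rvar_nth) simp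
qed (use assms in \<open>auto simp: bound_var_def clip_def nth_append proper_def\<close>)

text \<open>Cutting off at u makes every set denote a number below u, provided u > 0, and every such
  number is denoted by its singleton. A quantifier over numbers below the bound thus becomes a plain
  set quantifier.\<close>

definition num :: "nat \<Rightarrow> nat set \<Rightarrow> nat" where
  "num u X = number (X \<inter> {..<u})"

lemma num_less: "0 < u \<Longrightarrow> num u X < u"
  unfolding num_def by (rule number_less) auto

lemma num_singleton [simp]: "x < u \<Longrightarrow> num u {x} = x"
  by (simp add: num_def)

lemma number_eq_iff:
  assumes "finite X"
  shows "y = number X \<longleftrightarrow> (y \<in> X \<and> (\<forall>z<y. z \<notin> X)) \<or> (y = 0 \<and> X = {})"
proof (cases "X = {}")
  case False
  have "y = Min X \<longleftrightarrow> y \<in> X \<and> (\<forall>z<y. z \<notin> X)"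
    using Min_eq_iff[OF assms False, of y] by (metis eq_commute not_le)
  then show ?thesis using False by (simp add: number_def)
qed (simp add: number_def)

lemma raw_num_graph:
  assumes "rvar d A" "rvar d B" "rnum d y"
  shows "raw d (\<lambda>w L E. (y E \<in> A E \<and> y E < number (B E) \<and> (\<forall>z<L. z < y E \<longrightarrow> z \<notin> A E)) \<or>
      (y E = 0 \<and> (\<forall>z<L. z < number (B E) \<longrightarrow> z \<notin> A E)))"
  by (intro rawI assms)

lemma term_definable_num:
  assumes b: "bound_var b" and X: "set_var d X"
  shows "term_definable d (\<lambda>e. num (b e) (X e))"
proof -
  obtain i where i: "i < d" "\<And>e. proper d e \<Longrightarrow> X e = sets_of e ! i"
    using X unfolding set_var_def by blast
  show ?thesis
  proof (rule term_definable_direct[where k = 1 and G = "\<lambda>w L y E.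
      (y \<in> E ! i \<and> y < number (E ! d) \<and> (\<forall>z<L. z < y \<longrightarrow> z \<notin> E ! i)) \<or>
      (y = 0 \<and> (\<forall>z<L. z < number (E ! d) \<longrightarrow> z \<notin> E ! i))"])
    have r: "rvar (Suc d) (\<lambda>E. E ! i)" "rvar (Suc d) (\<lambda>E. E ! d)"
      using i(1) by (auto intro: rvar_nth)
    show "raw (Suc (Suc d)) (\<lambda>w L E.
      (number (hd E) \<in> tl E ! i \<and> number (hd E) < number (tl E ! d) \<and>
         (\<forall>z<L. z < number (hd E) \<longrightarrow> z \<notin> tl E ! i)) \<or>
      (number (hd E) = 0 \<and> (\<forall>z<L. z < number (tl E ! d) \<longrightarrow> z \<notin> tl E ! i)))"
      by (rule raw_num_graph[OF rvar_tl[OF r(1)] rvar_tl[OF r(2)] rnum_number[OF rvar_hd]])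
    fix e :: "'a env" assume e: "proper d e"
    then have "num (bound e) (X e) < bound e" by (intro num_less) (simp add: proper_def)
    then show "num (b e) (X e) \<le> bound e ^ 1" using b by (simp add: bound_var_def)
    fix L y assume s: "small 1 e L" and y: "y < L"
    have bL: "bound e < L" by (rule small_bound[OF s e])
    have c: "clip L e ! i = X e \<inter> {..<L}" "number (clip L e ! d) = bound e"
      using i e by (auto simp: clip_def nth_append proper_def)
    have "(y = num (b e) (X e)) = ((y \<in> X e \<inter> {..<bound e} \<and> (\<forall>z<y. z \<notin> X e \<inter> {..<bound e})) \<or>
        (y = 0 \<and> X e \<inter> {..<bound e} = {}))"
      using b unfolding num_def bound_var_def by (subst number_eq_iff) auto
    then show "((y \<in> clip L e ! i \<and> y < number (clip L e ! d) \<and> (\<forall>z<L. z < y \<longrightarrow> z \<notin> clip L e ! i)) \<or>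
      (y = 0 \<and> (\<forall>z<L. z < number (clip L e ! d) \<longrightarrow> z \<notin> clip L e ! i))) = (y = num (b e) (X e))"
      unfolding c using bL y by auto
  qed
qed

lemma term_definable_pop:
  assumes "term_definable d t"
  shows "term_definable (Suc d) (\<lambda>e. t (pop e))"
proof -
  obtain k Q where Q: "raw (Suc (Suc d)) Q"
    "\<And>k' e. k \<le> k' \<Longrightarrow> proper d e \<Longrightarrow> t e \<le> bound e ^ k'"
    "\<And>k' e L Y. k \<le> k' \<Longrightarrow> proper d e \<Longrightarrow> small k' e L \<Longrightarrow> Y \<subseteq> {..<L} \<Longrightarrow>
       Q (input e) L (Y # clip L e) = (number Y = t e)"
    by (rule term_definableE[OF assms], rule that)
  show ?thesis unfolding term_definable_def
  proof (intro exI[of _ k] exI[of _ "\<lambda>w L E. Q w L (hd E # tl (tl E))"] conjI raw_insert Q(1) allI impI)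
    fix e :: "'a env" assume e: "proper (Suc d) e"
    then show "t (pop e) \<le> bound e ^ k" using Q(2)[of k "pop e"] proper_pop[OF e] by simp
    fix L Y assume s: "small k e L" and Y: "Y \<subseteq> {..<L}"
    have "clip L e = (peek e \<inter> {..<L}) # clip L (pop e)"
      using clip_push[of L "peek e" "pop e"] push_peek_pop[OF e] by simp
    then show "Q (input e) L (hd (Y # clip L e) # tl (tl (Y # clip L e))) = (number Y = t (pop e))"
      using Q(3)[of k "pop e" L Y] proper_pop[OF e] s Y by (simp add: small_def)
  qed
qed

lemma small_definable_imp: "small_definable d t \<Longrightarrow> term_definable d t"
  by (simp add: small_definable_def)

lemma small_definable_less: "small_definable d t \<Longrightarrow> proper d e \<Longrightarrow> t e < bound e"
  by (simp add: small_definable_def)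

lemma small_definable_num [defI]: "bound_var b \<Longrightarrow> set_var d X \<Longrightarrow> small_definable d (\<lambda>e. num (b e) (X e))"
  unfolding small_definable_def
  by (auto intro: term_definable_num num_less simp: bound_var_def proper_def)

lemma small_definable_pop: "small_definable d t \<Longrightarrow> small_definable (Suc d) (\<lambda>e. t (pop e))"
  unfolding small_definable_def using term_definable_pop proper_pop by fastforce

lemma bound_var_bound [defI]: "bound_var bound" "bound_var (\<lambda>e. bound e)"
  by (simp_all add: bound_var_def)

lemma bound_var_pop [defI]: "bound_var b \<Longrightarrow> bound_var (\<lambda>e. b (pop e))"
  by (simp add: bound_var_def)

lemma input_var_input [defI]: "input_var input" "input_var (\<lambda>e. input e)"
  by (simp_all add: input_var_def)

lemma input_var_pop [defI]: "input_var w \<Longrightarrow> input_var (\<lambda>e. w (pop e))"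
  by (simp add: input_var_def)

lemma set_var_peek [defI]: "set_var (Suc d) peek" "set_var (Suc d) (\<lambda>e. peek e)"
  unfolding set_var_def by (auto simp: proper_def peek_def length_Suc_conv intro!: exI[of _ 0])

lemma set_var_pop [defI]: "set_var d X \<Longrightarrow> set_var (Suc d) (\<lambda>e. X (pop e))"
  unfolding set_var_def
proof (elim exE conjE)
  fix i assume "i < d" "\<forall>e::'a env. proper d e \<longrightarrow> X e = sets_of e ! i"
  then show "\<exists>i<Suc d. \<forall>e::'a env. proper (Suc d) e \<longrightarrow> X (pop e) = sets_of e ! i"
    using proper_pop by (intro exI[of _ "Suc i"]) (auto simp: nth_tl proper_def)
qed

text \<open>Environments reached by popping, all of which have the same bound.\<close>

definition env_var :: "('a env \<Rightarrow> 'a env) \<Rightarrow> bool" where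
  "env_var g \<longleftrightarrow> (\<forall>e. bound (g e) = bound e)"

lemma env_var_id [defI]: "env_var (\<lambda>e. e)"
  by (simp add: env_var_def)

lemma env_var_pop [defI]: "env_var g \<Longrightarrow> env_var (\<lambda>e. g (pop e))"
  by (simp add: env_var_def)

lemma bound_var_env_var: "env_var g \<Longrightarrow> bound_var (\<lambda>e. bound (g e))"
  by (simp add: env_var_def bound_var_def)

lemmas term_definable_bound [defI] = bound_var_env_var[THEN term_definable_bound_var]

text \<open>A pairing by a polynomial, so that it is a term without division.\<close>

definition pair :: "nat \<Rightarrow> nat \<Rightarrow> nat" where
  "pair x y = (x + y) * (x + y) + x"

text \<open>The code lies between (x + y)^2 and (x + y + 1)^2 - 1, so it determines x + y and then
  x.\<close>

lemma pair_inject [simp]: "pair x y = pair x' y' \<longleftrightarrow> x = x' \<and> y = y'"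
proof
  assume eq: "pair x y = pair x' y'"
  have "x + y = x' + y'"
  proof (rule ccontr)
    assume "x + y \<noteq> x' + y'"
    moreover have "pair x y < pair x' y'" if "x + y < x' + y'" for x y x' y'
    proof -
      have "pair x y < Suc (x + y) * Suc (x + y)" by (simp add: pair_def)
      also have "\<dots> \<le> (x' + y') * (x' + y')" using that by (intro mult_le_mono) auto
      finally show ?thesis by (simp add: pair_def)
    qed
    ultimately show False using eq by (metis linorder_neqE_nat less_irrefl)
  qed
  then show "x = x' \<and> y = y'" using eq by (simp add: pair_def)
qed simp

lemma term_definable_pair [defI]:
  "term_definable d s \<Longrightarrow> term_definable d t \<Longrightarrow> term_definable d (\<lambda>e. pair (s e) (t e))"
  unfolding pair_def by (intro term_definable_plus term_definable_times)

declare term_definable_pop [defI]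
declare small_definable_imp [defI]

lemma definable_ex_below_bound:
  assumes "bound_var b" "definable (Suc d) (\<lambda>e. P (num (bound e) (peek e)) (pop e))"
  shows "definable d (\<lambda>e. \<exists>x<b e. P x e)"
proof -
  have "definable (Suc d) (\<lambda>e. P (num (bound (pop e)) (peek e)) (pop e))"
    using assms(2) by simp
  then show ?thesis
  proof (rule definable_cong[OF definable_ex_set])
    fix e :: "'a env" assume "proper d e"
    then have "0 < bound e" by (simp add: proper_def)
    show "(\<exists>X. P (num (bound e) X) e) = (\<exists>x<b e. P x e)"
    proof
      assume "\<exists>x<b e. P x e"
      then obtain x where "x < bound e" "P x e" using assms(1) by (auto simp: bound_var_def)
      then show "\<exists>X. P (num (bound e) X) e" by (intro exI[of _ "{x}"]) simp
    next
      assume "\<exists>X. P (num (bound e) X) e"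
      then show "\<exists>x<b e. P x e"
        using num_less[OF \<open>0 < bound e\<close>] assms(1) by (auto simp: bound_var_def)
    qed
  qed
qed

lemma definable_ex_below:
  assumes "small_definable d t" "definable (Suc d) (\<lambda>e. P (num (bound e) (peek e)) (pop e))"
  shows "definable d (\<lambda>e. \<exists>x<t e. P x e)"
proof (rule definable_cong)
  show "definable d (\<lambda>e. \<exists>x<bound e. x < t e \<and> P x e)"
    by (intro definable_ex_below_bound definable_conj definable_less assms(2) defI small_definable_pop
        assms(1))
  fix e :: "'a env" assume "proper d e"
  then have "t e < bound e" using assms(1) by (simp add: small_definable_def)
  then show "(\<exists>x<bound e. x < t e \<and> P x e) = (\<exists>x<t e. P x e)" by (meson less_trans)
qed


lemma definable_all_below:
  assumes "small_definable d t" "definable (Suc d) (\<lambda>e. P (num (bound e) (peek e)) (pop e))"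
  shows "definable d (\<lambda>e. \<forall>x<t e. P x e)"
  by (rule definable_cong[OF definable_neg[OF definable_ex_below[OF assms(1) definable_neg[OF assms(2)]]]])
    simp

lemma definable_all_below_bound:
  assumes "bound_var b" "definable (Suc d) (\<lambda>e. P (num (bound e) (peek e)) (pop e))"
  shows "definable d (\<lambda>e. \<forall>x<b e. P x e)"
  by (rule definable_cong[OF definable_neg[OF definable_ex_below_bound[OF assms(1) definable_neg[OF assms(2)]]]])
    simp

lemmas definable_ex [defI] = bound_var_env_var[THEN definable_ex_below_bound] definable_ex_below

lemmas definable_all [defI] = bound_var_env_var[THEN definable_all_below_bound] definable_all_below

text \<open>The graph may be stated with \<open>num\<close>, the form that number quantifiers
  produce. The added conjunct, that the value is below the bound, excludes sets with a larger
  minimum, on which \<open>num\<close> and \<open>number\<close> differ.\<close>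

lemma small_definable_graph:
  assumes "definable (Suc d) (\<lambda>e. num (bound e) (peek e) = t (pop e))"
    and "\<And>e. proper d e \<Longrightarrow> t e < bound e"
  shows "small_definable d t"
proof -
  obtain k Q where Q: "raw (Suc (Suc d)) Q"
    "\<And>k' e L. k \<le> k' \<Longrightarrow> proper (Suc d) e \<Longrightarrow> small k' e L \<Longrightarrow>
       Q (input e) L (clip L e) = (num (bound e) (peek e) = t (pop e))"
    by (rule definableE[OF assms(1)], rule that)
  have "term_definable d t" unfolding term_definable_def
  proof (intro exI[of _ "Suc k"] exI[of _ "\<lambda>w L E. number (hd E) < number (tl E ! d) \<and> Q w L E"]
      conjI allI impI)
    have "rvar (Suc d) (\<lambda>E. E ! d)" by (rule rvar_nth) simp
    then show "raw (Suc (Suc d)) (\<lambda>w L E. number (hd E) < number (tl E ! d) \<and> Q w L E)"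
      by (intro raw_conj raw_less Q(1) rnum_number rvar_hd rvar_tl[of _ "\<lambda>E. E ! d"])
    fix e :: "'a env" assume e: "proper d e"
    have "t e \<le> bound e ^ 1" using assms(2)[OF e] by simp
    also have "\<dots> \<le> bound e ^ Suc k" using e by (intro power_increasing) (auto simp: proper_def)
    finally show "t e \<le> bound e ^ Suc k" .
    fix L Y assume s: "small (Suc k) e L" and Y: "Y \<subseteq> {..<L}"
    have d: "number (clip L e ! d) = bound e"
      using e by (simp add: clip_def nth_append proper_def)
    have q: "Q (input e) L (Y # clip L e) = (num (bound e) Y = t e)"
      using Q(2)[of "Suc k" "push Y e" L] e s Y by (simp add: clip_push Int_absorb2)
    have "num (bound e) Y = number Y" if lt: "number Y < bound e"
    proof (cases "Y = {}")
      case False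
      have fin: "finite Y" using Y finite_subset by blast
      have "Min Y \<in> Y \<inter> {..<bound e}" using lt Min_in[OF fin False] False by (simp add: number_def)
      moreover have "Min Y \<le> z" if "z \<in> Y \<inter> {..<bound e}" for z using Min_le[OF fin] that by simp
      ultimately have "Min (Y \<inter> {..<bound e}) = Min Y" by (intro Min_eqI) auto
      then show ?thesis using \<open>Min Y \<in> Y \<inter> {..<bound e}\<close> False by (auto simp: num_def number_def)
    qed (simp add: num_def)
    then show "(number (hd (Y # clip L e)) < number (tl (Y # clip L e) ! d) \<and>
        Q (input e) L (Y # clip L e)) = (number Y = t e)"
      using q d assms(2)[OF e] by auto
  qed
  then show ?thesis using assms(2) by (simp add: small_definable_def)
qed

lemma small_definable_1 [defI]: "small_definable d (\<lambda>e. Suc 0)" "small_definable d (\<lambda>e. 1)"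
  unfolding small_definable_def using term_definable_const by (auto simp: proper_def)

text \<open>The function with values below u whose graph is X; junk values are 0.\<close>

definition fn :: "nat \<Rightarrow> nat set \<Rightarrow> nat \<Rightarrow> nat" where
  "fn u X x = num u {y. pair x y \<in> X}"

lemma fn_less: "0 < u \<Longrightarrow> fn u X x < u"
  unfolding fn_def by (rule num_less)

text \<open>Together with \<open>fn_less\<close>: quantifying over sets X amounts to quantifying
  over functions with values below u.\<close>

lemma fn_surj:
  assumes "\<forall>x. f x < u"
  shows "f = fn u {pair x (f x) | x. True}"
proof
  fix x
  have "{y. pair x y \<in> {pair x (f x) | x. True}} = {f x}" by auto
  then show "f x = fn u {pair x (f x) | x. True} x" using assms by (simp add: fn_def)
qed

lemma fn_eq_iff:
  "y = fn u X x \<longleftrightarrow> (y < u \<and> pair x y \<in> X \<and> (\<forall>z<y. pair x z \<notin> X)) \<or> (y = 0 \<and> (\<forall>z<u. pair x z \<notin> X))"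
  unfolding fn_def num_def by (subst number_eq_iff) auto

lemma small_definable_fn [defI]:
  assumes b: "bound_var b" and X: "set_var d X" and t: "term_definable d t"
  shows "small_definable d (\<lambda>e. fn (b e) (X e) (t e))"
proof (rule small_definable_graph)
  have t': "term_definable (Suc d) (\<lambda>e. t (pop e))"
    "term_definable (Suc (Suc d)) (\<lambda>e. t (pop (pop e)))"
    by (intro term_definable_pop t)+
  have "definable (Suc d) (\<lambda>e. (num (bound e) (peek e) < bound e \<and>
       pair (t (pop e)) (num (bound e) (peek e)) \<in> X (pop e) \<and>
       (\<forall>z<num (bound e) (peek e). pair (t (pop e)) z \<notin> X (pop e))) \<or>
     (num (bound e) (peek e) = 0 \<and> (\<forall>z<bound e. pair (t (pop e)) z \<notin> X (pop e))))"
    by (intro t' X defI)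
  then show "definable (Suc d) (\<lambda>e. num (bound e) (peek e) = fn (b (pop e)) (X (pop e)) (t (pop e)))"
    unfolding fn_eq_iff using b by (simp add: bound_var_def)
  show "fn (b e) (X e) (t e) < bound e" if "proper d e" for e
    using that b fn_less by (simp add: bound_var_def proper_def)
qed

declare small_definable_pop [defI]

lemma definable_ex_fun [defI]:
  assumes "bound_var b" "definable (Suc d) (\<lambda>e. P (fn (bound e) (peek e)) (pop e))"
  shows "definable d (\<lambda>e. \<exists>f. (\<forall>x. f x < b e) \<and> P f e)"
proof -
  have "definable (Suc d) (\<lambda>e. P (fn (bound (pop e)) (peek e)) (pop e))"
    using assms(2) by simp
  then show ?thesis
  proof (rule definable_cong[OF definable_ex_set])
    fix e :: "'a env" assume "proper d e"
    then have *: "0 < bound e" "b e = bound e" using assms(1) by (simp_all add: proper_def bound_var_def)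
    show "(\<exists>X. P (fn (bound e) X) e) = (\<exists>f. (\<forall>x. f x < b e) \<and> P f e)"
    proof
      assume "\<exists>X. P (fn (bound e) X) e"
      then obtain X where "P (fn (bound e) X) e" by blast
      then show "\<exists>f. (\<forall>x. f x < b e) \<and> P f e"
        using fn_less[OF *(1)] * by (intro exI[of _ "fn (bound e) X"]) simp
    next
      assume "\<exists>f. (\<forall>x. f x < b e) \<and> P f e"
      then obtain f where f: "\<forall>x. f x < bound e" "P f e" using * by auto
      have "P (fn (bound e) {pair x (f x) | x. True}) e"
        using f(2) unfolding fn_surj[OF f(1), symmetric] .
      then show "\<exists>X. P (fn (bound e) X) e" by blast
    qed
  qed
qed

lemma definable_ex_rel [defI]:
  assumes "definable (Suc d) (\<lambda>e. P (\<lambda>x y. pair x y \<in> peek e) (pop e))"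
  shows "definable d (\<lambda>e. \<exists>R. P R e)"
proof (rule definable_cong[OF definable_ex_set[OF assms]])
  fix e :: "'a env"
  have R: "(\<lambda>x y. pair x y \<in> {pair x y | x y. R x y}) = R" for R :: "nat \<Rightarrow> nat \<Rightarrow> bool"
    by (intro ext) auto
  show "(\<exists>X. P (\<lambda>x y. pair x y \<in> X) e) = (\<exists>R. P R e)"
  proof
    assume "\<exists>R. P R e"
    then obtain R where "P R e" by blast
    then have "P (\<lambda>x y. pair x y \<in> {pair x y | x y. R x y}) e" unfolding R .
    then show "\<exists>X. P (\<lambda>x y. pair x y \<in> X) e" by blast
  qed blast
qed

text \<open>The length is the position of the first blank, and in a proper environment it is below
  the bound.\<close>

lemma small_definable_length [defI]:
  assumes "input_var w"
  shows "small_definable d (\<lambda>e. length (w e))"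
proof (rule small_definable_graph)
  have "definable (Suc d) (\<lambda>e. input_tape (input e) (num (bound e) (peek e)) = Blank \<and>
      (\<forall>i<num (bound e) (peek e). input_tape (input (pop e)) i \<noteq> Blank))"
    by (intro defI)
  then show "definable (Suc d) (\<lambda>e. num (bound e) (peek e) = length (w (pop e)))"
  proof (rule definable_cong)
    fix e :: "'a env"
    let ?n = "num (bound e) (peek e)"
    have "(input_tape (input e) n = Blank \<and> (\<forall>i<n. input_tape (input e) i \<noteq> Blank))
        = (n = length (input e))" for n
      unfolding input_tape_def by (auto intro: le_antisym simp: not_le[symmetric])
    then show "(input_tape (input e) ?n = Blank \<and> (\<forall>i<?n. input_tape (input (pop e)) i \<noteq> Blank)) =
        (?n = length (w (pop e)))"
      using assms by (simp add: input_var_def)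
  qed
qed (use assms in \<open>simp add: proper_def input_var_def\<close>)

lemma small_definable_div [defI]:
  assumes "small_definable d s" "small_definable d t"
  shows "small_definable d (\<lambda>e. s e div t e)"
proof (rule small_definable_graph)
  have "definable (Suc d) (\<lambda>e. (t (pop e) = 0 \<and> num (bound e) (peek e) = 0) \<or>
     (num (bound e) (peek e) * t (pop e) \<le> s (pop e) \<and>
      s (pop e) < num (bound e) (peek e) * t (pop e) + t (pop e)))"
    by (intro defI assms)
  then show "definable (Suc d) (\<lambda>e. num (bound e) (peek e) = s (pop e) div t (pop e))"
  proof (rule definable_cong)
    fix e :: "'a env"
    let ?n = "num (bound e) (peek e)"
    have "(b = 0 \<and> n = 0 \<or> n * b \<le> a \<and> a < n * b + b) = (n = a div b)" for n a b :: nat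
      by (metis add.commute add_cancel_left_right div_by_0 div_nat_eqI div_times_less_eq_dividend
          dividend_less_div_times gr0I less_nat_zero_code mult.commute mult_0_right mult_Suc_right)
    then show "(t (pop e) = 0 \<and> ?n = 0 \<or> ?n * t (pop e) \<le> s (pop e) \<and> s (pop e) < ?n * t (pop e) + t (pop e))
      = (?n = s (pop e) div t (pop e))" .
  qed
  show "s e div t e < bound e" if "proper d e" for e
    using small_definable_less[OF assms(1) that] by (meson div_le_dividend le_less_trans)
qed

lemma small_definable_mod [defI]:
  assumes "small_definable d s" "small_definable d t"
  shows "small_definable d (\<lambda>e. s e mod t e)"
proof (rule small_definable_graph)
  have "definable (Suc d) (\<lambda>e. num (bound e) (peek e) + (s (pop e) div t (pop e)) * t (pop e) = s (pop e))"
    by (intro defI assms)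
  then show "definable (Suc d) (\<lambda>e. num (bound e) (peek e) = s (pop e) mod t (pop e))"
    by (rule definable_cong) (metis add.commute add_left_cancel div_mult_mod_eq)
  show "s e mod t e < bound e" if "proper d e" for e
    using small_definable_less[OF assms(1) that] by (meson mod_less_eq_dividend le_less_trans)
qed

lemma small_definable_minus [defI]:
  assumes "small_definable d s" "small_definable d t"
  shows "small_definable d (\<lambda>e. s e - t e)"
proof (rule small_definable_graph)
  have "definable (Suc d) (\<lambda>e. (s (pop e) \<le> t (pop e) \<and> num (bound e) (peek e) = 0) \<or>
     num (bound e) (peek e) + t (pop e) = s (pop e))"
    by (intro defI assms)
  then show "definable (Suc d) (\<lambda>e. num (bound e) (peek e) = s (pop e) - t (pop e))"
    by (rule definable_cong) auto
  show "s e - t e < bound e" if "proper d e" for e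
    using small_definable_less[OF assms(1) that] by simp
qed

text \<open>Base and exponent both vary, so the successive powers are tabulated in a quantified
  function, with the products as terms.\<close>

lemma definable_power [defI]:
  assumes "small_definable d x" "small_definable d a" "small_definable d k"
  shows "definable d (\<lambda>e. x e = a e ^ k e)"
proof (rule definable_cong)
  show "definable d (\<lambda>e. \<exists>f. (\<forall>i. f i < bound e) \<and>
      (f 0 = 1 \<and> (\<forall>i<k e. f (Suc i) = f i * a e) \<and> x e = f (k e)))"
    by (intro defI assms)
  fix e :: "'a env" assume e: "proper d e"
  show "(\<exists>f. (\<forall>i. f i < bound e) \<and> (f 0 = 1 \<and> (\<forall>i<k e. f (Suc i) = f i * a e) \<and> x e = f (k e)))
     = (x e = a e ^ k e)"
  proof
    assume "\<exists>f. (\<forall>i. f i < bound e) \<and> (f 0 = 1 \<and> (\<forall>i<k e. f (Suc i) = f i * a e) \<and> x e = f (k e))"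
    then obtain f where f: "f 0 = 1" "\<forall>i<k e. f (Suc i) = f i * a e" "x e = f (k e)" by blast
    have "i \<le> k e \<Longrightarrow> f i = a e ^ i" for i
      using f by (induction i) auto
    then show "x e = a e ^ k e" using f(3) by simp
  next
    assume x: "x e = a e ^ k e"
    \<comment> \<open>Intermediate powers are at most x, hence below the bound. The exception is a =
      0, where 0^0 = 1 may exceed x but is still below a bound of at least 2.\<close>
    have lt: "a e ^ i < bound e" if "i \<le> k e" for i
    proof (cases "a e = 0")
      case True
      then show ?thesis using e by (cases i) (auto simp: proper_def)
    next
      case False
      then have "a e ^ i \<le> x e" unfolding x using that by (intro power_increasing) auto
      then show ?thesis using small_definable_less[OF assms(1) e] by simp
    qed
    show "\<exists>f. (\<forall>i. f i < bound e) \<and> (f 0 = 1 \<and> (\<forall>i<k e. f (Suc i) = f i * a e) \<and> x e = f (k e))"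
      using lt x e
      by (intro exI[of _ "\<lambda>i. if i \<le> k e then a e ^ i else 0"]) (auto simp: proper_def)
  qed
qed

section \<open>Definable words\<close>

definition at :: "'a list \<Rightarrow> nat \<Rightarrow> nat \<Rightarrow> 'a list \<Rightarrow> bool" where
  "at w i j u \<longleftrightarrow> j = i + length u \<and> j \<le> length w \<and> take (length u) (drop i w) = u"

lemma at_bounds: "at w i j u \<Longrightarrow> i \<le> j \<and> j \<le> length w \<and> j = i + length u"
  by (auto simp: at_def)

lemma at_all: "at w 0 (length w) u \<longleftrightarrow> u = w"
  by (auto simp: at_def)

lemma at_Nil: "at w i j [] \<longleftrightarrow> i = j \<and> i \<le> length w"
  by (auto simp: at_def)

lemma at_append: "at w i j (u @ v) \<longleftrightarrow> (\<exists>k. at w i k u \<and> at w k j v)"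
proof
  assume l: "at w i j (u @ v)"
  then have "take (length u) (drop i w) @ take (length v) (drop (length u) (drop i w)) = u @ v"
    unfolding at_def length_append take_add by blast
  moreover have "length (take (length u) (drop i w)) = length u" using l by (auto simp: at_def)
  ultimately have "at w i (i + length u) u \<and> at w (i + length u) j v"
    using l by (simp add: at_def add.commute)
  then show "\<exists>k. at w i k u \<and> at w k j v" by blast
next
  assume "\<exists>k. at w i k u \<and> at w k j v"
  then have u: "at w i (i + length u) u" and v: "at w (i + length u) j v" by (auto simp: at_def)
  then show "at w i j (u @ v)" by (simp add: at_def take_add add.commute)
qed

lemma at_append_bounded:
  assumes "length w < m"
  shows "at w i j (u @ v) \<longleftrightarrow> (\<exists>k<m. at w i k u \<and> at w k j v)"
  unfolding at_append using assms at_bounds by (metis le_less_trans)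

lemma at_single: "at w i j [a] \<longleftrightarrow> j = Suc i \<and> input_tape w i = Input a"
proof -
  have "take (Suc 0) (drop i w) = [w ! i]" if "i < length w"
    using that by (simp add: take_Suc_conv_app_nth)
  then show ?thesis by (auto simp: at_def input_tape_def)
qed

lemma at_concat_map:
  "at w i j (concat (map f [0..<m])) \<longleftrightarrow>
     (\<exists>p. p 0 = i \<and> p m = j \<and> i \<le> length w \<and> (\<forall>t<m. at w (p t) (p (Suc t)) (f t)))"
proof (induction m arbitrary: j)
  case 0
  show ?case by (auto simp: at_Nil)
next
  case (Suc m)
  show ?case (is "?l \<longleftrightarrow> ?r")
  proof
    assume ?l
    then obtain k where k: "at w i k (concat (map f [0..<m]))" "at w k j (f m)"
      by (auto simp: at_append)
    then obtain p where p: "p 0 = i" "p m = k" "i \<le> length w" "\<forall>t<m. at w (p t) (p (Suc t)) (f t)"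
      using Suc.IH by blast
    then show ?r using k(2)
      by (intro exI[of _ "p(Suc m := j)"]) (auto simp: less_Suc_eq)
  next
    assume ?r
    then obtain p where "p 0 = i" "p (Suc m) = j" "i \<le> length w" "\<forall>t<Suc m. at w (p t) (p (Suc t)) (f t)"
      by blast
    then have "at w i (p m) (concat (map f [0..<m]))" "at w (p m) j (f m)"
      using Suc.IH[of "p m"] by auto
    then show ?l by (auto simp: at_append)
  qed
qed

text \<open>The function p lists the cut points between the factors. They are positions in w and so
  below u; beyond the last one p is set to 0.\<close>

lemma at_concat_map_bounded:
  assumes "length w < u"
  shows "at w i j (concat (map f [0..<m])) \<longleftrightarrow> (\<exists>p. (\<forall>x. p x < u) \<and>
     (p 0 = i \<and> p m = j \<and> i \<le> length w \<and> (\<forall>t<m. at w (p t) (p (Suc t)) (f t))))"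
proof
  assume l: "at w i j (concat (map f [0..<m]))"
  then obtain p where p: "p 0 = i" "p m = j" "i \<le> length w" "\<forall>t<m. at w (p t) (p (Suc t)) (f t)"
    using at_concat_map by metis
  have "p t \<le> length w" if "t \<le> m" for t
  proof (cases "t = m")
    case False
    then have "at w (p t) (p (Suc t)) (f t)" using that p(4) by simp
    then show ?thesis using at_bounds le_trans by blast
  qed (use p at_bounds[OF l] in simp)
  then show "\<exists>p. (\<forall>x. p x < u) \<and>
     (p 0 = i \<and> p m = j \<and> i \<le> length w \<and> (\<forall>t<m. at w (p t) (p (Suc t)) (f t)))"
    using p assms by (intro exI[of _ "\<lambda>t. if t \<le> m then p t else 0"]) (auto intro: le_less_trans)
qed (use at_concat_map in metis)

text \<open>Words are not values of the logic. A word-valued term is handled through its occurrences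
  in the input, with two additional variables for start and end.\<close>

definition word_definable :: "nat \<Rightarrow> ('a env \<Rightarrow> 'a list) \<Rightarrow> bool" where
  "word_definable d u \<longleftrightarrow> definable (Suc (Suc d)) (\<lambda>e. at (input e)
     (num (bound e) (peek (pop e))) (num (bound e) (peek e)) (u (pop (pop e))))"

text \<open>A property of d variables is read in an environment of d' variables: its first ones are
  picked by \<open>js\<close> among the first k, the others are those behind position k. This moves
  the start and end variables of words into place.\<close>

lemma definable_rename:
  assumes "definable d P" "length js + (d' - k) = d" "distinct js" "\<forall>i\<in>set js. i < k" "k \<le> d'"
  shows "definable d' (\<lambda>e. P (Env (input e) (bound e) (map ((!) (sets_of e)) js @ drop k (sets_of e))))"
proof -
  let ?r = "\<lambda>e. Env (input e) (bound e) (map ((!) (sets_of e)) js @ drop k (sets_of e))"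
  obtain m Q where Q: "raw (Suc d) Q"
    "\<And>k' e L. m \<le> k' \<Longrightarrow> proper d e \<Longrightarrow> small k' e L \<Longrightarrow> Q (input e) L (clip L e) = P e"
    by (rule definableE[OF assms(1)], rule that)
  show ?thesis unfolding definable_def
  proof (intro exI[of _ m] exI[of _ "\<lambda>w L E. Q w L (map ((!) E) (js @ [k..<Suc d']))"] conjI allI impI)
    show "raw (Suc d') (\<lambda>w L E. Q w L (map ((!) E) (js @ [k..<Suc d'])))"
      by (rule raw_rename[OF Q(1), where js = "js @ [k..<Suc d']"]) (use assms in auto)
    fix e :: "'a env" and L assume e: "proper d' e" "small m e L"
    have len: "length (sets_of e) = d'" using e by (simp add: proper_def)
    have "map ((!) (clip L e)) [k..<Suc d'] = drop k (clip L e)"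
      by (rule nth_equalityI)
        (use length_clip[OF e(1), of L] assms(5) in \<open>simp_all add: nth_append del: upt_Suc\<close>)
    moreover have "map ((!) (clip L e)) js = map (\<lambda>X. X \<inter> {..<L}) (map ((!) (sets_of e)) js)"
      using assms(4,5) len by (auto simp: clip_def nth_append)
    ultimately have "map ((!) (clip L e)) (js @ [k..<Suc d']) = clip L (?r e)"
      using assms(5) len by (simp add: clip_def drop_map)
    moreover have "proper d (?r e)" using e(1) assms(2) len by (simp add: proper_def)
    ultimately show "Q (input e) L (map ((!) (clip L e)) (js @ [k..<Suc d'])) = P (?r e)"
      using Q(2)[of m "?r e" L] e(2) by (simp add: small_def)
  qed
qed

lemma proper_Suc_E:
  assumes "proper (Suc d) e"
  obtains X e' where "e = push X e'" "proper d e'"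
  using push_peek_pop[OF assms] proper_pop[OF assms] by metis

lemma push_Env: "Env w b (X # Xs) = push X (Env w b Xs)"
  by (simp add: push_def)

lemma definable_at [defI]:
  assumes w: "input_var w" and i: "term_definable d i" and j: "term_definable d j"
    and u: "word_definable d u"
  shows "definable d (\<lambda>e. at (w e) (i e) (j e) (u e))"
proof -
  have "definable (Suc (Suc d)) (\<lambda>e. at (input e)
     (num (bound e) (peek (pop e))) (num (bound e) (peek e)) (u (pop (pop e))))"
    using u by (simp add: word_definable_def)
  then have *: "definable (Suc (Suc d)) (\<lambda>e. at (input (pop (pop e)))
     (num (bound (pop e)) (peek (pop e))) (num (bound e) (peek e)) (u (pop (pop e))))" by simp
  have "definable d (\<lambda>e. \<exists>x<bound e. x = i e \<and> (\<exists>y<bound e. y = j e \<and> at (input e) x y (u e)))"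
    by (intro definable_ex definable_conj definable_eq term_definable_pop i j small_definable_imp
        small_definable_num env_var_id env_var_pop bound_var_bound bound_var_pop set_var_peek
        set_var_pop *)
  then show ?thesis
  proof (rule definable_cong)
    fix e :: "'a env" assume e: "proper d e"
    show "(\<exists>x<bound e. x = i e \<and> (\<exists>y<bound e. y = j e \<and> at (input e) x y (u e))) =
       at (w e) (i e) (j e) (u e)"
      using w at_bounds[of "input e" "i e" "j e" "u e"] e by (auto simp: input_var_def proper_def)
  qed
qed

lemma word_definable_Nil [defI]: "word_definable d (\<lambda>e. [])"
  unfolding word_definable_def at_Nil by (intro defI)

lemma word_definable_single [defI]: "word_definable d (\<lambda>e. [a])"
  unfolding word_definable_def at_single by (intro defI)

lemma word_definable_append [defI]:
  assumes "word_definable d u" "word_definable d v"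
  shows "word_definable d (\<lambda>e. u e @ v e)"
proof -
  note r1 = definable_rename[OF assms(1)[unfolded word_definable_def], of "[0, 2]" "Suc (Suc (Suc d))" 3]
  note r2 = definable_rename[OF assms(2)[unfolded word_definable_def], of "[1, 0]" "Suc (Suc (Suc d))" 3]
  have "definable (Suc (Suc (Suc d))) (\<lambda>e. at (input e) (num (bound e) (peek (pop (pop e))))
      (num (bound e) (peek e)) (u (pop (pop (pop e)))))"
    using r1 by (rule definable_cong)
      (auto elim!: proper_Suc_E simp: push_Env numeral_eq_Suc)
  moreover have "definable (Suc (Suc (Suc d))) (\<lambda>e. at (input e) (num (bound e) (peek e))
      (num (bound e) (peek (pop e))) (v (pop (pop (pop e)))))"
    using r2 by (rule definable_cong)
      (auto elim!: proper_Suc_E simp: push_Env numeral_eq_Suc)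
  ultimately have "definable (Suc (Suc d)) (\<lambda>e. \<exists>k<bound e.
      at (input e) (num (bound e) (peek (pop e))) k (u (pop (pop e))) \<and>
      at (input e) k (num (bound e) (peek e)) (v (pop (pop e))))"
    by (intro definable_ex definable_conj env_var_id) simp_all
  then show ?thesis unfolding word_definable_def
  proof (rule definable_cong)
    fix e :: "'a env" assume "proper (Suc (Suc d)) e"
    then have "length (input e) < bound e" by (simp add: proper_def)
    from at_append_bounded[OF this, symmetric]
    show "(\<exists>k<bound e. at (input e) (num (bound e) (peek (pop e))) k (u (pop (pop e))) \<and>
        at (input e) k (num (bound e) (peek e)) (v (pop (pop e)))) =
      at (input e) (num (bound e) (peek (pop e))) (num (bound e) (peek e)) (u (pop (pop e)) @ v (pop (pop e)))" .
  qed
qed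

lemma word_definable_Cons [defI]: "word_definable d u \<Longrightarrow> word_definable d (\<lambda>e. a # u e)"
  using word_definable_append[OF word_definable_single[of d a], of u] by simp

lemma word_definable_concat [defI]:
  assumes u: "word_definable (Suc d) (\<lambda>e. f (num (bound e) (peek e)) (pop e))"
    and m: "small_definable d m"
  shows "word_definable d (\<lambda>e. concat (map (\<lambda>t. f t e) [0..<m e]))"
proof -
  \<comment> \<open>Four variables stand between f and its context: start, end, the cut points p and
    the index t.\<close>
  let ?D = "Suc (Suc (Suc (Suc d)))"
  have "definable (Suc (Suc ?D)) (\<lambda>e. at (input e) (num (bound e) (peek (pop e)))
      (num (bound e) (peek e)) (f (num (bound e) (peek (pop (pop e)))) (pop (pop (pop (pop (pop (pop e))))))))"
    using definable_rename[OF u[unfolded word_definable_def], of "[0, 1, 2]" "Suc (Suc ?D)" 6]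
    by (rule definable_cong)
      (auto elim!: proper_Suc_E simp: push_Env numeral_eq_Suc)
  then have "word_definable ?D (\<lambda>e. f (num (bound e) (peek e)) (pop (pop (pop (pop e)))))"
    by (simp add: word_definable_def)
  then have w: "word_definable ?D (\<lambda>e. f (num (bound (pop e)) (peek e)) (pop (pop (pop (pop e)))))"
    by simp
  have "definable (Suc (Suc d)) (\<lambda>e. \<exists>p. (\<forall>x. p x < bound e) \<and>
     (p 0 = num (bound e) (peek (pop e)) \<and> p (m (pop (pop e))) = num (bound e) (peek e) \<and>
      num (bound e) (peek (pop e)) \<le> length (input e) \<and>
      (\<forall>t<m (pop (pop e)). at (input e) (p t) (p (Suc t)) (f t (pop (pop e))))))"
    by (intro w[simplified] defI m | simp only: env_simps)+
  then show ?thesis unfolding word_definable_def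
    by (rule definable_cong) (rule at_concat_map_bounded[symmetric], simp add: proper_def)
qed

lemma word_definable_if [defI]:
  assumes "definable d P" "word_definable d u" "word_definable d v"
  shows "word_definable d (\<lambda>e. if P e then u e else v e)"
proof -
  have "definable (Suc (Suc d)) (\<lambda>e. P (pop (pop e)))"
    using definable_rename[OF assms(1), of "[]" "Suc (Suc d)" 2]
    by (rule definable_cong) (auto elim!: proper_Suc_E simp: push_Env numeral_eq_Suc)
  then have "definable (Suc (Suc d)) (\<lambda>e. (P (pop (pop e)) \<and> at (input e)
       (num (bound e) (peek (pop e))) (num (bound e) (peek e)) (u (pop (pop e)))) \<or>
      (\<not> P (pop (pop e)) \<and> at (input e)
       (num (bound e) (peek (pop e))) (num (bound e) (peek e)) (v (pop (pop e)))))"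
    using assms(2,3) unfolding word_definable_def by (intro definable_disj definable_conj definable_neg)
  then show ?thesis unfolding word_definable_def by (rule definable_cong) auto
qed

lemma at_bits:
  assumes "length w < u" "x < u"
  shows "at w i j (bits x) \<longleftrightarrow> (\<exists>f. (\<forall>t. f t < u) \<and> (f i = x \<and> f j = 0 \<and> i \<le> j \<and> j \<le> length w \<and>
     (\<forall>t<j. i \<le> t \<longrightarrow> (input_tape w t = Input LOne \<and> f t = Suc (f (Suc t) + f (Suc t))) \<or>
        (input_tape w t = Input LZero \<and> f t \<noteq> 0 \<and> f t = f (Suc t) + f (Suc t)))))"
proof -
  \<comment> \<open>The induction carries the bound x for f, from which the bound u follows.\<close>
  have *: "at w i j (bits x) \<longleftrightarrow> (\<exists>f. f i = x \<and> f j = 0 \<and> i \<le> j \<and> j \<le> length w \<and>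
     (\<forall>t. t < j \<longrightarrow> i \<le> t \<longrightarrow> (input_tape w t = Input LOne \<and> f t = Suc (f (Suc t) + f (Suc t))) \<or>
        (input_tape w t = Input LZero \<and> f t \<noteq> 0 \<and> f t = f (Suc t) + f (Suc t))) \<and>
     (\<forall>t. f t \<le> x))" for i
  proof (induction x arbitrary: i rule: less_induct)
    case (less x)
    show ?case (is "?l \<longleftrightarrow> ?r")
    proof (cases "x = 0")
      case True
      then show ?thesis
        by (subst bits.simps) (auto simp: at_Nil intro!: exI[of _ "\<lambda>_. 0"] dest: le_neq_implies_less)
    next
      case False
      then have bits: "bits x = [if odd x then LOne else LZero] @ bits (x div 2)"
        by (subst bits.simps) (simp add: enc_bool_def)
      have IH: "at w (Suc i) j (bits (x div 2)) \<longleftrightarrow>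
        (\<exists>f. f (Suc i) = x div 2 \<and> f j = 0 \<and> Suc i \<le> j \<and> j \<le> length w \<and>
          (\<forall>t. t < j \<longrightarrow> Suc i \<le> t \<longrightarrow> (input_tape w t = Input LOne \<and> f t = Suc (f (Suc t) + f (Suc t))) \<or>
           (input_tape w t = Input LZero \<and> f t \<noteq> 0 \<and> f t = f (Suc t) + f (Suc t))) \<and>
          (\<forall>t. f t \<le> x div 2))"
        by (rule less.IH) (use False in simp)
      have l: "?l \<longleftrightarrow> input_tape w i = Input (if odd x then LOne else LZero) \<and>
          at w (Suc i) j (bits (x div 2))"
        unfolding bits at_append at_single by auto
      show ?thesis
      proof
        assume ?l
        then obtain f where i: "input_tape w i = Input (if odd x then LOne else LZero)"
          and f: "f (Suc i) = x div 2" "f j = 0" "Suc i \<le> j" "j \<le> length w"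
          "\<forall>t. t < j \<longrightarrow> Suc i \<le> t \<longrightarrow> (input_tape w t = Input LOne \<and> f t = Suc (f (Suc t) + f (Suc t))) \<or>
            (input_tape w t = Input LZero \<and> f t \<noteq> 0 \<and> f t = f (Suc t) + f (Suc t))"
          "\<forall>t. f t \<le> x div 2"
          unfolding l IH by blast
        have "x = x div 2 + x div 2 + x mod 2" by presburger
        show ?r
        proof (intro exI[of _ "f(i := x)"] conjI allI impI)
          fix t assume t: "t < j" "i \<le> t"
          show "(input_tape w t = Input LOne \<and> (f(i := x)) t = Suc ((f(i := x)) (Suc t) + (f(i := x)) (Suc t))) \<or>
            (input_tape w t = Input LZero \<and> (f(i := x)) t \<noteq> 0 \<and> (f(i := x)) t = (f(i := x)) (Suc t) + (f(i := x)) (Suc t))"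
          proof (cases "t = i")
            case True
            then show ?thesis using i f(1) False by (cases "odd x") (auto elim!: oddE evenE)
          next
            case False
            then show ?thesis using f(5) t by auto
          qed
        qed (use f in \<open>auto intro: order.trans\<close>)
      next
        assume ?r
        then obtain f where f: "f i = x" "f j = 0" "i \<le> j" "j \<le> length w"
          "\<And>t. t < j \<Longrightarrow> i \<le> t \<Longrightarrow> (input_tape w t = Input LOne \<and> f t = Suc (f (Suc t) + f (Suc t))) \<or>
            (input_tape w t = Input LZero \<and> f t \<noteq> 0 \<and> f t = f (Suc t) + f (Suc t))"
          by blast
        have ij: "i < j" using f(1-3) False by (metis le_neq_implies_less)
        from f(5)[OF ij order_refl]
        have i: "input_tape w i = Input (if odd x then LOne else LZero)" and "f (Suc i) = x div 2"
          using f(1) by auto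
        have le: "f t \<le> x div 2" if "Suc i \<le> t" "t \<le> j" for t
          using that
        proof (induction t rule: dec_induct)
          case base
          then show ?case using \<open>f (Suc i) = x div 2\<close> by simp
        next
          case (step t)
          then show ?case using f(5)[of t] by auto
        qed
        show ?l unfolding l IH
          using i ij f le \<open>f (Suc i) = x div 2\<close>
          by (intro conjI exI[of _ "\<lambda>t. if Suc i \<le> t \<and> t \<le> j then f t else 0"]) auto
      qed
    qed
  qed
  show ?thesis
  proof
    assume "at w i j (bits x)"
    then obtain f where f: "f i = x" "f j = 0" "i \<le> j" "j \<le> length w" "\<forall>t. f t \<le> x"
      "\<forall>t<j. i \<le> t \<longrightarrow> (input_tape w t = Input LOne \<and> f t = Suc (f (Suc t) + f (Suc t))) \<or>
        (input_tape w t = Input LZero \<and> f t \<noteq> 0 \<and> f t = f (Suc t) + f (Suc t))"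
      unfolding * by metis
    have "\<forall>t. f t < u" using f(5) assms(2) le_less_trans by metis
    with f(1-4,6) show "\<exists>f. (\<forall>t. f t < u) \<and> (f i = x \<and> f j = 0 \<and> i \<le> j \<and> j \<le> length w \<and>
     (\<forall>t<j. i \<le> t \<longrightarrow> (input_tape w t = Input LOne \<and> f t = Suc (f (Suc t) + f (Suc t))) \<or>
        (input_tape w t = Input LZero \<and> f t \<noteq> 0 \<and> f t = f (Suc t) + f (Suc t))))"
      by (intro exI[of _ f] conjI)
  next
    assume "\<exists>f. (\<forall>t. f t < u) \<and> (f i = x \<and> f j = 0 \<and> i \<le> j \<and> j \<le> length w \<and>
     (\<forall>t<j. i \<le> t \<longrightarrow> (input_tape w t = Input LOne \<and> f t = Suc (f (Suc t) + f (Suc t))) \<or>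
        (input_tape w t = Input LZero \<and> f t \<noteq> 0 \<and> f t = f (Suc t) + f (Suc t))))"
    then obtain f where f: "f i = x" "f j = 0" "i \<le> j" "j \<le> length w"
      "\<And>t. t < j \<Longrightarrow> i \<le> t \<Longrightarrow> (input_tape w t = Input LOne \<and> f t = Suc (f (Suc t) + f (Suc t))) \<or>
        (input_tape w t = Input LZero \<and> f t \<noteq> 0 \<and> f t = f (Suc t) + f (Suc t))"
      by blast
    have le: "f t \<le> x" if "i \<le> t" "t \<le> j" for t
      using that
    proof (induction t rule: dec_induct)
      case (step t)
      then show ?case using f(5)[of t] by auto
    qed (use f in simp)
    show "at w i j (bits x)" unfolding *
      using f le by (intro exI[of _ "\<lambda>t. if i \<le> t \<and> t \<le> j then f t else 0"]) auto
  qed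
qed

lemma word_definable_bits [defI]:
  assumes "small_definable d x"
  shows "word_definable d (\<lambda>e. bits (x e))"
proof -
  have "definable (Suc (Suc d)) (\<lambda>e. \<exists>f. (\<forall>t. f t < bound e) \<and>
     (f (num (bound e) (peek (pop e))) = x (pop (pop e)) \<and> f (num (bound e) (peek e)) = 0 \<and>
      num (bound e) (peek (pop e)) \<le> num (bound e) (peek e) \<and>
      num (bound e) (peek e) \<le> length (input e) \<and>
     (\<forall>t<num (bound e) (peek e). num (bound e) (peek (pop e)) \<le> t \<longrightarrow>
        (input_tape (input e) t = Input LOne \<and> f t = Suc (f (Suc t) + f (Suc t))) \<or>
        (input_tape (input e) t = Input LZero \<and> f t \<noteq> 0 \<and> f t = f (Suc t) + f (Suc t)))))"
    by (intro defI assms)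
  then show ?thesis unfolding word_definable_def
  proof (rule definable_cong)
    fix e :: "letter env" assume e: "proper (Suc (Suc d)) e"
    have "length (input e) < bound e" "x (pop (pop e)) < bound e"
      using e small_definable_less[OF assms proper_pop[OF proper_pop[OF e]]] by (simp_all add: proper_def)
    note at_bits[OF this, symmetric]
    then show "(\<exists>f. (\<forall>t. f t < bound e) \<and>
     (f (num (bound e) (peek (pop e))) = x (pop (pop e)) \<and> f (num (bound e) (peek e)) = 0 \<and>
      num (bound e) (peek (pop e)) \<le> num (bound e) (peek e) \<and>
      num (bound e) (peek e) \<le> length (input e) \<and>
     (\<forall>t<num (bound e) (peek e). num (bound e) (peek (pop e)) \<le> t \<longrightarrow>
        (input_tape (input e) t = Input LOne \<and> f t = Suc (f (Suc t) + f (Suc t))) \<or>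
        (input_tape (input e) t = Input LZero \<and> f t \<noteq> 0 \<and> f t = f (Suc t) + f (Suc t))))) =
      at (input e) (num (bound e) (peek (pop e))) (num (bound e) (peek e)) (bits (x (pop (pop e))))" .
  qed
qed

section \<open>Plays within a resource bound\<close>

text \<open>Concerns the action that F prescribes after xs; plays end exactly where it cannot be
  paid (\<open>b_maximal_iff\<close>).\<close>

definition affordable ::
  "('ag, 'st, 'act, 'pr) rbcgs \<Rightarrow> 'ag set \<Rightarrow> ('st list \<Rightarrow> 'ag \<Rightarrow> 'act) \<Rightarrow> ('ag \<Rightarrow> nat \<Rightarrow> nat)
     \<Rightarrow> 'st list \<Rightarrow> bool" where
  "affordable M A F b xs \<longleftrightarrow> (\<forall>a\<in>A. \<forall>j<nres M.
     consumption M (last xs) (F xs a) j \<le> energy M F b xs (length xs - 1) a j)"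

lemma energy_append: "i < length xs \<Longrightarrow> energy M F b (xs @ ys) i = energy M F b xs i"
  by (induction i) (auto simp: nth_append)

lemma energy_snoc:
  assumes "xs \<noteq> []"
  shows "energy M F b (xs @ [s]) (length xs) a j = energy M F b xs (length xs - 1) a j
    - consumption M (last xs) (F xs a) j + production M (last xs) (F xs a) j"
proof -
  obtain n where n: "length xs = Suc n" using assms by (cases xs) auto
  then show ?thesis
    using energy_append[of n xs M F b "[s]"] assms by (simp add: nth_append last_conv_nth)
qed

lemma b_consistent_single: "b_consistent M A F b [s] \<longleftrightarrow> s \<in> States M"
  by (simp add: b_consistent_def consistent_def computations_def)

lemma b_consistent_snoc:
  assumes "xs \<noteq> []"
  shows "b_consistent M A F b (xs @ [s]) \<longleftrightarrow> b_consistent M A F b xs \<and> s \<in> States M \<and>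
    s \<in> outcomes M A (last xs) (F xs) \<and> affordable M A F b xs"
proof -
  obtain n where n: "length xs = Suc n" using assms by (cases xs) auto
  have split: "(\<forall>i. Suc i < length (xs @ [s]) \<longrightarrow> Q i) \<longleftrightarrow> (\<forall>i. Suc i < length xs \<longrightarrow> Q i) \<and> Q n" for Q
    using n by (auto simp: less_Suc_eq)
  have 1: "consistent M A F (xs @ [s]) \<longleftrightarrow> consistent M A F xs \<and> s \<in> States M \<and>
      s \<in> outcomes M A (last xs) (F xs)"
    unfolding consistent_def split
    using n assms by (auto simp: computations_def nth_append last_conv_nth)
  have 2: "(\<forall>i. Suc i < length (xs @ [s]) \<longrightarrow> (\<forall>a\<in>A. \<forall>j<nres M.
        consumption M ((xs @ [s]) ! i) (F (take (Suc i) (xs @ [s])) a) j \<le> energy M F b (xs @ [s]) i a j)) \<longleftrightarrow>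
     (\<forall>i. Suc i < length xs \<longrightarrow> (\<forall>a\<in>A. \<forall>j<nres M.
        consumption M (xs ! i) (F (take (Suc i) xs) a) j \<le> energy M F b xs i a j)) \<and> affordable M A F b xs"
    unfolding split affordable_def
    using n assms by (auto simp: nth_append last_conv_nth energy_append)
  show ?thesis unfolding b_consistent_def 1 2 by blast
qed

lemma b_consistent_prefix: "b_consistent M A F b (xs @ ys) \<Longrightarrow> xs \<noteq> [] \<Longrightarrow> b_consistent M A F b xs"
proof (induction ys rule: rev_induct)
  case (snoc y ys)
  then show ?case using b_consistent_snoc[of "xs @ ys" M A F b y] by simp
qed simp

lemma b_consistent_not_Nil: "b_consistent M A F b xs \<Longrightarrow> xs \<noteq> [] \<and> set xs \<subseteq> States M"
  by (simp add: b_consistent_def consistent_def computations_def)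

lemma strategy_joint:
  assumes "strategy M A F" "b_consistent M A F b xs"
  shows "F xs \<in> joint_actions M A (last xs)" "last xs \<in> States M"
  using assms b_consistent_not_Nil[OF assms(2)]
  by (auto simp: strategy_def computations_def)

lemma outcomes_nonempty:
  assumes "rbcgs M" "A \<subseteq> Agt M" "s \<in> States M" "\<sigma> \<in> joint_actions M A s"
  shows "outcomes M A s \<sigma> \<noteq> {}" "outcomes M A s \<sigma> \<subseteq> States M"
proof -
  have "\<forall>a\<in>Agt M. \<exists>\<alpha>. \<alpha> \<in> avail M s a" using assms(1,3) unfolding rbcgs_def by blast
  then obtain g where g: "\<forall>a\<in>Agt M. g a \<in> avail M s a" by metis
  define \<sigma>' where "\<sigma>' = (\<lambda>a. if a \<in> A then \<sigma> a else if a \<in> Agt M then g a else undefined)"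
  have "\<sigma>' \<in> joint_actions M (Agt M) s"
    using g assms(2,4) unfolding joint_actions_def \<sigma>'_def by (auto simp: PiE_iff extensional_def)
  moreover have "restrict \<sigma>' A = \<sigma>"
    using assms(4) unfolding joint_actions_def \<sigma>'_def by (auto simp: PiE_iff extensional_def fun_eq_iff)
  ultimately show "outcomes M A s \<sigma> \<noteq> {}" unfolding outcomes_def by blast
  show "outcomes M A s \<sigma> \<subseteq> States M" using assms(1,3) unfolding outcomes_def rbcgs_def by blast
qed

text \<open>A joint action of A extends to one of all agents, so an affordable action always has an
  outcome and the play goes on.\<close>

lemma b_maximal_iff:
  assumes "rbcgs M" "A \<subseteq> Agt M" "strategy M A F"
  shows "b_maximal M A F b xs \<longleftrightarrow> b_consistent M A F b xs \<and> \<not> affordable M A F b xs"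
proof (cases "b_consistent M A F b xs")
  case True
  have ne: "xs \<noteq> []" using b_consistent_not_Nil[OF True] by simp
  have "affordable M A F b xs \<longleftrightarrow> (\<exists>ys. ys \<noteq> [] \<and> b_consistent M A F b (xs @ ys))"
  proof
    assume aff: "affordable M A F b xs"
    note out = outcomes_nonempty[OF assms(1,2) strategy_joint(2,1)[OF assms(3) True]]
    then obtain s where "s \<in> outcomes M A (last xs) (F xs)" "s \<in> States M" by blast
    then show "\<exists>ys. ys \<noteq> [] \<and> b_consistent M A F b (xs @ ys)"
      using b_consistent_snoc[OF ne, of M A F b s] aff True by (intro exI[of _ "[s]"]) simp
  next
    assume "\<exists>ys. ys \<noteq> [] \<and> b_consistent M A F b (xs @ ys)"
    then obtain y ys where "b_consistent M A F b ((xs @ [y]) @ ys)" by (metis append.assoc append_Cons append_Nil neq_Nil_conv)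
    then have "b_consistent M A F b (xs @ [y])" by (rule b_consistent_prefix) simp
    then show "affordable M A F b xs" unfolding b_consistent_snoc[OF ne] by simp
  qed
  then show ?thesis unfolding b_maximal_def using True by blast
qed (simp add: b_maximal_def)

lemma cost_facts:
  assumes "rbcgs M" "s \<in> States M" "a \<in> Agt M" "\<alpha> \<in> avail M s a"
  shows "1 \<le> consumption M s \<alpha> 0" "production M s \<alpha> 0 = 0"
proof -
  have "cost M s \<alpha> 0 \<le> -1" using assms unfolding rbcgs_def by blast
  then show "1 \<le> consumption M s \<alpha> 0" "production M s \<alpha> 0 = 0"
    by (simp_all add: consumption_def production_def)
qed

text \<open>Every step takes at least one unit of resource 0 and produces none of it, hence the
  first claim. Every step was affordable, hence the second. For the third, each step adds at most
  C.\<close>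

lemma b_consistent_energy:
  assumes M: "rbcgs M" "A \<subseteq> Agt M" "strategy M A F" and xs: "b_consistent M A F b xs" and a: "a \<in> A"
  shows "energy M F b xs (length xs - 1) a 0 + int (length xs) \<le> int (b a 0) + 1"
    and "\<And>j. j < nres M \<Longrightarrow> 0 \<le> energy M F b xs (length xs - 1) a j"
    and "\<And>j. j < nres M \<Longrightarrow>
      (\<And>s \<alpha>. s \<in> States M \<Longrightarrow> \<alpha> \<in> avail M s a \<Longrightarrow> production M s \<alpha> j \<le> int C) \<Longrightarrow>
      energy M F b xs (length xs - 1) a j \<le> int (b a j) + int (length xs - 1) * int C"
  using xs
proof (induction xs rule: rev_induct)
  case Nil
  {
    case 1 with b_consistent_not_Nil[of M A F b "[]"] show ?case by simp
  next
    case 2 with b_consistent_not_Nil[of M A F b "[]"] show ?case by simp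
  next
    case 3 with b_consistent_not_Nil[of M A F b "[]"] show ?case by simp
  }
next
  case (snoc s xs)
  have step: "energy M F b (xs @ [s]) (length xs) a j = energy M F b xs (length xs - 1) a j
    - consumption M (last xs) (F xs a) j + production M (last xs) (F xs a) j"
    "last xs \<in> States M" "F xs a \<in> avail M (last xs) a" "b_consistent M A F b xs"
    "affordable M A F b xs"
    if "xs \<noteq> []" "b_consistent M A F b (xs @ [s])" for j
  proof -
    show c: "b_consistent M A F b xs" "affordable M A F b xs"
      using that(2) unfolding b_consistent_snoc[OF that(1)] by simp_all
    show "last xs \<in> States M" "F xs a \<in> avail M (last xs) a"
      using strategy_joint[OF M(3) c(1)] a by (auto simp: joint_actions_def)
  qed (rule energy_snoc[OF that(1)])
  {
    case 1
    show ?case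
    proof (cases "xs = []")
      case False
      note st = step[OF False 1]
      show ?thesis
        using st(1)[of 0] cost_facts[OF M(1) st(2) _ st(3)] snoc.IH(1)[OF st(4)] a M(2) by auto
    qed simp
  next
    case (2 j)
    show ?case
    proof (cases "xs = []")
      case False
      note st = step[OF False 2(2)]
      have "consumption M (last xs) (F xs a) j \<le> energy M F b xs (length xs - 1) a j"
        using st(5) a 2(1) unfolding affordable_def by blast
      moreover have "0 \<le> production M (last xs) (F xs a) j" by (simp add: production_def)
      ultimately show ?thesis using st(1)[of j] by simp
    qed simp
  next
    case (3 j)
    show ?case
    proof (cases "xs = []")
      case False
      note st = step[OF False 3(3)]
      have "production M (last xs) (F xs a) j \<le> int C" by (rule 3(2)[OF st(2,3)])
      moreover have "0 \<le> consumption M (last xs) (F xs a) j" by (simp add: consumption_def)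
      moreover have "energy M F b xs (length xs - 1) a j \<le> int (b a j) + int (length xs - 1) * int C"
        by (rule snoc.IH(3)[OF 3(1,2) st(4)])
      moreover have "int (length xs) * int C = int (length xs - 1) * int C + int C"
        using False by (cases xs) (auto simp: algebra_simps)
      ultimately show ?thesis using st(1)[of j] by simp
    qed simp
  }
qed

lemma b_consistent_length:
  assumes "rbcgs M" "A \<subseteq> Agt M" "strategy M A F" "b_consistent M A F b xs" "a \<in> A"
  shows "length xs \<le> b a 0 + 1"
proof -
  have "0 < nres M" using assms(1) by (auto simp: rbcgs_def)
  then show ?thesis using b_consistent_energy(1)[OF assms] b_consistent_energy(2)[OF assms, of 0] by linarith
qed

text \<open>Extending as long as possible comes to an end, because the diminishing resource of the
  member a of A bounds the length.\<close>

lemma b_consistent_extend: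
  assumes "rbcgs M" "A \<subseteq> Agt M" "strategy M A F" "a \<in> A" "b_consistent M A F b xs"
  shows "\<exists>ys. b_maximal M A F b (xs @ ys)"
  using assms(5)
proof (induction "b a 0 + 1 - length xs" arbitrary: xs rule: less_induct)
  case less
  show ?case
  proof (cases "affordable M A F b xs")
    case True
    have ne: "xs \<noteq> []" using b_consistent_not_Nil[OF less.prems] by simp
    note out = outcomes_nonempty[OF assms(1,2) strategy_joint(2,1)[OF assms(3) less.prems]]
    then obtain s where "s \<in> outcomes M A (last xs) (F xs)" "s \<in> States M" by blast
    then have c: "b_consistent M A F b (xs @ [s])"
      using b_consistent_snoc[OF ne, of M A F b s] True less.prems by simp
    have "length (xs @ [s]) \<le> b a 0 + 1"
      by (rule b_consistent_length[OF assms(1-3) c assms(4)])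
    then have "b a 0 + 1 - length (xs @ [s]) < b a 0 + 1 - length xs" by simp
    from less.hyps[OF this c] obtain ys where "b_maximal M A F b ((xs @ [s]) @ ys)" by blast
    then show ?thesis by (intro exI[of _ "s # ys"]) simp
  next
    case False
    then have "b_maximal M A F b (xs @ [])"
      using b_maximal_iff[OF assms(1-3)] less.prems by simp
    then show ?thesis by blast
  qed
qed

text \<open>
  A uniform view of the three temporal operators: the play has to reach a prefix satisfying
  \<open>stop\<close>, all earlier prefixes satisfying \<open>go\<close>; unless \<open>strict\<close>, it may also satisfy \<open>go\<close> throughout.
\<close>

definition wins :: "('st list \<Rightarrow> bool) \<Rightarrow> ('st list \<Rightarrow> bool) \<Rightarrow> bool \<Rightarrow> 'st list \<Rightarrow> bool" where
  "wins stop go strict xs \<longleftrightarrow>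
     (\<exists>i<length xs. stop (take (Suc i) xs) \<and> (\<forall>j<i. go (take (Suc j) xs))) \<or>
     (\<not> strict \<and> (\<forall>j<length xs. go (take (Suc j) xs)))"

text \<open>A certificate checked history by history. W collects histories that are still to be
  decided; one that does not stop hands the obligation on to its successors, and in a strict game
  the play must not end there. As plays are finite, such local conditions capture winning.\<close>

definition winning_set ::
  "('ag, 'st, 'act, 'pr) rbcgs \<Rightarrow> 'ag set \<Rightarrow> ('st list \<Rightarrow> 'ag \<Rightarrow> 'act) \<Rightarrow> ('ag \<Rightarrow> nat \<Rightarrow> nat)
     \<Rightarrow> ('st list \<Rightarrow> bool) \<Rightarrow> ('st list \<Rightarrow> bool) \<Rightarrow> bool \<Rightarrow> 'st list set \<Rightarrow> bool" where
  "winning_set M A F b stop go strict W \<longleftrightarrow> (\<forall>xs\<in>W. b_consistent M A F b xs \<longrightarrow>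
     stop xs \<or> (go xs \<and> (strict \<longrightarrow> affordable M A F b xs) \<and>
       (affordable M A F b xs \<longrightarrow> (\<forall>s\<in>outcomes M A (last xs) (F xs). xs @ [s] \<in> W))))"

text \<open>A losing maximal play would remain in W without stopping up to its last history. No
  action is affordable there, so the game is not strict and \<open>go\<close> has held throughout,
  which is a win after all.\<close>

lemma wins_if_winning_set:
  assumes M: "rbcgs M" "A \<subseteq> Agt M" "strategy M A F"
    and W: "winning_set M A F b stop go strict W" "[hd xs] \<in> W" and xs: "b_maximal M A F b xs"
  shows "wins stop go strict xs"
proof (rule ccontr)
  assume lose: "\<not> wins stop go strict xs"
  have c: "b_consistent M A F b xs" and na: "\<not> affordable M A F b xs"
    using xs b_maximal_iff[OF M] by blast+
  have ne: "xs \<noteq> []" using b_consistent_not_Nil[OF c] by simp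
  have pre: "b_consistent M A F b (take (Suc j) xs)" for j
    using b_consistent_prefix[of M A F b "take (Suc j) xs" "drop (Suc j) xs"] c ne by simp
  have claim: "take (Suc j) xs \<in> W \<and> (\<forall>k<j. go (take (Suc k) xs))" if "j < length xs" for j
    using that
  proof (induction j)
    case 0
    then show ?case using W(2) ne by (cases xs) auto
  next
    case (Suc j)
    then have IH: "take (Suc j) xs \<in> W" "\<forall>k<j. go (take (Suc k) xs)" by auto
    have "\<not> stop (take (Suc j) xs)"
      using lose IH(2) Suc.prems unfolding wins_def by (meson Suc_lessD)
    moreover have snoc: "take (Suc (Suc j)) xs = take (Suc j) xs @ [xs ! Suc j]"
      using Suc.prems by (rule take_Suc_conv_app_nth)
    moreover have "affordable M A F b (take (Suc j) xs)"
      "xs ! Suc j \<in> outcomes M A (last (take (Suc j) xs)) (F (take (Suc j) xs))"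
      using pre[of "Suc j"] b_consistent_snoc[of "take (Suc j) xs" M A F b "xs ! Suc j"] ne
      unfolding snoc by simp_all
    ultimately have "go (take (Suc j) xs)" "take (Suc (Suc j)) xs \<in> W"
      using W(1) IH(1) pre[of j] unfolding winning_set_def by auto
    then show ?case using IH(2) by (auto simp: less_Suc_eq)
  qed
  obtain n where n: "length xs = Suc n" using ne by (cases xs) auto
  then have "xs \<in> W" "\<forall>k<n. go (take (Suc k) xs)" using claim[of n] by auto
  moreover have "\<not> stop xs"
  proof
    assume "stop xs"
    then have "wins stop go strict xs" unfolding wins_def
      using n calculation(2) by (intro disjI1 exI[of _ n]) simp
    then show False using lose by simp
  qed
  ultimately have "go xs" "\<not> strict" using W(1) c na unfolding winning_set_def by auto
  then have "wins stop go strict xs" unfolding wins_def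
    using n \<open>\<forall>k<n. go (take (Suc k) xs)\<close> by (intro disjI2) (auto simp: less_Suc_eq)
  then show False using lose by simp
qed

text \<open>The witness consists of the histories none of whose proper prefixes stops. What is
  required at such a history is read off a maximal play through it, which wins and can stop there or
  later only.\<close>

lemma winning_set_if_wins:
  assumes M: "rbcgs M" "A \<subseteq> Agt M" "strategy M A F" and a: "a \<in> A"
    and win: "\<And>xs. b_maximal M A F b xs \<Longrightarrow> hd xs \<in> S \<Longrightarrow> wins stop go strict xs"
  shows "winning_set M A F b stop go strict {xs. b_consistent M A F b xs \<and> hd xs \<in> S \<and>
     (\<forall>j. Suc j < length xs \<longrightarrow> \<not> stop (take (Suc j) xs))}" (is "winning_set _ _ _ _ _ _ _ ?W")
  unfolding winning_set_def
proof (intro ballI impI)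
  fix xs assume xs: "xs \<in> ?W" and c: "b_consistent M A F b xs"
  have ne: "xs \<noteq> []" using b_consistent_not_Nil[OF c] by simp
  have children: "xs @ [s] \<in> ?W"
    if "\<not> stop xs" "affordable M A F b xs" "s \<in> outcomes M A (last xs) (F xs)" for s
  proof -
    have "s \<in> States M"
      using outcomes_nonempty(2)[OF M(1,2) strategy_joint(2,1)[OF M(3) c]] that(3) by blast
    then have "b_consistent M A F b (xs @ [s])"
      using b_consistent_snoc[OF ne, of M A F b s] c that by simp
    moreover have "\<not> stop (take (Suc j) (xs @ [s]))" if "Suc j < length (xs @ [s])" for j
      using that xs \<open>\<not> stop xs\<close> by (cases "Suc j = length xs") auto
    ultimately show ?thesis using xs ne by simp
  qed
  show "stop xs \<or> (go xs \<and> (strict \<longrightarrow> affordable M A F b xs) \<and>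
       (affordable M A F b xs \<longrightarrow> (\<forall>s\<in>outcomes M A (last xs) (F xs). xs @ [s] \<in> ?W)))"
  proof (cases "stop xs")
    case False
    obtain ys where ys: "b_maximal M A F b (xs @ ys)"
      using b_consistent_extend[OF M a c] by blast
    then have "wins stop go strict (xs @ ys)" using win xs ne by simp
    then consider i where "i < length (xs @ ys)" "stop (take (Suc i) (xs @ ys))"
        "\<forall>j<i. go (take (Suc j) (xs @ ys))"
      | "\<not> strict" "\<forall>j<length (xs @ ys). go (take (Suc j) (xs @ ys))"
      unfolding wins_def by blast
    then have "go xs \<and> (strict \<longrightarrow> affordable M A F b xs)"
    proof cases
      case (1 i)
      have "\<not> i < length xs"
      proof
        assume i: "i < length xs"
        then have "stop (take (Suc i) xs)" using 1(2) by simp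
        then show False using xs False i by (cases "Suc i = length xs") auto
      qed
      then have "go (take (Suc (length xs - 1)) (xs @ ys))" using 1(3) ne
        by (metis diff_less length_greater_0_conv less_le_trans not_le zero_less_one)
      \<comment> \<open>The play stops strictly beyond xs, so it was continued after xs, and the
        action at xs was affordable.\<close>
      moreover obtain y zs where "ys = y # zs" using 1(1) \<open>\<not> i < length xs\<close> by (cases ys) auto
      then have "b_consistent M A F b ((xs @ [y]) @ zs)" using ys by (simp add: b_maximal_def)
      then have "b_consistent M A F b (xs @ [y])" by (rule b_consistent_prefix) simp
      then have "affordable M A F b xs" unfolding b_consistent_snoc[OF ne] by simp
      ultimately show ?thesis using ne by simp
    next
      case 2
      have "length xs - 1 < length (xs @ ys)" using ne by (cases xs) auto
      then have "go (take (Suc (length xs - 1)) (xs @ ys))" using 2(2) by blast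
      then show ?thesis using 2(1) ne by simp
    qed
    then show ?thesis using children[OF False] by blast
  qed simp
qed

text \<open>For Next, going on is possible at length 1 only and stopping at other lengths only, so a
  win stops exactly at the second state. Release stops where both formulas hold and is the one game
  that is not strict.\<close>

definition stop_at :: "nat \<Rightarrow> ('st \<Rightarrow> bool) \<Rightarrow> ('st \<Rightarrow> bool) \<Rightarrow> 'st list \<Rightarrow> bool" where
  "stop_at \<kappa> P Q xs \<longleftrightarrow> (\<kappa> = 0 \<and> length xs \<noteq> 1 \<and> P (last xs)) \<or> (\<kappa> = 1 \<and> Q (last xs)) \<or>
     (\<kappa> = 2 \<and> P (last xs) \<and> Q (last xs))"

definition go_on :: "nat \<Rightarrow> ('st \<Rightarrow> bool) \<Rightarrow> ('st \<Rightarrow> bool) \<Rightarrow> 'st list \<Rightarrow> bool" where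
  "go_on \<kappa> P Q xs \<longleftrightarrow> (\<kappa> = 0 \<and> length xs = 1) \<or> (\<kappa> = 1 \<and> P (last xs)) \<or> (\<kappa> = 2 \<and> Q (last xs))"

text \<open>The kinds 0, 1, 2 are the operators Next, Until, Release.\<close>

definition game ::
  "('ag, 'st, 'act, 'pr) rbcgs \<Rightarrow> 'ag set \<Rightarrow> ('ag \<Rightarrow> nat \<Rightarrow> nat) \<Rightarrow> 'st \<Rightarrow> nat
     \<Rightarrow> ('st \<Rightarrow> bool) \<Rightarrow> ('st \<Rightarrow> bool) \<Rightarrow> bool" where
  "game M A b s \<kappa> P Q \<longleftrightarrow> (\<exists>F. strategy M A F \<and> uniform M A F \<and>
     (\<forall>a\<in>A. \<forall>s'. (s', s) \<in> indist M a \<longrightarrow>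
        (\<forall>xs\<in>out M A s' F b. wins (stop_at \<kappa> P Q) (go_on \<kappa> P Q) (\<kappa> \<noteq> 2) xs)))"

lemma last_take_Suc: "i < length xs \<Longrightarrow> last (take (Suc i) xs) = xs ! i"
  by (simp add: take_Suc_conv_app_nth)

lemma out_not_Nil: "xs \<in> out M A s F b \<Longrightarrow> xs \<noteq> []"
  using b_consistent_not_Nil unfolding out_def b_maximal_def by blast

lemma wins_nth:
  assumes "\<And>i. i < length xs \<Longrightarrow> stop (take (Suc i) xs) = S i"
    and "\<And>i. i < length xs \<Longrightarrow> go (take (Suc i) xs) = G i"
  shows "wins stop go strict xs \<longleftrightarrow>
    (\<exists>i<length xs. S i \<and> (\<forall>j<i. G j)) \<or> (\<not> strict \<and> (\<forall>j<length xs. G j))"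
proof -
  have "(\<forall>j<i. go (take (Suc j) xs)) = (\<forall>j<i. G j)" if "i \<le> length xs" for i
    using assms(2) that by (simp add: less_le_trans)
  then have "(i < length xs \<and> stop (take (Suc i) xs) \<and> (\<forall>j<i. go (take (Suc j) xs))) =
      (i < length xs \<and> S i \<and> (\<forall>j<i. G j))" for i
    using assms(1) by (simp cong: conj_cong)
  then show ?thesis unfolding wins_def using assms(2) by simp
qed

lemma wins_0:
  assumes "xs \<noteq> []"
  shows "wins (stop_at 0 P Q) (go_on 0 P Q) True xs \<longleftrightarrow> length xs > 1 \<and> P (xs ! 1)"
proof
  assume "wins (stop_at 0 P Q) (go_on 0 P Q) True xs"
  then obtain i where i: "i < length xs" "stop_at 0 P Q (take (Suc i) xs)"
    "\<forall>j<i. go_on 0 P Q (take (Suc j) xs)"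
    unfolding wins_def by blast
  have "i \<noteq> 0" using i(1,2) by (auto simp: stop_at_def)
  moreover have "\<not> 1 < i" using i(1,3) by (auto simp: go_on_def)
  ultimately have "i = 1" by simp
  then show "length xs > 1 \<and> P (xs ! 1)" using i(1,2) by (auto simp: stop_at_def last_take_Suc)
next
  assume "length xs > 1 \<and> P (xs ! 1)"
  then show "wins (stop_at 0 P Q) (go_on 0 P Q) True xs"
    unfolding wins_def
    by (intro disjI1 exI[of _ 1]) (auto simp: stop_at_def go_on_def last_take_Suc)
qed

lemma sat_game:
  "sat M s (Next A b \<phi>) \<longleftrightarrow> game M A b s 0 (\<lambda>t. sat M t \<phi>) (\<lambda>t. sat M t \<phi>)"
  "sat M s (Until A b \<phi> \<psi>) \<longleftrightarrow> game M A b s 1 (\<lambda>t. sat M t \<phi>) (\<lambda>t. sat M t \<psi>)"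
  "sat M s (Release A b \<phi> \<psi>) \<longleftrightarrow> game M A b s 2 (\<lambda>t. sat M t \<phi>) (\<lambda>t. sat M t \<psi>)"
proof -
  have 1: "wins (stop_at 1 P Q) (go_on 1 P Q) True xs \<longleftrightarrow>
      (\<exists>i<length xs. Q (xs ! i) \<and> (\<forall>j<i. P (xs ! j)))" for P Q :: "'b \<Rightarrow> bool" and xs
    by (subst wins_nth[where S = "\<lambda>i. Q (xs ! i)" and G = "\<lambda>i. P (xs ! i)"])
      (simp_all add: stop_at_def go_on_def last_take_Suc)
  have le: "(\<forall>j\<le>i. R j) = (R i \<and> (\<forall>j<i. R j))" for i :: nat and R
    by (auto simp: le_less)
  have 2: "wins (stop_at 2 P Q) (go_on 2 P Q) False xs \<longleftrightarrow>
      (\<exists>i<length xs. P (xs ! i) \<and> (\<forall>j\<le>i. Q (xs ! j))) \<or> (\<forall>j<length xs. Q (xs ! j))"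
    for P Q :: "'b \<Rightarrow> bool" and xs
    by (subst wins_nth[where S = "\<lambda>i. P (xs ! i) \<and> Q (xs ! i)" and G = "\<lambda>i. Q (xs ! i)"])
      (simp_all add: stop_at_def go_on_def last_take_Suc le)
  show "sat M s (Next A b \<phi>) \<longleftrightarrow> game M A b s 0 (\<lambda>t. sat M t \<phi>) (\<lambda>t. sat M t \<phi>)"
  proof -
    have "(\<forall>xs\<in>out M A s' F b. length xs > 1 \<and> sat M (xs ! 1) \<phi>) =
        (\<forall>xs\<in>out M A s' F b. wins (stop_at 0 (\<lambda>t. sat M t \<phi>) (\<lambda>t. sat M t \<phi>))
           (go_on 0 (\<lambda>t. sat M t \<phi>) (\<lambda>t. sat M t \<phi>)) True xs)" for s' F
      by (intro ball_cong refl wins_0[symmetric] out_not_Nil)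
    then show ?thesis unfolding game_def sat.simps by simp
  qed
  show "sat M s (Until A b \<phi> \<psi>) \<longleftrightarrow> game M A b s 1 (\<lambda>t. sat M t \<phi>) (\<lambda>t. sat M t \<psi>)"
    using 1 unfolding game_def sat.simps by simp
  show "sat M s (Release A b \<phi> \<psi>) \<longleftrightarrow> game M A b s 2 (\<lambda>t. sat M t \<phi>) (\<lambda>t. sat M t \<psi>)"
    using 2 unfolding game_def sat.simps by simp
qed

text \<open>Equality on all that strategies and plays consult. An encoding does not show junk
  values, so a structure rebuilt from tables can only agree with the original one.\<close>

definition agree :: "('ag, 'st, 'act, 'pr) rbcgs \<Rightarrow> ('ag, 'st, 'act, 'pr) rbcgs \<Rightarrow> bool" where
  "agree M M' \<longleftrightarrow> Agt M = Agt M' \<and> nres M = nres M' \<and> States M = States M' \<and>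
     (\<forall>s\<in>States M. \<forall>a\<in>Agt M. avail M s a = avail M' s a) \<and>
     (\<forall>s\<in>States M. \<forall>a\<in>Agt M. \<forall>\<alpha>\<in>avail M s a. \<forall>j<nres M. cost M s \<alpha> j = cost M' s \<alpha> j) \<and>
     (\<forall>s\<in>States M. \<forall>\<sigma>\<in>joint_actions M (Agt M) s. succ_state M s \<sigma> = succ_state M' s \<sigma>) \<and>
     (\<forall>a\<in>Agt M. indist M a = indist M' a)"

lemma joint_actions_agree:
  assumes "agree M M'" "A \<subseteq> Agt M" "s \<in> States M"
  shows "joint_actions M A s = joint_actions M' A s"
  using assms unfolding joint_actions_def agree_def by (intro PiE_cong) blast

lemma agree_sym: "agree M M' \<Longrightarrow> agree M' M"
  using joint_actions_agree[of M M' "Agt M"] unfolding agree_def by auto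

lemma outcomes_agree:
  assumes "agree M M'" "s \<in> States M"
  shows "outcomes M A s \<sigma> = outcomes M' A s \<sigma>"
  using joint_actions_agree[OF assms(1) order_refl assms(2)] assms
  unfolding outcomes_def agree_def by auto

lemma b_consistent_agree:
  assumes ag: "agree M M'" and A: "A \<subseteq> Agt M" and F: "strategy M A F"
    and b: "\<forall>a\<in>A. \<forall>j<nres M. b a j = b' a j"
    and xs: "b_consistent M A F b xs"
  shows "b_consistent M' A F b' xs \<and>
    (\<forall>a\<in>A. \<forall>j<nres M. energy M F b xs (length xs - 1) a j = energy M' F b' xs (length xs - 1) a j)"
  using xs
proof (induction xs rule: rev_induct)
  case Nil
  then show ?case using b_consistent_not_Nil[of M A F b "[]"] by simp
next
  case (snoc s xs)
  show ?case
  proof (cases "xs = []")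
    case True
    then show ?thesis using snoc.prems ag b unfolding agree_def by (simp add: b_consistent_single)
  next
    case False
    note st = snoc.prems[unfolded b_consistent_snoc[OF False]]
    have c: "b_consistent M A F b xs" using st by simp
    note IH = snoc.IH[OF c]
    have lst: "last xs \<in> States M" and Fx: "\<And>a. a \<in> A \<Longrightarrow> F xs a \<in> avail M (last xs) a"
      using strategy_joint[OF F c] by (auto simp: joint_actions_def)
    have cost: "cost M (last xs) (F xs a) j = cost M' (last xs) (F xs a) j" if "a \<in> A" "j < nres M" for a j
      using ag lst Fx[OF that(1)] that A unfolding agree_def by blast
    then have cp: "consumption M (last xs) (F xs a) j = consumption M' (last xs) (F xs a) j"
      "production M (last xs) (F xs a) j = production M' (last xs) (F xs a) j"
      if "a \<in> A" "j < nres M" for a j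
      using that by (simp_all add: consumption_def production_def)
    have "nres M = nres M'" "States M = States M'" using ag unfolding agree_def by auto
    then have "affordable M' A F b' xs"
      using st IH cp unfolding affordable_def by auto
    then have "b_consistent M' A F b' (xs @ [s])"
      unfolding b_consistent_snoc[OF False]
      using st IH outcomes_agree[OF ag lst] \<open>States M = States M'\<close> by simp
    moreover have "energy M F b (xs @ [s]) (length xs) a j = energy M' F b' (xs @ [s]) (length xs) a j"
      if "a \<in> A" "j < nres M" for a j
      unfolding energy_snoc[OF False] using IH cp[OF that] that by simp
    ultimately show ?thesis by simp
  qed
qed

lemma strategy_agree:
  assumes "agree M M'" "A \<subseteq> Agt M"
  shows "strategy M A F = strategy M' A F"
proof -
  have "computations M = computations M'" using assms(1) by (simp add: computations_def agree_def)
  moreover have "joint_actions M A (last xs) = joint_actions M' A (last xs)" if "xs \<in> computations M" for xs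
    using that by (intro joint_actions_agree[OF assms]) (auto simp: computations_def)
  ultimately show ?thesis by (simp add: strategy_def)
qed

lemma out_agree:
  assumes ag: "agree M M'" and A: "A \<subseteq> Agt M" and F: "strategy M A F"
    and b: "\<forall>a\<in>A. \<forall>j<nres M. b a j = b' a j"
  shows "out M A s F b = out M' A s F b'"
proof -
  have n: "nres M = nres M'" "Agt M = Agt M'" using ag by (auto simp: agree_def)
  have "b_consistent M A F b xs \<longleftrightarrow> b_consistent M' A F b' xs" for xs
    using b_consistent_agree[OF ag A F b, of xs]
      b_consistent_agree[OF agree_sym[OF ag], of A F b' b xs] strategy_agree[OF ag A] F A b n
    by auto
  then show ?thesis unfolding out_def b_maximal_def by simp
qed

lemma wins_cong:
  assumes "\<And>i. i < length xs \<Longrightarrow> P (xs ! i) = P' (xs ! i)" "\<And>i. i < length xs \<Longrightarrow> Q (xs ! i) = Q' (xs ! i)"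
  shows "wins (stop_at \<kappa> P Q) (go_on \<kappa> P Q) st xs = wins (stop_at \<kappa> P' Q') (go_on \<kappa> P' Q') st xs"
proof -
  have *: "stop_at \<kappa> P Q (take (Suc i) xs) = stop_at \<kappa> P' Q' (take (Suc i) xs)"
    "go_on \<kappa> P Q (take (Suc i) xs) = go_on \<kappa> P' Q' (take (Suc i) xs)" if "i < length xs" for i
    using that assms by (simp_all add: stop_at_def go_on_def last_take_Suc)
  show ?thesis
    by (subst wins_nth[where S = "\<lambda>i. stop_at \<kappa> P' Q' (take (Suc i) xs)"
          and G = "\<lambda>i. go_on \<kappa> P' Q' (take (Suc i) xs)"])
      (simp_all add: * wins_def)
qed

lemma game_agree:
  assumes ag: "agree M M'" and A: "A \<subseteq> Agt M"
    and b: "\<forall>a\<in>A. \<forall>j<nres M. b a j = b' a j"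
    and P: "\<forall>t\<in>States M. P t = P' t" and Q: "\<forall>t\<in>States M. Q t = Q' t"
  shows "game M A b s \<kappa> P Q = game M' A b' s \<kappa> P' Q'"
proof -
  have c: "computations M = computations M'" and i: "\<And>a. a \<in> A \<Longrightarrow> indist M a = indist M' a"
    using ag A by (auto simp: computations_def agree_def)
  have u: "uniform M A F = uniform M' A F" for F
    unfolding uniform_def c using i by simp
  have w: "wins (stop_at \<kappa> P Q) (go_on \<kappa> P Q) (\<kappa> \<noteq> 2) xs = wins (stop_at \<kappa> P' Q') (go_on \<kappa> P' Q') (\<kappa> \<noteq> 2) xs"
    if "xs \<in> out M A s' F b" for xs s' F
  proof -
    have "set xs \<subseteq> States M"
      using that b_consistent_not_Nil unfolding out_def b_maximal_def by blast
    then show ?thesis using P Q nth_mem by (intro wins_cong) blast+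
  qed
  have "(strategy M A F \<and> uniform M A F \<and> (\<forall>a\<in>A. \<forall>s'. (s', s) \<in> indist M a \<longrightarrow>
        (\<forall>xs\<in>out M A s' F b. wins (stop_at \<kappa> P Q) (go_on \<kappa> P Q) (\<kappa> \<noteq> 2) xs))) \<longleftrightarrow>
      (strategy M' A F \<and> uniform M' A F \<and> (\<forall>a\<in>A. \<forall>s'. (s', s) \<in> indist M' a \<longrightarrow>
        (\<forall>xs\<in>out M' A s' F b'. wins (stop_at \<kappa> P' Q') (go_on \<kappa> P' Q') (\<kappa> \<noteq> 2) xs)))" for F
  proof (cases "strategy M A F")
    case True
    have "(\<forall>xs\<in>out M A s' F b. wins (stop_at \<kappa> P Q) (go_on \<kappa> P Q) (\<kappa> \<noteq> 2) xs) =
      (\<forall>xs\<in>out M' A s' F b'. wins (stop_at \<kappa> P' Q') (go_on \<kappa> P' Q') (\<kappa> \<noteq> 2) xs)" for s'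
      unfolding out_agree[OF ag A True b, symmetric] by (intro ball_cong refl w)
    then show ?thesis
      using strategy_agree[OF ag A] u i by simp
  qed (use strategy_agree[OF ag A] in simp)
  then show ?thesis unfolding game_def by simp
qed

section \<open>Strategies as tables\<close>

text \<open>Numerals in base B with digits \<open>Suc t\<close>. As 0 is no digit, lists of
  different lengths get different codes once all digits are below B. Extending a history by t maps
  its code c to c * B + Suc t, which is a term of the logic.\<close>

definition list_code :: "nat \<Rightarrow> nat list \<Rightarrow> nat" where
  "list_code B xs = foldl (\<lambda>c t. c * B + Suc t) 0 xs"

lemma list_code_simps [simp]:
  "list_code B [] = 0" "list_code B (xs @ [t]) = list_code B xs * B + Suc t"
  by (simp_all add: list_code_def)

lemma list_code_single [simp]: "list_code B [t] = Suc t"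
  using list_code_simps(2)[of B "[]" t] by simp

lemma code_step_inject:
  assumes "c * B + Suc t = c' * B + Suc t'" "Suc t < B" "Suc t' < B"
  shows "c = c' \<and> t = t'"
proof -
  have "(k * B + r) div B = k" "(k * B + r) mod B = r" if "r < B" for k r
    using that by simp_all
  then show ?thesis using assms by (metis nat.inject)
qed

lemma list_code_inject:
  assumes "list_code B xs = list_code B ys" "\<forall>t\<in>set xs. Suc t < B" "\<forall>t\<in>set ys. Suc t < B"
  shows "xs = ys"
  using assms
proof (induction xs arbitrary: ys rule: rev_induct)
  case Nil
  then show ?case by (cases ys rule: rev_cases) auto
next
  case (snoc t xs)
  then obtain u zs where ys: "ys = zs @ [u]" by (cases ys rule: rev_cases) auto
  have "list_code B xs = list_code B zs \<and> t = u"
    by (rule code_step_inject[of _ B]) (use snoc.prems ys in auto)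
  then show ?case using snoc ys by auto
qed

lemma list_code_less:
  assumes "\<forall>t\<in>set xs. Suc t < B" "1 \<le> B"
  shows "list_code B xs < B ^ length xs"
  using assms(1)
proof (induction xs rule: rev_induct)
  case (snoc t xs)
  then have "Suc (list_code B xs) \<le> B ^ length xs" by simp
  then have "Suc (list_code B xs) * B \<le> B ^ length xs * B" by (rule mult_le_mono1)
  moreover have "Suc t < B" using snoc.prems by simp
  ultimately show ?case by (simp add: mult.commute)
qed simp

text \<open>I contains the pair of empty histories, with code 0, and is closed under extension by
  indistinguishable states; so up to U it contains the lifted indistinguishability relation. F must
  respect all of I. A larger I makes this harder, so quantifying over I amounts to
  uniformity.\<close>

definition core_strategy ::
  "nat \<Rightarrow> nrbcgs \<Rightarrow> nat set \<Rightarrow> (nat \<Rightarrow> nat) \<Rightarrow> (nat \<Rightarrow> nat \<Rightarrow> bool) \<Rightarrow> bool" where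
  "core_strategy U M A F I \<longleftrightarrow> (\<forall>a<card (Agt M). a \<in> A \<longrightarrow>
     I (pair a 0) 0 \<and>
     (\<forall>c<U. \<forall>t<card (States M). c * Suc (card (States M)) + Suc t < U \<longrightarrow>
        F (pair (c * Suc (card (States M)) + Suc t) a) \<in> avail M t a) \<and>
     (\<forall>c<U. \<forall>c'<U. I (pair a c) c' \<longrightarrow> F (pair c a) = F (pair c' a) \<and>
        (\<forall>t<card (States M). \<forall>t'<card (States M). (t, t') \<in> indist M a \<longrightarrow>
           I (pair a (c * Suc (card (States M)) + Suc t)) (c' * Suc (card (States M)) + Suc t'))))"

definition core_affordable ::
  "nrbcgs \<Rightarrow> nat set \<Rightarrow> (nat \<Rightarrow> nat) \<Rightarrow> (nat \<Rightarrow> nat) \<Rightarrow> nat \<Rightarrow> nat \<Rightarrow> bool" where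
  "core_affordable M A F E x t \<longleftrightarrow> (\<forall>a<card (Agt M). a \<in> A \<longrightarrow> (\<forall>j<nres M.
     consumption M t (F (pair x a)) j \<le> int (E (pair x (pair a j)))))"

text \<open>Energies are constrained instead of computed: the entries of a successor must continue
  those of x. With the initial entries fixed in \<open>core_play\<close>, this forces the true
  energies along the plays followed by W.\<close>

definition core_successor ::
  "nrbcgs \<Rightarrow> nat set \<Rightarrow> (nat \<Rightarrow> nat) \<Rightarrow> (nat \<Rightarrow> nat) \<Rightarrow> nat set \<Rightarrow> nat \<Rightarrow> nat \<Rightarrow> nat \<Rightarrow> bool" where
  "core_successor M A F E W x t u \<longleftrightarrow> x * Suc (card (States M)) + Suc u \<in> W \<and>
     (\<forall>a<card (Agt M). a \<in> A \<longrightarrow> (\<forall>j<nres M.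
        int (E (pair (x * Suc (card (States M)) + Suc u) (pair a j))) = int (E (pair x (pair a j)))
          - consumption M t (F (pair x a)) j + production M t (F (pair x a)) j))"

text \<open>c is the code of the history without its last state t, hence 0 exactly for histories of
  length 1, at which Next goes on.\<close>

definition core_node ::
  "nrbcgs \<Rightarrow> nat set \<Rightarrow> nat \<Rightarrow> (nat \<Rightarrow> bool) \<Rightarrow> (nat \<Rightarrow> bool) \<Rightarrow> (nat \<Rightarrow> nat) \<Rightarrow> (nat \<Rightarrow> nat)
     \<Rightarrow> nat set \<Rightarrow> nat \<Rightarrow> nat \<Rightarrow> nat \<Rightarrow> bool" where
  "core_node M A \<kappa> P Q F E W c x t \<longleftrightarrow>
     ((\<kappa> = 0 \<and> c \<noteq> 0 \<and> P t) \<or> (\<kappa> = 1 \<and> Q t) \<or> (\<kappa> = 2 \<and> P t \<and> Q t)) \<or>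
     (((\<kappa> = 0 \<and> c = 0) \<or> (\<kappa> = 1 \<and> P t) \<or> (\<kappa> = 2 \<and> Q t)) \<and>
      (\<kappa> \<noteq> 2 \<longrightarrow> core_affordable M A F E x t) \<and>
      (core_affordable M A F E x t \<longrightarrow> (\<forall>\<sigma>\<in>joint_actions M (Agt M) t.
         (\<forall>a<card (Agt M). a \<in> A \<longrightarrow> \<sigma> a = F (pair x a)) \<longrightarrow>
         core_successor M A F E W x t (succ_state M t \<sigma>))))"

definition core_play ::
  "nat \<Rightarrow> nrbcgs \<Rightarrow> nat set \<Rightarrow> (nat \<Rightarrow> nat \<Rightarrow> nat) \<Rightarrow> nat \<Rightarrow> nat \<Rightarrow> (nat \<Rightarrow> bool) \<Rightarrow> (nat \<Rightarrow> bool)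
     \<Rightarrow> (nat \<Rightarrow> nat) \<Rightarrow> (nat \<Rightarrow> nat) \<Rightarrow> nat set \<Rightarrow> bool" where
  "core_play U M A b s \<kappa> P Q F E W \<longleftrightarrow>
     (\<forall>a<card (Agt M). a \<in> A \<longrightarrow> (\<forall>t<card (States M). (t, s) \<in> indist M a \<longrightarrow> Suc t \<in> W)) \<and>
     (\<forall>t<card (States M). \<forall>a<card (Agt M). a \<in> A \<longrightarrow>
        (\<forall>j<nres M. E (pair (Suc t) (pair a j)) = b a j)) \<and>
     (\<forall>c<U. \<forall>t<card (States M). c * Suc (card (States M)) + Suc t \<in> W \<longrightarrow>
        c * Suc (card (States M)) + Suc t < U \<longrightarrow>
        core_node M A \<kappa> P Q F E W c (c * Suc (card (States M)) + Suc t) t)"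

text \<open>
  Plays are represented by their codes x. F gives the actions, E the energies and W the winning
  set. The relation I only has to contain indistinguishability, so that all conditions are
  local.
\<close>

definition core ::
  "nat \<Rightarrow> nrbcgs \<Rightarrow> nat set \<Rightarrow> (nat \<Rightarrow> nat \<Rightarrow> nat) \<Rightarrow> nat \<Rightarrow> nat \<Rightarrow> (nat \<Rightarrow> bool) \<Rightarrow> (nat \<Rightarrow> bool) \<Rightarrow> bool" where
  "core U M A b s \<kappa> P Q \<longleftrightarrow> (\<exists>F. (\<forall>x. F x < U) \<and> (\<exists>E. (\<forall>x. E x < U) \<and> (\<exists>W I.
     core_strategy U M A F I \<and> core_play U M A b s \<kappa> P Q F E W)))"

lemma coreI:
  assumes "\<And>x. F x < U" "\<And>x. E x < U" "core_strategy U M A F I" "core_play U M A b s \<kappa> P Q F E W"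
  shows "core U M A b s \<kappa> P Q"
  unfolding core_def using assms
  by (intro exI[of _ F] exI[of _ E] exI[of _ W] exI[of _ I] conjI allI)

lemma numberedD:
  assumes "numbered M"
  shows "t \<in> States M \<longleftrightarrow> t < card (States M)" "a \<in> Agt M \<longleftrightarrow> a < card (Agt M)"
    "\<alpha> \<in> Acts M \<longleftrightarrow> \<alpha> < card (Acts M)"
  using assms unfolding numbered_def by (metis lessThan_iff)+

text \<open>No play of a member of A is longer than N, and histories up to that length have codes
  below U, where the table is reliable.\<close>

lemma core_imp_game:
  assumes M: "rbcgs M" "numbered M" and A: "A \<subseteq> Agt M"
    and N: "\<And>a. a \<in> A \<Longrightarrow> b a 0 + 1 \<le> N" "1 \<le> N" "Suc (card (States M)) ^ N \<le> U"
    and core: "core_strategy U M A F I" "core_play U M A b s \<kappa> P Q F E W"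
  shows "game M A b s \<kappa> P Q"
proof -
  define B where "B = Suc (card (States M))"
  \<comment> \<open>Longer histories occur in no play, but G must be available and uniform there as
    well. The entry of the one-state history made of the last state serves, since last states of
    indistinguishable histories are indistinguishable.\<close>
  define G where "G = (\<lambda>xs. restrict (\<lambda>a. if length xs \<le> N then F (pair (list_code B xs) a)
      else F (pair (Suc (last xs)) a)) A)"
  have St: "t \<in> States M \<longleftrightarrow> Suc t < B" for t using numberedD(1)[OF M(2)] by (simp add: B_def)
  have less: "list_code B xs < U" if "set xs \<subseteq> States M" "length xs \<le> N" for xs
  proof -
    have "list_code B xs < B ^ length xs"
      by (rule list_code_less) (use that St in \<open>auto simp: B_def\<close>)
    also have "\<dots> \<le> B ^ N" using that(2) by (intro power_increasing) (auto simp: B_def)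
    finally show ?thesis using N(3) by (simp add: B_def)
  qed
  have less1: "Suc t < U" if "t \<in> States M" for t using less[of "[t]"] that N(2) by simp
  have U0: "0 < U" using less[of "[]"] by simp
  have aA: "a < card (Agt M)" if "a \<in> A" for a using A that numberedD(2)[OF M(2)] by blast
  have csI0: "I (pair a 0) 0" if "a \<in> A" for a
    using core(1) aA[OF that] that unfolding core_strategy_def by simp
  have csF: "F (pair (c * B + Suc t) a) \<in> avail M t a"
    if "a \<in> A" "c < U" "t < card (States M)" "c * B + Suc t < U" for a c t
    using core(1) aA[OF that(1)] that unfolding core_strategy_def B_def by blast
  have csEq: "F (pair c a) = F (pair c' a)" if "a \<in> A" "c < U" "c' < U" "I (pair a c) c'" for a c c'
    using core(1) aA[OF that(1)] that unfolding core_strategy_def by blast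
  have csI: "I (pair a (c * B + Suc t)) (c' * B + Suc t')"
    if "a \<in> A" "c < U" "c' < U" "I (pair a c) c'" "t < card (States M)" "t' < card (States M)"
      "(t, t') \<in> indist M a" for a c c' t t'
    using core(1) aA[OF that(1)] that unfolding core_strategy_def B_def by blast
  have cpS: "Suc t \<in> W" if "a \<in> A" "t < card (States M)" "(t, s) \<in> indist M a" for a t
    using core(2) aA[OF that(1)] that unfolding core_play_def by blast
  have cpE: "E (pair (Suc t) (pair a j)) = b a j" if "a \<in> A" "t < card (States M)" "j < nres M" for a t j
    using core(2) aA[OF that(1)] that unfolding core_play_def by blast
  have cpN: "core_node M A \<kappa> P Q F E W c (c * B + Suc t) t"
    if "c < U" "t < card (States M)" "c * B + Suc t \<in> W" "c * B + Suc t < U" for c t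
    using core(2) that unfolding core_play_def B_def by blast
  have strat: "strategy M A G"
    unfolding strategy_def
  proof
    fix xs assume "xs \<in> computations M"
    then have xs: "xs \<noteq> []" "set xs \<subseteq> States M" by (auto simp: computations_def)
    then obtain ys t where ys: "xs = ys @ [t]" by (metis rev_exhaust)
    have t: "t \<in> States M" "t < card (States M)" using xs ys St by (auto simp: B_def)
    have "G xs a \<in> avail M t a" if "a \<in> A" for a
    proof (cases "length xs \<le> N")
      case True
      have "list_code B ys < U" "list_code B ys * B + Suc t < U"
        using less[of ys] less[of xs] True ys xs by auto
      then show ?thesis
        using csF[OF that _ t(2)] True that ys unfolding G_def by simp
    next
      case False
      have "F (pair (0 * B + Suc t) a) \<in> avail M t a"
        by (rule csF[OF that U0 t(2)]) (use less1[OF t(1)] in simp)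
      then show ?thesis using False that ys unfolding G_def by simp
    qed
    then show "G xs \<in> joint_actions M A (last xs)"
      using ys by (auto simp: joint_actions_def G_def)
  qed
  have I: "I (pair a (list_code B xs)) (list_code B ys)"
    if "a \<in> A" "list_all2 (\<lambda>s s'. (s, s') \<in> indist M a) xs ys" "set xs \<subseteq> States M" "set ys \<subseteq> States M"
      "length xs \<le> N" for a xs ys
    using that(2-5)
  proof (induction xs arbitrary: ys rule: rev_induct)
    case Nil
    then show ?case using csI0[OF that(1)] by simp
  next
    case (snoc t xs)
    then obtain u zs where ys: "ys = zs @ [u]" "list_all2 (\<lambda>s s'. (s, s') \<in> indist M a) xs zs"
      "(t, u) \<in> indist M a"
      by (auto simp: list_all2_append1 list_all2_Cons1)
    have "length zs = length xs" using ys(2) list_all2_lengthD by metis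
    then have "list_code B xs < U" "list_code B zs < U"
      using less[of xs] less[of zs] snoc.prems ys by auto
    moreover have "I (pair a (list_code B xs)) (list_code B zs)"
      using snoc.IH[OF ys(2)] snoc.prems ys by auto
    moreover have "t < card (States M)" "u < card (States M)"
      using snoc.prems ys numberedD(1)[OF M(2)] by auto
    ultimately show ?case using csI[OF that(1)] ys by simp
  qed
  have unif: "uniform M A G"
    unfolding uniform_def
  proof (intro ballI impI)
    fix a xs ys
    assume a: "a \<in> A" and "xs \<in> computations M" "ys \<in> computations M"
      and l: "list_all2 (\<lambda>s s'. (s, s') \<in> indist M a) xs ys"
    then have xs: "xs \<noteq> []" "set xs \<subseteq> States M" and ys: "ys \<noteq> []" "set ys \<subseteq> States M"
      by (auto simp: computations_def)
    have len: "length ys = length xs" using l list_all2_lengthD by metis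
    show "G xs a = G ys a"
    proof (cases "length xs \<le> N")
      case True
      then have "F (pair (list_code B xs) a) = F (pair (list_code B ys) a)"
        using I[OF a l xs(2) ys(2)] less[of xs] less[of ys] xs ys len by (intro csEq[OF a]) auto
      then show ?thesis using True a len by (simp add: G_def)
    next
      case False
      have "(last xs, last ys) \<in> indist M a"
        using l xs(1) ys(1) len by (simp add: list_all2_conv_all_nth last_conv_nth)
      then have "I (pair a (list_code B [last xs])) (list_code B [last ys])"
        using xs ys N(2) by (intro I[OF a]) auto
      then have "F (pair (Suc (last xs)) a) = F (pair (Suc (last ys)) a)"
        using less1[of "last xs"] less1[of "last ys"] xs ys last_in_set
        by (intro csEq[OF a]) (auto simp: subset_iff)
      then show ?thesis using False a len by (simp add: G_def)
    qed
  qed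
  \<comment> \<open>For the empty coalition the condition on computations ranges over no agent and
    holds trivially. Otherwise a member a0 bounds the length of plays.\<close>
  show ?thesis
  proof (cases "A = {}")
    case True
    then show ?thesis unfolding game_def using strat unif by blast
  next
    case False
    then obtain a0 where a0: "a0 \<in> A" by blast
    \<comment> \<open>Besides membership in W, the table must hold the true energies; this is what
      lets \<open>core_affordable\<close> mean \<open>affordable\<close> at the histories of
      V.\<close>
    define V where "V = {xs. list_code B xs \<in> W \<and> (\<forall>a\<in>A. \<forall>j<nres M.
        int (E (pair (list_code B xs) (pair a j))) = energy M G b xs (length xs - 1) a j)}"
    have win: "winning_set M A G b (stop_at \<kappa> P Q) (go_on \<kappa> P Q) (\<kappa> \<noteq> 2) V"
      unfolding winning_set_def
    proof (intro ballI impI)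
      fix xs assume V: "xs \<in> V" and c: "b_consistent M A G b xs"
      have ne: "xs \<noteq> []" "set xs \<subseteq> States M" using b_consistent_not_Nil[OF c] by auto
      obtain ys t where ys: "xs = ys @ [t]" using ne by (metis rev_exhaust)
      have t: "t < card (States M)" "last xs = t" using ne ys numberedD(1)[OF M(2)] by auto
      have len: "length xs \<le> N"
        using b_consistent_length[OF M(1) A strat c a0] N(1)[OF a0] by simp
      let ?x = "list_code B xs"
      have x: "?x = list_code B ys * B + Suc t" "?x < U" "list_code B ys < U"
        using ys less[of xs] less[of ys] len ne by auto
      have Gx: "G xs a = F (pair ?x a)" if "a \<in> A" for a using that len by (simp add: G_def)
      have en: "int (E (pair ?x (pair a j))) = energy M G b xs (length xs - 1) a j"
        if "a \<in> A" "j < nres M" for a j using V that unfolding V_def by blast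
      have node: "core_node M A \<kappa> P Q F E W (list_code B ys) ?x t"
        using cpN[OF x(3) t(1)] V x unfolding V_def by simp
      have ca: "core_affordable M A F E ?x t \<longleftrightarrow> affordable M A G b xs"
        unfolding core_affordable_def affordable_def t(2)
        using en Gx aA by auto
      have cl: "list_code B ys = 0 \<longleftrightarrow> length xs = 1"
        unfolding ys by (cases ys rule: rev_cases) auto
      have ch: "xs @ [u] \<in> V"
        if all: "\<forall>\<sigma>\<in>joint_actions M (Agt M) t. (\<forall>a<card (Agt M). a \<in> A \<longrightarrow> \<sigma> a = F (pair ?x a)) \<longrightarrow>
          core_successor M A F E W ?x t (succ_state M t \<sigma>)"
          and u: "u \<in> outcomes M A (last xs) (G xs)" for u
      proof -
        obtain \<sigma> where \<sigma>: "\<sigma> \<in> joint_actions M (Agt M) t" "restrict \<sigma> A = G xs" "u = succ_state M t \<sigma>"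
          using u t unfolding outcomes_def by blast
        have "\<sigma> a = F (pair ?x a)" if "a \<in> A" for a
          using \<sigma>(2) Gx[OF that] that by (metis restrict_apply')
        then have s: "core_successor M A F E W ?x t u" using all \<sigma> by blast
        then show ?thesis
          using en Gx aA t energy_snoc[OF ne(1), of M G b u]
          unfolding core_successor_def V_def B_def[symmetric] by auto
      qed
      show "stop_at \<kappa> P Q xs \<or> (go_on \<kappa> P Q xs \<and> (\<kappa> \<noteq> 2 \<longrightarrow> affordable M A G b xs) \<and>
         (affordable M A G b xs \<longrightarrow> (\<forall>s\<in>outcomes M A (last xs) (G xs). xs @ [s] \<in> V)))"
        using node[unfolded core_node_def ca cl] ch unfolding stop_at_def go_on_def t(2) by blast
    qed
    have "wins (stop_at \<kappa> P Q) (go_on \<kappa> P Q) (\<kappa> \<noteq> 2) xs"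
      if a: "a \<in> A" and s': "(s', s) \<in> indist M a" and xs: "xs \<in> out M A s' G b" for a s' xs
    proof (rule wins_if_winning_set[OF M(1) A strat win])
      have "s' \<in> States M" using M(1) a A s' unfolding rbcgs_def by blast
      then have t: "s' < card (States M)" using numberedD(1)[OF M(2)] by simp
      have "[s'] \<in> V"
        using cpS[OF a t s'] cpE[OF _ t] unfolding V_def by simp
      then show "[hd xs] \<in> V" using xs by (simp add: out_def)
      show "b_maximal M A G b xs" using xs by (simp add: out_def)
    qed
    then show ?thesis unfolding game_def using strat unif by blast
  qed
qed

text \<open>Not every number c' * B + Suc t is the code of a history, since c' may have a digit 0,
  yet \<open>core_strategy\<close> wants an available action there too. So an entry comes from F, or
  is any available action, or any number below U. Injectivity of the codes lets each entry be chosen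
  separately.\<close>

lemma exists_action_table:
  assumes M: "rbcgs M" "numbered M" and A: "A \<subseteq> Agt M" and F: "strategy M A F"
    and U: "0 < U" "card (Acts M) \<le> U" and B: "B = Suc (card (States M))"
  shows "\<exists>G. \<forall>x. G x < U \<and> (\<forall>c a. x = pair c a \<longrightarrow> a \<in> A \<longrightarrow>
     (\<forall>xs\<in>computations M. c = list_code B xs \<longrightarrow> G x = F xs a) \<and>
     (\<forall>c' t. c = c' * B + Suc t \<longrightarrow> t \<in> States M \<longrightarrow> G x \<in> avail M t a))"
proof (rule choice, rule allI)
  fix x
  have St: "t \<in> States M \<longleftrightarrow> Suc t < B" for t using numberedD(1)[OF M(2)] by (simp add: B)
  have av: "avail M t a \<noteq> {} \<and> avail M t a \<subseteq> Acts M" if "t \<in> States M" "a \<in> A" for t a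
    using M(1) that A unfolding rbcgs_def by blast
  have lt: "\<alpha> < U" if "\<alpha> \<in> Acts M" for \<alpha>
    using that numberedD(3)[OF M(2)] U(2) by (meson less_le_trans)
  show "\<exists>y. y < U \<and> (\<forall>c a. x = pair c a \<longrightarrow> a \<in> A \<longrightarrow>
     (\<forall>xs\<in>computations M. c = list_code B xs \<longrightarrow> y = F xs a) \<and>
     (\<forall>c' t. c = c' * B + Suc t \<longrightarrow> t \<in> States M \<longrightarrow> y \<in> avail M t a))" (is "\<exists>y. ?ok y")
  proof (cases "\<exists>c a. x = pair c a \<and> a \<in> A")
    case False
    then show ?thesis using U(1) by blast
  next
    case True
    then obtain c a where x: "x = pair c a" "a \<in> A" by blast
    have ok: "?ok y \<longleftrightarrow> y < U \<and> (\<forall>xs\<in>computations M. c = list_code B xs \<longrightarrow> y = F xs a) \<and>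
        (\<forall>c' t. c = c' * B + Suc t \<longrightarrow> t \<in> States M \<longrightarrow> y \<in> avail M t a)" for y
      using x by auto
    show ?thesis unfolding ok
    proof (cases "\<exists>xs\<in>computations M. c = list_code B xs")
      case True
      then obtain xs where xs: "xs \<in> computations M" "c = list_code B xs" by blast
      have sub: "set xs \<subseteq> States M" "xs \<noteq> []" using xs by (auto simp: computations_def)
      have last: "last xs \<in> States M" using sub by auto
      have Fx: "F xs a \<in> avail M (last xs) a"
        using F xs(1) x(2) by (auto simp: strategy_def joint_actions_def)
      have 1: "F ys a = F xs a" if "ys \<in> computations M" "c = list_code B ys" for ys
      proof -
        have "ys = xs"
          by (rule list_code_inject[of B]) (use that xs sub St in \<open>auto simp: computations_def\<close>)
        then show ?thesis by simp
      qed
      have 2: "t = last xs" if "c = c' * B + Suc t" "t \<in> States M" for c' t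
      proof -
        obtain ys u where ys: "xs = ys @ [u]" using sub(2) by (metis rev_exhaust)
        have "c' = list_code B ys \<and> t = u"
          by (rule code_step_inject[of _ B]) (use that xs ys sub St in auto)
        then show ?thesis using ys by simp
      qed
      show "\<exists>y<U. (\<forall>xs\<in>computations M. c = list_code B xs \<longrightarrow> y = F xs a) \<and>
        (\<forall>c' t. c = c' * B + Suc t \<longrightarrow> t \<in> States M \<longrightarrow> y \<in> avail M t a)"
        using Fx av[OF last x(2)] lt 1 2 by (intro exI[of _ "F xs a"]) auto
    next
      case no: False
      show "\<exists>y<U. (\<forall>xs\<in>computations M. c = list_code B xs \<longrightarrow> y = F xs a) \<and>
        (\<forall>c' t. c = c' * B + Suc t \<longrightarrow> t \<in> States M \<longrightarrow> y \<in> avail M t a)"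
      proof (cases "\<exists>c' t. c = c' * B + Suc t \<and> t \<in> States M")
        case True
        then obtain c' t where t: "c = c' * B + Suc t" "t \<in> States M" by blast
        then obtain \<alpha> where \<alpha>: "\<alpha> \<in> avail M t a" "\<alpha> \<in> Acts M" using av[OF t(2) x(2)] by blast
        have "t' = t" if "c = c'' * B + Suc t'" "t' \<in> States M" for c'' t'
          using code_step_inject[of c'' B t' c' t] that t St by auto
        then show ?thesis using \<alpha> lt no by (intro exI[of _ \<alpha>]) blast
      next
        case False
        then show ?thesis using no U(1) by blast
      qed
    qed
  qed
qed

text \<open>Energies are nonnegative and at most b + N * C, as a play has at most N states; so they
  fit as natural numbers below U.\<close>

lemma exists_energy_table:
  assumes M: "rbcgs M" "numbered M" and A: "A \<subseteq> Agt M" and F: "strategy M A F"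
    and N: "\<And>a. a \<in> A \<Longrightarrow> b a 0 + 1 \<le> N"
    and C: "\<And>s a \<alpha> j. s \<in> States M \<Longrightarrow> a \<in> A \<Longrightarrow> \<alpha> \<in> avail M s a \<Longrightarrow> j < nres M \<Longrightarrow>
      production M s \<alpha> j \<le> int C"
    and U: "0 < U" "\<And>a j. a \<in> A \<Longrightarrow> j < nres M \<Longrightarrow> b a j + N * C < U"
    and B: "B = Suc (card (States M))"
  shows "\<exists>E. \<forall>x. E x < U \<and> (\<forall>xs a j. x = pair (list_code B xs) (pair a j) \<longrightarrow>
     b_consistent M A F b xs \<longrightarrow> a \<in> A \<longrightarrow> j < nres M \<longrightarrow>
     int (E x) = energy M F b xs (length xs - 1) a j)"
proof (rule choice, rule allI)
  fix x
  have St: "t \<in> States M \<longleftrightarrow> Suc t < B" for t using numberedD(1)[OF M(2)] by (simp add: B)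
  show "\<exists>y. y < U \<and> (\<forall>xs a j. x = pair (list_code B xs) (pair a j) \<longrightarrow>
     b_consistent M A F b xs \<longrightarrow> a \<in> A \<longrightarrow> j < nres M \<longrightarrow>
     int y = energy M F b xs (length xs - 1) a j)"
  proof (cases "\<exists>xs a j. x = pair (list_code B xs) (pair a j) \<and> b_consistent M A F b xs \<and> a \<in> A \<and> j < nres M")
    case True
    then obtain xs a j where x: "x = pair (list_code B xs) (pair a j)" "b_consistent M A F b xs"
      "a \<in> A" "j < nres M" by blast
    have e0: "0 \<le> energy M F b xs (length xs - 1) a j"
      by (rule b_consistent_energy(2)[OF M(1) A F x(2-4)])
    have "energy M F b xs (length xs - 1) a j \<le> int (b a j) + int (length xs - 1) * int C"
      by (rule b_consistent_energy(3)[OF M(1) A F x(2-4)]) (rule C[OF _ x(3) _ x(4)])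
    also have "\<dots> = int (b a j + (length xs - 1) * C)" by simp
    also have "\<dots> \<le> int (b a j + N * C)"
    proof -
      have "length xs - 1 \<le> N" using b_consistent_length[OF M(1) A F x(2,3)] N[OF x(3)] by simp
      then show ?thesis by (simp only: of_nat_le_iff add_le_cancel_left mult_le_mono1)
    qed
    also have "\<dots> < int U" using U(2)[OF x(3,4)] by (simp only: of_nat_less_iff)
    finally have "nat (energy M F b xs (length xs - 1) a j) < U" using e0 by linarith
    moreover have "ys = xs" if "list_code B ys = list_code B xs" "b_consistent M A F b ys" for ys
      by (rule list_code_inject[of B])
        (use that St b_consistent_not_Nil[OF that(2)] b_consistent_not_Nil[OF x(2)] in auto)
    ultimately show ?thesis using e0 x
      by (intro exI[of _ "nat (energy M F b xs (length xs - 1) a j)"]) auto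
  qed (use U(1) in blast)
qed

lemma game_imp_core:
  assumes M: "rbcgs M" "numbered M" and A: "A \<subseteq> Agt M"
    and N: "\<And>a. a \<in> A \<Longrightarrow> b a 0 + 1 \<le> N"
    and C: "\<And>s a \<alpha> j. s \<in> States M \<Longrightarrow> a \<in> A \<Longrightarrow> \<alpha> \<in> avail M s a \<Longrightarrow> j < nres M \<Longrightarrow>
      production M s \<alpha> j \<le> int C"
    and U: "0 < U" "card (Acts M) \<le> U" "\<And>a j. a \<in> A \<Longrightarrow> j < nres M \<Longrightarrow> b a j + N * C < U"
    and game: "game M A b s \<kappa> P Q"
  shows "core U M A b s \<kappa> P Q"
proof (cases "A = {}")
  case True
  have "core_strategy U M A (\<lambda>_. 0) (\<lambda>_ _. False)" "core_play U M A b s \<kappa> P Q (\<lambda>_. 0) (\<lambda>_. 0) {}"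
    using True by (auto simp: core_strategy_def core_play_def)
  then show ?thesis using U(1) by (intro coreI)
next
  case False
  then obtain a0 where a0: "a0 \<in> A" by blast
  define B where "B = Suc (card (States M))"
  have St: "t \<in> States M \<longleftrightarrow> Suc t < B" for t using numberedD(1)[OF M(2)] by (simp add: B_def)
  obtain F where F: "strategy M A F" "uniform M A F"
    and win: "\<And>a s' xs. a \<in> A \<Longrightarrow> (s', s) \<in> indist M a \<Longrightarrow> xs \<in> out M A s' F b \<Longrightarrow>
       wins (stop_at \<kappa> P Q) (go_on \<kappa> P Q) (\<kappa> \<noteq> 2) xs"
    using game unfolding game_def by blast
  define S where "S = {s'. \<exists>a\<in>A. (s', s) \<in> indist M a}"
  define V where "V = {xs. b_consistent M A F b xs \<and> hd xs \<in> S \<and>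
     (\<forall>j. Suc j < length xs \<longrightarrow> \<not> stop_at \<kappa> P Q (take (Suc j) xs))}"
  have V: "winning_set M A F b (stop_at \<kappa> P Q) (go_on \<kappa> P Q) (\<kappa> \<noteq> 2) V"
    unfolding V_def
    by (rule winning_set_if_wins[OF M(1) A F(1) a0]) (use win in \<open>auto simp: S_def out_def\<close>)
  obtain G where G: "\<And>x. G x < U"
    and GF: "\<And>a xs. a \<in> A \<Longrightarrow> xs \<in> computations M \<Longrightarrow> G (pair (list_code B xs) a) = F xs a"
    and Ga: "\<And>a c t. a \<in> A \<Longrightarrow> t \<in> States M \<Longrightarrow> G (pair (c * B + Suc t) a) \<in> avail M t a"
    using exists_action_table[OF M A F(1) U(1,2) B_def] by metis
  obtain E where E: "\<And>x. E x < U"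
    and EF: "\<And>xs a j. b_consistent M A F b xs \<Longrightarrow> a \<in> A \<Longrightarrow> j < nres M \<Longrightarrow>
      int (E (pair (list_code B xs) (pair a j))) = energy M F b xs (length xs - 1) a j"
  proof -
    have "\<exists>E. \<forall>x. E x < U \<and> (\<forall>xs a j. x = pair (list_code B xs) (pair a j) \<longrightarrow>
       b_consistent M A F b xs \<longrightarrow> a \<in> A \<longrightarrow> j < nres M \<longrightarrow>
       int (E x) = energy M F b xs (length xs - 1) a j)"
      by (rule exists_energy_table[where N = N and C = C, OF M A F(1) _ _ U(1) _ B_def])
        (rule N C U(3) | assumption)+
    then show ?thesis using that by metis
  qed
  \<comment> \<open>Here I is indistinguishability itself, transported to codes; what
    \<open>core_strategy\<close> asks of it is the uniformity of F.\<close>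
  define I where "I = (\<lambda>x c'. \<exists>a xs ys. a \<in> A \<and> x = pair a (list_code B xs) \<and> c' = list_code B ys \<and>
     list_all2 (\<lambda>s s'. (s, s') \<in> indist M a) xs ys \<and> set xs \<subseteq> States M \<and> set ys \<subseteq> States M)"
  have strat: "core_strategy U M A G I"
    unfolding core_strategy_def B_def[symmetric]
  proof (intro allI impI conjI)
    fix a assume a: "a \<in> A"
    show "I (pair a 0) 0" unfolding I_def
      by (intro exI[of _ a] exI[of _ "[]"]) (use a in simp)
    show "G (pair (c * B + Suc t) a) \<in> avail M t a" if "t < card (States M)" for c t
      using Ga[OF a] that numberedD(1)[OF M(2)] by simp
    fix c c' assume "I (pair a c) c'"
    then obtain xs ys where xs: "c = list_code B xs" "c' = list_code B ys"
      "list_all2 (\<lambda>s s'. (s, s') \<in> indist M a) xs ys" "set xs \<subseteq> States M" "set ys \<subseteq> States M"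
      unfolding I_def by auto
    show "G (pair c a) = G (pair c' a)"
    proof (cases "xs = []")
      case True
      then show ?thesis using xs by simp
    next
      case False
      then have "ys \<noteq> []" using xs(3) by auto
      then have c: "xs \<in> computations M" "ys \<in> computations M"
        using False xs by (auto simp: computations_def)
      then have "F xs a = F ys a" using F(2) a xs(3) unfolding uniform_def by blast
      then show ?thesis using GF[OF a] c xs by simp
    qed
    fix t t' assume t: "t < card (States M)" "t' < card (States M)" "(t, t') \<in> indist M a"
    then have "list_all2 (\<lambda>s s'. (s, s') \<in> indist M a) (xs @ [t]) (ys @ [t'])"
      using xs(3) by (simp add: list_all2_appendI)
    then show "I (pair a (c * B + Suc t)) (c' * B + Suc t')" unfolding I_def
      using a xs t numberedD(1)[OF M(2)]
      by (intro exI[of _ a] exI[of _ "xs @ [t]"] exI[of _ "ys @ [t']"]) auto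
  qed
  have play: "core_play U M A b s \<kappa> P Q G E (list_code B ` V)"
    unfolding core_play_def B_def[symmetric]
  proof (intro allI impI conjI)
    fix a t assume "a \<in> A" "t < card (States M)" "(t, s) \<in> indist M a"
    then have "[t] \<in> V"
      using numberedD(1)[OF M(2)] by (auto simp: V_def S_def b_consistent_single)
    then show "Suc t \<in> list_code B ` V" by (metis image_eqI list_code_single)
  next
    fix t a j assume "t < card (States M)" "a \<in> A" "j < nres M"
    then have "int (E (pair (list_code B [t]) (pair a j))) = int (b a j)"
      using numberedD(1)[OF M(2)] by (subst EF) (auto simp: b_consistent_single)
    then show "E (pair (Suc t) (pair a j)) = b a j" by simp
  next
    fix c t assume t: "t < card (States M)" and "c * B + Suc t \<in> list_code B ` V"
    then obtain xs where xs: "xs \<in> V" "list_code B xs = c * B + Suc t" by auto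
    have cons: "b_consistent M A F b xs" using xs by (simp add: V_def)
    have ne: "xs \<noteq> []" "set xs \<subseteq> States M" using b_consistent_not_Nil[OF cons] by auto
    then have comp: "xs \<in> computations M" by (simp add: computations_def)
    obtain ys u where ys: "xs = ys @ [u]" using ne by (metis rev_exhaust)
    have eq: "c = list_code B ys \<and> t = u"
      by (rule code_step_inject[of _ B]) (use xs ys ne St t numberedD(1)[OF M(2)] in auto)
    then have lst: "last xs = t" using ys by simp
    let ?x = "list_code B xs"
    have ca: "core_affordable M A G E ?x t \<longleftrightarrow> affordable M A F b xs"
      unfolding core_affordable_def affordable_def lst
      using EF[OF cons] GF[OF _ comp] A numberedD(2)[OF M(2)] by auto
    have cl: "c = 0 \<longleftrightarrow> length xs = 1"
      using eq unfolding ys by (cases ys rule: rev_cases) auto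
    have ch: "core_successor M A G E (list_code B ` V) ?x t (succ_state M t \<sigma>)"
      if all: "\<forall>s\<in>outcomes M A t (F xs). xs @ [s] \<in> V"
        and \<sigma>: "\<sigma> \<in> joint_actions M (Agt M) t" "\<forall>a<card (Agt M). a \<in> A \<longrightarrow> \<sigma> a = G (pair ?x a)" for \<sigma>
    proof -
      have "restrict \<sigma> A = F xs"
      proof
        fix a
        have "F xs \<in> extensional A"
          using strategy_joint(1)[OF F(1) cons] by (simp add: joint_actions_def PiE_iff)
        then show "restrict \<sigma> A a = F xs a"
          using \<sigma>(2) GF[OF _ comp] A numberedD(2)[OF M(2)] by (auto simp: extensional_def restrict_def)
      qed
      then have v: "xs @ [succ_state M t \<sigma>] \<in> V"
        using all \<sigma>(1) unfolding outcomes_def by blast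
      then have c': "b_consistent M A F b (xs @ [succ_state M t \<sigma>])" by (simp add: V_def)
      have "list_code B (xs @ [succ_state M t \<sigma>]) \<in> list_code B ` V" using v by blast
      moreover have "int (E (pair (?x * B + Suc (succ_state M t \<sigma>)) (pair a j))) =
          int (E (pair ?x (pair a j))) - consumption M t (G (pair ?x a)) j + production M t (G (pair ?x a)) j"
        if "a \<in> A" "j < nres M" for a j
        using EF[OF c' that] EF[OF cons that] GF[OF that(1) comp]
          energy_snoc[OF ne(1), of M F b "succ_state M t \<sigma>" a j] lst by simp
      ultimately show ?thesis unfolding core_successor_def B_def[symmetric] by simp
    qed
    have "stop_at \<kappa> P Q xs \<or> (go_on \<kappa> P Q xs \<and> (\<kappa> \<noteq> 2 \<longrightarrow> affordable M A F b xs) \<and>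
       (affordable M A F b xs \<longrightarrow> (\<forall>s\<in>outcomes M A t (F xs). xs @ [s] \<in> V)))"
      using V xs(1) cons unfolding winning_set_def lst[symmetric] by blast
    then show "core_node M A \<kappa> P Q G E (list_code B ` V) c (c * B + Suc t) t"
      unfolding xs(2)[symmetric] core_node_def ca cl
      using ch unfolding stop_at_def go_on_def lst by blast
  qed
  show ?thesis by (rule coreI[OF G E strat play])
qed

section \<open>Structures as tables\<close>

text \<open>Most significant digit first: the numerical order of codes is then the lexicographic
  order of tuples, in which the encoding lists joint actions.\<close>

primrec digits :: "nat \<Rightarrow> nat \<Rightarrow> nat \<Rightarrow> nat list" where
  "digits m 0 c = []"
| "digits m (Suc n) c = (c div m ^ n) # digits m n (c mod m ^ n)"

lemma length_digits [simp]: "length (digits m n c) = n"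
  by (induction n arbitrary: c) auto

lemma digits_nth:
  assumes "a < n" "c < m ^ n"
  shows "digits m n c ! a = c div m ^ (n - 1 - a) mod m"
  using assms
proof (induction n arbitrary: a c)
  case (Suc n)
  show ?case
  proof (cases a)
    case 0
    have "c div m ^ n < m" using Suc.prems(2) by (simp add: less_mult_imp_div_less)
    then show ?thesis using 0 by simp
  next
    case (Suc a')
    then have a': "a' < n" using Suc.prems(1) by simp
    have m: "0 < m" using Suc.prems(2) by (cases m) auto
    have "digits m n (c mod m ^ n) ! a' = (c mod m ^ n) div m ^ (n - 1 - a') mod m"
      by (rule Suc.IH[OF a']) (simp add: m)
    also have "\<dots> = c div m ^ (n - 1 - a') mod m"
    proof -
      \<comment> \<open>Splits m^n at digit a', so that the quotient of a remainder becomes a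
        remainder of the quotient.\<close>
      have n: "m ^ n = m ^ (n - 1 - a') * (m * m ^ a')"
        using a' by (simp flip: power_Suc power_add)
      have "(c mod m ^ n) div m ^ (n - 1 - a') = (c div m ^ (n - 1 - a')) mod (m * m ^ a')"
        unfolding n by (simp add: mod_mult2_eq m)
      then show ?thesis by (simp add: mod_mult2_eq)
    qed
    finally show ?thesis using Suc by simp
  qed
qed simp

lemma upt_mult: "[0..<m * k] = concat (map (\<lambda>x. map (\<lambda>r. x * k + r) [0..<k]) [0..<m])"
proof (induction m)
  case (Suc m)
  have "[0..<Suc m * k] = [0..<m * k] @ map (\<lambda>r. m * k + r) [0..<k]"
    using upt_add_eq_append[of 0 "m * k" k] map_add_upt[of "m * k" k] by (simp add: add.commute)
  then show ?case using Suc by simp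
qed simp

lemma concat_filter: "concat (map f (filter P xs)) = concat (map (\<lambda>x. if P x then f x else []) xs)"
  by (induction xs) auto

text \<open>Listing a product lexicographically amounts to running through all numbers below m^n and
  dropping those with a forbidden digit. This lets the successor table of the input be matched by a
  loop over codes.\<close>

lemma product_lists_filter:
  "product_lists (map (\<lambda>P. filter P [0..<m]) Ps) =
     map (digits m (length Ps)) (filter (\<lambda>c. list_all2 (\<lambda>P x. P x) Ps (digits m (length Ps) c))
       [0..<m ^ length Ps])"
proof (induction Ps)
  case (Cons P Ps)
  let ?n = "length Ps"
  have *: "digits m (Suc ?n) (x * m ^ ?n + r) = x # digits m ?n r" if "r < m ^ ?n" for x r
  proof -
    have "(x * k + r) div k = x" "(x * k + r) mod k = r" if "r < k" for k
      using that by simp_all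
    from this[OF that] show ?thesis by simp
  qed
  \<comment> \<open>The numbers with leading digit x form one block; the condition on the leading
    digit keeps or drops the block as a whole.\<close>
  have "filter (\<lambda>c. list_all2 (\<lambda>P x. P x) (P # Ps) (digits m (Suc ?n) c)) (map (\<lambda>r. x * m ^ ?n + r) [0..<m ^ ?n])
    = (if P x then map (\<lambda>r. x * m ^ ?n + r)
        (filter (\<lambda>c. list_all2 (\<lambda>P x. P x) Ps (digits m ?n c)) [0..<m ^ ?n]) else [])" for x
  proof -
    have "list_all2 (\<lambda>P x. P x) (P # Ps) (digits m (Suc ?n) (x * m ^ ?n + r)) =
        (P x \<and> list_all2 (\<lambda>P x. P x) Ps (digits m ?n r))" if "r < m ^ ?n" for r
      unfolding *[OF that] by simp
    then have "filter (\<lambda>r. list_all2 (\<lambda>P x. P x) (P # Ps) (digits m (Suc ?n) (x * m ^ ?n + r))) [0..<m ^ ?n] =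
        filter (\<lambda>r. P x \<and> list_all2 (\<lambda>P x. P x) Ps (digits m ?n r)) [0..<m ^ ?n]"
      by (intro filter_cong refl) (simp only: set_upt atLeastLessThan_iff)
    then show ?thesis unfolding filter_map comp_def by simp
  qed
  note inner = this
  define fs where "fs = filter (\<lambda>c. list_all2 (\<lambda>P x. P x) Ps (digits m ?n c)) [0..<m ^ ?n]"
  define h where "h = (\<lambda>x. if P x then map (\<lambda>r. x * m ^ ?n + r) fs else [])"
  define h' where "h' = (\<lambda>x. if P x then map (Cons x) (map (digits m ?n) fs) else [])"
  have F: "filter (\<lambda>c. list_all2 (\<lambda>P x. P x) (P # Ps) (digits m (Suc ?n) c)) [0..<m ^ Suc ?n] =
      concat (map h [0..<m])"
    unfolding power_Suc upt_mult filter_concat map_map comp_def inner h_def fs_def ..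
  have H: "map (digits m (Suc ?n)) (h x) = h' x" for x
  proof -
    have "set fs \<subseteq> {..<m ^ ?n}" by (auto simp: fs_def)
    then have "map (digits m (Suc ?n)) (map (\<lambda>r. x * m ^ ?n + r) fs) = map (Cons x) (map (digits m ?n) fs)"
      unfolding map_map comp_def using * by (intro map_cong refl) blast
    then show ?thesis by (simp only: h_def h'_def if_distrib list.map(1) split: if_split) simp
  qed
  have A: "map (digits m (Suc ?n)) (filter (\<lambda>c. list_all2 (\<lambda>P x. P x) (P # Ps) (digits m (Suc ?n) c)) [0..<m ^ Suc ?n]) =
      concat (map h' [0..<m])"
    unfolding F map_concat by (simp only: map_map comp_def H)
  have L: "product_lists (map (\<lambda>P. filter P [0..<m]) (P # Ps)) = concat (map h' [0..<m])"
    unfolding h'_def fs_def using Cons.IH by (simp add: concat_filter cong: if_cong)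
  show ?case unfolding L length_Cons A ..
qed simp

definition joint_code :: "nat \<Rightarrow> nat \<Rightarrow> (nat \<Rightarrow> nat) \<Rightarrow> nat" where
  "joint_code m n \<sigma> = foldl (\<lambda>c a. c * m + \<sigma> a) 0 [0..<n]"

definition joint_decode :: "nat \<Rightarrow> nat \<Rightarrow> nat \<Rightarrow> nat \<Rightarrow> nat" where
  "joint_decode m n c = restrict (\<lambda>a. digits m n c ! a) {..<n}"

lemma joint_code_less: "\<forall>a<n. \<sigma> a < m \<Longrightarrow> joint_code m n \<sigma> < m ^ n"
proof (induction n)
  case (Suc n)
  then have "Suc (joint_code m n \<sigma>) * m \<le> m ^ n * m" by (intro mult_le_mono1) simp
  moreover have "\<sigma> n < m" using Suc.prems by simp
  ultimately show ?case by (simp add: joint_code_def mult.commute)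
qed (simp add: joint_code_def)

lemma digits_joint_code:
  assumes "\<forall>a<n. \<sigma> a < m" "a < n"
  shows "digits m n (joint_code m n \<sigma>) ! a = \<sigma> a"
proof -
  have "joint_code m n \<sigma> div m ^ (n - 1 - a) mod m = \<sigma> a"
    using assms
  proof (induction n)
    case (Suc n)
    have c: "joint_code m (Suc n) \<sigma> = joint_code m n \<sigma> * m + \<sigma> n" "\<sigma> n < m"
      using Suc.prems by (simp_all add: joint_code_def)
    show ?case
    proof (cases "a = n")
      case True
      then show ?thesis using c by simp
    next
      case False
      then have a: "a < n" using Suc.prems by simp
      then have "Suc n - 1 - a = Suc (n - 1 - a)" by simp
      then have "joint_code m (Suc n) \<sigma> div m ^ (Suc n - 1 - a) =
          (joint_code m n \<sigma> * m + \<sigma> n) div m div m ^ (n - 1 - a)"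
        using c by (simp add: div_mult2_eq)
      also have "(joint_code m n \<sigma> * m + \<sigma> n) div m = joint_code m n \<sigma>" using c by simp
      finally show ?thesis using Suc a by simp
    qed
  qed simp
  then show ?thesis using digits_nth[OF assms(2) joint_code_less[OF assms(1)]] by simp
qed

lemma joint_code_digits:
  assumes "c < m ^ n" "\<forall>a<n. \<sigma> a = c div m ^ (n - 1 - a) mod m"
  shows "joint_code m n \<sigma> = c"
  using assms
proof (induction n arbitrary: c)
  case 0
  then show ?case by (simp add: joint_code_def)
next
  case (Suc n)
  have "joint_code m n \<sigma> = c div m"
  proof (rule Suc.IH)
    show "c div m < m ^ n" using Suc.prems(1) by (simp add: less_mult_imp_div_less mult.commute)
    show "\<forall>a<n. \<sigma> a = c div m div m ^ (n - 1 - a) mod m"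
    proof (intro allI impI)
      fix a assume a: "a < n"
      then have "Suc n - 1 - a = Suc (n - 1 - a)" by simp
      then show "\<sigma> a = c div m div m ^ (n - 1 - a) mod m"
        using Suc.prems(2) a by (simp add: div_mult2_eq)
    qed
  qed
  moreover have "\<sigma> n = c mod m" using Suc.prems(2) by simp
  ultimately show ?case by (simp add: joint_code_def)
qed

text \<open>
  A structure is read off a single function f on codes of pairs: the first component selects a
  table, the second one is the code of the arguments.
\<close>

definition n_agents :: "(nat \<Rightarrow> nat) \<Rightarrow> nat" where "n_agents f = f (pair 0 0)"
definition n_res :: "(nat \<Rightarrow> nat) \<Rightarrow> nat" where "n_res f = f (pair 1 0)"
definition n_states :: "(nat \<Rightarrow> nat) \<Rightarrow> nat" where "n_states f = f (pair 2 0)"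
definition n_props :: "(nat \<Rightarrow> nat) \<Rightarrow> nat" where "n_props f = f (pair 3 0)"
definition n_acts :: "(nat \<Rightarrow> nat) \<Rightarrow> nat" where "n_acts f = f (pair 4 0)"
definition t_val :: "(nat \<Rightarrow> nat) \<Rightarrow> nat \<Rightarrow> nat \<Rightarrow> bool" where
  "t_val f p s \<longleftrightarrow> f (pair 5 (pair p s)) = 1"
definition t_avail :: "(nat \<Rightarrow> nat) \<Rightarrow> nat \<Rightarrow> nat \<Rightarrow> nat \<Rightarrow> bool" where
  "t_avail f s a \<alpha> \<longleftrightarrow> f (pair 6 (pair s (pair a \<alpha>))) = 1"
definition t_neg :: "(nat \<Rightarrow> nat) \<Rightarrow> nat \<Rightarrow> nat \<Rightarrow> nat \<Rightarrow> bool" where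
  "t_neg f s \<alpha> i \<longleftrightarrow> f (pair 7 (pair s (pair \<alpha> i))) = 1"
definition t_mag :: "(nat \<Rightarrow> nat) \<Rightarrow> nat \<Rightarrow> nat \<Rightarrow> nat \<Rightarrow> nat" where
  "t_mag f s \<alpha> i = f (pair 8 (pair s (pair \<alpha> i)))"
definition t_succ :: "(nat \<Rightarrow> nat) \<Rightarrow> nat \<Rightarrow> nat \<Rightarrow> nat" where
  "t_succ f s c = f (pair 9 (pair s c))"
definition t_indist :: "(nat \<Rightarrow> nat) \<Rightarrow> nat \<Rightarrow> nat \<Rightarrow> nat \<Rightarrow> bool" where
  "t_indist f a s s' \<longleftrightarrow> f (pair 10 (pair a (pair s s'))) = 1"
definition t_pow :: "(nat \<Rightarrow> nat) \<Rightarrow> nat \<Rightarrow> nat" where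
  "t_pow f k = f (pair 11 k)"

lemmas table_defs = n_agents_def n_res_def n_states_def n_props_def n_acts_def t_val_def t_avail_def
  t_neg_def t_mag_def t_succ_def t_indist_def t_pow_def

definition structure_of :: "(nat \<Rightarrow> nat) \<Rightarrow> nrbcgs" where
  "structure_of f = \<lparr>
     Agt = {..<n_agents f}, nres = n_res f, States = {..<n_states f}, Props = {..<n_props f},
     val = (\<lambda>p. {s. s < n_states f \<and> t_val f p s}),
     Acts = {..<n_acts f},
     avail = (\<lambda>s a. {\<alpha>. \<alpha> < n_acts f \<and> t_avail f s a \<alpha>}),
     cost = (\<lambda>s \<alpha> i. if t_neg f s \<alpha> i then - int (t_mag f s \<alpha> i) else int (t_mag f s \<alpha> i)),
     succ_state = (\<lambda>s \<sigma>. t_succ f s (joint_code (n_acts f) (n_agents f) \<sigma>)),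
     indist = (\<lambda>a. {(s, s'). s < n_states f \<and> s' < n_states f \<and> t_indist f a s s'})\<rparr>"

lemma structure_of_simps [simp]:
  "Agt (structure_of f) = {..<n_agents f}" "nres (structure_of f) = n_res f"
  "States (structure_of f) = {..<n_states f}" "Props (structure_of f) = {..<n_props f}"
  "s \<in> val (structure_of f) p \<longleftrightarrow> s < n_states f \<and> t_val f p s"
  "Acts (structure_of f) = {..<n_acts f}"
  "\<alpha> \<in> avail (structure_of f) s a \<longleftrightarrow> \<alpha> < n_acts f \<and> t_avail f s a \<alpha>"
  "cost (structure_of f) s \<alpha> i = (if t_neg f s \<alpha> i then - int (t_mag f s \<alpha> i) else int (t_mag f s \<alpha> i))"
  "succ_state (structure_of f) s \<sigma> = t_succ f s (joint_code (n_acts f) (n_agents f) \<sigma>)"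
  "(s, s') \<in> indist (structure_of f) a \<longleftrightarrow> s < n_states f \<and> s' < n_states f \<and> t_indist f a s s'"
  by (simp_all add: structure_of_def)

lemma numbered_structure_of [simp]: "numbered (structure_of f)"
  by (simp add: numbered_def)

text \<open>The powers of the number of actions, needed to extract digits, are tabulated as well.\<close>

definition t_digit :: "(nat \<Rightarrow> nat) \<Rightarrow> nat \<Rightarrow> nat \<Rightarrow> nat" where
  "t_digit f c a = c div t_pow f (n_agents f - Suc 0 - a) mod n_acts f"

definition t_joint :: "(nat \<Rightarrow> nat) \<Rightarrow> nat \<Rightarrow> nat \<Rightarrow> bool" where
  "t_joint f s c \<longleftrightarrow> (\<forall>a<n_agents f. t_avail f s a (t_digit f c a))"

definition t_powers :: "(nat \<Rightarrow> nat) \<Rightarrow> bool" where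
  "t_powers f \<longleftrightarrow> t_pow f 0 = 1 \<and> (\<forall>k<n_agents f. t_pow f (Suc k) = t_pow f k * n_acts f) \<and> 0 < n_acts f"

lemma t_pow:
  assumes "t_powers f" "k \<le> n_agents f"
  shows "t_pow f k = n_acts f ^ k"
  using assms(2) by (induction k) (use assms(1) in \<open>auto simp: t_powers_def mult.commute\<close>)

lemma t_digit:
  assumes "t_powers f" "a < n_agents f" "c < n_acts f ^ n_agents f"
  shows "t_digit f c a = digits (n_acts f) (n_agents f) c ! a" "t_digit f c a < n_acts f"
proof -
  show "t_digit f c a = digits (n_acts f) (n_agents f) c ! a"
    using digits_nth[OF assms(2,3)] t_pow[OF assms(1), of "n_agents f - Suc 0 - a"]
    by (simp add: t_digit_def)
  show "t_digit f c a < n_acts f" using assms(1) by (simp add: t_digit_def t_powers_def)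
qed

text \<open>Digits translate between available joint actions and the codes singled out by
  \<open>t_joint\<close>. A quantifier over functions thus becomes one over numbers up to the
  tabulated value m^n.\<close>

lemma ball_joint_actions:
  assumes "t_powers f"
  shows "(\<forall>\<sigma>\<in>joint_actions (structure_of f) (Agt (structure_of f)) s. R (succ_state (structure_of f) s \<sigma>) \<sigma>) \<longleftrightarrow>
    (\<forall>c<t_pow f (n_agents f). t_joint f s c \<longrightarrow> R (t_succ f s c) (restrict (t_digit f c) {..<n_agents f}))"
    (is "?l \<longleftrightarrow> ?r")
proof
  let ?m = "n_acts f" and ?n = "n_agents f"
  have pow: "t_pow f ?n = ?m ^ ?n" using t_pow[OF assms] by simp
  assume l: ?l
  show ?r
  proof (intro allI impI)
    fix c assume c: "c < t_pow f ?n" "t_joint f s c"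
    let ?\<sigma> = "restrict (t_digit f c) {..<?n}"
    have "?\<sigma> \<in> joint_actions (structure_of f) (Agt (structure_of f)) s"
      using c t_digit(2)[OF assms] pow unfolding joint_actions_def t_joint_def by auto
    moreover have "joint_code ?m ?n ?\<sigma> = c"
      by (rule joint_code_digits) (use c pow t_digit(1)[OF assms] digits_nth in auto)
    ultimately show "R (t_succ f s c) ?\<sigma>" using l by fastforce
  qed
next
  let ?m = "n_acts f" and ?n = "n_agents f"
  have pow: "t_pow f ?n = ?m ^ ?n" using t_pow[OF assms] by simp
  assume r: ?r
  show ?l
  proof
    fix \<sigma> assume \<sigma>: "\<sigma> \<in> joint_actions (structure_of f) (Agt (structure_of f)) s"
    then have lt: "\<forall>a<?n. \<sigma> a < ?m" and av: "\<forall>a<?n. t_avail f s a (\<sigma> a)" and ext: "\<sigma> \<in> extensional {..<?n}"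
      by (auto simp: joint_actions_def PiE_iff)
    let ?c = "joint_code ?m ?n \<sigma>"
    have c: "?c < ?m ^ ?n" by (rule joint_code_less[OF lt])
    have d: "t_digit f ?c a = \<sigma> a" if "a < ?n" for a
      using t_digit(1)[OF assms that c] digits_joint_code[OF lt that] by simp
    have "restrict (t_digit f ?c) {..<?n} = \<sigma>"
      using d ext by (auto simp: restrict_def extensional_def fun_eq_iff)
    moreover have "t_joint f s ?c" using d av by (simp add: t_joint_def)
    ultimately show "R (succ_state (structure_of f) s \<sigma>) \<sigma>" using r c pow by force
  qed
qed

lemma concat_joint_actions:
  assumes "t_powers f"
  shows "concat (map (\<lambda>\<sigma>. g (succ_state (structure_of f) s \<sigma>)) (joint_action_list (structure_of f) s)) =
    concat (map (\<lambda>c. if t_joint f s c then g (t_succ f s c) else []) [0..<t_pow f (n_agents f)])"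
proof -
  let ?m = "n_acts f" and ?n = "n_agents f"
  have pow: "t_pow f ?n = ?m ^ ?n" using t_pow[OF assms] by simp
  let ?Ps = "map (\<lambda>a \<alpha>. \<alpha> \<in> avail (structure_of f) s a) [0..<?n]"
  have e: "map (\<lambda>a. filter (\<lambda>\<alpha>. \<alpha> \<in> avail (structure_of f) s a) [0..<?m]) [0..<?n] =
      map (\<lambda>P. filter P [0..<?m]) ?Ps" by simp
  have "length ?Ps = ?n" by simp
  note p = product_lists_filter[of ?m ?Ps, unfolded this]
  have j: "joint_action_list (structure_of f) s = map (\<lambda>xs. restrict ((!) xs) {..<?n})
      (map (digits ?m ?n) (filter (\<lambda>c. list_all2 (\<lambda>P x. P x) ?Ps (digits ?m ?n c)) [0..<?m ^ ?n]))"
    unfolding joint_action_list_def structure_of_simps(1,6) card_lessThan e p ..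
  have v: "list_all2 (\<lambda>P x. P x) ?Ps (digits ?m ?n c) \<longleftrightarrow> t_joint f s c" if "c < ?m ^ ?n" for c
    using t_digit[OF assms _ that] by (auto simp: list_all2_conv_all_nth t_joint_def)
  have fc: "filter (\<lambda>c. list_all2 (\<lambda>P x. P x) ?Ps (digits ?m ?n c)) [0..<?m ^ ?n] =
      filter (t_joint f s) [0..<?m ^ ?n]"
    by (intro filter_cong refl v) simp
  have "joint_action_list (structure_of f) s =
      map (\<lambda>c. restrict ((!) (digits ?m ?n c)) {..<?n}) (filter (t_joint f s) [0..<?m ^ ?n])"
    unfolding j fc map_map comp_def ..
  moreover have "joint_code ?m ?n (restrict ((!) (digits ?m ?n c)) {..<?n}) = c" if "c < ?m ^ ?n" for c
    by (rule joint_code_digits[OF that]) (use digits_nth[OF _ that] in auto)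
  ultimately have "map (\<lambda>\<sigma>. g (succ_state (structure_of f) s \<sigma>)) (joint_action_list (structure_of f) s) =
      map (\<lambda>c. g (t_succ f s c)) (filter (t_joint f s) [0..<?m ^ ?n])"
    by simp
  then show ?thesis unfolding pow by (simp add: concat_filter)
qed

section \<open>The encodings as definable words\<close>

definition brk :: "letter list \<Rightarrow> letter list" where
  "brk u = LOpen # u @ [LClose]"

lemma bracket_brk: "bracket ws = brk (concat ws)"
  by (simp add: bracket_def brk_def)

lemma enc_unary_brk: "enc_unary k = brk (concat (map (\<lambda>_. [LOne]) [0..<k]))"
  by (simp add: enc_unary_def bracket_brk map_replicate_trivial)

lemma enc_nat_brk: "enc_nat k = brk (bits k)"
  by (simp add: enc_nat_def bracket_brk)

lemma enc_int_brk:
  "enc_int (if P then - int m else int m) = brk (enc_bool (P \<and> m \<noteq> 0) @ bits m)"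
  by (simp add: enc_int_def bracket_brk enc_bool_def)

lemma word_definable_brk [defI]: "word_definable d u \<Longrightarrow> word_definable d (\<lambda>e. brk (u e))"
  unfolding brk_def by (intro word_definable_Cons word_definable_append word_definable_single)

lemma word_definable_enc_bool [defI]: "definable d P \<Longrightarrow> word_definable d (\<lambda>e. enc_bool (P e))"
proof -
  assume "definable d P"
  then have "word_definable d (\<lambda>e. if P e then [LOne] else [LZero])"
    by (intro word_definable_if word_definable_single)
  moreover have "(\<lambda>e. enc_bool (P e)) = (\<lambda>e. if P e then [LOne] else [LZero])"
    by (auto simp: enc_bool_def)
  ultimately show ?thesis by simp
qed

lemma word_definable_enc_unary [defI]:
  "small_definable d k \<Longrightarrow> word_definable d (\<lambda>e. enc_unary (k e))"
  unfolding enc_unary_brk by (intro word_definable_brk word_definable_concat word_definable_single)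

lemma word_definable_enc_nat [defI]:
  "small_definable d k \<Longrightarrow> word_definable d (\<lambda>e. enc_nat (k e))"
  unfolding enc_nat_brk by (intro word_definable_brk word_definable_bits)

text \<open>The rules for a function f below apply to a function variable, that is to \<open>fn (b e) (X e)\<close>.\<close>

lemma small_definable_table [defI]:
  assumes "bound_var b" "set_var d X"
  shows "small_definable d (\<lambda>e. n_agents (fn (b e) (X e)))"
    "small_definable d (\<lambda>e. n_res (fn (b e) (X e)))"
    "small_definable d (\<lambda>e. n_states (fn (b e) (X e)))"
    "small_definable d (\<lambda>e. n_props (fn (b e) (X e)))"
    "small_definable d (\<lambda>e. n_acts (fn (b e) (X e)))"
  unfolding table_defs by (intro assms defI)+

lemma small_definable_table2 [defI]:
  assumes "bound_var b" "set_var d X" "term_definable d s" "term_definable d t"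
  shows "small_definable d (\<lambda>e. t_succ (fn (b e) (X e)) (s e) (t e))"
    "definable d (\<lambda>e. t_val (fn (b e) (X e)) (s e) (t e))"
  unfolding table_defs by (intro assms defI)+

lemma small_definable_table3 [defI]:
  assumes "bound_var b" "set_var d X" "term_definable d s" "term_definable d t" "term_definable d u"
  shows "small_definable d (\<lambda>e. t_mag (fn (b e) (X e)) (s e) (t e) (u e))"
    "definable d (\<lambda>e. t_avail (fn (b e) (X e)) (s e) (t e) (u e))"
    "definable d (\<lambda>e. t_neg (fn (b e) (X e)) (s e) (t e) (u e))"
    "definable d (\<lambda>e. t_indist (fn (b e) (X e)) (s e) (t e) (u e))"
  unfolding table_defs by (intro assms defI)+

lemma small_definable_t_pow [defI]:
  assumes "bound_var b" "set_var d X" "term_definable d s"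
  shows "small_definable d (\<lambda>e. t_pow (fn (b e) (X e)) (s e))"
  unfolding table_defs by (intro assms defI)

lemma small_definable_t_digit [defI]:
  assumes "bound_var b" "set_var d X" "small_definable d c" "small_definable d a"
  shows "small_definable d (\<lambda>e. t_digit (fn (b e) (X e)) (c e) (a e))"
  unfolding t_digit_def by (intro assms defI)

lemma definable_t_joint [defI]:
  assumes "bound_var b" "set_var d X" "small_definable d s" "small_definable d c"
  shows "definable d (\<lambda>e. t_joint (fn (b e) (X e)) (s e) (c e))"
  unfolding t_joint_def by (intro assms defI)

lemma definable_t_powers [defI]:
  assumes "bound_var b" "set_var d X"
  shows "definable d (\<lambda>e. t_powers (fn (b e) (X e)))"
  unfolding t_powers_def by (intro assms defI)

text \<open>\<open>rbcgs\<close> for the structure read off f, up to what holds by construction,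
  together with the correctness of the tabulated powers.\<close>

definition t_wf :: "(nat \<Rightarrow> nat) \<Rightarrow> bool" where
  "t_wf f \<longleftrightarrow> t_powers f \<and> 0 < n_agents f \<and> 0 < n_res f \<and> 0 < n_states f \<and>
     (\<forall>s<n_states f. \<forall>a<n_agents f. (\<exists>\<alpha><n_acts f. t_avail f s a \<alpha>) \<and>
        (\<forall>\<alpha><n_acts f. t_avail f s a \<alpha> \<longrightarrow> t_neg f s \<alpha> 0 \<and> t_mag f s \<alpha> 0 \<noteq> 0)) \<and>
     (\<forall>s<n_states f. \<forall>c<t_pow f (n_agents f). t_joint f s c \<longrightarrow> t_succ f s c < n_states f)"

lemma definable_t_wf [defI]:
  assumes "bound_var b" "set_var d X"
  shows "definable d (\<lambda>e. t_wf (fn (b e) (X e)))"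
  unfolding t_wf_def by (intro assms defI)

lemma t_wf: "t_wf f \<longleftrightarrow> t_powers f \<and> rbcgs (structure_of f)"
proof (cases "t_powers f")
  case True
  have succ: "(\<forall>\<sigma>\<in>joint_actions (structure_of f) {..<n_agents f} s. succ_state (structure_of f) s \<sigma> \<in> {..<n_states f})
    \<longleftrightarrow> (\<forall>c<t_pow f (n_agents f). t_joint f s c \<longrightarrow> t_succ f s c < n_states f)" for s
    using ball_joint_actions[OF True, where R = "\<lambda>u _. u \<in> {..<n_states f}"]
    unfolding structure_of_simps(1) lessThan_iff .
  have cost: "cost (structure_of f) s \<alpha> 0 \<le> -1 \<longleftrightarrow> t_neg f s \<alpha> 0 \<and> t_mag f s \<alpha> 0 \<noteq> 0" for s \<alpha>
    by auto
  have sub: "avail (structure_of f) s a \<subseteq> {..<n_acts f}" "val (structure_of f) p \<subseteq> {..<n_states f}"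
    "indist (structure_of f) a \<subseteq> {..<n_states f} \<times> {..<n_states f}" for s a p
    by auto
  have ne: "avail (structure_of f) s a \<noteq> {} \<longleftrightarrow> (\<exists>\<alpha><n_acts f. t_avail f s a \<alpha>)" for s a
    using structure_of_simps(7)[of _ f s a] by (metis all_not_in_conv)
  have pos: "{..<n::nat} \<noteq> {} \<longleftrightarrow> 0 < n" for n by (cases n) auto
  have acts: "0 < n_acts f" using True by (simp add: t_powers_def)
  have av: "(\<forall>\<alpha>\<in>avail (structure_of f) s a. S \<alpha>) \<longleftrightarrow> (\<forall>\<alpha><n_acts f. t_avail f s a \<alpha> \<longrightarrow> S \<alpha>)" for s a S
    by auto
  have lt: "(\<forall>x\<in>{..<n}. S x) \<longleftrightarrow> (\<forall>x<n. S x)" for n :: nat and S by (simp add: Ball_def)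
  show ?thesis
    unfolding t_wf_def rbcgs_def succ structure_of_simps(1,2,3,4,6) sub ne pos av cost lt
    using True acts by (simp add: Suc_le_eq sub all_conj_distrib) (rule conj_cong[OF refl], blast)
qed (simp add: t_wf_def)

definition t_model :: "(nat \<Rightarrow> nat) \<Rightarrow> letter list" where
  "t_model f = brk (enc_unary (n_agents f) @ enc_unary (n_res f) @ enc_unary (n_states f) @
     enc_unary (n_props f) @ enc_unary (n_acts f) @
     brk (concat (map (\<lambda>p. brk (concat (map (\<lambda>s. enc_bool (s < n_states f \<and> t_val f p s))
        [0..<n_states f]))) [0..<n_props f])) @
     brk (concat (map (\<lambda>s. brk (concat (map (\<lambda>a. brk (concat (map (\<lambda>\<alpha>. enc_bool (\<alpha> < n_acts f \<and> t_avail f s a \<alpha>))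
        [0..<n_acts f]))) [0..<n_agents f]))) [0..<n_states f])) @
     brk (concat (map (\<lambda>s. brk (concat (map (\<lambda>\<alpha>. if \<alpha> < n_acts f \<and> (\<exists>a<n_agents f. t_avail f s a \<alpha>)
        then brk (concat (map (\<lambda>i. brk (enc_bool (t_neg f s \<alpha> i \<and> t_mag f s \<alpha> i \<noteq> 0) @ bits (t_mag f s \<alpha> i)))
          [0..<n_res f])) else []) [0..<n_acts f]))) [0..<n_states f])) @
     brk (concat (map (\<lambda>s. brk (concat (map (\<lambda>c. if t_joint f s c then enc_nat (t_succ f s c) else [])
        [0..<t_pow f (n_agents f)]))) [0..<n_states f])) @
     brk (concat (map (\<lambda>a. brk (concat (map (\<lambda>s. brk (concat (map (\<lambda>s'. enc_bool
        (s < n_states f \<and> s' < n_states f \<and> t_indist f a s s')) [0..<n_states f])))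
          [0..<n_states f]))) [0..<n_agents f])))"

lemma enc_model_structure_of:
  assumes "t_powers f"
  shows "enc_model (structure_of f) = t_model f"
  unfolding enc_model_def t_model_def Let_def bracket_brk concat_filter
    concat_joint_actions[OF assms, where g = enc_nat]
  by (simp del: structure_of_simps(8) add: structure_of_simps(8) enc_int_brk Bex_def cong: if_cong)

lemma word_definable_t_model [defI]:
  assumes "bound_var b" "set_var d X"
  shows "word_definable d (\<lambda>e. t_model (fn (b e) (X e)))"
  unfolding t_model_def by (intro assms defI)

definition coalition :: "(nat \<Rightarrow> nat) \<Rightarrow> (nat \<Rightarrow> nat) \<Rightarrow> nat set" where
  "coalition f g = {a. a < n_agents f \<and> g (pair 0 a) = 1}"

definition bounds :: "(nat \<Rightarrow> nat) \<Rightarrow> nat \<Rightarrow> nat \<Rightarrow> nat" where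
  "bounds g a j = g (pair 1 (pair a j))"

definition t_bound :: "(nat \<Rightarrow> nat) \<Rightarrow> (nat \<Rightarrow> nat) \<Rightarrow> letter list" where
  "t_bound f g = brk (concat (map (\<lambda>a. if g (pair 0 a) = 1
     then brk (concat (map (\<lambda>i. enc_unary (g (pair 1 (pair a i)))) [0..<n_res f])) else brk [])
     [0..<n_agents f]))"

lemma enc_bound_structure_of:
  "enc_bound (structure_of f) (coalition f g) (bounds g) = t_bound f g"
proof -
  have "map (\<lambda>a. if a \<in> coalition f g then bracket (map (\<lambda>i. enc_unary (bounds g a i)) [0..<n_res f])
      else bracket []) [0..<n_agents f] = map (\<lambda>a. if g (pair 0 a) = 1
     then brk (concat (map (\<lambda>i. enc_unary (g (pair 1 (pair a i)))) [0..<n_res f])) else brk [])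
     [0..<n_agents f]"
    by (intro map_cong refl) (simp add: coalition_def bounds_def bracket_brk)
  then show ?thesis
    unfolding enc_bound_def t_bound_def structure_of_simps(1,2) card_lessThan
    by (subst bracket_brk) (simp only:)
qed

lemma word_definable_t_bound [defI]:
  assumes "bound_var b" "set_var d X" "bound_var b'" "set_var d Y"
  shows "word_definable d (\<lambda>e. t_bound (fn (b e) (X e)) (fn (b' e) (Y e)))"
  unfolding t_bound_def by (intro assms defI)

text \<open>From here to \<open>t_core\<close> the local conditions are restated for a structure
  read off f and a coalition with its bound read off g, using natural numbers only and joint actions
  as codes. This is the form in which the definability rules apply.\<close>

definition t_strategy ::
  "nat \<Rightarrow> (nat \<Rightarrow> nat) \<Rightarrow> (nat \<Rightarrow> nat) \<Rightarrow> (nat \<Rightarrow> nat) \<Rightarrow> (nat \<Rightarrow> nat \<Rightarrow> bool) \<Rightarrow> bool" where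
  "t_strategy U f g F I \<longleftrightarrow> (\<forall>a<n_agents f. g (pair 0 a) = 1 \<longrightarrow>
     I (pair a 0) 0 \<and>
     (\<forall>c<U. \<forall>t<n_states f. c * Suc (n_states f) + Suc t < U \<longrightarrow>
        F (pair (c * Suc (n_states f) + Suc t) a) < n_acts f \<and>
        t_avail f t a (F (pair (c * Suc (n_states f) + Suc t) a))) \<and>
     (\<forall>c<U. \<forall>c'<U. I (pair a c) c' \<longrightarrow> F (pair c a) = F (pair c' a) \<and>
        (\<forall>t<n_states f. \<forall>t'<n_states f. t_indist f a t t' \<longrightarrow>
           I (pair a (c * Suc (n_states f) + Suc t)) (c' * Suc (n_states f) + Suc t'))))"

definition t_affordable ::
  "(nat \<Rightarrow> nat) \<Rightarrow> (nat \<Rightarrow> nat) \<Rightarrow> (nat \<Rightarrow> nat) \<Rightarrow> (nat \<Rightarrow> nat) \<Rightarrow> nat \<Rightarrow> nat \<Rightarrow> bool" where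
  "t_affordable f g F E x t \<longleftrightarrow> (\<forall>a<n_agents f. g (pair 0 a) = 1 \<longrightarrow> (\<forall>j<n_res f.
     t_neg f t (F (pair x a)) j \<longrightarrow> t_mag f t (F (pair x a)) j \<le> E (pair x (pair a j))))"

text \<open>The integer equation for energies is split by the sign of the cost, so that additions of
  natural numbers remain.\<close>

definition t_successor ::
  "(nat \<Rightarrow> nat) \<Rightarrow> (nat \<Rightarrow> nat) \<Rightarrow> (nat \<Rightarrow> nat) \<Rightarrow> (nat \<Rightarrow> nat) \<Rightarrow> nat set \<Rightarrow> nat \<Rightarrow> nat \<Rightarrow> nat \<Rightarrow> bool" where
  "t_successor f g F E W x t u \<longleftrightarrow> x * Suc (n_states f) + Suc u \<in> W \<and>
     (\<forall>a<n_agents f. g (pair 0 a) = 1 \<longrightarrow> (\<forall>j<n_res f.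
        (t_neg f t (F (pair x a)) j \<and> E (pair (x * Suc (n_states f) + Suc u) (pair a j)) +
            t_mag f t (F (pair x a)) j = E (pair x (pair a j))) \<or>
        (\<not> t_neg f t (F (pair x a)) j \<and> E (pair (x * Suc (n_states f) + Suc u) (pair a j)) =
            E (pair x (pair a j)) + t_mag f t (F (pair x a)) j)))"

definition t_node ::
  "(nat \<Rightarrow> nat) \<Rightarrow> (nat \<Rightarrow> nat) \<Rightarrow> nat \<Rightarrow> (nat \<Rightarrow> bool) \<Rightarrow> (nat \<Rightarrow> bool) \<Rightarrow> (nat \<Rightarrow> nat) \<Rightarrow> (nat \<Rightarrow> nat)
     \<Rightarrow> nat set \<Rightarrow> nat \<Rightarrow> nat \<Rightarrow> nat \<Rightarrow> bool" where
  "t_node f g \<kappa> P Q F E W c x t \<longleftrightarrow>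
     ((\<kappa> = 0 \<and> c \<noteq> 0 \<and> P t) \<or> (\<kappa> = 1 \<and> Q t) \<or> (\<kappa> = 2 \<and> P t \<and> Q t)) \<or>
     (((\<kappa> = 0 \<and> c = 0) \<or> (\<kappa> = 1 \<and> P t) \<or> (\<kappa> = 2 \<and> Q t)) \<and>
      (\<kappa> \<noteq> 2 \<longrightarrow> t_affordable f g F E x t) \<and>
      (t_affordable f g F E x t \<longrightarrow> (\<forall>c'<t_pow f (n_agents f). t_joint f t c' \<longrightarrow>
         (\<forall>a<n_agents f. g (pair 0 a) = 1 \<longrightarrow> t_digit f c' a = F (pair x a)) \<longrightarrow>
         t_successor f g F E W x t (t_succ f t c'))))"

definition t_play ::
  "nat \<Rightarrow> (nat \<Rightarrow> nat) \<Rightarrow> (nat \<Rightarrow> nat) \<Rightarrow> nat \<Rightarrow> nat \<Rightarrow> (nat \<Rightarrow> bool) \<Rightarrow> (nat \<Rightarrow> bool)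
     \<Rightarrow> (nat \<Rightarrow> nat) \<Rightarrow> (nat \<Rightarrow> nat) \<Rightarrow> nat set \<Rightarrow> bool" where
  "t_play U f g s \<kappa> P Q F E W \<longleftrightarrow>
     (\<forall>a<n_agents f. g (pair 0 a) = 1 \<longrightarrow> (\<forall>t<n_states f. t_indist f a t s \<longrightarrow> Suc t \<in> W)) \<and>
     (\<forall>t<n_states f. \<forall>a<n_agents f. g (pair 0 a) = 1 \<longrightarrow>
        (\<forall>j<n_res f. E (pair (Suc t) (pair a j)) = g (pair 1 (pair a j)))) \<and>
     (\<forall>c<U. \<forall>t<n_states f. c * Suc (n_states f) + Suc t \<in> W \<longrightarrow>
        c * Suc (n_states f) + Suc t < U \<longrightarrow>
        t_node f g \<kappa> P Q F E W c (c * Suc (n_states f) + Suc t) t)"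

definition t_core ::
  "nat \<Rightarrow> (nat \<Rightarrow> nat) \<Rightarrow> (nat \<Rightarrow> nat) \<Rightarrow> nat \<Rightarrow> nat \<Rightarrow> (nat \<Rightarrow> bool) \<Rightarrow> (nat \<Rightarrow> bool) \<Rightarrow> bool" where
  "t_core U f g s \<kappa> P Q \<longleftrightarrow> (\<exists>F. (\<forall>x. F x < U) \<and> (\<exists>E. (\<forall>x. E x < U) \<and> (\<exists>W I.
     t_strategy U f g F I \<and> t_play U f g s \<kappa> P Q F E W)))"

lemma consumption_structure_of:
  "consumption (structure_of f) s \<alpha> j = (if t_neg f s \<alpha> j then int (t_mag f s \<alpha> j) else 0)"
  "production (structure_of f) s \<alpha> j = (if t_neg f s \<alpha> j then 0 else int (t_mag f s \<alpha> j))"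
  by (auto simp: consumption_def production_def)

lemma core_structure_of:
  assumes "t_powers f" "s < n_states f"
  shows "core U (structure_of f) (coalition f g) (bounds g) s \<kappa> P Q = t_core U f g s \<kappa> P Q"
proof -
  let ?M = "structure_of f" and ?A = "coalition f g"
  have strat: "core_strategy U ?M ?A F I = t_strategy U f g F I" for F I
    unfolding core_strategy_def t_strategy_def coalition_def by auto
  have aff: "core_affordable ?M ?A F E x t = t_affordable f g F E x t" for F E x t
    unfolding core_affordable_def t_affordable_def coalition_def
    by (auto simp: consumption_structure_of)
  have succ: "core_successor ?M ?A F E W x t u = t_successor f g F E W x t u" for F E W x t u
  proof -
    have "(int m = int n - (if b then int k else 0) + (if b then 0 else int k)) =
       ((b \<and> m + k = n) \<or> (\<not> b \<and> m = n + k))" for m n k b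
      by auto
    then show ?thesis
      unfolding core_successor_def t_successor_def coalition_def consumption_structure_of by simp
  qed
  have node: "core_node ?M ?A \<kappa> P Q F E W c x t = t_node f g \<kappa> P Q F E W c x t" for F E W c x t
  proof -
    have "(\<forall>\<sigma>\<in>joint_actions ?M (Agt ?M) t. (\<forall>a<card (Agt ?M). a \<in> ?A \<longrightarrow> \<sigma> a = F (pair x a)) \<longrightarrow>
         core_successor ?M ?A F E W x t (succ_state ?M t \<sigma>)) \<longleftrightarrow>
      (\<forall>c'<t_pow f (n_agents f). t_joint f t c' \<longrightarrow>
         (\<forall>a<n_agents f. g (pair 0 a) = 1 \<longrightarrow> t_digit f c' a = F (pair x a)) \<longrightarrow>
         t_successor f g F E W x t (t_succ f t c'))"
      unfolding succ
      by (subst ball_joint_actions[OF assms(1), where R = "\<lambda>u \<sigma>. (\<forall>a<card (Agt ?M). a \<in> ?A \<longrightarrow>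
        \<sigma> a = F (pair x a)) \<longrightarrow> t_successor f g F E W x t u"]) (simp add: coalition_def)
    then show ?thesis unfolding core_node_def t_node_def aff by simp
  qed
  have "core_play U ?M ?A (bounds g) s \<kappa> P Q F E W = t_play U f g s \<kappa> P Q F E W" for F E W
    unfolding core_play_def t_play_def node using assms(2) by (simp add: coalition_def bounds_def)
  then show ?thesis unfolding core_def t_core_def strat by simp
qed

lemma definable_t_strategy [defI]:
  assumes "env_var h" "bound_var b" "set_var d X" "bound_var b'" "set_var d Y"
    "bound_var c" "set_var d F" "set_var d I"
  shows "definable d (\<lambda>e. t_strategy (bound (h e)) (fn (b e) (X e)) (fn (b' e) (Y e)) (fn (c e) (F e))
    (\<lambda>x y. pair x y \<in> I e))"
  unfolding t_strategy_def by (intro assms defI)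

lemma definable_t_affordable [defI]:
  assumes "bound_var b" "set_var d X" "bound_var b'" "set_var d Y"
    "bound_var c" "set_var d F" "bound_var c'" "set_var d E" "term_definable d x" "term_definable d t"
  shows "definable d (\<lambda>e. t_affordable (fn (b e) (X e)) (fn (b' e) (Y e)) (fn (c e) (F e)) (fn (c' e) (E e))
    (x e) (t e))"
  unfolding t_affordable_def by (intro assms defI)

lemma definable_t_successor [defI]:
  assumes "bound_var b" "set_var d X" "bound_var b'" "set_var d Y"
    "bound_var c" "set_var d F" "bound_var c'" "set_var d E" "set_var d W"
    "term_definable d x" "term_definable d t" "term_definable d u"
  shows "definable d (\<lambda>e. t_successor (fn (b e) (X e)) (fn (b' e) (Y e)) (fn (c e) (F e)) (fn (c' e) (E e))
    (W e) (x e) (t e) (u e))"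
  unfolding t_successor_def by (intro assms defI)

text \<open>P and Q occur as the rows i and j of a relation coded in the set Z, namely of the table
  of truth values of subformulas.\<close>

lemma definable_t_node [defI]:
  assumes "bound_var b" "set_var d X" "bound_var b'" "set_var d Y"
    "bound_var c" "set_var d F" "bound_var c'" "set_var d E" "set_var d W"
    "small_definable d v" "term_definable d x" "small_definable d t"
    "term_definable d i" "term_definable d j" "set_var d Z"
  shows "definable d (\<lambda>e. t_node (fn (b e) (X e)) (fn (b' e) (Y e)) \<kappa> (\<lambda>t. pair (i e) t \<in> Z e)
    (\<lambda>t. pair (j e) t \<in> Z e) (fn (c e) (F e)) (fn (c' e) (E e)) (W e) (v e) (x e) (t e))"
  unfolding t_node_def by (intro assms defI)

lemma definable_t_play [defI]:
  assumes "env_var h" "bound_var b" "set_var d X" "bound_var b'" "set_var d Y"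
    "bound_var c" "set_var d F" "bound_var c'" "set_var d E" "set_var d W"
    "small_definable d s" "term_definable d i" "term_definable d j" "set_var d Z"
  shows "definable d (\<lambda>e. t_play (bound (h e)) (fn (b e) (X e)) (fn (b' e) (Y e)) (s e) \<kappa>
    (\<lambda>t. pair (i e) t \<in> Z e) (\<lambda>t. pair (j e) t \<in> Z e) (fn (c e) (F e)) (fn (c' e) (E e)) (W e))"
  unfolding t_play_def by (intro assms defI)

lemma definable_t_core [defI]:
  assumes "env_var h" "bound_var b" "set_var d X" "bound_var b'" "set_var d Y"
    "small_definable d s" "term_definable d i" "term_definable d j" "set_var d Z"
  shows "definable d (\<lambda>e. t_core (bound (h e)) (fn (b e) (X e)) (fn (b' e) (Y e)) (s e) \<kappa>
     (\<lambda>t. pair (i e) t \<in> Z e) (\<lambda>t. pair (j e) t \<in> Z e))"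
  unfolding t_core_def by (intro assms bound_var_env_var defI)

section \<open>From structures to tables\<close>

definition unpair :: "nat \<Rightarrow> nat \<times> nat" where
  "unpair = inv (\<lambda>(x, y). pair x y)"

lemma unpair_pair [simp]: "unpair (pair x y) = (x, y)"
proof -
  have "inj (\<lambda>(x, y). pair x y)" by (auto simp: inj_def)
  from inv_f_f[OF this, of "(x, y)"] show ?thesis by (simp add: unpair_def)
qed

text \<open>Outside the domains the entries are 0 in place of the junk values of M, which obey no
  bound in terms of the input.\<close>

definition table_of :: "nrbcgs \<Rightarrow> nat \<Rightarrow> nat" where
  "table_of M z = (case unpair z of (k, y) \<Rightarrow>
     if k = 0 then card (Agt M) else if k = 1 then nres M else if k = 2 then card (States M)
     else if k = 3 then card (Props M) else if k = 4 then card (Acts M)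
     else if k = 5 then (case unpair y of (p, s) \<Rightarrow> of_bool (p \<in> Props M \<and> s \<in> val M p))
     else if k = 6 then (case unpair y of (s, x) \<Rightarrow> case unpair x of (a, \<alpha>) \<Rightarrow>
       of_bool (s \<in> States M \<and> a \<in> Agt M \<and> \<alpha> \<in> avail M s a))
     else if k = 7 then (case unpair y of (s, x) \<Rightarrow> case unpair x of (\<alpha>, i) \<Rightarrow>
       of_bool (s \<in> States M \<and> (\<exists>a\<in>Agt M. \<alpha> \<in> avail M s a) \<and> i < nres M \<and> cost M s \<alpha> i < 0))
     else if k = 8 then (case unpair y of (s, x) \<Rightarrow> case unpair x of (\<alpha>, i) \<Rightarrow>
       if s \<in> States M \<and> (\<exists>a\<in>Agt M. \<alpha> \<in> avail M s a) \<and> i < nres M then nat \<bar>cost M s \<alpha> i\<bar> else 0)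
     else if k = 9 then (case unpair y of (s, c) \<Rightarrow>
       let \<sigma> = joint_decode (card (Acts M)) (card (Agt M)) c in
       if s \<in> States M \<and> \<sigma> \<in> joint_actions M (Agt M) s then succ_state M s \<sigma> else 0)
     else if k = 10 then (case unpair y of (a, x) \<Rightarrow> of_bool (a \<in> Agt M \<and> unpair x \<in> indist M a))
     else if k = 11 \<and> y \<le> card (Agt M) then card (Acts M) ^ y
     else 0)"

lemma table_of_simps [simp]:
  "n_agents (table_of M) = card (Agt M)" "n_res (table_of M) = nres M"
  "n_states (table_of M) = card (States M)" "n_props (table_of M) = card (Props M)"
  "n_acts (table_of M) = card (Acts M)"
  "t_val (table_of M) p s \<longleftrightarrow> p \<in> Props M \<and> s \<in> val M p"
  "t_avail (table_of M) s a \<alpha> \<longleftrightarrow> s \<in> States M \<and> a \<in> Agt M \<and> \<alpha> \<in> avail M s a"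
  "t_neg (table_of M) s \<alpha> i \<longleftrightarrow>
     s \<in> States M \<and> (\<exists>a\<in>Agt M. \<alpha> \<in> avail M s a) \<and> i < nres M \<and> cost M s \<alpha> i < 0"
  "t_mag (table_of M) s \<alpha> i =
     (if s \<in> States M \<and> (\<exists>a\<in>Agt M. \<alpha> \<in> avail M s a) \<and> i < nres M then nat \<bar>cost M s \<alpha> i\<bar> else 0)"
  "t_succ (table_of M) s c = (let \<sigma> = joint_decode (card (Acts M)) (card (Agt M)) c in
       if s \<in> States M \<and> \<sigma> \<in> joint_actions M (Agt M) s then succ_state M s \<sigma> else 0)"
  "t_indist (table_of M) a s s' \<longleftrightarrow> a \<in> Agt M \<and> (s, s') \<in> indist M a"
  "t_pow (table_of M) k = (if k \<le> card (Agt M) then card (Acts M) ^ k else 0)"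
  unfolding table_defs table_of_def by (simp_all add: of_bool_def)

lemma joint_decode_code:
  assumes "\<sigma> \<in> extensional {..<n}" "\<forall>a<n. \<sigma> a < m"
  shows "joint_decode m n (joint_code m n \<sigma>) = \<sigma>"
  using assms digits_joint_code[OF assms(2)]
  unfolding joint_decode_def by (auto simp: restrict_def extensional_def fun_eq_iff)

lemma rbcgs_pos:
  assumes "rbcgs M"
  shows "0 < card (Agt M)" "0 < nres M" "0 < card (States M)" "0 < card (Acts M)"
  using assms unfolding rbcgs_def by (auto simp: card_gt_0_iff Suc_le_eq)

lemma t_powers_table_of: "rbcgs M \<Longrightarrow> t_powers (table_of M)"
  using rbcgs_pos(4) by (simp add: t_powers_def mult.commute)

lemma agree_table_of:
  assumes M: "rbcgs M" "numbered M"
  shows "agree M (structure_of (table_of M))"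
proof -
  have num: "Agt M = {..<card (Agt M)}" "States M = {..<card (States M)}" "Acts M = {..<card (Acts M)}"
    using M(2) by (simp_all add: numbered_def)
  note mem = numberedD[OF M(2)]
  have sub: "avail M s a \<subseteq> Acts M" if "s \<in> States M" "a \<in> Agt M" for s a
    using M(1) that unfolding rbcgs_def by blast
  have ind: "indist M a \<subseteq> States M \<times> States M" if "a \<in> Agt M" for a
    using M(1) that unfolding rbcgs_def by blast
  have succ: "succ_state M s \<sigma> = succ_state (structure_of (table_of M)) s \<sigma>"
    if "s \<in> States M" "\<sigma> \<in> joint_actions M (Agt M) s" for s \<sigma>
  proof -
    have "\<sigma> \<in> extensional (Agt M)"
      using that(2) by (simp add: joint_actions_def PiE_iff)
    then have "\<sigma> \<in> extensional {..<card (Agt M)}" unfolding num(1)[symmetric] .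
    moreover have "\<sigma> a < card (Acts M)" if "a < card (Agt M)" for a
    proof -
      have a: "a \<in> Agt M" using that mem(2) by simp
      then have "\<sigma> a \<in> avail M s a" using \<open>\<sigma> \<in> joint_actions M (Agt M) s\<close> by (auto simp: joint_actions_def)
      then show ?thesis using sub[OF \<open>s \<in> States M\<close> a] mem(3) by blast
    qed
    ultimately show ?thesis using that joint_decode_code by simp
  qed
  have cost: "cost M s \<alpha> j = cost (structure_of (table_of M)) s \<alpha> j"
    if "s \<in> States M" "a \<in> Agt M" "\<alpha> \<in> avail M s a" "j < nres M" for s a \<alpha> j
  proof -
    have "\<exists>a\<in>Agt M. \<alpha> \<in> avail M s a" using that by blast
    then show ?thesis using that by simp
  qed
  have avail: "avail M s a = avail (structure_of (table_of M)) s a" if "s \<in> States M" "a \<in> Agt M" for s a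
    using sub[OF that] that mem(3) by auto
  have indist: "indist M a = indist (structure_of (table_of M)) a" if "a \<in> Agt M" for a
    using ind[OF that] that mem(1) by auto
  show ?thesis unfolding agree_def structure_of_simps(1,2,3) table_of_simps(1,2,3)
    by (intro conjI ballI allI impI num(1,2) refl avail cost succ indist)
qed

definition same :: "('ag, 'st, 'act, 'pr) rbcgs \<Rightarrow> ('ag, 'st, 'act, 'pr) rbcgs \<Rightarrow> bool" where
  "same M M' \<longleftrightarrow> agree M M' \<and> Props M = Props M' \<and> Acts M = Acts M' \<and>
     (\<forall>p\<in>Props M. val M p = val M' p)"

lemma same_table_of:
  assumes "rbcgs M" "numbered M"
  shows "same M (structure_of (table_of M))"
proof -
  have "Props M = {..<card (Props M)}" "Acts M = {..<card (Acts M)}"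
    using assms(2) by (simp_all add: numbered_def)
  moreover have "val M p = val (structure_of (table_of M)) p" if "p \<in> Props M" for p
  proof -
    have "val M p \<subseteq> States M" using assms(1) that unfolding rbcgs_def by blast
    then show ?thesis using that numberedD(1)[OF assms(2)] by auto
  qed
  ultimately show ?thesis
    unfolding same_def structure_of_simps(4,6) table_of_simps(4,5)
    by (intro conjI ballI agree_table_of assms)
qed

lemma sat_same:
  assumes "same M M'" "formula_over M \<phi>" "s \<in> States M"
  shows "sat M s \<phi> = sat M' s \<phi>"
  using assms(2,3)
proof (induction \<phi> arbitrary: s)
  case (Atom p)
  then show ?case using assms(1) by (simp add: same_def)
next
  case (Next A b \<phi>)
  show ?case unfolding sat_game
    by (rule game_agree) (use assms(1) Next in \<open>auto simp: same_def\<close>)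
next
  case (Until A b \<phi> \<psi>)
  show ?case unfolding sat_game
    by (rule game_agree) (use assms(1) Until in \<open>auto simp: same_def\<close>)
next
  case (Release A b \<phi> \<psi>)
  show ?case unfolding sat_game
    by (rule game_agree) (use assms(1) Release in \<open>auto simp: same_def\<close>)
qed auto

lemma formula_over_same: "same M M' \<Longrightarrow> formula_over M \<phi> = formula_over M' \<phi>"
  by (induction \<phi>) (auto simp: same_def agree_def)

lemma enc_formula_same: "same M M' \<Longrightarrow> enc_formula M \<phi> = enc_formula M' \<phi>"
  by (induction \<phi>) (simp_all add: same_def agree_def enc_bound_def cong: if_cong)

lemma joint_action_list_sub:
  assumes "numbered M"
  shows "set (joint_action_list M s) \<subseteq> joint_actions M (Agt M) s"
proof
  fix \<sigma> assume "\<sigma> \<in> set (joint_action_list M s)"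
  then obtain xs where xs: "\<sigma> = restrict (\<lambda>a. xs ! a) {..<card (Agt M)}"
    "list_all2 (\<lambda>x ys. x \<in> set ys) xs
       (map (\<lambda>a. filter (\<lambda>\<alpha>. \<alpha> \<in> avail M s a) [0..<card (Acts M)]) [0..<card (Agt M)])"
    unfolding joint_action_list_def product_lists_set set_map by blast
  have "\<sigma> \<in> joint_actions M {..<card (Agt M)} s"
    using xs(2) unfolding joint_actions_def xs(1) list_all2_conv_all_nth by (auto simp: PiE_iff)
  then show "\<sigma> \<in> joint_actions M (Agt M) s"
    using assms by (simp add: numbered_def)
qed

lemma enc_model_same:
  assumes "same M M'" "numbered M" "numbered M'"
  shows "enc_model M = enc_model M'"
proof -
  have e: "Agt M = Agt M'" "nres M = nres M'" "States M = States M'" "Props M = Props M'" "Acts M = Acts M'"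
    using assms(1) by (auto simp: same_def agree_def)
  have lt: "s \<in> set [0..<card (States M')] \<longleftrightarrow> s \<in> States M" "a \<in> set [0..<card (Agt M')] \<longleftrightarrow> a \<in> Agt M"
    "p \<in> set [0..<card (Props M')] \<longleftrightarrow> p \<in> Props M" for s a p
    using e assms(2) unfolding numbered_def by auto
  have val: "val M p = val M' p" if "p \<in> set [0..<card (Props M')]" for p
    using assms(1) that lt(3) unfolding same_def by blast
  have av: "avail M s a = avail M' s a" if "s \<in> set [0..<card (States M')]" "a \<in> set [0..<card (Agt M')]" for s a
    using assms(1) that lt unfolding same_def agree_def by blast
  have ind: "indist M a = indist M' a" if "a \<in> set [0..<card (Agt M')]" for a
    using assms(1) that lt unfolding same_def agree_def by blast
  have av': "(\<exists>a\<in>Agt M'. \<alpha> \<in> avail M s a) = (\<exists>a\<in>Agt M'. \<alpha> \<in> avail M' s a)"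
    if "s \<in> set [0..<card (States M')]" for s \<alpha>
    using av[OF that] lt(2) e(1) by auto
  have cost: "cost M s \<alpha> i = cost M' s \<alpha> i"
    if "s \<in> set [0..<card (States M')]" "\<exists>a\<in>Agt M'. \<alpha> \<in> avail M' s a" "i \<in> set [0..<nres M']" for s \<alpha> i
    using assms(1) that(2)[folded av'[OF that(1)]] that(1,3) lt(1) e
    unfolding same_def agree_def by auto
  have jl: "joint_action_list M s = joint_action_list M' s" if "s \<in> set [0..<card (States M')]" for s
    unfolding joint_action_list_def e using av[OF that]
    by (intro arg_cong2[where f = map] arg_cong[where f = product_lists] map_cong filter_cong refl) auto
  have succ: "succ_state M s \<sigma> = succ_state M' s \<sigma>"
    if "s \<in> set [0..<card (States M')]" "\<sigma> \<in> set (joint_action_list M' s)" for s \<sigma>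
  proof -
    have "s \<in> States M" using that(1) lt(1) by blast
    moreover have "\<sigma> \<in> joint_actions M (Agt M) s"
      using joint_action_list_sub[OF assms(2), of s] that(2) jl[OF that(1)] by auto
    ultimately show ?thesis using assms(1) by (simp add: same_def agree_def)
  qed
  show ?thesis
    unfolding enc_model_def Let_def e
    by (intro arg_cong[where f = bracket] arg_cong2[where f = "(#)"] refl map_cong filter_cong av' jl
        arg_cong[where f = enc_bool] arg_cong[where f = enc_nat] arg_cong[where f = enc_int])
      (auto simp: val av ind cost succ)
qed

lemma rbcgs_same:
  assumes "same M M'" "rbcgs M" "\<forall>p\<in>Props M. val M' p \<subseteq> States M"
  shows "rbcgs M'"
proof -
  have e: "Agt M = Agt M'" "nres M = nres M'" "States M = States M'" "Props M = Props M'" "Acts M = Acts M'"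
    using assms(1) by (auto simp: same_def agree_def)
  have av: "avail M s a = avail M' s a" if "s \<in> States M'" "a \<in> Agt M'" for s a
    using assms(1) that e unfolding same_def agree_def by blast
  have cost: "cost M s \<alpha> 0 = cost M' s \<alpha> 0" if "s \<in> States M'" "a \<in> Agt M'" "\<alpha> \<in> avail M' s a" for s a \<alpha>
    using assms(1,2) that av[OF that(1,2)] e unfolding same_def agree_def rbcgs_def by auto
  have ja: "joint_actions M (Agt M') s = joint_actions M' (Agt M') s" if "s \<in> States M'" for s
    unfolding joint_actions_def by (intro PiE_cong av that)
  have succ: "succ_state M s \<sigma> = succ_state M' s \<sigma>"
    if "s \<in> States M'" "\<sigma> \<in> joint_actions M' (Agt M') s" for s \<sigma>
    using assms(1) that ja[OF that(1)] e unfolding same_def agree_def by auto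
  have ind: "indist M a = indist M' a" if "a \<in> Agt M'" for a
    using assms(1) that e unfolding same_def agree_def by auto
  note r = assms(2)[unfolded rbcgs_def e]
  show ?thesis unfolding rbcgs_def
  proof (intro conjI ballI)
    show "avail M' s a \<subseteq> Acts M'" "avail M' s a \<noteq> {}" if "s \<in> States M'" "a \<in> Agt M'" for s a
      unfolding av[OF that, symmetric] using r that by simp_all
    show "cost M' s \<alpha> 0 \<le> - 1" if "s \<in> States M'" "a \<in> Agt M'" "\<alpha> \<in> avail M' s a" for s a \<alpha>
      unfolding cost[OF that, symmetric] using r that unfolding av[OF that(1,2), symmetric] by simp
    show "succ_state M' s \<sigma> \<in> States M'" if "s \<in> States M'" "\<sigma> \<in> joint_actions M' (Agt M') s" for s \<sigma>
      unfolding succ[OF that, symmetric] using r that unfolding ja[OF that(1), symmetric] by simp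
    show "indist M' a \<subseteq> States M' \<times> States M'" if "a \<in> Agt M'" for a
      unfolding ind[OF that, symmetric] using r that by simp
    show "val M' p \<subseteq> States M'" if "p \<in> Props M'" for p
      using assms(3) that e by simp
  qed (insert r, (elim conjE, assumption)+)
qed

lemma rbcgs_table_of:
  assumes "rbcgs M" "numbered M"
  shows "rbcgs (structure_of (table_of M))"
proof (rule rbcgs_same[OF same_table_of[OF assms] assms(1)], intro ballI subsetI)
  fix p s assume "s \<in> val (structure_of (table_of M)) p"
  then have "s < card (States M)" by simp
  then show "s \<in> States M" unfolding numberedD(1)[OF assms(2)] .
qed

section \<open>Bounds in terms of the length of the input\<close>

lemma length_brk [simp]: "length (brk u) = length u + 2"
  by (simp add: brk_def)

lemma length_enc_unary [simp]: "length (enc_unary k) = k + 2"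
  by (simp add: enc_unary_brk length_concat comp_def sum_list_triv)

lemma length_concat_map_member:
  assumes "x < m"
  shows "length (f x) \<le> length (concat (map f [0..<m]))"
proof -
  have "length (f x) \<in> set (map length (map f [0..<m]))" using assms by auto
  then show ?thesis unfolding length_concat by (rule member_le_sum_list) simp
qed

lemma less_power_bits: "k < 2 ^ length (bits k)"
proof (induction k rule: less_induct)
  case (less k)
  show ?case
  proof (cases "k = 0")
    case False
    then have "k div 2 < 2 ^ length (bits (k div 2))" by (intro less) simp
    moreover have "length (bits k) = Suc (length (bits (k div 2)))"
      using False by (subst bits.simps) (simp add: enc_bool_def)
    ultimately show ?thesis by simp
  qed simp
qed

text \<open>Cardinalities are written in unary and so are below n; magnitudes of costs are in binary
  and so are below 2^n. The last claim asks for an available action because other costs are not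
  written.\<close>

lemma t_model_bounds:
  assumes "length (t_model f) \<le> n"
  shows "n_agents f < n" "n_res f < n" "n_states f < n" "n_props f < n" "n_acts f < n"
    and "s < n_states f \<Longrightarrow> a < n_agents f \<Longrightarrow> \<alpha> < n_acts f \<Longrightarrow> t_avail f s a \<alpha> \<Longrightarrow> i < n_res f \<Longrightarrow>
      t_mag f s \<alpha> i < 2 ^ n"
proof -
  show "n_agents f < n" "n_res f < n" "n_states f < n" "n_props f < n" "n_acts f < n"
    using assms unfolding t_model_def by simp_all
  assume *: "s < n_states f" "a < n_agents f" "\<alpha> < n_acts f" "t_avail f s a \<alpha>" "i < n_res f"
  define h where "h = (\<lambda>i. brk (enc_bool (t_neg f s \<alpha> i \<and> t_mag f s \<alpha> i \<noteq> 0) @ bits (t_mag f s \<alpha> i)))"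
  define c where "c = (\<lambda>s \<alpha>. if \<alpha> < n_acts f \<and> (\<exists>a<n_agents f. t_avail f s a \<alpha>)
        then brk (concat (map (\<lambda>i. brk (enc_bool (t_neg f s \<alpha> i \<and> t_mag f s \<alpha> i \<noteq> 0) @ bits (t_mag f s \<alpha> i)))
          [0..<n_res f])) else [])"
  define r where "r = (\<lambda>s. brk (concat (map (c s) [0..<n_acts f])))"
  have "length (bits (t_mag f s \<alpha> i)) \<le> length (h i)" by (simp add: h_def)
  also have "\<dots> \<le> length (concat (map h [0..<n_res f]))" by (rule length_concat_map_member[OF *(5)])
  also have "\<dots> \<le> length (c s \<alpha>)" using * by (auto simp: c_def h_def)
  also have "\<dots> \<le> length (concat (map (c s) [0..<n_acts f]))" by (rule length_concat_map_member[OF *(3)])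
  also have "\<dots> \<le> length (r s)" by (simp add: r_def)
  also have "\<dots> \<le> length (concat (map r [0..<n_states f]))" by (rule length_concat_map_member[OF *(1)])
  also have "\<dots> \<le> length (t_model f)" unfolding t_model_def r_def c_def by simp
  finally have "length (bits (t_mag f s \<alpha> i)) \<le> n" using assms by simp
  then have "(2 :: nat) ^ length (bits (t_mag f s \<alpha> i)) \<le> 2 ^ n" by (intro power_increasing) auto
  then show "t_mag f s \<alpha> i < 2 ^ n" using less_power_bits[of "t_mag f s \<alpha> i"] by linarith
qed

text \<open>This is where the unary representation of bounds enters. It keeps the length of plays,
  at most b + 1, linear in the input, and hence the codes of plays singly exponential.\<close>

lemma t_bound_bounds:
  assumes "length (t_bound f g) \<le> n" "a \<in> coalition f g" "j < n_res f"
  shows "bounds g a j + 1 \<le> n"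
proof -
  define h where "h = (\<lambda>i. enc_unary (g (pair 1 (pair a i))))"
  define c where "c = (\<lambda>a. if g (pair 0 a) = 1
     then brk (concat (map (\<lambda>i. enc_unary (g (pair 1 (pair a i)))) [0..<n_res f])) else brk [])"
  have "bounds g a j + 2 = length (h j)" by (simp add: bounds_def h_def)
  also have "\<dots> \<le> length (concat (map h [0..<n_res f]))" by (rule length_concat_map_member[OF assms(3)])
  also have "\<dots> \<le> length (c a)" using assms(2) by (simp add: c_def h_def coalition_def)
  also have "\<dots> \<le> length (concat (map c [0..<n_agents f]))"
    by (rule length_concat_map_member) (use assms(2) in \<open>simp add: coalition_def\<close>)
  also have "\<dots> \<le> length (t_bound f g)" by (simp add: t_bound_def c_def)
  finally show ?thesis using assms(1) by simp
qed

text \<open>It exceeds every 2^k with k \<le> (n + 2)^2. This covers n^n \<le> 2^(n * n), for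
  histories and joint actions, and n + n * 2^n \<le> 2^(2 * n + 1), for energies; the factor 2 makes
  the inequalities strict.\<close>

definition threshold :: "nat \<Rightarrow> nat" where
  "threshold n = 2 * 2 ^ ((n + 2) * (n + 2))"

lemma less_threshold:
  "x \<le> n ^ n \<Longrightarrow> x < threshold n" "x \<le> n \<Longrightarrow> x < threshold n" "x \<le> 2 ^ n \<Longrightarrow> x < threshold n"
  "n + n * 2 ^ n < threshold n"
proof -
  have le: "2 ^ k < threshold n" if "k \<le> (n + 2) * (n + 2)" for k
  proof -
    define X :: nat where "X = 2 ^ ((n + 2) * (n + 2))"
    have "2 ^ k \<le> X" unfolding X_def using that by (intro power_increasing) auto
    moreover have "0 < X" by (simp add: X_def)
    ultimately show ?thesis unfolding threshold_def X_def[symmetric] by linarith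
  qed
  have "n ^ n \<le> (2 ^ n) ^ n" by (rule power_mono[OF less_imp_le[OF less_exp]]) simp
  also have "\<dots> = 2 ^ (n * n)" by (simp add: power_mult)
  finally show "x \<le> n ^ n \<Longrightarrow> x < threshold n" using le[of "n * n"] by simp
  show p: "x \<le> 2 ^ n \<Longrightarrow> x < threshold n" for x using le[of n] by simp
  show "x \<le> n \<Longrightarrow> x < threshold n" using p less_exp[of n] by (meson less_imp_le order.trans)
  have "n + n * 2 ^ n \<le> 2 ^ n * 2 ^ n + 2 ^ n * 2 ^ n"
    using less_exp[of n] by (intro add_mono mult_le_mono) (auto simp: le_square intro: order.trans[of _ "2 ^ n"])
  also have "\<dots> = 2 ^ (n + n + 1)" by (simp add: power_add)
  also have "\<dots> < threshold n" by (rule le) simp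
  finally show "n + n * 2 ^ n < threshold n" .
qed

lemma table_of_less:
  assumes M: "rbcgs M" "numbered M" and n: "length (enc_model M) \<le> n"
  shows "table_of M z < threshold n"
proof -
  let ?f = "table_of M"
  have "enc_model M = t_model ?f"
    using enc_model_same[OF same_table_of[OF M] M(2)] enc_model_structure_of[OF t_powers_table_of[OF M(1)]]
    by simp
  then have len: "length (t_model ?f) \<le> n" using n by simp
  note b = t_model_bounds[OF len, unfolded table_of_simps]
  have c: "card (Agt M) < threshold n" "nres M < threshold n" "card (States M) < threshold n"
    "card (Props M) < threshold n" "card (Acts M) < threshold n"
    using b(1-5) by (auto intro: less_threshold(2))
  have one: "of_bool P < threshold n" for P using less_threshold(3)[of "of_bool P"] by simp
  have pow: "card (Acts M) ^ y < threshold n" if "y \<le> card (Agt M)" for y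
  proof (rule less_threshold(1))
    have "card (Acts M) ^ y \<le> n ^ y" using b(5) by (intro power_mono) auto
    also have "\<dots> \<le> n ^ n" using b that by (intro power_increasing) auto
    finally show "card (Acts M) ^ y \<le> n ^ n" .
  qed
  have mag: "nat \<bar>cost M s \<alpha> i\<bar> < threshold n"
    if st: "s \<in> States M" "\<exists>a\<in>Agt M. \<alpha> \<in> avail M s a" "i < nres M" for s \<alpha> i
  proof -
    obtain a where a: "a \<in> Agt M" "\<alpha> \<in> avail M s a" using st(2) by blast
    have "\<alpha> \<in> Acts M" using M(1) st(1) a unfolding rbcgs_def by blast
    then have "t_mag ?f s \<alpha> i < 2 ^ n"
      using t_model_bounds(6)[OF len, of s a \<alpha> i] st a numberedD[OF M(2)] by simp
    then show ?thesis using st by (intro less_threshold(3)) simp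
  qed
  have succ: "succ_state M s \<sigma> < threshold n"
    if "s \<in> States M" "\<sigma> \<in> joint_actions M (Agt M) s" for s \<sigma>
  proof -
    have "succ_state M s \<sigma> \<in> States M" using M(1) that unfolding rbcgs_def by blast
    then have "succ_state M s \<sigma> < card (States M)" using numberedD(1)[OF M(2)] by blast
    then show ?thesis using c(3) by simp
  qed
  have zero: "0 < threshold n" by (simp add: threshold_def)
  show ?thesis
    unfolding table_of_def Let_def prod.case_eq_if
    by (intro if_split[where P = "\<lambda>x. x < threshold n", THEN iffD2] conjI impI c one pow mag succ zero)
      (auto simp: c one zero intro: mag succ pow)
qed

text \<open>The two directions are used with N = n, as bounds are below n, and with C = 2^n, as
  production is below 2^n. The base \<open>Suc (n_states f)\<close> is at most n, so n^n suffices
  for the codes of plays.\<close>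

lemma t_core_game:
  assumes wf: "t_wf f" and n: "length (t_model f) \<le> n" "length (t_bound f g) \<le> n" and s: "s < n_states f"
  shows "t_core (threshold n) f g s \<kappa> P Q \<longleftrightarrow>
    game (structure_of f) (coalition f g) (bounds g) s \<kappa> P Q"
proof -
  let ?M = "structure_of f" and ?A = "coalition f g" and ?U = "threshold n"
  have M: "t_powers f" "rbcgs ?M" using wf by (simp_all add: t_wf)
  have A: "?A \<subseteq> Agt ?M" by (auto simp: coalition_def)
  note b = t_model_bounds[OF n(1)]
  have res: "0 < n_res f" using wf by (simp add: t_wf_def)
  have bnd: "bounds g a j + 1 \<le> n" if "a \<in> ?A" "j < n_res f" for a j
    by (rule t_bound_bounds[OF n(2) that])
  have N: "bounds g a 0 + 1 \<le> n" if "a \<in> ?A" for a by (rule bnd[OF that res])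
  have "core ?U ?M ?A (bounds g) s \<kappa> P Q \<longleftrightarrow> game ?M ?A (bounds g) s \<kappa> P Q"
  proof
    assume "core ?U ?M ?A (bounds g) s \<kappa> P Q"
    then obtain F E W I where F: "core_strategy ?U ?M ?A F I" "core_play ?U ?M ?A (bounds g) s \<kappa> P Q F E W"
      unfolding core_def by blast
    show "game ?M ?A (bounds g) s \<kappa> P Q"
    proof (rule core_imp_game[OF M(2) numbered_structure_of A N _ _ F])
      show "1 \<le> n" using b(1) by simp
      have "Suc (n_states f) ^ n \<le> n ^ n" using b(3) by (intro power_mono) auto
      then show "Suc (card (States ?M)) ^ n \<le> ?U" using less_threshold(1)[of "Suc (n_states f) ^ n" n] by simp
    qed
  next
    assume game: "game ?M ?A (bounds g) s \<kappa> P Q"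
    show "core ?U ?M ?A (bounds g) s \<kappa> P Q"
    proof (rule game_imp_core[OF M(2) numbered_structure_of A N _ _ _ _ game, where C = "2 ^ n"])
      fix s a \<alpha> j assume *: "s \<in> States ?M" "a \<in> ?A" "\<alpha> \<in> avail ?M s a" "j < nres ?M"
      have "t_mag f s \<alpha> j < 2 ^ n"
        by (rule b(6)[of s a]) (use * in \<open>simp_all add: coalition_def\<close>)
      then show "production ?M s \<alpha> j \<le> int (2 ^ n)"
        unfolding consumption_structure_of by (simp flip: of_nat_power)
    next
      show "0 < ?U" by (simp add: threshold_def)
      show "card (Acts ?M) \<le> ?U" using b(5) less_threshold(2)[of "n_acts f" n] by simp
      fix a j assume "a \<in> ?A" "j < nres ?M"
      then have "bounds g a j + 1 \<le> n" by (intro bnd) simp_all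
      then show "bounds g a j + n * 2 ^ n < ?U" using less_threshold(4)[of n] by linarith
    qed
  qed
  then show ?thesis unfolding core_structure_of[OF M(1) s] .
qed

section \<open>Formulas and their tables of truth values\<close>

text \<open>
  A subformula occurrence is named by its start i in the word w. Then \<open>en i\<close> is its end and
  \<open>T i\<close> its set of states; \<open>en i = 0\<close> means that there is no occurrence at i.
\<close>

definition temporal_at ::
  "letter list \<Rightarrow> nat \<Rightarrow> (nat \<Rightarrow> nat) \<Rightarrow> (nat \<Rightarrow> nat) \<Rightarrow> (nat \<Rightarrow> nat \<Rightarrow> bool) \<Rightarrow> nat \<Rightarrow> (nat \<Rightarrow> nat)
     \<Rightarrow> nat \<Rightarrow> letter \<Rightarrow> nat \<Rightarrow> nat \<Rightarrow> bool" where
  "temporal_at w U f en T i g \<kappa> x k m \<longleftrightarrow>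
     at w i k (LOpen # x # t_bound f g) \<and> en k \<noteq> 0 \<and> en m \<noteq> 0 \<and> at w (en m) (en i) [LClose] \<and>
     (\<forall>s<n_states f. T i s \<longleftrightarrow> t_core U f g s \<kappa> (T k) (T m))"

definition parsed ::
  "letter list \<Rightarrow> nat \<Rightarrow> (nat \<Rightarrow> nat) \<Rightarrow> (nat \<Rightarrow> nat) \<Rightarrow> (nat \<Rightarrow> nat \<Rightarrow> bool) \<Rightarrow> nat \<Rightarrow> bool" where
  "parsed w U f en T i \<longleftrightarrow>
     (\<exists>p<n_props f. at w i (en i) (brk (LAtom # enc_nat p)) \<and> (\<forall>s<n_states f. T i s \<longleftrightarrow> t_val f p s)) \<or>
     (at w i (i + 2) (LOpen # [LNeg]) \<and> en (i + 2) \<noteq> 0 \<and> at w (en (i + 2)) (en i) [LClose] \<and>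
       (\<forall>s<n_states f. T i s \<longleftrightarrow> \<not> T (i + 2) s)) \<or>
     (at w i (i + 2) (LOpen # [LOr]) \<and> en (i + 2) \<noteq> 0 \<and> en (en (i + 2)) \<noteq> 0 \<and>
       at w (en (en (i + 2))) (en i) [LClose] \<and>
       (\<forall>s<n_states f. T i s \<longleftrightarrow> T (i + 2) s \<or> T (en (i + 2)) s)) \<or>
     (\<exists>g. (\<forall>x. g x < U) \<and> (\<exists>k<U. temporal_at w U f en T i g 0 LNext k k \<or>
       temporal_at w U f en T i g 1 LUntil k (en k) \<or>
       temporal_at w U f en T i g 2 LRelease k (en k)))"

lemma definable_temporal_at [defI]:
  assumes "input_var w" "env_var h" "bound_var b" "set_var d X" "bound_var c" "set_var d E" "set_var d T"
    "term_definable d i" "bound_var b'" "set_var d Y" "term_definable d k" "term_definable d m"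
  shows "definable d (\<lambda>e. temporal_at (w e) (bound (h e)) (fn (b e) (X e)) (fn (c e) (E e))
    (\<lambda>x y. pair x y \<in> T e) (i e) (fn (b' e) (Y e)) \<kappa> x (k e) (m e))"
  unfolding temporal_at_def by (intro assms defI)

lemma definable_parsed [defI]:
  assumes "input_var w" "env_var h" "bound_var b" "set_var d X" "bound_var c" "set_var d E" "set_var d T"
    "term_definable d i"
  shows "definable d (\<lambda>e. parsed (w e) (bound (h e)) (fn (b e) (X e)) (fn (c e) (E e))
    (\<lambda>x y. pair x y \<in> T e) (i e))"
  unfolding parsed_def by (intro assms bound_var_env_var defI)

lemma at_appendI: "at w i k u \<Longrightarrow> at w k j v \<Longrightarrow> at w i j (u @ v)"
  unfolding at_append by blast

lemma agree_refl: "agree M M"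
  by (simp add: agree_def)

lemma coalition_sub: "coalition f g \<subseteq> {..<n_agents f}"
  by (auto simp: coalition_def)

lemma temporal_at_game:
  assumes wf: "t_wf f" and len: "length (t_model f) \<le> length w"
    and t: "temporal_at w (threshold (length w)) f en T i g \<kappa> x k m"
    and P: "\<forall>s<n_states f. T k s \<longleftrightarrow> P s" and Q: "\<forall>s<n_states f. T m s \<longleftrightarrow> Q s"
    and s: "s < n_states f"
  shows "T i s \<longleftrightarrow> game (structure_of f) (coalition f g) (bounds g) s \<kappa> P Q"
proof -
  have "at w i k (LOpen # x # t_bound f g)" using t by (simp add: temporal_at_def)
  then have lb: "length (t_bound f g) \<le> length w" by (simp add: at_def)
  have "T i s \<longleftrightarrow> t_core (threshold (length w)) f g s \<kappa> (T k) (T m)"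
    using t s by (simp add: temporal_at_def)
  also have "\<dots> \<longleftrightarrow> game (structure_of f) (coalition f g) (bounds g) s \<kappa> (T k) (T m)"
    by (rule t_core_game[OF wf len lb s])
  also have "\<dots> \<longleftrightarrow> game (structure_of f) (coalition f g) (bounds g) s \<kappa> P Q"
    by (rule game_agree[OF agree_refl]) (use P Q in \<open>auto simp: coalition_def\<close>)
  finally show ?thesis .
qed

text \<open>\<open>en\<close> and T are guesses with local checks. They are right because every
  subformula starts strictly further right than the formula it belongs to, which allows an induction
  on the distance to the end of w.\<close>

lemma parsed_sound:
  assumes wf: "t_wf f" and len: "length (t_model f) \<le> length w"
    and p: "\<forall>i<threshold (length w). en i \<noteq> 0 \<longrightarrow> parsed w (threshold (length w)) f en T i"
    and i: "en i \<noteq> 0" "i \<le> length w"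
  shows "\<exists>\<phi>. formula_over (structure_of f) \<phi> \<and> at w i (en i) (enc_formula (structure_of f) \<phi>) \<and>
    (\<forall>s<n_states f. T i s \<longleftrightarrow> sat (structure_of f) s \<phi>)"
  using i
proof (induction "length w - i" arbitrary: i rule: less_induct)
  case less
  let ?M = "structure_of f" and ?U = "threshold (length w)"
  let ?ok = "\<lambda>i \<phi>. formula_over ?M \<phi> \<and> at w i (en i) (enc_formula ?M \<phi>) \<and>
    (\<forall>s<n_states f. T i s \<longleftrightarrow> sat ?M s \<phi>)"
  have IH: "\<exists>\<phi>. ?ok k \<phi>" if "en k \<noteq> 0" "i < k" "k \<le> length w" for k
    by (rule less.hyps[OF _ that(1,3)]) (use that in simp)
  have next_node: "i < k \<and> k \<le> length w" if "at w i k (a # u)" for k a u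
    using that by (simp add: at_def)
  have "i < ?U" using less.prems(2) by (rule less_threshold(2))
  then have "parsed w ?U f en T i" using p less.prems(1) by blast
  then consider
    (atom) p where "p < n_props f" "at w i (en i) (brk (LAtom # enc_nat p))" "\<forall>s<n_states f. T i s \<longleftrightarrow> t_val f p s"
  | (neg) "at w i (i + 2) (LOpen # [LNeg])" "en (i + 2) \<noteq> 0" "at w (en (i + 2)) (en i) [LClose]"
      "\<forall>s<n_states f. T i s \<longleftrightarrow> \<not> T (i + 2) s"
  | (or) "at w i (i + 2) (LOpen # [LOr])" "en (i + 2) \<noteq> 0" "en (en (i + 2)) \<noteq> 0"
      "at w (en (en (i + 2))) (en i) [LClose]" "\<forall>s<n_states f. T i s \<longleftrightarrow> T (i + 2) s \<or> T (en (i + 2)) s"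
  | (unary) g k where "temporal_at w ?U f en T i g 0 LNext k k"
  | (binary) g k \<kappa> x where "temporal_at w ?U f en T i g \<kappa> x k (en k)"
      "\<kappa> = 1 \<and> x = LUntil \<or> \<kappa> = 2 \<and> x = LRelease"
    unfolding parsed_def by blast
  then show ?case
  proof cases
    case atom
    then show ?thesis by (intro exI[of _ "Atom p"]) (simp add: bracket_def brk_def)
  next
    case neg
    obtain \<phi> where \<phi>: "?ok (i + 2) \<phi>" using IH[OF neg(2)] next_node[OF neg(1)] by blast
    have "at w i (en i) ((LOpen # [LNeg]) @ enc_formula ?M \<phi> @ [LClose])"
      using neg(1,3) \<phi> by (intro at_appendI[of w i "i + 2"] at_appendI[of w "i + 2" "en (i + 2)"]) auto
    then show ?thesis using \<phi> neg(4) by (intro exI[of _ "Neg \<phi>"]) (simp add: bracket_def)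
  next
    case or
    obtain \<phi> where \<phi>: "?ok (i + 2) \<phi>" using IH[OF or(2)] next_node[OF or(1)] by blast
    have "i < en (i + 2) \<and> en (i + 2) \<le> length w"
      using \<phi> at_bounds[of w "i + 2" "en (i + 2)" "enc_formula ?M \<phi>"] by simp
    then obtain \<psi> where \<psi>: "?ok (en (i + 2)) \<psi>" using IH[OF or(3)] by blast
    have "at w i (en i) ((LOpen # [LOr]) @ enc_formula ?M \<phi> @ enc_formula ?M \<psi> @ [LClose])"
      using or(1,4) \<phi> \<psi> by (intro at_appendI[of w i "i + 2"] at_appendI[of w "i + 2" "en (i + 2)"]
        at_appendI[of w "en (i + 2)" "en (en (i + 2))"]) auto
    then show ?thesis using \<phi> \<psi> or(5) by (intro exI[of _ "Or \<phi> \<psi>"]) (simp add: bracket_def)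
  next
    case unary
    note t = unary[unfolded temporal_at_def]
    obtain \<phi> where \<phi>: "?ok k \<phi>" using IH[of k] next_node[of k] t by blast
    have "at w i (en i) ((LOpen # LNext # t_bound f g) @ enc_formula ?M \<phi> @ [LClose])"
      using t \<phi> by (intro at_appendI[of w i k] at_appendI[of w k "en k"]) auto
    moreover have "T i s \<longleftrightarrow> sat ?M s (Next (coalition f g) (bounds g) \<phi>)" if "s < n_states f" for s
      unfolding sat_game by (rule temporal_at_game[OF wf len unary]) (use \<phi> that in simp_all)
    ultimately show ?thesis using \<phi>
      by (intro exI[of _ "Next (coalition f g) (bounds g) \<phi>"])
        (simp add: bracket_def enc_bound_structure_of coalition_sub del: sat.simps)
  next
    case binary
    note t = binary(1)[unfolded temporal_at_def]
    obtain \<phi> where \<phi>: "?ok k \<phi>" using IH[of k] next_node[of k] t by blast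
    have "i < en k \<and> en k \<le> length w"
      using \<phi> at_bounds[of w k "en k" "enc_formula ?M \<phi>"] next_node[of k] t by fastforce
    then obtain \<psi> where \<psi>: "?ok (en k) \<psi>" using IH[of "en k"] t by blast
    have "at w i (en i) ((LOpen # x # t_bound f g) @ enc_formula ?M \<phi> @ enc_formula ?M \<psi> @ [LClose])"
      using t \<phi> \<psi> by (intro at_appendI[of w i k] at_appendI[of w k "en k"] at_appendI[of w "en k" "en (en k)"]) auto
    moreover have "T i s \<longleftrightarrow> game ?M (coalition f g) (bounds g) s \<kappa> (\<lambda>t. sat ?M t \<phi>) (\<lambda>t. sat ?M t \<psi>)"
      if "s < n_states f" for s
      by (rule temporal_at_game[OF wf len binary(1)]) (use \<phi> \<psi> that in simp_all)
    ultimately show ?thesis using \<phi> \<psi> binary(2)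
      by (intro exI[of _ "(if \<kappa> = 1 then Until else Release) (coalition f g) (bounds g) \<phi> \<psi>"])
        (auto simp: bracket_def enc_bound_structure_of coalition_sub sat_game simp del: sat.simps)
  qed
qed

text \<open>Confining the annotation to the segment from i to j allows annotations of consecutive
  segments to be joined without conflict.\<close>

definition annotated ::
  "letter list \<Rightarrow> (nat \<Rightarrow> nat) \<Rightarrow> nat \<Rightarrow> nat \<Rightarrow> (nat \<Rightarrow> nat) \<Rightarrow> (nat \<Rightarrow> nat \<Rightarrow> bool) \<Rightarrow> bool" where
  "annotated w f i j en T \<longleftrightarrow>
     (\<forall>x. en x \<noteq> 0 \<longrightarrow> i \<le> x \<and> x < j \<and> en x \<le> length w \<and> parsed w (threshold (length w)) f en T x)"

lemma temporal_at_mono: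
  assumes "\<forall>y. en y \<noteq> 0 \<longrightarrow> en' y = en y \<and> T' y = T y" "en x \<noteq> 0"
    and "temporal_at w U f en T x g \<kappa> a k m"
  shows "temporal_at w U f en' T' x g \<kappa> a k m"
  using assms unfolding temporal_at_def by simp

text \<open>The check at x consults \<open>en\<close> and T only at positions where
  \<open>en\<close> is nonzero, so annotating further positions leaves it intact.\<close>

lemma parsed_mono:
  assumes ext: "\<forall>y. en y \<noteq> 0 \<longrightarrow> en' y = en y \<and> T' y = T y" and x: "en x \<noteq> 0"
    and p: "parsed w U f en T x"
  shows "parsed w U f en' T' x"
proof -
  have t: "temporal_at w U f en' T' x g \<kappa> a k k \<and> en' k = en k"
    if "temporal_at w U f en T x g \<kappa> a k k" for g \<kappa> a k
    using temporal_at_mono[OF ext x that] that ext by (simp add: temporal_at_def)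
  have t2: "temporal_at w U f en' T' x g \<kappa> a k (en' k)"
    if "temporal_at w U f en T x g \<kappa> a k (en k)" for g \<kappa> a k
  proof -
    have "en' k = en k" using that ext by (simp add: temporal_at_def)
    then show ?thesis using temporal_at_mono[OF ext x that] by simp
  qed
  from p consider
    (atom) "\<exists>p<n_props f. at w x (en x) (brk (LAtom # enc_nat p)) \<and> (\<forall>s<n_states f. T x s \<longleftrightarrow> t_val f p s)"
  | (neg) "at w x (x + 2) (LOpen # [LNeg])" "en (x + 2) \<noteq> 0" "at w (en (x + 2)) (en x) [LClose]"
      "\<forall>s<n_states f. T x s \<longleftrightarrow> \<not> T (x + 2) s"
  | (or) "at w x (x + 2) (LOpen # [LOr])" "en (x + 2) \<noteq> 0" "en (en (x + 2)) \<noteq> 0"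
      "at w (en (en (x + 2))) (en x) [LClose]" "\<forall>s<n_states f. T x s \<longleftrightarrow> T (x + 2) s \<or> T (en (x + 2)) s"
  | (temporal) g k where "\<forall>x. g x < U" "k < U" "temporal_at w U f en T x g 0 LNext k k \<or>
       temporal_at w U f en T x g 1 LUntil k (en k) \<or> temporal_at w U f en T x g 2 LRelease k (en k)"
    unfolding parsed_def by blast
  then show ?thesis
  proof cases
    case atom
    then show ?thesis using ext x by (simp add: parsed_def)
  next
    case neg
    then show ?thesis using ext x by (simp add: parsed_def)
  next
    case or
    then show ?thesis using ext x by (simp add: parsed_def)
  next
    case temporal
    then show ?thesis using t t2 unfolding parsed_def by blast
  qed
qed

lemma annotated_mono:
  assumes "annotated w f i j en T" "\<forall>y. en y \<noteq> 0 \<longrightarrow> en' y = en y \<and> T' y = T y" "en x \<noteq> 0"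
  shows "i \<le> x \<and> x < j \<and> en' x \<le> length w \<and> parsed w (threshold (length w)) f en' T' x"
  using assms parsed_mono[OF assms(2,3)] unfolding annotated_def by simp

lemma annotated_union:
  assumes "annotated w f i k en T" "annotated w f k j en' T'" "i \<le> k" "k \<le> j"
  shows "annotated w f i j (\<lambda>x. if en x \<noteq> 0 then en x else en' x) (\<lambda>x. if en x \<noteq> 0 then T x else T' x)"
  unfolding annotated_def
proof (intro allI impI)
  let ?en = "\<lambda>x. if en x \<noteq> 0 then en x else en' x" and ?T = "\<lambda>x. if en x \<noteq> 0 then T x else T' x"
  have 1: "\<forall>y. en y \<noteq> 0 \<longrightarrow> ?en y = en y \<and> ?T y = T y" by simp
  have "en y = 0" if "en' y \<noteq> 0" for y
    using assms(1,2) that unfolding annotated_def by (meson not_less)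
  then have 2: "\<forall>y. en' y \<noteq> 0 \<longrightarrow> ?en y = en' y \<and> ?T y = T' y" by simp
  fix x assume "?en x \<noteq> 0"
  then consider "en x \<noteq> 0" | "en' x \<noteq> 0" by (auto split: if_splits)
  then show "i \<le> x \<and> x < j \<and> ?en x \<le> length w \<and> parsed w (threshold (length w)) f ?en ?T x"
  proof cases
    case 1
    from annotated_mono[OF assms(1) \<open>\<forall>y. en y \<noteq> 0 \<longrightarrow> ?en y = en y \<and> ?T y = T y\<close> 1]
    show ?thesis using assms(4) by simp
  next
    case 2
    from annotated_mono[OF assms(2) \<open>\<forall>y. en' y \<noteq> 0 \<longrightarrow> ?en y = en' y \<and> ?T y = T' y\<close> 2]
    show ?thesis using assms(3) by simp
  qed
qed

lemma annotated_Cons: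
  assumes "annotated w f k m en T" "i < k" "m \<le> j" "i < j" "j \<le> length w"
    and "parsed w (threshold (length w)) f (en(i := j)) (T(i := R)) i"
  shows "annotated w f i j (en(i := j)) (T(i := R))"
  unfolding annotated_def
proof (intro allI impI)
  have "en i = 0" using assms(1,2) unfolding annotated_def by (meson not_less)
  then have e: "\<forall>y. en y \<noteq> 0 \<longrightarrow> (en(i := j)) y = en y \<and> (T(i := R)) y = T y" by auto
  fix x assume "(en(i := j)) x \<noteq> 0"
  then consider "x = i" | "en x \<noteq> 0" by (auto split: if_splits)
  then show "i \<le> x \<and> x < j \<and> (en(i := j)) x \<le> length w \<and>
      parsed w (threshold (length w)) f (en(i := j)) (T(i := R)) x"
  proof cases
    case 1
    then show ?thesis using assms(4,5,6) by simp
  next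
    case 2
    note annotated_mono[where en' = "en(i := j)" and T' = "T(i := R)", OF assms(1) e 2]
    then show ?thesis using assms(2,3) by (simp del: fun_upd_apply)
  qed
qed

text \<open>b is arbitrary outside A and beyond the resources of the structure. Setting these values
  to 0 changes neither the encoding nor the game and keeps g below the threshold.\<close>

lemma bound_table:
  assumes A: "A \<subseteq> {..<n_agents f}" and len: "length (enc_bound (structure_of f) A b) \<le> n"
  obtains g where "coalition f g = A" "\<forall>a\<in>A. \<forall>j<n_res f. b a j = bounds g a j"
    "t_bound f g = enc_bound (structure_of f) A b" "\<forall>x. g x < threshold n"
proof -
  define g where "g = (\<lambda>z. case unpair z of (k, y) \<Rightarrow> if k = 0 then of_bool (y \<in> A)
    else if k = 1 then (case unpair y of (a, j) \<Rightarrow> if a \<in> A \<and> j < n_res f then b a j else 0) else 0)"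
  have c: "coalition f g = A" using A by (auto simp: coalition_def g_def)
  have b: "\<forall>a\<in>A. \<forall>j<n_res f. b a j = bounds g a j" by (simp add: bounds_def g_def)
  have "enc_bound (structure_of f) A b = enc_bound (structure_of f) A (bounds g)"
    unfolding enc_bound_def
    by (intro arg_cong[where f = bracket] map_cong refl if_cong) (use b in auto)
  then have t: "t_bound f g = enc_bound (structure_of f) A b"
    using enc_bound_structure_of[of f g] c by simp
  have "b a j < threshold n" if "a \<in> A" "j < n_res f" for a j
  proof (rule less_threshold(2))
    have "bounds g a j + 1 \<le> n" by (rule t_bound_bounds[of f]) (use that t len c in simp_all)
    then show "b a j \<le> n" using b that by simp
  qed
  moreover have "of_bool P < threshold n" for P
    using less_threshold(3)[of "of_bool P" n] by simp
  moreover have "0 < threshold n" by (simp add: threshold_def)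
  ultimately have "\<forall>x. g x < threshold n" unfolding g_def by (auto split: prod.split)
  then show ?thesis by (rule that[OF c b t])
qed

lemma temporal_atI:
  assumes wf: "t_wf f" and len: "length (t_model f) \<le> length w"
    and g: "coalition f g = A" "\<forall>a\<in>A. \<forall>j<n_res f. b a j = bounds g a j"
    and at: "at w i k (LOpen # x # t_bound f g)" and en: "en k \<noteq> 0" "en m \<noteq> 0"
    and close: "at w (en m) (en i) [LClose]"
    and T: "\<forall>s<n_states f. T i s \<longleftrightarrow> game (structure_of f) A b s \<kappa> (T k) (T m)"
  shows "temporal_at w (threshold (length w)) f en T i g \<kappa> x k m"
proof -
  have lb: "length (t_bound f g) \<le> length w" using at by (simp add: at_def)
  have "t_core (threshold (length w)) f g s \<kappa> (T k) (T m) \<longleftrightarrow> T i s" if s: "s < n_states f" for s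
  proof -
    have "t_core (threshold (length w)) f g s \<kappa> (T k) (T m) \<longleftrightarrow>
        game (structure_of f) (coalition f g) (bounds g) s \<kappa> (T k) (T m)"
      by (rule t_core_game[OF wf len lb s])
    also have "\<dots> \<longleftrightarrow> game (structure_of f) A b s \<kappa> (T k) (T m)"
      unfolding g(1) by (rule game_agree[OF agree_refl]) (use g coalition_sub[of f g] in auto)
    finally show ?thesis using T s by simp
  qed
  then show ?thesis using at en close by (simp add: temporal_at_def)
qed

lemma annotated_two:
  assumes "annotated w f k l en T" "en k = l" "annotated w f l m en' T'" "en' l = m" "k < l" "l < m"
  obtains en'' T'' where "en'' k = l" "en'' l = m" "T'' k = T k" "T'' l = T' l" "annotated w f k m en'' T''"
proof
  show "annotated w f k m (\<lambda>x. if en x \<noteq> 0 then en x else en' x) (\<lambda>x. if en x \<noteq> 0 then T x else T' x)"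
    by (rule annotated_union[OF assms(1,3)]) (use assms(5,6) in simp_all)
  \<comment> \<open>The first annotation lies before l, so at l the union takes its entries from the
    second one.\<close>
  have "en l = 0" using assms(1) unfolding annotated_def by (meson less_irrefl)
  then show "(if en k \<noteq> 0 then en k else en' k) = l" "(if en l \<noteq> 0 then en l else en' l) = m"
    "(if en k \<noteq> 0 then T k else T' k) = T k" "(if en l \<noteq> 0 then T l else T' l) = T' l"
    using assms by simp_all
qed

lemma at_formula: "at w i j (enc_formula M \<phi>) \<Longrightarrow> i < j \<and> j \<le> length w"
  by (cases \<phi>) (auto simp: at_def bracket_def)

text \<open>Annotations are built bottom-up: those of the subformulas are joined, and then the start
  i receives its end and its true set of states.\<close>

lemma parsed_complete:
  assumes wf: "t_wf f" and len: "length (t_model f) \<le> length w"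
    and "formula_over (structure_of f) \<phi>" "at w i j (enc_formula (structure_of f) \<phi>)"
  shows "\<exists>en T. en i = j \<and> T i = (\<lambda>s. sat (structure_of f) s \<phi>) \<and> annotated w f i j en T"
proof -
  let ?M = "structure_of f"
  let ?ann = "\<lambda>\<phi> i j. \<exists>en T. en i = j \<and> T i = (\<lambda>s. sat ?M s \<phi>) \<and> annotated w f i j en T"
  \<comment> \<open>Until and Release share this step; they differ in the kind \<kappa> and in the
    letter x.\<close>
  have binary: "\<exists>en T. en i = j \<and> T i = (\<lambda>s. game ?M A b s \<kappa> (\<lambda>t. sat ?M t \<phi>) (\<lambda>t. sat ?M t \<psi>)) \<and>
      annotated w f i j en T"
    if A: "A \<subseteq> {..<n_agents f}"
      and IH: "\<And>i j. formula_over ?M \<phi> \<Longrightarrow> at w i j (enc_formula ?M \<phi>) \<Longrightarrow> ?ann \<phi> i j"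
        "\<And>i j. formula_over ?M \<psi> \<Longrightarrow> at w i j (enc_formula ?M \<psi>) \<Longrightarrow> ?ann \<psi> i j"
      and over: "formula_over ?M \<phi>" "formula_over ?M \<psi>"
      and w: "at w i j (bracket [[x], enc_bound ?M A b, enc_formula ?M \<phi>, enc_formula ?M \<psi>])"
      and \<kappa>: "\<kappa> = 1 \<and> x = LUntil \<or> \<kappa> = 2 \<and> x = LRelease"
    for A \<kappa> x b \<phi> \<psi> i j
  proof -
    have ij: "i < j" "j \<le> length w" using w by (auto simp: at_def bracket_def)
    have "at w i j ((LOpen # x # enc_bound ?M A b) @ enc_formula ?M \<phi> @ enc_formula ?M \<psi> @ [LClose])"
      using w by (simp add: bracket_def)
    then obtain k l m where at: "at w i k (LOpen # x # enc_bound ?M A b)" "at w k l (enc_formula ?M \<phi>)"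
      "at w l m (enc_formula ?M \<psi>)" "at w m j [LClose]"
      unfolding at_append by blast
    have k: "i < k" and b: "length (enc_bound ?M A b) \<le> length w" using at(1) by (simp_all add: at_def)
    note kl = at_formula[OF at(2)] at_formula[OF at(3)] at_bounds[OF at(4)]
    obtain en1 T1 where en1: "en1 k = l" "T1 k = (\<lambda>s. sat ?M s \<phi>)" "annotated w f k l en1 T1"
      using IH(1)[OF over(1) at(2)] by auto
    obtain en2 T2 where en2: "en2 l = m" "T2 l = (\<lambda>s. sat ?M s \<psi>)" "annotated w f l m en2 T2"
      using IH(2)[OF over(2) at(3)] by auto
    obtain en T where en: "en k = l" "en l = m" "T k = (\<lambda>s. sat ?M s \<phi>)" "T l = (\<lambda>s. sat ?M s \<psi>)"
      "annotated w f k m en T"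
      by (rule annotated_two[OF en1(3,1) en2(3,1)]) (use kl en1 en2 in simp_all)
    obtain g where g: "coalition f g = A" "\<forall>a\<in>A. \<forall>j<n_res f. b a j = bounds g a j"
      "t_bound f g = enc_bound ?M A b" "\<forall>x. g x < threshold (length w)"
      by (rule bound_table[OF A b])
    let ?en = "en(i := j)" and ?T = "T(i := (\<lambda>s. game ?M A b s \<kappa> (\<lambda>t. sat ?M t \<phi>) (\<lambda>t. sat ?M t \<psi>)))"
    have "annotated w f i j ?en ?T"
    proof (rule annotated_Cons[OF en(5)])
      have "temporal_at w (threshold (length w)) f ?en ?T i g \<kappa> x k (?en k)"
        by (rule temporal_atI[OF wf len g(1,2)]) (use at en k kl g(3) in simp_all)
      moreover have "k < threshold (length w)" using kl by (intro less_threshold(2)) simp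
      ultimately show "parsed w (threshold (length w)) f ?en ?T i"
        using g(4) \<kappa> unfolding parsed_def by blast
    qed (use ij k kl in simp_all)
    then show ?thesis by (intro exI[of _ ?en] exI[of _ ?T] conjI fun_upd_same)
  qed
  show ?thesis using assms(3,4)
  proof (induction \<phi> arbitrary: i j)
    case (Atom p)
    let ?en = "(\<lambda>_. 0)(i := j)" and ?T = "(\<lambda>_ _. False)(i := (\<lambda>s. sat (structure_of f) s (Atom p)))"
    have ij: "i < j" "j \<le> length w" using at_formula[OF Atom(2)] by auto
    have "annotated w f i j ?en ?T"
    proof (rule annotated_Cons[where k = j and m = j])
      show "annotated w f j j (\<lambda>_. 0) (\<lambda>_ _. False)" by (simp add: annotated_def)
      show "parsed w (threshold (length w)) f ?en ?T i"
        using Atom unfolding parsed_def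
        by (intro disjI1 exI[of _ p]) (simp add: bracket_def brk_def)
    qed (use ij in simp_all)
    then show ?case by (intro exI[of _ ?en] exI[of _ ?T] conjI fun_upd_same)
  next
    case (Neg \<phi>)
    let ?M = "structure_of f"
    have ij: "i < j" "j \<le> length w" using at_formula[OF Neg(3)] by auto
    have "at w i j ((LOpen # [LNeg]) @ enc_formula ?M \<phi> @ [LClose])"
      using Neg.prems by (simp add: bracket_def)
    then obtain k l where at: "at w i k (LOpen # [LNeg])" "at w k l (enc_formula ?M \<phi>)" "at w l j [LClose]"
      unfolding at_append by blast
    have k: "k = i + 2" using at(1) by (simp add: at_def)
    note kl = at_formula[OF at(2)] at_bounds[OF at(3)]
    obtain en T where en: "en k = l" "T k = (\<lambda>s. sat ?M s \<phi>)" "annotated w f k l en T"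
      using Neg.IH[OF _ at(2)] Neg.prems by auto
    let ?en = "en(i := j)" and ?T = "T(i := (\<lambda>s. sat ?M s (Neg \<phi>)))"
    have "annotated w f i j ?en ?T"
    proof (rule annotated_Cons[OF en(3)])
      show "parsed w (threshold (length w)) f ?en ?T i"
        using at en kl unfolding parsed_def k by (intro disjI2[OF disjI1]) simp
    qed (use ij k kl in simp_all)
    then show ?case by (intro exI[of _ ?en] exI[of _ ?T] conjI fun_upd_same)
  next
    case (Or \<phi> \<psi>)
    let ?M = "structure_of f"
    have ij: "i < j" "j \<le> length w" using at_formula[OF Or.prems(2)] by auto
    have "at w i j ((LOpen # [LOr]) @ enc_formula ?M \<phi> @ enc_formula ?M \<psi> @ [LClose])"
      using Or.prems by (simp add: bracket_def)
    then obtain k l m where at: "at w i k (LOpen # [LOr])" "at w k l (enc_formula ?M \<phi>)"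
      "at w l m (enc_formula ?M \<psi>)" "at w m j [LClose]"
      unfolding at_append by blast
    have k: "k = i + 2" using at(1) by (simp add: at_def)
    note kl = at_formula[OF at(2)] at_formula[OF at(3)] at_bounds[OF at(4)]
    obtain en1 T1 where en1: "en1 k = l" "T1 k = (\<lambda>s. sat ?M s \<phi>)" "annotated w f k l en1 T1"
      using Or.IH(1)[OF _ at(2)] Or.prems by auto
    obtain en2 T2 where en2: "en2 l = m" "T2 l = (\<lambda>s. sat ?M s \<psi>)" "annotated w f l m en2 T2"
      using Or.IH(2)[OF _ at(3)] Or.prems by auto
    obtain en T where en: "en k = l" "en l = m" "T k = (\<lambda>s. sat ?M s \<phi>)" "T l = (\<lambda>s. sat ?M s \<psi>)"
      "annotated w f k m en T"
      by (rule annotated_two[OF en1(3,1) en2(3,1)]) (use kl en1 en2 in simp_all)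
    let ?en = "en(i := j)" and ?T = "T(i := (\<lambda>s. sat ?M s (Or \<phi> \<psi>)))"
    have "annotated w f i j ?en ?T"
    proof (rule annotated_Cons[OF en(5)])
      show "parsed w (threshold (length w)) f ?en ?T i"
        using at en kl unfolding parsed_def k by (intro disjI2[OF disjI2[OF disjI1]]) simp
    qed (use ij k kl in simp_all)
    then show ?case by (intro exI[of _ ?en] exI[of _ ?T] conjI fun_upd_same)
  next
    case (Next A b \<phi>)
    let ?M = "structure_of f"
    have ij: "i < j" "j \<le> length w" using at_formula[OF Next.prems(2)] by auto
    have "at w i j ((LOpen # LNext # enc_bound ?M A b) @ enc_formula ?M \<phi> @ [LClose])"
      using Next.prems by (simp add: bracket_def)
    then obtain k l where at: "at w i k (LOpen # LNext # enc_bound ?M A b)" "at w k l (enc_formula ?M \<phi>)"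
      "at w l j [LClose]"
      unfolding at_append by blast
    have k: "i < k" and b: "length (enc_bound ?M A b) \<le> length w" using at(1) by (simp_all add: at_def)
    note kl = at_formula[OF at(2)] at_bounds[OF at(3)]
    obtain en T where en: "en k = l" "T k = (\<lambda>s. sat ?M s \<phi>)" "annotated w f k l en T"
      using Next.IH[OF _ at(2)] Next.prems by auto
    have A: "A \<subseteq> {..<n_agents f}" using Next.prems by simp
    obtain g where g: "coalition f g = A" "\<forall>a\<in>A. \<forall>j<n_res f. b a j = bounds g a j"
      "t_bound f g = enc_bound ?M A b" "\<forall>x. g x < threshold (length w)"
      by (rule bound_table[OF A b])
    let ?en = "en(i := j)" and ?T = "T(i := (\<lambda>s. sat ?M s (Next A b \<phi>)))"
    have "annotated w f i j ?en ?T"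
    proof (rule annotated_Cons[OF en(3)])
      have "temporal_at w (threshold (length w)) f ?en ?T i g 0 LNext k k"
        by (rule temporal_atI[OF wf len g(1,2)]) (use at en k kl g(3) in \<open>simp_all add: sat_game del: sat.simps\<close>)
      moreover have "k < threshold (length w)" using kl by (intro less_threshold(2)) simp
      ultimately show "parsed w (threshold (length w)) f ?en ?T i"
        using g(4) unfolding parsed_def by blast
    qed (use ij k kl in simp_all)
    then show ?case by (intro exI[of _ ?en] exI[of _ ?T] conjI fun_upd_same)
  next
    case (Until A b \<phi> \<psi>)
    show ?case unfolding sat_game
      by (rule binary[where \<kappa> = 1 and x = LUntil, OF _ Until.IH]) (use Until.prems in simp_all)
  next
    case (Release A b \<phi> \<psi>)
    show ?case unfolding sat_game
      by (rule binary[where \<kappa> = 2 and x = LRelease, OF _ Release.IH]) (use Release.prems in simp_all)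
  qed
qed

section \<open>The decision procedure\<close>

text \<open>Nested operators cost no further quantifiers: the truth values of all subformulas are
  guessed together in T and pinned down by \<open>parsed\<close>. So one fixed sentence serves
  formulas of any size.\<close>

definition accepted :: "letter list \<Rightarrow> nat \<Rightarrow> bool" where
  "accepted w U \<longleftrightarrow> (\<exists>f. (\<forall>x. f x < U) \<and> (t_wf f \<and> (\<exists>s<n_states f. \<exists>k<U.
     at w 0 k (LOpen # t_model f @ enc_nat s) \<and> (\<exists>en. (\<forall>x. en x < U) \<and> (\<exists>T. en k \<noteq> 0 \<and>
       at w (en k) (length w) [LClose] \<and> T k s \<and> (\<forall>i<U. en i \<noteq> 0 \<longrightarrow> parsed w U f en T i))))))"

lemma definable_accepted:
  assumes "input_var w" "env_var h"
  shows "definable d (\<lambda>e. accepted (w e) (bound (h e)))"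
  unfolding accepted_def by (intro assms bound_var_env_var defI)

lemma accepted_iff: "accepted w (threshold (length w)) \<longleftrightarrow> w \<in> model_checking"
proof
  let ?U = "threshold (length w)"
  assume "accepted w ?U"
  then obtain f s k en T where wf: "t_wf f" and s: "s < n_states f"
    and at: "at w 0 k (LOpen # t_model f @ enc_nat s)" and en: "en k \<noteq> 0"
    "at w (en k) (length w) [LClose]" "T k s" "\<forall>i<?U. en i \<noteq> 0 \<longrightarrow> parsed w ?U f en T i"
    unfolding accepted_def by (elim exE conjE) (rule that, assumption+)
  let ?M = "structure_of f"
  have len: "length (t_model f) \<le> length w" and k: "k \<le> length w" using at by (simp_all add: at_def)
  obtain \<phi> where \<phi>: "formula_over ?M \<phi>" "at w k (en k) (enc_formula ?M \<phi>)"
    "\<forall>s<n_states f. T k s \<longleftrightarrow> sat ?M s \<phi>"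
    using parsed_sound[OF wf len en(4,1) k] by blast
  have M: "t_powers f" "rbcgs ?M" using wf by (simp_all add: t_wf)
  have "at w 0 (length w) ((LOpen # t_model f @ enc_nat s) @ enc_formula ?M \<phi> @ [LClose])"
    by (rule at_appendI[OF at at_appendI[OF \<phi>(2) en(2)]])
  then have "w = enc_instance ?M s \<phi>"
    unfolding at_all by (simp add: enc_instance_def bracket_def enc_model_structure_of[OF M(1)])
  moreover have "sat ?M s \<phi>" using \<phi>(3) s en(3) by blast
  ultimately show "w \<in> model_checking"
    unfolding model_checking_def using M(2) numbered_structure_of s \<phi>(1)
    by (intro CollectI exI[of _ ?M] exI[of _ s] exI[of _ \<phi>] conjI) simp_all
next
  let ?U = "threshold (length w)"
  assume "w \<in> model_checking"
  then obtain M s \<phi> where w: "w = enc_instance M s \<phi>" and M: "rbcgs M" "numbered M" and s: "s \<in> States M"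
    and \<phi>: "formula_over M \<phi>" "sat M s \<phi>"
    unfolding model_checking_def by blast
  define f where "f = table_of M"
  let ?M = "structure_of f"
  have same: "same M ?M" unfolding f_def by (rule same_table_of[OF M])
  have pw: "t_powers f" unfolding f_def by (rule t_powers_table_of[OF M(1)])
  have wf: "t_wf f" unfolding t_wf using pw rbcgs_table_of[OF M] by (simp add: f_def)
  have mod: "enc_model M = t_model f"
    using enc_model_same[OF same M(2) numbered_structure_of] enc_model_structure_of[OF pw] by simp
  have w': "w = (LOpen # t_model f @ enc_nat s) @ enc_formula ?M \<phi> @ [LClose]"
    unfolding w enc_instance_def mod enc_formula_same[OF same] by (simp add: bracket_def)
  then have "at w 0 (length w) ((LOpen # t_model f @ enc_nat s) @ enc_formula ?M \<phi> @ [LClose])"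
    unfolding at_all by simp
  then obtain k j where at: "at w 0 k (LOpen # t_model f @ enc_nat s)"
    "at w k j (enc_formula ?M \<phi>)" "at w j (length w) [LClose]"
    unfolding at_append by blast
  have len: "length (t_model f) \<le> length w" using w' by simp
  have "formula_over ?M \<phi>" using \<phi>(1) formula_over_same[OF same] by blast
  from parsed_complete[OF wf len this at(2)]
  obtain en T where en: "en k = j" "T k = (\<lambda>s. sat ?M s \<phi>)" "annotated w f k j en T" by blast
  have kj: "k < j" "j \<le> length w" using at_formula[OF at(2)] by auto
  have "f x < ?U" for x unfolding f_def by (rule table_of_less[OF M]) (use len mod in simp)
  moreover have "s < n_states f" using s numberedD(1)[OF M(2)] by (simp add: f_def)
  moreover have "k < ?U" using kj by (intro less_threshold(2)) simp
  moreover have "en x < ?U" for x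
    using en(3) by (intro less_threshold(2), cases "en x = 0") (simp_all add: annotated_def)
  moreover have "T k s" using en(2) sat_same[OF same \<phi>(1) s] \<phi>(2) by simp
  moreover have "\<forall>i<?U. en i \<noteq> 0 \<longrightarrow> parsed w ?U f en T i" using en(3) by (simp add: annotated_def)
  moreover have "en k \<noteq> 0" "at w (en k) (length w) [LClose]" using en(1) kj at(3) by simp_all
  ultimately show "accepted w ?U"
    unfolding accepted_def using wf at(1)
    by (intro exI[of _ f] exI[of _ s] exI[of _ k] exI[of _ en] exI[of _ T] conjI allI) simp_all
qed

text \<open>\<open>definable_power\<close> works with terms below the bound, so base, exponent and
  power are quantified numbers; at the threshold all three are indeed below it.\<close>

lemma definable_threshold:
  assumes "input_var w" "env_var h"
  shows "definable d (\<lambda>e. bound (h e) = threshold (length (w e)))"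
proof -
  have "definable d (\<lambda>e. \<exists>a<bound (h e). \<exists>m<bound (h e). \<exists>p<bound (h e). a = 2 \<and>
     m = (length (w e) + 2) * (length (w e) + 2) \<and> p = a ^ m \<and> bound (h e) = 2 * p)"
    by (intro assms bound_var_env_var definable_power defI)
  then show ?thesis
  proof (rule definable_cong)
    fix e :: "'a env"
    let ?n = "(length (w e) + 2) * (length (w e) + 2)"
    define N where "N = ?n"
    have "4 \<le> N" unfolding N_def by simp
    have "2 < threshold (length (w e))" "?n < threshold (length (w e))" "2 ^ ?n < threshold (length (w e))"
      using less_exp[of N] \<open>4 \<le> N\<close> unfolding threshold_def N_def[symmetric] by linarith+
    then show "(\<exists>a<bound (h e). \<exists>m<bound (h e). \<exists>p<bound (h e). a = 2 \<and>
       m = (length (w e) + 2) * (length (w e) + 2) \<and> p = a ^ m \<and> bound (h e) = 2 * p) =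
      (bound (h e) = threshold (length (w e)))"
      unfolding threshold_def by auto
  qed
qed

lemma raw_sentence:
  assumes "raw 0 Q"
  obtains \<phi> where "fm_wf 0 \<phi>" "\<And>w L. 1 \<le> L \<Longrightarrow> sem \<phi> w L [] = Q w L []"
  using assms unfolding raw_def by auto

text \<open>
  The least tape length at which the threshold fits is exponential, since the formulas only
  need some fixed power of the threshold.
\<close>

lemma threshold_power_le:
  "\<exists>c. \<forall>n. threshold n ^ K < c * 2 ^ (n ^ 3)"
proof -
  \<comment> \<open>For n \<ge> 10 * K and n > 0, the estimate (n + 2)^2 + 1 \<le> 10 * n^2 bounds
    the exponent by n^3. For smaller n it is at most its value at 10 * K, which is D.\<close>
  define D where "D = ((10 * K + 2) * (10 * K + 2) + 1) * K"
  have exp: "((n + 2) * (n + 2) + 1) * K \<le> n ^ 3 + D" for n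
  proof (cases "10 * K \<le> n")
    case True
    show ?thesis
    proof (cases "n = 0")
      case False
      then have n: "n \<le> n * n" "1 \<le> n * n" by (simp_all add: Suc_le_eq)
      have "(n + 2) * (n + 2) + 1 = n * n + 4 * n + 5" by (simp add: algebra_simps)
      also have "\<dots> \<le> 10 * (n * n)" using n by linarith
      finally have "((n + 2) * (n + 2) + 1) * K \<le> 10 * (n * n) * K" by (rule mult_le_mono1)
      also have "\<dots> = n * n * (10 * K)" by simp
      also have "\<dots> \<le> n * n * n" by (rule mult_le_mono2[OF True])
      finally show ?thesis by (simp add: power3_eq_cube)
    qed (use True in simp)
  next
    case False
    then have "((n + 2) * (n + 2) + 1) * K \<le> D"
      unfolding D_def by (intro mult_le_mono1 add_mono mult_le_mono) auto
    then show ?thesis by simp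
  qed
  have "threshold n ^ K < (2 * 2 ^ D) * 2 ^ (n ^ 3)" for n
  proof -
    have "threshold n ^ K = 2 ^ (((n + 2) * (n + 2) + 1) * K)"
      by (simp add: threshold_def flip: power_Suc power_mult)
    also have "\<dots> \<le> 2 ^ (n ^ 3 + D)" by (intro power_increasing exp) simp
    also have "\<dots> < (2 * 2 ^ D) * 2 ^ (n ^ 3)" by (simp add: power_add)
    finally show ?thesis .
  qed
  then show ?thesis by blast
qed

text \<open>Q has its intended meaning only in a proper environment with enough room, so the
  sentence itself ensures both: X is a singleton {u}, u^K is below L, a blank before position u
  shows that the input is shorter than u, and u is at least 2.\<close>

definition threshold_set :: "nat \<Rightarrow> (letter list \<Rightarrow> nat \<Rightarrow> nat set list \<Rightarrow> bool) \<Rightarrow>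
    letter list \<Rightarrow> nat \<Rightarrow> nat set \<Rightarrow> bool" where
  "threshold_set K Q w L X \<longleftrightarrow> X \<noteq> {} \<and> (\<forall>x<L. x \<in> X \<longrightarrow> x = number X) \<and>
     (\<exists>z<L. power_below L (number X) K z) \<and> (\<exists>p<L. p < number X \<and> input_tape w p = Blank) \<and>
     number X \<noteq> 0 \<and> number X \<noteq> 1 \<and> Q w L [X]"

theorem theorem3p3:
  shows "model_checking \<in> EXPSPACE"
proof -
  let ?thr = "\<lambda>e :: letter env. bound e = threshold (length (input e))" and ?acc = "\<lambda>e. accepted (input e) (bound e)"
  have thr: "definable 0 ?thr" by (intro definable_threshold defI)
  obtain k Q where Q: "raw (Suc 0) Q"
    "\<And>k' e L. k \<le> k' \<Longrightarrow> proper 0 e \<Longrightarrow> small k' e L \<Longrightarrow> Q (input e) L (clip L e) = ?thr e"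
    by (rule definableE[OF thr], rule that)
  have acc: "definable 0 ?acc" by (intro definable_accepted defI)
  obtain k' R where R: "raw (Suc 0) R"
    "\<And>l e L. k' \<le> l \<Longrightarrow> proper 0 e \<Longrightarrow> small l e L \<Longrightarrow> R (input e) L (clip L e) = ?acc e"
    by (rule definableE[OF acc], rule that)
  define K where "K = max k k'"
  let ?S = "threshold_set (Suc K) Q"
  have env: "Q w L [{u}] = (u = threshold (length w))" "R w L [{u}] = accepted w u"
    if "2 \<le> u" "length w < u" "u ^ Suc K < L" for w L u
  proof -
    have "proper 0 (Env w u [])" "small K (Env w u []) L" "clip L (Env w u []) = [{u}]"
      using that by (simp_all add: proper_def small_def clip_def)
    then show "Q w L [{u}] = (u = threshold (length w))" "R w L [{u}] = accepted w u"
      using Q(2)[of K "Env w u []" L] R(2)[of K "Env w u []" L] by (simp_all add: K_def)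
  qed
  \<comment> \<open>Whatever L is, the side conditions make Q and R meaningful; Q then forces u to
    be the threshold, and R decides membership.\<close>
  have sound: "X = {threshold (length w)} \<and> R w L [X] = (w \<in> model_checking)"
    if S: "?S w L X" and X: "X \<subseteq> {..<L}" for w L X
  proof -
    note S' = S[unfolded threshold_set_def]
    define u where "u = number X"
    have "X = {u}" using S' X unfolding u_def by (auto simp: subset_iff)
    have "u ^ Suc K < L" using S' power_below_sound unfolding u_def by blast
    moreover have "2 \<le> u" using S' by (simp add: u_def)
    moreover have "length w < u" using S' unfolding u_def input_tape_def by (auto split: if_splits)
    ultimately have "Q w L [{u}] = (u = threshold (length w))" "R w L [{u}] = accepted w u"
      by (rule env[rotated 2])+
    then show ?thesis using S' accepted_iff unfolding \<open>X = {u}\<close> by auto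
  qed
  \<comment> \<open>The exponent K + 3 is the one that \<open>power_below_complete\<close> asks for
    to express the power Suc K.\<close>
  have complete: "?S w L {threshold (length w)}" if L: "threshold (length w) ^ (K + 3) < L" for w L
  proof -
    let ?u = "threshold (length w)"
    have u: "2 \<le> ?u" by (simp add: threshold_def)
    have w: "length w < ?u" by (rule less_threshold(2)) simp
    have mono: "?u ^ m < L" if "m \<le> K + 3" for m
      using L power_increasing[OF that, of ?u] u by linarith
    have "power_below L ?u (Suc K) (?u ^ Suc K)"
      by (rule power_below_complete[OF u]) (rule mono, simp)
    moreover have "?u ^ Suc K < L" by (rule mono) simp
    moreover have "Q w L [{?u}]" using env(1)[OF u w mono[of "Suc K"]] by simp
    moreover have "length w < L" using mono[of 1] w by simp
    moreover have "input_tape w (length w) = Blank" by (simp add: input_tape_def)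
    ultimately show ?thesis unfolding threshold_set_def number_singleton using u w by auto
  qed
  have S: "raw (Suc 0) (\<lambda>w L E. ?S w L (hd E))"
  proof -
    have "raw (Suc 0) (\<lambda>w L E. Q w L [hd E])"
      by (rule raw_cong[OF Q(1)]) (auto simp: length_Suc_conv)
    then show ?thesis unfolding threshold_set_def by (intro rawI)
  qed
  have "raw 0 (\<lambda>w L E. \<exists>X\<subseteq>{..<L}. ?S w L X)" by (rule raw_ex[OF S])
  then obtain B where B: "fm_wf 0 B" "\<And>w L. 1 \<le> L \<Longrightarrow> sem B w L [] = (\<exists>X\<subseteq>{..<L}. ?S w L X)"
    by (rule raw_sentence) (rule that)
  have "raw (Suc 0) (\<lambda>w L E. R w L [hd E])"
    by (rule raw_cong[OF R(1)]) (auto simp: length_Suc_conv)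
  then have "raw 0 (\<lambda>w L E. \<exists>X\<subseteq>{..<L}. ?S w L X \<and> R w L [X])"
    by (intro raw_ex raw_conj S)
  then obtain \<phi> where \<phi>: "fm_wf 0 \<phi>" "\<And>w L. 1 \<le> L \<Longrightarrow> sem \<phi> w L [] = (\<exists>X\<subseteq>{..<L}. ?S w L X \<and> R w L [X])"
    by (rule raw_sentence) (rule that)
  obtain c where c: "\<And>n. threshold n ^ (K + 4) < c * 2 ^ (n ^ 3)"
    using threshold_power_le[of "K + 4"] by blast
  have "model_checking \<in> DSPACE (\<lambda>n. 2 ^ (n ^ 3))"
  proof (rule fm_DSPACE[OF B(1) \<phi>(1)])
    fix w :: "letter list"
    let ?u = "threshold (length w)" and ?L = "Suc (threshold (length w) ^ (K + 3))"
    have u: "2 \<le> ?u" by (simp add: threshold_def)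
    have "1 \<le> ?u ^ (K + 3)" using u by simp
    then have "?L \<le> ?u ^ (K + 3) * 2" by linarith
    also have "\<dots> \<le> ?u ^ (K + 3) * ?u" by (rule mult_le_mono2[OF u])
    also have "\<dots> = ?u ^ (K + 4)" by (simp add: eval_nat_numeral)
    also have "\<dots> < c * 2 ^ (length w ^ 3)" by (rule c)
    finally have "?L < c * 2 ^ (length w ^ 3)" .
    moreover have "{?u} \<subseteq> {..<?L}" using power_increasing[of 1 "K + 3" ?u] u by simp
    then have "sem B w ?L []" using B(2)[of ?L] complete[of w ?L] by auto
    ultimately show "\<exists>L\<ge>1. L < c * 2 ^ (length w ^ 3) \<and> sem B w L []"
      by (intro exI[of _ ?L]) simp
  next
    fix w :: "letter list" and L assume L: "1 \<le> L" "sem B w L []"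
    then obtain X where "X \<subseteq> {..<L}" "?S w L X" using B(2) by blast
    then show "sem \<phi> w L [] \<longleftrightarrow> w \<in> model_checking"
      unfolding \<phi>(2)[OF L(1)] using sound by blast
  qed
  then show ?thesis unfolding EXPSPACE_def by blast
qed

end
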